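(* Let $k$ be an algebraically closed field, let $X$ be a smooth projective irreducible curve over $k$, and let $G$ be a finite subgroup of the group of automorphisms of $X$ over $k$. Assume that either $\operatorname{char} k = 0$ or $\operatorname{char} k = p$ does not divide $|G|$. Let $\pi : X \to Y = X/G$ be the quotient map and let $\tilde{\Gamma}_G$ be its ramification module. Let $V_1, \dots, V_M$ be representatives of the isomorphism classes of irreducible $\mathbb{Q}[G]$-modules, and let $H_1, \dots, H_M$ be representatives of the conjugacy classes of cyclic subgroups of $G$ (there are equally many of each). If $\tilde{\Gamma}_G$ has a $\mathbb{Q}[G]$-module structure, then it decomposes into irreducible $\mathbb{Q}[G]$-modules as $$ \tilde{\Gamma}_G \simeq \bigoplus_{j=1}^{M} \frac{1}{m_j^2 d_j}\left( \sum_{\ell=1}^{M} \bigl(\dim(V_j) - \dim(V_j^{H_\ell})\bigr)\frac{R_\ell}{2} \right) V_j , $$ where the coefficient of $V_j$ is its multiplicity. Here dimensions are over $\mathbb{Q}$, $V_j^{H_\ell}$ is the subspace of $V_j$ fixed by $H_\ell$, $R_\ell$ is the number of branch points of $\pi$ in $Y$ over which the inertia groups are conjugate to $H_\ell$, $m_j$ is the Schur index of $V_j$, and $d_j$ is the number of pairwise non-isomorphic absolutely irreducible constituents of $V_j$ after extension of scalars.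
   Context: Inertia: for a point $P \in X(k)$, the inertia group $G_P$ is the stabilizer of $P$ in $G$; under the assumption on $\operatorname{char} k$ it is cyclic, and the inertia groups at the points above a given point of $Y$ are conjugate to each other. Put $e_P = |G_P|$. A branch point is a point of $Y$ over which the inertia groups are nontrivial. If $H_\ell$ is the trivial group, $R_\ell$ may be set to $0$ (its coefficient in the formula vanishes). Ramification module: for $P \in X(k)$, $G_P$ acts on the cotangent space of $X$ at $P$ by a character $\psi_P : G_P \to k^\times$, the ramification character at $P$. Let $X(k)_{ram}$ be the set of points $P$ with $G_P$ nontrivial, and set $$\Gamma_G = \sum_{P \in X(k)_{ram}} \operatorname{Ind}_{G_P}^{G}\Bigl( \sum_{\ell=1}^{e_P - 1} \ell\, \psi_P^{\ell} \Bigr).$$ By a theorem of Nakajima there is a unique (up to isomorphism) $G$-module $\tilde{\Gamma}_G$ over $k$ with $\Gamma_G = |G|\,\tilde{\Gamma}_G$ (i.e. $\Gamma_G$ is a direct sum of $|G|$ copies of $\tilde\Gamma_G$). The ramification module is $\tilde{\Gamma}_G$. Characters: since $|G|$ is invertible in $k$, $k[G]$-modules are semisimple. Fix an identification of the $|G|$-th roots of unity of $k$ with those of $\overline{\mathbb{Q}}$. The (Brauer) character of a finite-dimensional $k[G]$-module is the $\overline{\mathbb{Q}}$-valued character obtained by lifting eigenvalues of group elements via this identification. "$\tilde{\Gamma}_G$ has a $\mathbb{Q}[G]$-module structure" means that its (Brauer) character is the character of a finite-dimensional $\mathbb{Q}[G]$-module; the displayed decomposition is that of this $\mathbb{Q}[G]$-module.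 Decomposition of $V_j$: let $F$ be a finite extension of $\mathbb{Q}$ such that every irreducible $F[G]$-module is absolutely irreducible. Then $$V_j \otimes_{\mathbb{Q}} F \simeq m_j \bigoplus_{r=1}^{d_j} W_{jr},$$ where the $W_{jr}$ ($1 \le r \le d_j$) are pairwise non-isomorphic irreducible $F[G]$-modules, all of the same dimension, and $m_j$ is the Schur index. This defines $m_j$ and $d_j$. *)

theory Defs
  imports
    "HOL-Analysis.Abstract_Topology"
    "HOL-Library.Poly_Mapping"
    "HOL-Algebra.Algebraic_Closure_Type"
    "HOL-Algebra.Bij"
    "HOL-Algebra.Group_Action"
    "Jordan_Normal_Form.Char_Poly"
    "Jordan_Normal_Form.VS_Connect"
begin

section \<open>Projective varieties over an algebraically closed field\<close>

text \<open>A polynomial maps exponent vectors (finitely supported functions on variable indices)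
  to coefficients.\<close>

type_synonym 'k mpoly = "(nat \<Rightarrow>\<^sub>0 nat) \<Rightarrow>\<^sub>0 'k"

definition monom_eval :: "(nat \<Rightarrow>\<^sub>0 nat) \<Rightarrow> 'k::comm_ring_1 vec \<Rightarrow> 'k" where
  "monom_eval m v = (\<Prod>i\<in>Poly_Mapping.keys m. (v $ i) ^ Poly_Mapping.lookup m i)"

definition mp_eval :: "'k::comm_ring_1 mpoly \<Rightarrow> 'k vec \<Rightarrow> 'k" where
  "mp_eval f v = (\<Sum>m\<in>Poly_Mapping.keys f. Poly_Mapping.lookup f m * monom_eval m v)"

text \<open>Homogeneous polynomials of degree \<open>d\<close> in the variables \<open>x\<^sub>0, \<dots>, x\<^sub>n\<close>.\<close>

definition is_form :: "nat \<Rightarrow> nat \<Rightarrow> 'k::comm_ring_1 mpoly \<Rightarrow> bool" where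
  "is_form n d f \<longleftrightarrow> (\<forall>m\<in>Poly_Mapping.keys f. Poly_Mapping.keys m \<subseteq> {..n} \<and>
     (\<Sum>i\<in>Poly_Mapping.keys m. Poly_Mapping.lookup m i) = d)"

text \<open>A point of projective \<open>n\<close>-space is the set of all its homogeneous coordinate vectors.\<close>

type_synonym 'k point = "'k vec set"

definition proj_space :: "nat \<Rightarrow> 'k::field point set" where
  "proj_space n = {P. \<exists>v\<in>carrier_vec (Suc n). v \<noteq> 0\<^sub>v (Suc n) \<and> P = {c \<cdot>\<^sub>v v | c. c \<noteq> 0}}"

definition zero_locus :: "nat \<Rightarrow> 'k::field mpoly set \<Rightarrow> 'k point set" where
  "zero_locus n S = {P \<in> proj_space n. \<forall>f\<in>S. \<forall>v\<in>P. mp_eval f v = 0}"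

definition zariski :: "nat \<Rightarrow> 'k::field point topology" where
  "zariski n = topology (\<lambda>U. \<exists>S. (\<forall>f\<in>S. \<exists>d. is_form n d f) \<and> U = proj_space n - zero_locus n S)"

lemma mp_eval_superset:
  assumes "finite A" "Poly_Mapping.keys f \<subseteq> A"
  shows "mp_eval f v = (\<Sum>m\<in>A. Poly_Mapping.lookup f m * monom_eval m v)"
  unfolding mp_eval_def using assms
  by (intro sum.mono_neutral_left) (auto simp: in_keys_iff)

lemma mp_eval_add: "mp_eval (f + g) v = mp_eval f v + mp_eval g v"
proof -
  let ?A = "Poly_Mapping.keys f \<union> Poly_Mapping.keys g"
  have "mp_eval (f + g) v = (\<Sum>m\<in>?A. Poly_Mapping.lookup (f + g) m * monom_eval m v)"
    by (rule mp_eval_superset) (auto simp: Poly_Mapping.keys_add)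
  also have "\<dots> = mp_eval f v + mp_eval g v"
    by (simp add: mp_eval_superset[of ?A] lookup_add algebra_simps sum.distrib)
  finally show ?thesis .
qed

lemma mp_eval_zero [simp]: "mp_eval 0 v = 0"
  by (simp add: mp_eval_def)

lemma mp_eval_sum: "mp_eval (sum F A) v = (\<Sum>a\<in>A. mp_eval (F a) v)"
  by (induction A rule: infinite_finite_induct) (auto simp: mp_eval_add)

lemma mp_eval_single: "mp_eval (Poly_Mapping.single m c) v = c * monom_eval m v"
  by (cases "c = 0") (auto simp: mp_eval_def)

lemma mp_eval_one: "mp_eval 1 v = 1"
  using mp_eval_single[of 0 1 v] by (simp add: monom_eval_def)

lemma monom_eval_superset:
  assumes "finite A" "Poly_Mapping.keys m \<subseteq> A"
  shows "monom_eval m v = (\<Prod>i\<in>A. (v $ i) ^ Poly_Mapping.lookup m i)"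
  unfolding monom_eval_def using assms
  by (intro prod.mono_neutral_left) (auto simp: in_keys_iff)

lemma monom_eval_add: "monom_eval (m + m') v = monom_eval m v * monom_eval m' v"
proof -
  let ?A = "Poly_Mapping.keys m \<union> Poly_Mapping.keys m'"
  have "monom_eval (m + m') v = (\<Prod>i\<in>?A. (v $ i) ^ Poly_Mapping.lookup (m + m') i)"
    by (rule monom_eval_superset) (auto simp: Poly_Mapping.keys_add)
  also have "\<dots> = monom_eval m v * monom_eval m' v"
    by (simp add: monom_eval_superset[of ?A] lookup_add power_add prod.distrib)
  finally show ?thesis .
qed

lemma poly_mapping_as_sum:
  "f = (\<Sum>m\<in>Poly_Mapping.keys f. Poly_Mapping.single m (Poly_Mapping.lookup f m))"
  by (rule poly_mapping_eqI)
     (auto simp: lookup_sum lookup_single when_def in_keys_iff sum.delta)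

lemma mp_eval_mult: "mp_eval (f * g) v = mp_eval f v * mp_eval g v"
proof -
  let ?s = "\<lambda>f m. Poly_Mapping.single m (Poly_Mapping.lookup f m)"
  have "f * g = (\<Sum>m\<in>Poly_Mapping.keys f. ?s f m) * (\<Sum>l\<in>Poly_Mapping.keys g. ?s g l)"
    by (rule arg_cong2[where f = "(*)", OF poly_mapping_as_sum poly_mapping_as_sum])
  also have "mp_eval \<dots> v = mp_eval f v * mp_eval g v"
    by (simp add: sum_product mp_eval_sum mult_single mp_eval_single monom_eval_add
        mp_eval_def[of f] mp_eval_def[of g] algebra_simps)
  finally show ?thesis .
qed

lemma is_form_mult:
  assumes "is_form n d f" "is_form n e g"
  shows "is_form n (d + e) (f * g)"
  unfolding is_form_def
proof
  fix m assume "m \<in> Poly_Mapping.keys (f * g)"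
  then obtain a b where ab: "a \<in> Poly_Mapping.keys f" "b \<in> Poly_Mapping.keys g" "m = a + b"
    using keys_mult[of f g] by blast
  let ?A = "Poly_Mapping.keys a \<union> Poly_Mapping.keys b"
  have sup: "(\<Sum>i\<in>Poly_Mapping.keys x. Poly_Mapping.lookup x i) = (\<Sum>i\<in>?A. Poly_Mapping.lookup x i)"
    if "Poly_Mapping.keys x \<subseteq> ?A" for x
    using that by (intro sum.mono_neutral_left) (auto simp: in_keys_iff)
  have sub: "Poly_Mapping.keys m \<subseteq> ?A"
    unfolding ab(3) by (rule Poly_Mapping.keys_add)
  have "(\<Sum>i\<in>Poly_Mapping.keys m. Poly_Mapping.lookup m i) =
        (\<Sum>i\<in>Poly_Mapping.keys a. Poly_Mapping.lookup a i) +
        (\<Sum>i\<in>Poly_Mapping.keys b. Poly_Mapping.lookup b i)"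
    using sup[OF sub] sup[of a] sup[of b] by (simp add: ab(3) lookup_add sum.distrib)
  moreover have "Poly_Mapping.keys a \<subseteq> {..n}" "Poly_Mapping.keys b \<subseteq> {..n}"
      "(\<Sum>i\<in>Poly_Mapping.keys a. Poly_Mapping.lookup a i) = d"
      "(\<Sum>i\<in>Poly_Mapping.keys b. Poly_Mapping.lookup b i) = e"
    using assms ab(1,2) by (auto simp: is_form_def)
  ultimately show "Poly_Mapping.keys m \<subseteq> {..n} \<and>
      (\<Sum>i\<in>Poly_Mapping.keys m. Poly_Mapping.lookup m i) = d + e"
    using sub by (simp, blast)
qed

lemma mp_eval_smult:
  assumes "is_form n d f" "v \<in> carrier_vec (Suc n)"
  shows "mp_eval f (c \<cdot>\<^sub>v v) = c ^ d * mp_eval f v"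
proof -
  have "monom_eval m (c \<cdot>\<^sub>v v) = c ^ d * monom_eval m v" if "m \<in> Poly_Mapping.keys f" for m
  proof -
    have m: "Poly_Mapping.keys m \<subseteq> {..n}" "(\<Sum>i\<in>Poly_Mapping.keys m. Poly_Mapping.lookup m i) = d"
      using assms(1) that by (auto simp: is_form_def)
    have "monom_eval m (c \<cdot>\<^sub>v v) =
        (\<Prod>i\<in>Poly_Mapping.keys m. c ^ Poly_Mapping.lookup m i * (v $ i) ^ Poly_Mapping.lookup m i)"
      unfolding monom_eval_def using m(1) assms(2)
      by (intro prod.cong) (auto simp: power_mult_distrib)
    then show ?thesis
      using m(2) by (simp add: prod.distrib monom_eval_def flip: power_sum)
  qed
  then show ?thesis
    by (simp add: mp_eval_def sum_distrib_left algebra_simps)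
qed

lemma form_vanishes_on_point:
  assumes "P \<in> proj_space n" "is_form n d f" "v \<in> P" "w \<in> P" "mp_eval f v = 0"
  shows "mp_eval f w = 0"
proof -
  obtain u where u: "u \<in> carrier_vec (Suc n)" "P = {c \<cdot>\<^sub>v u | c. c \<noteq> 0}"
    using assms(1) by (auto simp: proj_space_def)
  then obtain a b where "v = a \<cdot>\<^sub>v u" "a \<noteq> 0" "w = b \<cdot>\<^sub>v u"
    using assms(3,4) by blast
  then show ?thesis
    using assms(5) mp_eval_smult[OF assms(2) u(1)] by simp
qed

lemma point_nonempty: "P \<in> proj_space n \<Longrightarrow> P \<noteq> {}"
  unfolding proj_space_def using one_neq_zero by blast

lemma openin_zariski:
  fixes U :: "'a::field point set"
  shows "openin (zariski n) U \<longleftrightarrow>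
     (\<exists>S. (\<forall>f\<in>S. \<exists>d. is_form n d f) \<and> U = proj_space n - zero_locus n S)"
proof -
  let ?L = "\<lambda>U :: 'a point set. \<exists>S. (\<forall>f\<in>S. \<exists>d. is_form n d f) \<and> U = proj_space n - zero_locus n S"
  have "istopology ?L"
    unfolding istopology_def
  proof (intro conjI allI impI)
    fix A B :: "'a point set" assume "?L A" "?L B"
    then obtain S T where S: "\<forall>f\<in>S. \<exists>d. is_form n d f" "A = proj_space n - zero_locus n S"
      and T: "\<forall>f\<in>T. \<exists>d. is_form n d f" "B = proj_space n - zero_locus n T" by blast
    let ?ST = "{f * g | f g. f \<in> S \<and> g \<in> T}"
    have "zero_locus n ?ST = zero_locus n S \<union> zero_locus n T"
    proof (intro equalityI subsetI)
      fix P assume P: "P \<in> zero_locus n ?ST"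
      then have PP: "P \<in> proj_space n" by (simp add: zero_locus_def)
      have prod0: "mp_eval f v * mp_eval g v = 0" if "f \<in> S" "g \<in> T" "v \<in> P" for f g v
        using P that unfolding zero_locus_def by (force simp flip: mp_eval_mult)
      show "P \<in> zero_locus n S \<union> zero_locus n T"
      proof (cases "P \<in> zero_locus n S")
        case False
        then obtain f v where f: "f \<in> S" "v \<in> P" "mp_eval f v \<noteq> 0"
          using PP by (auto simp: zero_locus_def)
        have "mp_eval g w = 0" if "g \<in> T" "w \<in> P" for g w
          using form_vanishes_on_point[OF PP _ f(2) that(2)] T(1) prod0[OF f(1) that(1) f(2)] f(3) that(1)
          by auto
        then show ?thesis using PP by (simp add: zero_locus_def)
      qed simp
    qed (auto simp: zero_locus_def mp_eval_mult)
    moreover have "\<forall>f\<in>?ST. \<exists>d. is_form n d f"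
      using S(1) T(1) is_form_mult by blast
    ultimately show "?L (A \<inter> B)"
      using S(2) T(2) by (intro exI[of _ ?ST]) auto
  next
    fix K :: "'a point set set" assume "\<forall>A\<in>K. ?L A"
    then obtain F where F: "\<And>A. A \<in> K \<Longrightarrow> (\<forall>f\<in>F A. \<exists>d. is_form n d f) \<and> A = proj_space n - zero_locus n (F A)"
      by metis
    have "\<Union>K = proj_space n - zero_locus n (\<Union>(F ` K))"
    proof (intro equalityI subsetI)
      fix P assume "P \<in> \<Union>K"
      then obtain A where "A \<in> K" "P \<in> A" by blast
      then show "P \<in> proj_space n - zero_locus n (\<Union>(F ` K))"
        using F[of A] by (fastforce simp: zero_locus_def)
    next
      fix P assume P: "P \<in> proj_space n - zero_locus n (\<Union>(F ` K))"
      then obtain A f v where "A \<in> K" "f \<in> F A" "v \<in> P" "mp_eval f v \<noteq> 0"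
        by (auto simp: zero_locus_def)
      then have "P \<in> proj_space n - zero_locus n (F A)"
        using P by (auto simp: zero_locus_def)
      then show "P \<in> \<Union>K" using F[of A] \<open>A \<in> K\<close> by blast
    qed
    then show "?L (\<Union>K)" using F by (intro exI[of _ "\<Union>(F ` K)"]) auto
  qed
  then show ?thesis by (simp add: zariski_def topology_inverse')
qed

lemma topspace_zariski: "topspace (zariski n) = (proj_space n :: 'a::field point set)"
proof -
  have "is_form n 0 (Poly_Mapping.single 0 (1::'a))"
    by (auto simp: is_form_def)
  moreover have "zero_locus n {Poly_Mapping.single 0 (1::'a)} = {}"
    using point_nonempty by (auto simp: zero_locus_def mp_eval_one)
  ultimately have "openin (zariski n) (proj_space n :: 'a point set)"
    unfolding openin_zariski by (intro exI[of _ "{Poly_Mapping.single 0 1}"]) auto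
  moreover have "U \<subseteq> proj_space n" if "openin (zariski n) U" for U :: "'a point set"
    using that by (auto simp: openin_zariski)
  ultimately show ?thesis
    by (auto simp: topspace_def)
qed

lemma closedin_zariski:
  fixes Z :: "'a::field point set"
  shows "closedin (zariski n) Z \<longleftrightarrow> (\<exists>S. (\<forall>f\<in>S. \<exists>d. is_form n d f) \<and> Z = zero_locus n S)"
proof -
  have sub: "zero_locus n S \<subseteq> proj_space n" for S :: "'a mpoly set"
    by (auto simp: zero_locus_def)
  have "closedin (zariski n) Z \<longleftrightarrow> Z \<subseteq> proj_space n \<and>
      (\<exists>S. (\<forall>f\<in>S. \<exists>d. is_form n d f) \<and> proj_space n - Z = proj_space n - zero_locus n S)"
    by (simp add: closedin_def topspace_zariski openin_zariski)
  also have "\<dots> \<longleftrightarrow> (\<exists>S. (\<forall>f\<in>S. \<exists>d. is_form n d f) \<and> Z = zero_locus n S)"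
    using sub by blast
  finally show ?thesis .
qed

definition var_top :: "nat \<Rightarrow> 'k::field point set \<Rightarrow> 'k point topology" where
  "var_top n C = subtopology (zariski n) C"

definition irreducible_closed :: "'a topology \<Rightarrow> 'a set \<Rightarrow> bool" where
  "irreducible_closed T Z \<longleftrightarrow> closedin T Z \<and> Z \<noteq> {} \<and>
     (\<forall>A B. closedin T A \<and> closedin T B \<and> Z \<subseteq> A \<union> B \<longrightarrow> Z \<subseteq> A \<or> Z \<subseteq> B)"

text \<open>The supremum of the lengths of chains of irreducible closed subsets is \<open>d\<close>.\<close>

definition has_irreducible_chain :: "'a topology \<Rightarrow> nat \<Rightarrow> bool" where
  "has_irreducible_chain T d \<longleftrightarrow> (\<exists>Z :: nat \<Rightarrow> 'a set.
     (\<forall>i\<le>d. irreducible_closed T (Z i)) \<and> (\<forall>i<d. Z i \<subset> Z (Suc i)))"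

definition has_krull_dim :: "'a topology \<Rightarrow> nat \<Rightarrow> bool" where
  "has_krull_dim T d \<longleftrightarrow> has_irreducible_chain T d \<and> \<not> has_irreducible_chain T (Suc d)"

text \<open>Elements of the local ring at \<open>P\<close> are represented by total functions on points that are
  quotients of forms of equal degree near \<open>P\<close>; two functions represent the same element
  iff they agree on a neighbourhood of \<open>P\<close> in \<open>C\<close>.\<close>

definition regular_at :: "nat \<Rightarrow> 'k::field point set \<Rightarrow> 'k point \<Rightarrow> ('k point \<Rightarrow> 'k) \<Rightarrow> bool" where
  "regular_at n C P f \<longleftrightarrow> (\<exists>U d a b. openin (var_top n C) U \<and> P \<in> U \<and>
     is_form n d a \<and> is_form n d b \<and>
     (\<forall>Q\<in>U. \<forall>v\<in>Q. mp_eval b v \<noteq> 0 \<and> f Q = mp_eval a v / mp_eval b v))"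

definition germ_eq ::
  "nat \<Rightarrow> 'k::field point set \<Rightarrow> 'k point \<Rightarrow> ('k point \<Rightarrow> 'k) \<Rightarrow> ('k point \<Rightarrow> 'k) \<Rightarrow> bool" where
  "germ_eq n C P f g \<longleftrightarrow> (\<exists>U. openin (var_top n C) U \<and> P \<in> U \<and> (\<forall>Q\<in>U. f Q = g Q))"

definition max_ideal :: "nat \<Rightarrow> 'k::field point set \<Rightarrow> 'k point \<Rightarrow> ('k point \<Rightarrow> 'k) set" where
  "max_ideal n C P = {f. regular_at n C P f \<and> f P = 0}"

definition max_ideal_sq :: "nat \<Rightarrow> 'k::field point set \<Rightarrow> 'k point \<Rightarrow> ('k point \<Rightarrow> 'k) set" where
  "max_ideal_sq n C P = {f. \<exists>N a b. (\<forall>i<N::nat. a i \<in> max_ideal n C P \<and> b i \<in> max_ideal n C P) \<and>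
     germ_eq n C P f (\<lambda>Q. \<Sum>i<N. a i Q * b i Q)}"

text \<open>The functions \<open>t 0, \<dots>, t (d - 1)\<close> induce a basis of the cotangent space, which is the
  quotient of \<^const>\<open>max_ideal\<close> by \<^const>\<open>max_ideal_sq\<close>.\<close>

definition has_cotangent_dim :: "nat \<Rightarrow> 'k::field point set \<Rightarrow> 'k point \<Rightarrow> nat \<Rightarrow> bool" where
  "has_cotangent_dim n C P d \<longleftrightarrow> (\<exists>t :: nat \<Rightarrow> 'k point \<Rightarrow> 'k.
     (\<forall>i<d. t i \<in> max_ideal n C P) \<and>
     (\<forall>f\<in>max_ideal n C P. \<exists>!c. c \<in> {..<d} \<rightarrow>\<^sub>E UNIV \<and>
        (\<lambda>Q. f Q - (\<Sum>i<d. c i * t i Q)) \<in> max_ideal_sq n C P))"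

text \<open>Smoothness over an algebraically closed field: every cotangent space has dimension
  \<open>dim C\<close>.\<close>

definition smooth_projective_curve :: "nat \<Rightarrow> 'k::alg_closed_field point set \<Rightarrow> bool" where
  "smooth_projective_curve n C \<longleftrightarrow>
     irreducible_closed (zariski n) C \<and> has_krull_dim (var_top n C) 1 \<and>
     (\<forall>P\<in>C. has_cotangent_dim n C P 1)"

definition variety_morphism ::
  "nat \<Rightarrow> 'k::field point set \<Rightarrow> nat \<Rightarrow> 'k point set \<Rightarrow> ('k point \<Rightarrow> 'k point) \<Rightarrow> bool" where
  "variety_morphism n C m Y \<phi> \<longleftrightarrow> continuous_map (var_top n C) (var_top m Y) \<phi> \<and>
     (\<forall>V f. openin (var_top m Y) V \<and> (\<forall>Q\<in>V. regular_at m Y Q f) \<longrightarrow>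
        (\<forall>P\<in>C. \<phi> P \<in> V \<longrightarrow> regular_at n C P (f \<circ> \<phi>)))"

definition aut_group :: "nat \<Rightarrow> 'k::field point set \<Rightarrow> ('k point \<Rightarrow> 'k point) monoid" where
  "aut_group n C = (BijGroup C)\<lparr>carrier := {\<phi> \<in> Bij C. variety_morphism n C n C \<phi> \<and>
     variety_morphism n C n C (restrict (inv_into C \<phi>) C)}\<rparr>"

definition finite_automorphism_group ::
  "nat \<Rightarrow> 'k::field point set \<Rightarrow> ('k point \<Rightarrow> 'k point) monoid \<Rightarrow> bool" where
  "finite_automorphism_group n C G \<longleftrightarrow> (\<exists>A. subgroup A (aut_group n C) \<and> finite A \<and>
     G = (aut_group n C)\<lparr>carrier := A\<rparr>)"


section \<open>Finite-dimensional modules over group algebras\<close>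

text \<open>A finite-dimensional module over \<open>K[G]\<close> is given, after a choice of basis, by a matrix
  representation of \<open>G\<close>. Dimension \<open>0\<close> is allowed.\<close>

type_synonym ('g, 'a) rep = "'g \<Rightarrow> 'a mat"

definition rep_dim :: "('g, 'b) monoid_scheme \<Rightarrow> ('g, 'a) rep \<Rightarrow> nat" where
  "rep_dim G \<rho> = dim_row (\<rho> \<one>\<^bsub>G\<^esub>)"

definition is_rep :: "('g, 'b) monoid_scheme \<Rightarrow> ('g, 'a::field) rep \<Rightarrow> bool" where
  "is_rep G \<rho> \<longleftrightarrow>
     (\<forall>g\<in>carrier G. \<rho> g \<in> carrier_mat (rep_dim G \<rho>) (rep_dim G \<rho>)) \<and>
     \<rho> \<one>\<^bsub>G\<^esub> = 1\<^sub>m (rep_dim G \<rho>) \<and>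
     (\<forall>g\<in>carrier G. \<forall>h\<in>carrier G. \<rho> (g \<otimes>\<^bsub>G\<^esub> h) = \<rho> g * \<rho> h)"

definition rep_iso ::
  "('g, 'b) monoid_scheme \<Rightarrow> ('g, 'a::field) rep \<Rightarrow> ('g, 'a) rep \<Rightarrow> bool" where
  "rep_iso G \<rho> \<sigma> \<longleftrightarrow> rep_dim G \<rho> = rep_dim G \<sigma> \<and>
     (\<exists>T \<in> carrier_mat (rep_dim G \<rho>) (rep_dim G \<rho>). invertible_mat T \<and>
        (\<forall>g\<in>carrier G. T * \<rho> g = \<sigma> g * T))"

definition irreducible_rep :: "('g, 'b) monoid_scheme \<Rightarrow> ('g, 'a::field) rep \<Rightarrow> bool" where
  "irreducible_rep G \<rho> \<longleftrightarrow> is_rep G \<rho> \<and> rep_dim G \<rho> > 0 \<and>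
     (\<forall>W. subspace class_ring W (module_vec TYPE('a) (rep_dim G \<rho>)) \<and>
          (\<forall>g\<in>carrier G. \<forall>w\<in>W. \<rho> g *\<^sub>v w \<in> W) \<longrightarrow>
          W = {0\<^sub>v (rep_dim G \<rho>)} \<or> W = carrier_vec (rep_dim G \<rho>))"

definition rep_direct_sum :: "('g, 'a::zero) rep list \<Rightarrow> ('g, 'a) rep" where
  "rep_direct_sum \<rho>s = (\<lambda>g. diag_block_mat (map (\<lambda>\<rho>. \<rho> g) \<rho>s))"

definition extend_scalars :: "('a \<Rightarrow> 'b) \<Rightarrow> ('g, 'a) rep \<Rightarrow> ('g, 'b) rep" where
  "extend_scalars h \<rho> = (\<lambda>g. map_mat h (\<rho> g))"

definition fixed_dim ::
  "('g, 'b) monoid_scheme \<Rightarrow> ('g, 'a::field) rep \<Rightarrow> 'g set \<Rightarrow> nat" where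
  "fixed_dim G \<rho> H = vectorspace.dim class_ring
     ((module_vec TYPE('a) (rep_dim G \<rho>))\<lparr>carrier :=
        {v \<in> carrier_vec (rep_dim G \<rho>). \<forall>h\<in>H. \<rho> h *\<^sub>v v = v}\<rparr>)"

definition char_rep :: "('g \<Rightarrow> 'a) \<Rightarrow> ('g, 'a) rep" where
  "char_rep \<psi> = (\<lambda>g. mat 1 1 (\<lambda>_. \<psi> g))"

text \<open>For left coset representatives \<open>t\<^sub>1, \<dots>, t\<^sub>m\<close> of \<open>H\<close> in \<open>G\<close>, the block of the induced
  representation at \<open>g\<close> in position \<open>(i, j)\<close> is \<open>\<sigma>\<close> at the inverse of \<open>t\<^sub>i\<close> times \<open>g\<close> times
  \<open>t\<^sub>j\<close> if that element lies in \<open>H\<close>, and zero otherwise. The isomorphism class does not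
  depend on the choice of the representatives.\<close>

definition coset_reps :: "('g, 'b) monoid_scheme \<Rightarrow> 'g set \<Rightarrow> 'g list" where
  "coset_reps G H = (SOME ts. distinct ts \<and> set ts \<subseteq> carrier G \<and>
     (\<forall>x\<in>carrier G. \<exists>!t. t \<in> set ts \<and> inv\<^bsub>G\<^esub> t \<otimes>\<^bsub>G\<^esub> x \<in> H))"

definition induced_rep ::
  "('g, 'b) monoid_scheme \<Rightarrow> 'g set \<Rightarrow> ('g, 'a::zero) rep \<Rightarrow> ('g, 'a) rep" where
  "induced_rep G H \<sigma> = (let ts = coset_reps G H; d = rep_dim G \<sigma> in
     (\<lambda>g. mat (length ts * d) (length ts * d) (\<lambda>(r, c).
        let x = inv\<^bsub>G\<^esub> (ts ! (r div d)) \<otimes>\<^bsub>G\<^esub> g \<otimes>\<^bsub>G\<^esub> (ts ! (c div d))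
        in if x \<in> H then \<sigma> x $$ (r mod d, c mod d) else 0)))"

definition rep_trace :: "('g, 'a::comm_monoid_add) rep \<Rightarrow> 'g \<Rightarrow> 'a" where
  "rep_trace \<rho> g = (\<Sum>i<dim_row (\<rho> g). \<rho> g $$ (i, i))"

definition root_identification :: "nat \<Rightarrow> ('k::field \<Rightarrow> rat alg_closure) \<Rightarrow> bool" where
  "root_identification N \<iota> \<longleftrightarrow> bij_betw \<iota> {x. x ^ N = 1} {z. z ^ N = 1} \<and>
     (\<forall>x y. x ^ N = 1 \<and> y ^ N = 1 \<longrightarrow> \<iota> (x * y) = \<iota> x * \<iota> y)"

text \<open>The Brauer character: sum of the lifted eigenvalues, with multiplicity.\<close>

definition brauer_char ::
  "('k::field \<Rightarrow> rat alg_closure) \<Rightarrow> ('g, 'k) rep \<Rightarrow> 'g \<Rightarrow> rat alg_closure" where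
  "brauer_char \<iota> \<rho> g = (\<Sum>\<zeta> | poly (char_poly (\<rho> g)) \<zeta> = 0.
     of_nat (Polynomial.order \<zeta> (char_poly (\<rho> g))) * \<iota> \<zeta>)"

definition has_rational_structure ::
  "('g, 'b) monoid_scheme \<Rightarrow> ('k::field \<Rightarrow> rat alg_closure) \<Rightarrow> ('g, 'k) rep \<Rightarrow> ('g, rat) rep \<Rightarrow> bool"
where
  "has_rational_structure G \<iota> \<rho> U \<longleftrightarrow> is_rep G U \<and>
     (\<forall>g\<in>carrier G. to_ac (rep_trace U g) = brauer_char \<iota> \<rho> g)"

definition irreducible_representatives ::
  "('g, 'b) monoid_scheme \<Rightarrow> nat \<Rightarrow> (nat \<Rightarrow> ('g, 'a::field) rep) \<Rightarrow> bool" where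
  "irreducible_representatives G M V \<longleftrightarrow>
     (\<forall>j\<in>{1..M}. irreducible_rep G (V j)) \<and>
     (\<forall>i\<in>{1..M}. \<forall>j\<in>{1..M}. rep_iso G (V i) (V j) \<longrightarrow> i = j) \<and>
     (\<forall>\<rho>. irreducible_rep G \<rho> \<longrightarrow> (\<exists>j\<in>{1..M}. rep_iso G \<rho> (V j)))"

definition conjugate_subgroups :: "('g, 'b) monoid_scheme \<Rightarrow> 'g set \<Rightarrow> 'g set \<Rightarrow> bool" where
  "conjugate_subgroups G H K \<longleftrightarrow> (\<exists>g\<in>carrier G. K = (\<lambda>h. g \<otimes>\<^bsub>G\<^esub> h \<otimes>\<^bsub>G\<^esub> inv\<^bsub>G\<^esub> g) ` H)"

definition cyclic_subgroup :: "('g, 'b) monoid_scheme \<Rightarrow> 'g set \<Rightarrow> bool" where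
  "cyclic_subgroup G H \<longleftrightarrow> (\<exists>g\<in>carrier G. H = generate G {g})"

definition cyclic_representatives ::
  "('g, 'b) monoid_scheme \<Rightarrow> nat \<Rightarrow> (nat \<Rightarrow> 'g set) \<Rightarrow> bool" where
  "cyclic_representatives G M H \<longleftrightarrow>
     (\<forall>l\<in>{1..M}. cyclic_subgroup G (H l)) \<and>
     (\<forall>i\<in>{1..M}. \<forall>l\<in>{1..M}. conjugate_subgroups G (H i) (H l) \<longrightarrow> i = l) \<and>
     (\<forall>K. cyclic_subgroup G K \<longrightarrow> (\<exists>l\<in>{1..M}. conjugate_subgroups G K (H l)))"

text \<open>Absolute irreducibility is irreducibility over an algebraic closure of the ground field.\<close>

definition absolutely_irreducible_rep ::
  "('g, 'b) monoid_scheme \<Rightarrow> ('g, 'f::field) rep \<Rightarrow> bool" where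
  "absolutely_irreducible_rep G \<rho> \<longleftrightarrow> is_rep G \<rho> \<and> irreducible_rep G (extend_scalars to_ac \<rho>)"

definition finite_extension_of_rat :: "'f::field_char_0 itself \<Rightarrow> bool" where
  "finite_extension_of_rat _ \<longleftrightarrow>
     (\<exists>B::'f set. finite B \<and> (\<forall>x. \<exists>q::'f \<Rightarrow> rat. x = (\<Sum>b\<in>B. of_rat (q b) * b)))"

definition splitting_field :: "'f::field itself \<Rightarrow> ('g, 'b) monoid_scheme \<Rightarrow> bool" where
  "splitting_field _ G \<longleftrightarrow>
     (\<forall>\<rho>::('g, 'f) rep. irreducible_rep G \<rho> \<longrightarrow> absolutely_irreducible_rep G \<rho>)"

text \<open>The decomposition of \<open>V \<otimes> F\<close> into \<open>m\<close> copies of \<open>W 1 \<oplus> \<dots> \<oplus> W d\<close>; it determines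
  the Schur index \<open>m\<close> and the number \<open>d\<close> of constituents.\<close>

definition schur_decomposition ::
  "('g, 'b) monoid_scheme \<Rightarrow> ('g, rat) rep \<Rightarrow> nat \<Rightarrow> nat \<Rightarrow> (nat \<Rightarrow> ('g, 'f::field_char_0) rep) \<Rightarrow> bool"
where
  "schur_decomposition G V m d W \<longleftrightarrow>
     (\<forall>r\<in>{1..d}. irreducible_rep G (W r)) \<and>
     (\<forall>r\<in>{1..d}. \<forall>s\<in>{1..d}. rep_iso G (W r) (W s) \<longrightarrow> r = s) \<and>
     (\<forall>r\<in>{1..d}. \<forall>s\<in>{1..d}. rep_dim G (W r) = rep_dim G (W s)) \<and>
     rep_iso G (extend_scalars of_rat V) (rep_direct_sum (concat (replicate m (map W [1..<Suc d]))))"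


section \<open>The ramification module\<close>

abbreviation inertia :: "('p \<Rightarrow> 'p) monoid \<Rightarrow> 'p \<Rightarrow> ('p \<Rightarrow> 'p) set" where
  "inertia G P \<equiv> stabilizer G (\<lambda>g. g) P"

text \<open>The left action of \<open>g\<close> on functions is composition with the inverse of \<open>g\<close>; for \<open>g\<close> in
  the inertia group at \<open>P\<close> it induces multiplication by a scalar on the cotangent space at \<open>P\<close>.\<close>

definition ram_char ::
  "nat \<Rightarrow> 'k::field point set \<Rightarrow> ('k point \<Rightarrow> 'k point) monoid \<Rightarrow> 'k point \<Rightarrow>
   ('k point \<Rightarrow> 'k point) \<Rightarrow> 'k" where
  "ram_char n C G P g = (THE c. \<forall>f\<in>max_ideal n C P.
     (\<lambda>Q. f ((inv\<^bsub>G\<^esub> g) Q) - c * f Q) \<in> max_ideal_sq n C P)"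

definition ramified_points :: "('p \<Rightarrow> 'p) monoid \<Rightarrow> 'p set \<Rightarrow> 'p set" where
  "ramified_points G C = {P \<in> C. inertia G P \<noteq> {\<one>\<^bsub>G\<^esub>}}"

text \<open>The summand \<open>\<Sum> \<ell> \<psi>\<^sup>\<ell>\<close> over \<open>\<ell> = 1, \<dots>, e - 1\<close>: each power \<open>\<psi>\<^sup>\<ell>\<close> occurs \<open>\<ell>\<close> times.\<close>

definition local_ram_rep ::
  "nat \<Rightarrow> 'k::field point set \<Rightarrow> ('k point \<Rightarrow> 'k point) monoid \<Rightarrow> 'k point \<Rightarrow>
   ('k point \<Rightarrow> 'k point, 'k) rep" where
  "local_ram_rep n C G P = rep_direct_sum (concat (map
     (\<lambda>l. replicate l (char_rep (\<lambda>g. ram_char n C G P g ^ l))) [1..<card (inertia G P)]))"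

text \<open>The ramified points are listed in some order, which does not affect the
  isomorphism class.\<close>

definition gamma_rep ::
  "nat \<Rightarrow> 'k::field point set \<Rightarrow> ('k point \<Rightarrow> 'k point) monoid \<Rightarrow> ('k point \<Rightarrow> 'k point, 'k) rep" where
  "gamma_rep n C G = rep_direct_sum (map (\<lambda>P. induced_rep G (inertia G P) (local_ram_rep n C G P))
     (SOME Ps. distinct Ps \<and> set Ps = ramified_points G C))"

text \<open>The ramification module is characterised up to isomorphism by this condition.\<close>

definition is_ramification_module ::
  "nat \<Rightarrow> 'k::field point set \<Rightarrow> ('k point \<Rightarrow> 'k point) monoid \<Rightarrow>
   ('k point \<Rightarrow> 'k point, 'k) rep \<Rightarrow> bool" where
  "is_ramification_module n C G \<Gamma>t \<longleftrightarrow> is_rep G \<Gamma>t \<and>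
     rep_iso G (gamma_rep n C G) (rep_direct_sum (replicate (card (carrier G)) \<Gamma>t))"

text \<open>The points of \<open>Y = C/G\<close> are the \<open>G\<close>-orbits on \<open>C\<close>; the orbit \<open>y\<close> is the fibre over
  \<open>y\<close>.\<close>

definition branch_points :: "('p \<Rightarrow> 'p) monoid \<Rightarrow> 'p set \<Rightarrow> 'p set set" where
  "branch_points G C = {y \<in> orbits G C (\<lambda>g. g). \<forall>P\<in>y. inertia G P \<noteq> {\<one>\<^bsub>G\<^esub>}}"

definition num_branch_points :: "('p \<Rightarrow> 'p) monoid \<Rightarrow> 'p set \<Rightarrow> ('p \<Rightarrow> 'p) set \<Rightarrow> nat" where
  "num_branch_points G C H =
     card {y \<in> branch_points G C. \<forall>P\<in>y. conjugate_subgroups G (inertia G P) H}"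

end

theory Submission
  imports
    Defs
    "HOL-Algebra.Multiplicative_Group"
    "HOL-Analysis.Abstract_Limits"
    "HOL-Combinatorics.Permutations"
begin

text \<open>Let \<open>N = |G|\<close> and let \<open>\<chi>\<^sub>j\<close> be the character of \<open>V\<^sub>j\<close>. Extending scalars to a splitting
  field shows \<open>\<langle>\<chi>\<^sub>j, \<chi>\<^sub>j\<rangle> = m\<^sub>j\<^sup>2 d\<^sub>j\<close>, so the multiplicity of \<open>V\<^sub>j\<close> in the ramification module is its
  inner product with \<open>\<chi>\<^sub>j\<close> divided by \<open>m\<^sub>j\<^sup>2 d\<^sub>j\<close>. By Frobenius reciprocity a ramified point \<open>P\<close>
  contributes to \<open>N\<close> times that inner product the inner product of \<open>\<Sum> \<ell> \<psi>\<^sub>P\<^sup>\<ell>\<close> with \<open>\<chi>\<^sub>j\<close> on the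
  inertia group \<open>G\<^sub>P\<close>. As \<open>\<chi>\<^sub>j\<close> is rational, \<open>\<chi>\<^sub>j(h\<inverse>) = \<chi>\<^sub>j(h)\<close>, so only the symmetrisation of
  \<open>\<Sum> \<ell> \<psi>\<^sub>P\<^sup>\<ell>\<close> under inversion matters, and because \<open>\<psi>\<^sub>P\<close> is injective it equals \<open>-e/2\<close> away from the
  identity and \<open>e(e - 1)/2\<close> at the identity, where \<open>e = |G\<^sub>P|\<close>. The contribution is therefore
  \<open>e (dim V\<^sub>j - dim V\<^sub>j\<^bsup>G\<^sub>P\<^esup>)/2\<close>, and summing over the \<open>N/e\<close> points of each orbit gives the formula.

  Injectivity of \<open>\<psi>\<^sub>P\<close>, which also makes \<open>G\<^sub>P\<close> cyclic, is where the geometry enters: the local ring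
  at \<open>P\<close> is a discrete valuation ring, an element of \<open>G\<^sub>P\<close> acting trivially on the cotangent space
  acts trivially on the local ring because \<open>N\<close> is invertible, and then it fixes a nonempty, hence dense, open set.\<close>

section \<open>Rational representations\<close>

text \<open>The Brauer character is a sum of lifted eigenvalues, not the lift of a trace, so it has
  to be computed from characteristic polynomials. A group element acts on an induced module by a
  monomial matrix; a cycle of length \<open>L > 1\<close> has a full coset of the
  \<open>L\<close>-th roots of unity as eigenvalues, whose lifts sum to zero, so only fixed basis
  vectors count and the usual formula for induced characters results. Invertibility of
  \<open>N\<close> in \<open>k\<close> enters here as well: it makes these roots distinct.
  Rationality of the \<open>V\<^sub>j\<close> is used through positivity: a sum of rational squares
  vanishes only if every square does, which gives left inverses of injective matrices and
  nondegenerate invariant forms. Germs are kept as functions together with a neighbourhood filter;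
  no quotient ring is formed, and identities between germs hold eventually along the filter. Krull's
  intersection theorem rests on a chain condition inherited from homogeneous ideals. The same
  condition, with dimension one, makes the set of ramified points finite, without which the list
  inside \<open>gamma_rep\<close> would be unspecified.\<close>

definition mat_trace :: "'a::comm_monoid_add mat \<Rightarrow> 'a" where
  "mat_trace A = (\<Sum>i<dim_row A. A $$ (i, i))"

lemma mat_trace_mult_comm:
  fixes A B :: "'a::comm_semiring_0 mat"
  assumes "A \<in> carrier_mat n m" "B \<in> carrier_mat m n"
  shows "mat_trace (A * B) = mat_trace (B * A)"
proof -
  have "mat_trace (A * B) = (\<Sum>i<n. \<Sum>j<m. A $$ (i, j) * B $$ (j, i))"
    using assms by (auto simp: mat_trace_def scalar_prod_def lessThan_atLeast0 intro!: sum.cong)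
  also have "\<dots> = (\<Sum>j<m. \<Sum>i<n. A $$ (i, j) * B $$ (j, i))"
    by (rule sum.swap)
  also have "\<dots> = mat_trace (B * A)"
    using assms by (auto simp: mat_trace_def scalar_prod_def lessThan_atLeast0 mult.commute intro!: sum.cong)
  finally show ?thesis .
qed

lemma mat_trace_one [simp]: "mat_trace (1\<^sub>m n :: 'a::semiring_1 mat) = of_nat n"
  by (simp add: mat_trace_def)

lemma invertible_matE:
  assumes "T \<in> carrier_mat n n" "invertible_mat T"
  obtains S where "S \<in> carrier_mat n n" "S * T = 1\<^sub>m n" "T * S = 1\<^sub>m n"
proof -
  obtain S where S: "inverts_mat T S" "inverts_mat S T"
    using assms(2) by (auto simp: invertible_mat_def)
  have "dim_col S = n" "dim_row S = n"
    using S assms(1) unfolding inverts_mat_def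
    by (metis carrier_matD index_mult_mat(2,3) index_one_mat(2,3))+
  then show ?thesis
    using S assms(1) that[of S] by (auto simp: inverts_mat_def)
qed

lemma invertible_matI:
  assumes "T \<in> carrier_mat n n" "S \<in> carrier_mat n n" "S * T = 1\<^sub>m n" "T * S = 1\<^sub>m n"
  shows "invertible_mat T"
  using assms by (auto simp: invertible_mat_def inverts_mat_def intro!: exI[of _ S])

lemma similar_mat_intertwine:
  fixes T A B :: "'a::semiring_1 mat"
  assumes "T \<in> carrier_mat n n" "invertible_mat T" "A \<in> carrier_mat n n" "B \<in> carrier_mat n n"
    "T * A = B * T"
  shows "similar_mat A B"
proof -
  obtain S where S: "S \<in> carrier_mat n n" "S * T = 1\<^sub>m n" "T * S = 1\<^sub>m n"
    using invertible_matE[OF assms(1,2)] .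
  have "A = S * T * A" using S assms(3) by simp
  also have "\<dots> = S * (T * A)" using S(1) assms(1,3) by (rule assoc_mult_mat)
  also have "\<dots> = S * B * T" unfolding assms(5) using S(1) assms(4,1) by (rule assoc_mult_mat[symmetric])
  finally have "A = S * B * T" .
  then show ?thesis
    using S assms by (intro similar_matI[of A B S T n]) auto
qed

lemma mat_trace_similar:
  fixes A B :: "'a::comm_semiring_1 mat"
  assumes "similar_mat A B"
  shows "mat_trace A = mat_trace B"
proof -
  obtain n P Q where *: "{A, B, P, Q} \<subseteq> carrier_mat n n" "P * Q = 1\<^sub>m n" "Q * P = 1\<^sub>m n" "A = P * B * Q"
    using similar_matD[OF assms] by blast
  have "mat_trace A = mat_trace (Q * (P * B))"
    using * mat_trace_mult_comm[of "P * B" n n Q] by auto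
  also have "Q * (P * B) = Q * P * B"
    using * by (intro assoc_mult_mat[symmetric]) auto
  also have "\<dots> = B" using * left_mult_one_mat[of B n n] by simp
  finally show ?thesis .
qed

lemma mat_eqI_mult_vec:
  fixes A B :: "'a::semiring_1 mat"
  assumes "A \<in> carrier_mat n m" "B \<in> carrier_mat n m"
    "\<And>x. x \<in> carrier_vec m \<Longrightarrow> A *\<^sub>v x = B *\<^sub>v x"
  shows "A = B"
proof (rule eq_matI)
  fix i j assume ij: "i < dim_row B" "j < dim_col B"
  have "(A *\<^sub>v unit_vec m j) $ i = (B *\<^sub>v unit_vec m j) $ i"
    using assms(3)[of "unit_vec m j"] by simp
  then show "A $$ (i, j) = B $$ (i, j)"
    using ij assms(1,2) by simp
qed (use assms in auto)

section \<open>Subspaces and idempotents in terms of matrices\<close>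

lemma subspace_vecI:
  fixes W :: "'a::field vec set"
  assumes "W \<subseteq> carrier_vec n" "0\<^sub>v n \<in> W"
    "\<And>v w. v \<in> W \<Longrightarrow> w \<in> W \<Longrightarrow> v + w \<in> W"
    "\<And>c v. v \<in> W \<Longrightarrow> c \<cdot>\<^sub>v v \<in> W"
  shows "subspace class_ring W (module_vec TYPE('a) n)"
proof -
  interpret vec_space "TYPE('a)" n .
  have "submodule class_ring W V"
    using assms by unfold_locales
      (auto simp: class_ring_simps module_vec_simps uminus_l_inv_vec)
  then show ?thesis
    unfolding subspace_def using vec_vs by blast
qed

text \<open>A maximal linearly independent subset of \<open>W\<close> exists because independent
  sets have at most \<open>n\<close> elements; its vectors are the columns of \<open>B\<close>. From
  here on the dimension of a subspace enters as the size of a matrix.\<close>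

lemma subspace_matrix:
  fixes W :: "'a::field vec set"
  assumes W: "subspace class_ring W (module_vec TYPE('a) n)"
    and d: "d = vectorspace.dim class_ring ((module_vec TYPE('a) n)\<lparr>carrier := W\<rparr>)"
  obtains B where "B \<in> carrier_mat n d" "W = {B *\<^sub>v x | x. x \<in> carrier_vec d}"
    "\<And>x. x \<in> carrier_vec d \<Longrightarrow> B *\<^sub>v x = 0\<^sub>v n \<Longrightarrow> x = 0\<^sub>v d"
proof -
  interpret vec_space "TYPE('a)" n .
  have sm: "submodule class_ring W V"
    using W by (simp add: subspace_def)
  have Wc: "W \<subseteq> carrier_vec n"
    using sm by (auto simp: submodule_def module_vec_simps)
  interpret W: vectorspace class_ring "vs W"
    using W subspace_is_vs by blast
  have "lin_indpt {}" by (auto simp: lin_dep_def)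
  moreover have "finite A \<and> card A \<le> dim" if "A \<subseteq> W \<and> lin_indpt A" for A
    using li_le_dim[OF fin_dim, of A] Wc that by blast
  ultimately have "\<exists>S. finite S \<and> maximal S (\<lambda>S. S \<subseteq> W \<and> lin_indpt S)"
    using maximal_exists[of "\<lambda>S. S \<subseteq> W \<and> lin_indpt S" dim "{}"] by blast
  then obtain S where S: "finite S" "maximal S (\<lambda>S. S \<subseteq> W \<and> lin_indpt S)" by blast
  have SW: "S \<subseteq> W" "lin_indpt S" using S by (auto simp: maximal_def)
  have ld: "module.lin_dep class_ring (vs W) T \<longleftrightarrow> lin_dep T" if "T \<subseteq> W" for T
    by (rule span_li_not_depend(2)[OF that sm])
  have "(\<lambda>S. S \<subseteq> carrier (vs W) \<and> \<not> module.lin_dep class_ring (vs W) S) =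
      (\<lambda>S. S \<subseteq> W \<and> lin_indpt S)"
  proof
    fix T show "(T \<subseteq> carrier (vs W) \<and> \<not> module.lin_dep class_ring (vs W) T) = (T \<subseteq> W \<and> lin_indpt T)"
      using ld[of T] by (cases "T \<subseteq> W") simp_all
  qed
  with S(2) have "maximal S (\<lambda>S. S \<subseteq> carrier (vs W) \<and> \<not> module.lin_dep class_ring (vs W) S)"
    by (simp only:)
  then have bas: "W.basis S" by (rule W.max_li_is_basis)
  have dimS: "d = card S" using W.dim_basis[OF S(1) bas] d by simp
  have spanS: "span S = W"
    using bas span_li_not_depend(1)[OF SW(1) sm] unfolding W.basis_def by simp
  obtain ws where ws: "set ws = S" "distinct ws"
    using finite_distinct_list[OF S(1)] by blast
  have len: "length ws = d" using ws dimS distinct_card by fastforce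
  have wsc: "set ws \<subseteq> carrier_vec n" using ws SW Wc by auto
  define B where "B = mat_of_cols n ws"
  have Bc: "B \<in> carrier_mat n d" using len by (auto simp: B_def)
  have lc: "lincomb_list f ws = B *\<^sub>v vec d f" for f
  proof -
    have "\<forall>w\<in>set ws. dim_vec w = n" using wsc by auto
    from lincomb_list_as_mat_mult[OF this] show ?thesis using len by (simp add: B_def)
  qed
  have "W = span_list ws" using span_list_as_span[OF wsc] spanS ws by simp
  also have "\<dots> = {B *\<^sub>v x | x. x \<in> carrier_vec d}"
  proof (intro equalityI subsetI)
    fix v assume "v \<in> {B *\<^sub>v x | x. x \<in> carrier_vec d}"
    then obtain x where x: "v = B *\<^sub>v x" "x \<in> carrier_vec d" by blast
    then have "vec d (($) x) = x" by auto
    then have "v = lincomb_list (($) x) ws" unfolding lc using x by simp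
    then show "v \<in> span_list ws" by (auto simp: span_list_def)
  qed (auto simp: span_list_def lc)
  finally have WB: "W = {B *\<^sub>v x | x. x \<in> carrier_vec d}" .
  have inj: "x = 0\<^sub>v d" if x: "x \<in> carrier_vec d" "B *\<^sub>v x = 0\<^sub>v n" for x
  proof -
    \<comment> \<open>Coefficients of a linear combination over the set \<open>S\<close> are indexed
      by vectors, the entries of \<open>x\<close> by positions; \<open>idx\<close> translates
      between the two.\<close>
    define idx where "idx = the_inv_into {..<d} ((!) ws)"
    have idx: "idx (ws ! i) = i" if "i < d" for i
      unfolding idx_def using that ws(2) len by (intro the_inv_into_f_f inj_on_nth) auto
    have "lincomb (\<lambda>w. x $ idx w) (set ws) = lincomb_list (\<lambda>i. x $ idx (ws ! i)) ws"
      by (rule lincomb_as_lincomb_list_distinct[OF wsc ws(2)])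
    also have "\<dots> = B *\<^sub>v vec d (\<lambda>i. x $ idx (ws ! i))" by (rule lc)
    also have "vec d (\<lambda>i. x $ idx (ws ! i)) = x" using x(1) idx by auto
    finally have z: "lincomb (\<lambda>w. x $ idx w) S = 0\<^sub>v n" using x ws by simp
    have "x $ i = 0" if i: "i < d" for i
    proof (rule ccontr)
      assume "x $ i \<noteq> 0"
      then have "lin_dep S" unfolding lin_dep_def
        using z S(1) idx[OF i] ws(1) nth_mem[of i ws] i len
        by (intro exI[of _ S] exI[of _ "\<lambda>w. x $ idx w"] exI[of _ "ws ! i"]) auto
      then show False using SW by blast
    qed
    then show ?thesis using x(1) by (intro eq_vecI) auto
  qed
  show ?thesis using that Bc WB inj by blast
qed

text \<open>The Gram matrix \<open>B\<^sup>T * B\<close> is invertible: for \<open>x\<close> in its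
  kernel the scalar product of \<open>B *\<^sub>v x\<close> with itself is zero, and it is a sum of
  rational squares.\<close>

lemma left_inverse_rat:
  fixes B :: "rat mat"
  assumes B: "B \<in> carrier_mat n d" and inj: "\<And>x. x \<in> carrier_vec d \<Longrightarrow> B *\<^sub>v x = 0\<^sub>v n \<Longrightarrow> x = 0\<^sub>v d"
  shows "\<exists>C\<in>carrier_mat d n. C * B = 1\<^sub>m d"
proof -
  have "det (B\<^sup>T * B) \<noteq> 0"
  proof
    assume "det (B\<^sup>T * B) = 0"
    then obtain x where x: "x \<in> carrier_vec d" "x \<noteq> 0\<^sub>v d" "(B\<^sup>T * B) *\<^sub>v x = 0\<^sub>v d"
      using det_0_iff_vec_prod_zero[of "B\<^sup>T * B" d] B by auto
    have "0 = x \<bullet> (B\<^sup>T *\<^sub>v (B *\<^sub>v x))"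
      using x B by (metis assoc_mult_mat_vec scalar_prod_right_zero transpose_carrier_mat)
    also have "\<dots> = (B *\<^sub>v x) \<bullet> (B *\<^sub>v x)"
      using B x(1) transpose_vec_mult_scalar[of "B\<^sup>T" d n "B *\<^sub>v x" x] by simp
    finally have "\<forall>i<n. (B *\<^sub>v x) $ i = 0"
      using B by (simp add: scalar_prod_def sum_nonneg_eq_0_iff)
    then have "B *\<^sub>v x = 0\<^sub>v n" using B by (intro eq_vecI) auto
    then show False using inj x by blast
  qed
  then obtain D where D: "D \<in> carrier_mat d d" "D * (B\<^sup>T * B) = 1\<^sub>m d"
    using det_non_zero_imp_unit[of "B\<^sup>T * B" d "()"] B
    by (auto simp: Units_def ring_mat_simps)
  then show ?thesis
    using B by (intro bexI[of _ "D * B\<^sup>T"]) auto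
qed

text \<open>A rank factorisation. It identifies the trace of a projection with the dimension of its
  image, because \<open>B * C\<close> and \<open>C * B\<close> have the same trace.\<close>

lemma idempotent_factor:
  fixes E :: "rat mat"
  assumes E: "E \<in> carrier_mat n n" "E * E = E"
    and d: "d = vectorspace.dim class_ring ((module_vec TYPE(rat) n)\<lparr>carrier := {v \<in> carrier_vec n. E *\<^sub>v v = v}\<rparr>)"
  obtains B C where "B \<in> carrier_mat n d" "C \<in> carrier_mat d n" "C * B = 1\<^sub>m d" "B * C = E"
proof -
  let ?W = "{v \<in> carrier_vec n. E *\<^sub>v v = v}"
  have "subspace class_ring ?W (module_vec TYPE(rat) n)"
    using E(1) by (intro subspace_vecI) (auto simp: mult_add_distrib_mat_vec mult_mat_vec)
  from subspace_matrix[OF this d] obtain B where B: "B \<in> carrier_mat n d" "?W = {B *\<^sub>v x | x. x \<in> carrier_vec d}"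
    "\<And>x. x \<in> carrier_vec d \<Longrightarrow> B *\<^sub>v x = 0\<^sub>v n \<Longrightarrow> x = 0\<^sub>v d" by blast
  obtain C where C: "C \<in> carrier_mat d n" "C * B = 1\<^sub>m d"
    using left_inverse_rat[OF B(1,3)] by blast
  have EB: "E * B = B"
  proof (rule mat_eqI_mult_vec)
    fix x :: "rat vec" assume x: "x \<in> carrier_vec d"
    then have "B *\<^sub>v x \<in> ?W" using B(2) by blast
    then show "E * B *\<^sub>v x = B *\<^sub>v x" using x E B(1) by simp
  qed (use E B in auto)
  \<comment> \<open>A left inverse of \<open>B\<close> alone gives some projection onto the image of
    \<open>E\<close>. Composing it with \<open>E\<close> makes the kernels agree as well.\<close>
  have "B * (C * E) = E"
  proof (rule mat_eqI_mult_vec)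
    fix x :: "rat vec" assume x: "x \<in> carrier_vec n"
    have "E *\<^sub>v (E *\<^sub>v x) = E *\<^sub>v x"
      using E x by (metis assoc_mult_mat_vec)
    then have "E *\<^sub>v x \<in> ?W" using E x by auto
    then obtain y where y: "y \<in> carrier_vec d" "E *\<^sub>v x = B *\<^sub>v y" using B(2) by blast
    have "C *\<^sub>v (B *\<^sub>v y) = y"
      using C B(1) y(1) by (metis assoc_mult_mat_vec one_mult_mat_vec)
    then have "B *\<^sub>v (C *\<^sub>v (E *\<^sub>v x)) = E *\<^sub>v x" using y by simp
    then show "B * (C * E) *\<^sub>v x = E *\<^sub>v x" using x E B C
      by (smt (verit) assoc_mult_mat_vec mult_carrier_mat mult_mat_vec_carrier)
  qed (use E B C in auto)
  moreover have "C * E * B = 1\<^sub>m d"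
    using C B(1) E EB by simp
  ultimately show ?thesis
    using that[of B "C * E"] B(1) C(1) E(1) by auto
qed

text \<open>Matrices of all sizes share one type and have no common zero, so the sum is formed
  entrywise with explicit dimensions.\<close>

definition mat_sum :: "nat \<Rightarrow> nat \<Rightarrow> 'g set \<Rightarrow> ('g \<Rightarrow> 'a::comm_monoid_add mat) \<Rightarrow> 'a mat" where
  "mat_sum n m S f = mat n m (\<lambda>(i, j). \<Sum>g\<in>S. f g $$ (i, j))"

lemma mat_sum_carrier [simp]: "mat_sum n m S f \<in> carrier_mat n m"
  by (simp add: mat_sum_def)

lemma mat_sum_cong: "(\<And>g. g \<in> S \<Longrightarrow> f g = h g) \<Longrightarrow> mat_sum n m S f = mat_sum n m S h"
  by (simp add: mat_sum_def)

lemma mat_sum_mult_left: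
  fixes A :: "'a::comm_semiring_0 mat"
  assumes A: "A \<in> carrier_mat k n" and f: "\<And>g. g \<in> S \<Longrightarrow> f g \<in> carrier_mat n m"
  shows "A * mat_sum n m S f = mat_sum k m S (\<lambda>g. A * f g)"
proof (rule eq_matI)
  fix i j assume ij: "i < dim_row (mat_sum k m S (\<lambda>g. A * f g))" "j < dim_col (mat_sum k m S (\<lambda>g. A * f g))"
  then have "(A * mat_sum n m S f) $$ (i, j) = (\<Sum>l\<in>{0..<n}. \<Sum>g\<in>S. A $$ (i, l) * f g $$ (l, j))"
    using A by (auto simp: mat_sum_def scalar_prod_def sum_distrib_left intro!: sum.cong)
  also have "\<dots> = (\<Sum>g\<in>S. \<Sum>l\<in>{0..<n}. A $$ (i, l) * f g $$ (l, j))"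
    by (rule sum.swap)
  also have "\<dots> = (\<Sum>g\<in>S. (A * f g) $$ (i, j))"
  proof (intro sum.cong refl)
    fix g assume "g \<in> S"
    from f[OF this] show "(\<Sum>l = 0..<n. A $$ (i, l) * f g $$ (l, j)) = (A * f g) $$ (i, j)"
      using A ij by (simp add: mat_sum_def scalar_prod_def)
  qed
  finally show "(A * mat_sum n m S f) $$ (i, j) = mat_sum k m S (\<lambda>g. A * f g) $$ (i, j)"
    using ij by (simp add: mat_sum_def)
qed (use A in \<open>auto simp: mat_sum_def\<close>)

lemma mat_sum_mult_right:
  fixes A :: "'a::comm_semiring_0 mat"
  assumes A: "A \<in> carrier_mat m k" and f: "\<And>g. g \<in> S \<Longrightarrow> f g \<in> carrier_mat n m"
  shows "mat_sum n m S f * A = mat_sum n k S (\<lambda>g. f g * A)"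
proof (rule eq_matI)
  fix i j assume ij: "i < dim_row (mat_sum n k S (\<lambda>g. f g * A))" "j < dim_col (mat_sum n k S (\<lambda>g. f g * A))"
  then have "(mat_sum n m S f * A) $$ (i, j) = (\<Sum>l\<in>{0..<m}. \<Sum>g\<in>S. f g $$ (i, l) * A $$ (l, j))"
    using A by (auto simp: mat_sum_def scalar_prod_def sum_distrib_right intro!: sum.cong)
  also have "\<dots> = (\<Sum>g\<in>S. \<Sum>l\<in>{0..<m}. f g $$ (i, l) * A $$ (l, j))"
    by (rule sum.swap)
  also have "\<dots> = (\<Sum>g\<in>S. (f g * A) $$ (i, j))"
  proof (intro sum.cong refl)
    fix g assume "g \<in> S"
    from f[OF this] show "(\<Sum>l = 0..<m. f g $$ (i, l) * A $$ (l, j)) = (f g * A) $$ (i, j)"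
      using A ij by (simp add: mat_sum_def scalar_prod_def)
  qed
  finally show "(mat_sum n m S f * A) $$ (i, j) = mat_sum n k S (\<lambda>g. f g * A) $$ (i, j)"
    using ij by (simp add: mat_sum_def)
qed (use A in \<open>auto simp: mat_sum_def\<close>)

lemma mat_sum_reindex:
  assumes "bij_betw p S T"
  shows "mat_sum n m S (\<lambda>g. f (p g)) = mat_sum n m T f"
  using assms by (simp add: mat_sum_def sum.reindex_bij_betw[where g = "\<lambda>x. f x $$ _"])

lemma mat_trace_mat_sum:
  assumes "\<And>g. g \<in> S \<Longrightarrow> f g \<in> carrier_mat n n"
  shows "mat_trace (mat_sum n n S f) = (\<Sum>g\<in>S. mat_trace (f g))"
proof -
  have "mat_trace (mat_sum n n S f) = (\<Sum>i<n. \<Sum>g\<in>S. f g $$ (i, i))"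
    by (simp add: mat_trace_def mat_sum_def)
  also have "\<dots> = (\<Sum>g\<in>S. mat_trace (f g))"
    unfolding sum.swap[of _ S] using assms by (intro sum.cong refl) (auto simp: mat_trace_def)
  finally show ?thesis .
qed

lemma mat_sum_mult_vec_const:
  fixes v w :: "'a::field vec"
  assumes f: "\<And>g. g \<in> S \<Longrightarrow> f g \<in> carrier_mat n m" and v: "v \<in> carrier_vec m" "w \<in> carrier_vec n"
    and "\<And>g. g \<in> S \<Longrightarrow> f g *\<^sub>v v = w"
  shows "mat_sum n m S f *\<^sub>v v = of_nat (card S) \<cdot>\<^sub>v w"
proof (rule eq_vecI)
  fix i assume "i < dim_vec (of_nat (card S) \<cdot>\<^sub>v w)"
  then have i: "i < n" using v by simp
  have "(mat_sum n m S f *\<^sub>v v) $ i = (\<Sum>j\<in>{0..<m}. \<Sum>g\<in>S. f g $$ (i, j) * v $ j)"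
    using i v by (simp add: mat_sum_def scalar_prod_def sum_distrib_right)
  also have "\<dots> = (\<Sum>g\<in>S. \<Sum>j\<in>{0..<m}. f g $$ (i, j) * v $ j)" by (rule sum.swap)
  also have "\<dots> = (\<Sum>g\<in>S. (f g *\<^sub>v v) $ i)"
  proof (intro sum.cong refl)
    fix g assume "g \<in> S"
    from f[OF this] show "(\<Sum>j = 0..<m. f g $$ (i, j) * v $ j) = (f g *\<^sub>v v) $ i"
      using i v by (simp add: scalar_prod_def)
  qed
  also have "\<dots> = of_nat (card S) * w $ i" using assms(4) by simp
  finally show "(mat_sum n m S f *\<^sub>v v) $ i = (of_nat (card S) \<cdot>\<^sub>v w) $ i"
    using i v by simp
qed (use v in \<open>auto simp: mat_sum_def\<close>)

section \<open>Averaging over the group and Schur's lemma\<close>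

locale finite_group = group G for G :: "('g, 'b) monoid_scheme" (structure) +
  assumes finite_carrier [simp]: "finite (carrier G)"
begin

lemma is_repD:
  assumes "is_rep G \<rho>"
  shows "g \<in> carrier G \<Longrightarrow> \<rho> g \<in> carrier_mat (rep_dim G \<rho>) (rep_dim G \<rho>)"
    and "\<rho> \<one> = 1\<^sub>m (rep_dim G \<rho>)"
    and "g \<in> carrier G \<Longrightarrow> h \<in> carrier G \<Longrightarrow> \<rho> (g \<otimes> h) = \<rho> g * \<rho> h"
  using assms by (auto simp: is_rep_def)

lemma rep_trace_eq: "rep_trace \<rho> g = mat_trace (\<rho> g)"
  by (simp add: rep_trace_def mat_trace_def)

lemma rep_inv:
  assumes "is_rep G \<rho>" "g \<in> carrier G"
  shows "\<rho> g * \<rho> (inv g) = 1\<^sub>m (rep_dim G \<rho>)" "\<rho> (inv g) * \<rho> g = 1\<^sub>m (rep_dim G \<rho>)"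
  using is_repD[OF assms(1)] assms(2) by (metis inv_closed r_inv l_inv)+

lemma order_pos: "card (carrier G) > 0"
  using finite_carrier one_closed card_gt_0_iff by blast

lemma bij_mult_left: "h \<in> carrier G \<Longrightarrow> bij_betw (\<lambda>g. h \<otimes> g) (carrier G) (carrier G)"
  by (rule bij_betwI[where g = "\<lambda>g. inv h \<otimes> g"]) (auto simp flip: m_assoc)

text \<open>The average of a linear map from the space of \<sigma> to that of \<rho>. Without the
  factor \<open>1 / |G|\<close> it makes sense in every characteristic.\<close>

definition avg :: "('g, 'a::field) rep \<Rightarrow> ('g, 'a) rep \<Rightarrow> 'a mat \<Rightarrow> 'a mat" where
  "avg \<rho> \<sigma> Y = mat_sum (rep_dim G \<rho>) (rep_dim G \<sigma>) (carrier G) (\<lambda>g. \<rho> g * Y * \<sigma> (inv g))"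

lemma avg_carrier [simp]: "avg \<rho> \<sigma> Y \<in> carrier_mat (rep_dim G \<rho>) (rep_dim G \<sigma>)"
  by (simp add: avg_def)

text \<open>Left multiplication by \<open>h\<close> permutes the summands, at the price of a factor
  \<open>\<sigma> h\<close> on the right.\<close>

lemma avg_intertwines:
  fixes \<rho> \<sigma> :: "('g, 'a::field) rep"
  assumes \<rho>: "is_rep G \<rho>" and \<sigma>: "is_rep G \<sigma>" and Y: "Y \<in> carrier_mat (rep_dim G \<rho>) (rep_dim G \<sigma>)"
    and h: "h \<in> carrier G"
  shows "\<rho> h * avg \<rho> \<sigma> Y = avg \<rho> \<sigma> Y * \<sigma> h"
proof -
  let ?n = "rep_dim G \<rho>" and ?m = "rep_dim G \<sigma>"
  note R = is_repD[OF \<rho>] and S = is_repD[OF \<sigma>]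
  have c: "\<rho> g * Y * \<sigma> (inv g) \<in> carrier_mat ?n ?m" if "g \<in> carrier G" for g
    using R(1)[OF that] S(1)[of "inv g"] Y that by auto
  have "\<rho> h * avg \<rho> \<sigma> Y = mat_sum ?n ?m (carrier G) (\<lambda>g. \<rho> h * (\<rho> g * Y * \<sigma> (inv g)))"
    unfolding avg_def by (rule mat_sum_mult_left[OF R(1)[OF h] c])
  also have "\<dots> = mat_sum ?n ?m (carrier G) (\<lambda>g. \<rho> (h \<otimes> g) * Y * \<sigma> (inv (h \<otimes> g)) * \<sigma> h)"
  proof (rule mat_sum_cong)
    fix g assume g: "g \<in> carrier G"
    have 1: "\<sigma> (inv (h \<otimes> g)) * \<sigma> h = \<sigma> (inv g)"
      using S(3)[of "inv (h \<otimes> g)" h] g h by (simp add: inv_mult_group m_assoc)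
    note cc = R(1)[OF h] R(1)[OF g] Y S(1)[of "inv g"] S(1)[of "inv (h \<otimes> g)"] S(1)[OF h]
    have "\<rho> (h \<otimes> g) * Y * \<sigma> (inv (h \<otimes> g)) * \<sigma> h = (\<rho> (h \<otimes> g) * Y) * (\<sigma> (inv (h \<otimes> g)) * \<sigma> h)"
      using cc g h R(1)[of "h \<otimes> g"] by (intro assoc_mult_mat[of _ ?n ?m _ ?m _ ?m]) auto
    also have "\<dots> = (\<rho> h * \<rho> g * Y) * \<sigma> (inv g)"
      unfolding 1 R(3)[OF h g] ..
    also have "\<dots> = \<rho> h * (\<rho> g * Y * \<sigma> (inv g))"
      using cc g by (simp add: assoc_mult_mat[of _ ?n ?n _ ?n _ ?m] assoc_mult_mat[of _ ?n ?n _ ?m _ ?m])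
    finally show "\<rho> h * (\<rho> g * Y * \<sigma> (inv g)) = \<rho> (h \<otimes> g) * Y * \<sigma> (inv (h \<otimes> g)) * \<sigma> h" ..
  qed
  also have "\<dots> = mat_sum ?n ?m (carrier G) (\<lambda>g. \<rho> g * Y * \<sigma> (inv g) * \<sigma> h)"
    by (rule mat_sum_reindex[OF bij_mult_left[OF h]])
  also have "\<dots> = avg \<rho> \<sigma> Y * \<sigma> h"
    unfolding avg_def by (rule mat_sum_mult_right[OF S(1)[OF h] c, symmetric])
  finally show ?thesis .
qed

text \<open>The kernel and the image of \<open>M\<close> are invariant subspaces, so irreducibility
  makes the kernel zero and the image everything. The inverse is assembled from preimages of the
  unit vectors.\<close>

lemma schur_invertible:
  fixes \<rho> \<sigma> :: "('g, 'a::field_char_0) rep"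
  assumes \<rho>: "irreducible_rep G \<rho>" and \<sigma>: "irreducible_rep G \<sigma>"
    and M: "M \<in> carrier_mat (rep_dim G \<rho>) (rep_dim G \<sigma>)"
    and com: "\<And>h. h \<in> carrier G \<Longrightarrow> \<rho> h * M = M * \<sigma> h"
    and nz: "M \<noteq> 0\<^sub>m (rep_dim G \<rho>) (rep_dim G \<sigma>)"
  shows "\<exists>T \<in> carrier_mat (rep_dim G \<sigma>) (rep_dim G \<rho>).
    M * T = 1\<^sub>m (rep_dim G \<rho>) \<and> T * M = 1\<^sub>m (rep_dim G \<sigma>)"
proof -
  let ?n = "rep_dim G \<rho>" and ?m = "rep_dim G \<sigma>"
  have rr: "is_rep G \<rho>" "is_rep G \<sigma>" using \<rho> \<sigma> by (auto simp: irreducible_rep_def)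
  note R = is_repD[OF rr(1)] and S = is_repD[OF rr(2)]
  let ?K = "{v \<in> carrier_vec ?m. M *\<^sub>v v = 0\<^sub>v ?n}"
  let ?I = "{M *\<^sub>v v | v. v \<in> carrier_vec ?m}"
  have zM: "0\<^sub>v ?n = M *\<^sub>v 0\<^sub>v ?m" using M by auto
  have comv: "M *\<^sub>v (\<sigma> g *\<^sub>v w) = \<rho> g *\<^sub>v (M *\<^sub>v w)" if "g \<in> carrier G" "w \<in> carrier_vec ?m" for g w
    using com[OF that(1)] R(1)[OF that(1)] S(1)[OF that(1)] M that(2) by (metis assoc_mult_mat_vec)
  have subK: "subspace class_ring ?K (module_vec TYPE('a) ?m)"
    using M zM by (intro subspace_vecI) (auto simp: mult_add_distrib_mat_vec[OF M] mult_mat_vec[OF M])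
  have subI: "subspace class_ring ?I (module_vec TYPE('a) ?n)"
  proof (rule subspace_vecI)
    fix v w assume "v \<in> ?I" "w \<in> ?I"
    then obtain a b where "v = M *\<^sub>v a" "w = M *\<^sub>v b" "a \<in> carrier_vec ?m" "b \<in> carrier_vec ?m" by blast
    then show "v + w \<in> ?I" using mult_add_distrib_mat_vec[OF M, of a b] by (auto intro!: exI[of _ "a + b"])
  next
    fix c v assume "v \<in> ?I"
    then obtain a where "v = M *\<^sub>v a" "a \<in> carrier_vec ?m" by blast
    then show "c \<cdot>\<^sub>v v \<in> ?I" using mult_mat_vec[OF M, of a c] by (auto intro!: exI[of _ "c \<cdot>\<^sub>v a"])
  qed (use M zM in \<open>auto intro!: exI[of _ "0\<^sub>v ?m"]\<close>)
  have "\<forall>g\<in>carrier G. \<forall>w\<in>?K. \<sigma> g *\<^sub>v w \<in> ?K"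
  proof (intro ballI)
    fix g w assume "g \<in> carrier G" "w \<in> ?K"
    then show "\<sigma> g *\<^sub>v w \<in> ?K"
      using comv[of g w] S(1)[of g] mult_mat_vec_carrier[OF S(1)[of g], of w] R(1)[of g] by auto
  qed
  then have K: "?K = {0\<^sub>v ?m} \<or> ?K = carrier_vec ?m"
    using \<sigma> subK unfolding irreducible_rep_def by blast
  have "\<forall>g\<in>carrier G. \<forall>w\<in>?I. \<rho> g *\<^sub>v w \<in> ?I"
  proof (intro ballI)
    fix g w assume g: "g \<in> carrier G" and "w \<in> ?I"
    then obtain a where "w = M *\<^sub>v a" "a \<in> carrier_vec ?m" by blast
    then show "\<rho> g *\<^sub>v w \<in> ?I"
      using comv[of g a, symmetric] S(1)[of g] g by (auto intro!: exI[of _ "\<sigma> g *\<^sub>v a"])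
  qed
  then have I: "?I = {0\<^sub>v ?n} \<or> ?I = carrier_vec ?n"
    using \<rho> subI unfolding irreducible_rep_def by blast
  have ex: "\<exists>v\<in>carrier_vec ?m. M *\<^sub>v v \<noteq> 0\<^sub>v ?n"
  proof (rule ccontr)
    assume "\<not> ?thesis"
    then have "M = 0\<^sub>m ?n ?m" using M by (intro mat_eqI_mult_vec[OF M]) auto
    then show False using nz by blast
  qed
  have K0: "?K = {0\<^sub>v ?m}" using K ex by blast
  have I1: "?I = carrier_vec ?n" using I ex by blast
  have "\<forall>i<?n. \<exists>s. s \<in> carrier_vec ?m \<and> M *\<^sub>v s = unit_vec ?n i"
  proof (intro allI impI)
    fix i have "unit_vec ?n i \<in> ?I" using I1 by simp
    then show "\<exists>s. s \<in> carrier_vec ?m \<and> M *\<^sub>v s = unit_vec ?n i" by force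
  qed
  then obtain s where s: "\<And>i. i < ?n \<Longrightarrow> s i \<in> carrier_vec ?m \<and> M *\<^sub>v s i = unit_vec ?n i" by metis
  define T where "T = mat ?m ?n (\<lambda>(i, j). s j $ i)"
  have T: "T \<in> carrier_mat ?m ?n" by (simp add: T_def)
  have colT: "col T j = s j" if "j < ?n" for j
    using s[OF that] that by (intro eq_vecI) (auto simp: T_def)
  have MT: "M * T = 1\<^sub>m ?n"
  proof (rule eq_matI)
    fix i j assume ij: "i < dim_row (1\<^sub>m ?n)" "j < dim_col (1\<^sub>m ?n)"
    then have "(M * T) $$ (i, j) = row M i \<bullet> s j" using M T colT by simp
    also have "\<dots> = (M *\<^sub>v s j) $ i" using ij M by simp
    also have "\<dots> = 1\<^sub>m ?n $$ (i, j)" using s ij by auto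
    finally show "(M * T) $$ (i, j) = 1\<^sub>m ?n $$ (i, j)" .
  qed (use M T in auto)
  have TM: "T * M = 1\<^sub>m ?m"
  proof (rule mat_eqI_mult_vec)
    fix x :: "'a vec" assume x: "x \<in> carrier_vec ?m"
    let ?y = "T *\<^sub>v (M *\<^sub>v x)"
    have y: "?y \<in> carrier_vec ?m" "M *\<^sub>v x \<in> carrier_vec ?n" using T M x by auto
    have "M *\<^sub>v ?y = (M * T) *\<^sub>v (M *\<^sub>v x)" using M T y(2) by (rule assoc_mult_mat_vec[symmetric])
    then have "M *\<^sub>v ?y = M *\<^sub>v x" using MT y by simp
    then have "M *\<^sub>v (?y - x) = 0\<^sub>v ?n" using M y x by (subst mult_minus_distrib_mat_vec) auto
    then have "?y - x \<in> ?K" using y x by auto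
    then have "?y - x = 0\<^sub>v ?m" using K0 by auto
    then have "(?y - x) $ i = 0" if "i < ?m" for i using that by simp
    then have "?y $ i = x $ i" if "i < ?m" for i using that x y(1) by force
    moreover have "dim_vec ?y = ?m" "dim_vec x = ?m" using x y(1) by (simp_all only: carrier_vecD)
    ultimately have "?y = x" by (metis eq_vecI)
    then show "T * M *\<^sub>v x = 1\<^sub>m ?m *\<^sub>v x" using T M x by (simp add: assoc_mult_mat_vec[OF T M x])
  qed (use T M in auto)
  show ?thesis using T MT TM by blast
qed

lemma schur_iso:
  fixes \<rho> \<sigma> :: "('g, 'a::field_char_0) rep"
  assumes \<rho>: "irreducible_rep G \<rho>" and \<sigma>: "irreducible_rep G \<sigma>"
    and M: "M \<in> carrier_mat (rep_dim G \<rho>) (rep_dim G \<sigma>)"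
    and com: "\<And>h. h \<in> carrier G \<Longrightarrow> \<rho> h * M = M * \<sigma> h"
    and nz: "M \<noteq> 0\<^sub>m (rep_dim G \<rho>) (rep_dim G \<sigma>)"
  shows "rep_iso G \<sigma> \<rho>"
proof -
  let ?n = "rep_dim G \<rho>" and ?m = "rep_dim G \<sigma>"
  obtain T where T: "T \<in> carrier_mat ?m ?n" "M * T = 1\<^sub>m ?n" "T * M = 1\<^sub>m ?m"
    using schur_invertible[OF assms] by blast
  \<comment> \<open>The two identity matrices \<open>M * T\<close> and \<open>T * M\<close> have
    equal traces, and in characteristic zero this forces equal dimensions.\<close>
  have "(of_nat ?n :: 'a) = of_nat ?m"
    using mat_trace_mult_comm[OF M T(1)] T by simp
  then have "?n = ?m" by simp
  then show ?thesis
    unfolding rep_iso_def using M T com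
    by (intro conjI bexI[of _ M] invertible_matI[of M ?n T]) auto
qed

end

lemma mat_assoc:
  fixes A B C :: "'a::semiring_0 mat"
  shows "dim_col A = dim_row B \<Longrightarrow> dim_col B = dim_row C \<Longrightarrow> A * B * C = A * (B * C)"
  by (intro assoc_mult_mat) auto

lemma smult_mat_mult_vec:
  fixes A :: "'a::comm_semiring_0 mat"
  assumes "A \<in> carrier_mat n m" "v \<in> carrier_vec m"
  shows "(c \<cdot>\<^sub>m A) *\<^sub>v v = c \<cdot>\<^sub>v (A *\<^sub>v v)"
  using assms by (intro eq_vecI) (auto simp: scalar_prod_def sum_distrib_left mult.assoc intro!: sum.cong)

lemma scalar_prod_mult_mat_vec:
  fixes A :: "'a::comm_semiring_0 mat"
  assumes "x \<in> carrier_vec n" "A \<in> carrier_mat n n"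
  shows "x \<bullet> (A *\<^sub>v x) = (\<Sum>i\<in>{0..<n}. \<Sum>j\<in>{0..<n}. x $ i * (A $$ (i, j) * x $ j))"
  using assms by (simp add: scalar_prod_def sum_distrib_left)

section \<open>Orthogonality of characters\<close>

definition elem_mat :: "nat \<Rightarrow> nat \<Rightarrow> nat \<Rightarrow> nat \<Rightarrow> 'a::zero_neq_one mat" where
  "elem_mat n m k l = mat n m (\<lambda>(i, j). if i = k \<and> j = l then 1 else 0)"

lemma elem_mat_carrier [simp]: "elem_mat n m k l \<in> carrier_mat n m"
  by (simp add: elem_mat_def)

lemma elem_mat_sandwich:
  fixes A B :: "'a::comm_semiring_1 mat"
  assumes "A \<in> carrier_mat p n" "B \<in> carrier_mat m q" "i < p" "j < q" "k < n" "l < m"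
  shows "(A * elem_mat n m k l * B) $$ (i, j) = A $$ (i, k) * B $$ (l, j)"
proof -
  have "(A * elem_mat n m k l) $$ (i, b) = (if b = l then A $$ (i, k) else 0)" if "b < m" for b
  proof -
    have "(A * elem_mat n m k l) $$ (i, b) = (\<Sum>a\<in>{0..<n}. A $$ (i, a) * (if a = k \<and> b = l then 1 else 0))"
      using assms that by (simp add: elem_mat_def scalar_prod_def)
    also have "\<dots> = (\<Sum>a\<in>{0..<n}. if a = k then (if b = l then A $$ (i, k) else 0) else 0)"
      by (intro sum.cong) auto
    finally show ?thesis using assms(5) by simp
  qed
  then have "(A * elem_mat n m k l * B) $$ (i, j) = (\<Sum>b\<in>{0..<m}. (if b = l then A $$ (i, k) else 0) * B $$ (b, j))"
    using assms by (simp add: elem_mat_def scalar_prod_def)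
  also have "\<dots> = (\<Sum>b\<in>{0..<m}. if b = l then A $$ (i, k) * B $$ (l, j) else 0)"
    by (intro sum.cong) auto
  finally show ?thesis using assms(6) by simp
qed

lemma mat_trace_elem_mat:
  "k < n \<Longrightarrow> mat_trace (elem_mat n n k l :: 'a::comm_semiring_1 mat) = (if k = l then 1 else 0)"
proof -
  assume k: "k < n"
  have "mat_trace (elem_mat n n k l :: 'a mat) = (\<Sum>i<n. if i = k then (if k = l then 1 else 0) else 0)"
    by (auto simp: mat_trace_def elem_mat_def intro!: sum.cong)
  then show ?thesis using k by simp
qed

lemma mat_trace_transpose: "A \<in> carrier_mat n n \<Longrightarrow> mat_trace (A\<^sup>T) = mat_trace A"
  by (auto simp: mat_trace_def)

lemma mat_trace_smult: "A \<in> carrier_mat n n \<Longrightarrow> mat_trace (c \<cdot>\<^sub>m A) = c * mat_trace A"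
  for c :: "'a::comm_semiring_1"
  by (auto simp: mat_trace_def sum_distrib_left)

context finite_group begin

text \<open>A product of two diagonal entries is an entry of
  \<open>\<rho> g * E * \<sigma> (inv g)\<close> for a matrix unit \<open>E\<close>. This reduces
  the inner product to averages, to which Schur's lemma applies.\<close>

lemma character_inner_product:
  fixes \<rho> \<sigma> :: "('g, 'a::field) rep"
  assumes \<rho>: "is_rep G \<rho>" and \<sigma>: "is_rep G \<sigma>"
  shows "(\<Sum>g\<in>carrier G. rep_trace \<rho> g * rep_trace \<sigma> (inv g)) =
    (\<Sum>i<rep_dim G \<rho>. \<Sum>j<rep_dim G \<sigma>. avg \<rho> \<sigma> (elem_mat (rep_dim G \<rho>) (rep_dim G \<sigma>) i j) $$ (i, j))"
proof -
  let ?n = "rep_dim G \<rho>" and ?m = "rep_dim G \<sigma>"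
  note R = is_repD[OF \<rho>] and S = is_repD[OF \<sigma>]
  have "(\<Sum>g\<in>carrier G. rep_trace \<rho> g * rep_trace \<sigma> (inv g)) =
      (\<Sum>g\<in>carrier G. \<Sum>i<?n. \<Sum>j<?m. (\<rho> g * elem_mat ?n ?m i j * \<sigma> (inv g)) $$ (i, j))"
  proof (intro sum.cong refl)
    fix g assume g: "g \<in> carrier G"
    then have *: "\<rho> g \<in> carrier_mat ?n ?n" "\<sigma> (inv g) \<in> carrier_mat ?m ?m" using R S by auto
    then show "rep_trace \<rho> g * rep_trace \<sigma> (inv g) =
        (\<Sum>i<?n. \<Sum>j<?m. (\<rho> g * elem_mat ?n ?m i j * \<sigma> (inv g)) $$ (i, j))"
      by (simp add: rep_trace_def sum_product elem_mat_sandwich[OF *] del: index_mult_mat)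
  qed
  also have "\<dots> = (\<Sum>i<?n. \<Sum>g\<in>carrier G. \<Sum>j<?m. (\<rho> g * elem_mat ?n ?m i j * \<sigma> (inv g)) $$ (i, j))"
    by (rule sum.swap)
  also have "\<dots> = (\<Sum>i<?n. \<Sum>j<?m. \<Sum>g\<in>carrier G. (\<rho> g * elem_mat ?n ?m i j * \<sigma> (inv g)) $$ (i, j))"
    by (intro sum.cong refl sum.swap)
  finally show ?thesis by (simp add: avg_def mat_sum_def)
qed

lemma schur_orthogonal:
  fixes \<rho> \<sigma> :: "('g, 'a::field_char_0) rep"
  assumes \<rho>: "irreducible_rep G \<rho>" and \<sigma>: "irreducible_rep G \<sigma>" and "\<not> rep_iso G \<sigma> \<rho>"
  shows "(\<Sum>g\<in>carrier G. rep_trace \<rho> g * rep_trace \<sigma> (inv g)) = 0"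
proof -
  have rr: "is_rep G \<rho>" "is_rep G \<sigma>" using \<rho> \<sigma> by (auto simp: irreducible_rep_def)
  have "avg \<rho> \<sigma> Y = 0\<^sub>m (rep_dim G \<rho>) (rep_dim G \<sigma>)" if "Y \<in> carrier_mat (rep_dim G \<rho>) (rep_dim G \<sigma>)" for Y
    using schur_iso[OF \<rho> \<sigma> avg_carrier avg_intertwines[OF rr that]] assms(3) by blast
  then show ?thesis
    unfolding character_inner_product[OF rr] by simp
qed

text \<open>Over an algebraically closed field every average is a scalar matrix, and comparing
  traces determines the scalar as \<open>|G|\<close> times the trace of \<open>Y\<close> divided by
  the dimension. For matrix units only the diagonal ones contribute, each the same amount.\<close>

lemma schur_norm:
  fixes \<rho> :: "('g, 'a::{alg_closed_field, field_char_0}) rep"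
  assumes \<rho>: "irreducible_rep G \<rho>"
  shows "(\<Sum>g\<in>carrier G. rep_trace \<rho> g * rep_trace \<rho> (inv g)) = of_nat (card (carrier G))"
proof -
  let ?n = "rep_dim G \<rho>"
  have r: "is_rep G \<rho>" and n: "?n > 0" using \<rho> by (auto simp: irreducible_rep_def)
  note R = is_repD[OF r]
  \<comment> \<open>Subtracting an eigenvalue leaves an intertwiner that kills an eigenvector. It is
    not invertible, so by Schur's lemma it is zero.\<close>
  have sc: "\<exists>c. avg \<rho> \<rho> Y = c \<cdot>\<^sub>m 1\<^sub>m ?n" if Y: "Y \<in> carrier_mat ?n ?n" for Y
  proof -
    let ?M = "avg \<rho> \<rho> Y"
    have "degree (char_poly ?M) > 0" using degree_monic_char_poly[OF avg_carrier[of \<rho> \<rho> Y]] n by simp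
    then obtain c where "poly (char_poly ?M) c = 0" using alg_closed_imp_poly_has_root by blast
    then have "eigenvalue ?M c" using eigenvalue_root_char_poly[OF avg_carrier[of \<rho> \<rho> Y]] by simp
    then obtain v where v: "v \<in> carrier_vec ?n" "v \<noteq> 0\<^sub>v ?n" "?M *\<^sub>v v = c \<cdot>\<^sub>v v"
      unfolding eigenvalue_def eigenvector_def by (metis avg_carrier carrier_matD(1))
    let ?D = "?M - c \<cdot>\<^sub>m 1\<^sub>m ?n"
    have D: "?D \<in> carrier_mat ?n ?n" by (rule minus_carrier_mat) simp
    have Dv: "?D *\<^sub>v v = 0\<^sub>v ?n"
    proof -
      have "?D *\<^sub>v v = ?M *\<^sub>v v - (c \<cdot>\<^sub>m 1\<^sub>m ?n) *\<^sub>v v"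
        using v(1) by (intro minus_mult_distrib_mat_vec[of _ ?n ?n]) auto
      also have "(c \<cdot>\<^sub>m 1\<^sub>m ?n) *\<^sub>v v = c \<cdot>\<^sub>v v" using v(1) by (intro eq_vecI) auto
      finally show ?thesis using v(1,3) by simp
    qed
    have com: "\<rho> h * ?D = ?D * \<rho> h" if h: "h \<in> carrier G" for h
      using avg_intertwines[OF r r Y h] R(1)[OF h]
      by (simp add: mult_minus_distrib_mat[OF _ avg_carrier] minus_mult_distrib_mat[OF avg_carrier]
           mult_smult_distrib[of _ ?n ?n _ ?n] mult_smult_assoc_mat[of _ ?n ?n _ ?n])
    have "?D = 0\<^sub>m ?n ?n"
    proof (rule ccontr)
      assume "?D \<noteq> 0\<^sub>m ?n ?n"
      from schur_invertible[OF \<rho> \<rho> D com this] obtain T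
        where T: "T \<in> carrier_mat ?n ?n" "T * ?D = 1\<^sub>m ?n" by blast
      have "v = (T * ?D) *\<^sub>v v" using T v(1) by simp
      also have "\<dots> = T *\<^sub>v (?D *\<^sub>v v)" using T(1) D v(1) by (rule assoc_mult_mat_vec)
      also have "\<dots> = 0\<^sub>v ?n" unfolding Dv using T(1) by (intro eq_vecI) auto
      finally show False using v(2) by simp
    qed
    have "?M $$ (i, j) = (c \<cdot>\<^sub>m 1\<^sub>m ?n) $$ (i, j)" if "i < ?n" "j < ?n" for i j
    proof -
      have "?D $$ (i, j) = 0" using \<open>?D = 0\<^sub>m ?n ?n\<close> that by simp
      then show ?thesis using that by simp
    qed
    then have "?M = c \<cdot>\<^sub>m 1\<^sub>m ?n" by (intro eq_matI) (auto simp: carrier_matD[OF avg_carrier])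
    then show ?thesis by blast
  qed
  have tr: "mat_trace (avg \<rho> \<rho> Y) = of_nat (card (carrier G)) * mat_trace Y" if Y: "Y \<in> carrier_mat ?n ?n" for Y
  proof -
    have "mat_trace (\<rho> g * Y * \<rho> (inv g)) = mat_trace Y" if g: "g \<in> carrier G" for g
    proof -
      have "mat_trace (\<rho> g * Y * \<rho> (inv g)) = mat_trace (\<rho> (inv g) * (\<rho> g * Y))"
        using g R(1)[of "inv g"] mult_carrier_mat[OF R(1)[OF g] Y] by (intro mat_trace_mult_comm[of _ ?n ?n]) auto
      also have "\<rho> (inv g) * (\<rho> g * Y) = (\<rho> (inv g) * \<rho> g) * Y"
        using R(1)[OF g] R(1)[of "inv g"] g Y by (simp add: mat_assoc)
      finally show ?thesis using rep_inv[OF r g] Y by simp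
    qed
    moreover have "\<rho> g * Y * \<rho> (inv g) \<in> carrier_mat ?n ?n" if "g \<in> carrier G" for g
      using R(1)[OF that] R(1)[of "inv g"] Y that by simp
    ultimately show ?thesis unfolding avg_def by (simp add: mat_trace_mat_sum)
  qed
  have entry: "avg \<rho> \<rho> (elem_mat ?n ?n i j) $$ (i, j) = (if i = j then of_nat (card (carrier G)) / of_nat ?n else 0)"
    if ij: "i < ?n" "j < ?n" for i j
  proof -
    obtain c where c: "avg \<rho> \<rho> (elem_mat ?n ?n i j) = c \<cdot>\<^sub>m 1\<^sub>m ?n" using sc elem_mat_carrier by blast
    have "c * of_nat ?n = of_nat (card (carrier G)) * (if i = j then 1 else 0)"
      using tr[OF elem_mat_carrier[of ?n ?n i j]] ij
      unfolding c mat_trace_elem_mat[OF ij(1)] by (simp add: mat_trace_smult[of _ ?n])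
    then show ?thesis unfolding c using ij n by (auto simp: field_simps)
  qed
  show ?thesis
  proof -
    have "(\<Sum>i<?n. \<Sum>j<?n. avg \<rho> \<rho> (elem_mat ?n ?n i j) $$ (i, j)) =
        (\<Sum>i<?n. \<Sum>j<?n. if i = j then of_nat (card (carrier G)) / of_nat ?n else 0)"
      by (intro sum.cong refl entry) auto
    then show ?thesis unfolding character_inner_product[OF r r] using n by simp
  qed
qed

text \<open>The sum of \<open>(\<rho> g)\<^sup>T * \<rho> g\<close> over the group is invariant by
  reindexing, and positive definite because its values are sums of rational squares. It identifies
  the representation with its dual.\<close>

lemma rat_invariant_form:
  fixes \<rho> :: "('g, rat) rep"
  assumes r: "is_rep G \<rho>"
  obtains B where "B \<in> carrier_mat (rep_dim G \<rho>) (rep_dim G \<rho>)" "invertible_mat B"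
    "\<And>h. h \<in> carrier G \<Longrightarrow> B * \<rho> h = (\<rho> (inv h))\<^sup>T * B"
proof -
  let ?n = "rep_dim G \<rho>"
  note R = is_repD[OF r]
  define B where "B = mat_sum ?n ?n (carrier G) (\<lambda>g. (\<rho> g)\<^sup>T * \<rho> g)"
  have B: "B \<in> carrier_mat ?n ?n" by (simp add: B_def)
  have c: "(\<rho> g)\<^sup>T * \<rho> g \<in> carrier_mat ?n ?n" if "g \<in> carrier G" for g
    using R(1)[OF that] by auto
  have "B *\<^sub>v x = 0\<^sub>v ?n \<Longrightarrow> x = 0\<^sub>v ?n" if x: "x \<in> carrier_vec ?n" for x
  proof -
    assume Bx: "B *\<^sub>v x = 0\<^sub>v ?n"
    have "0 = (\<Sum>i\<in>{0..<?n}. x $ i * (B *\<^sub>v x) $ i)" using Bx by simp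
    also have "\<dots> = (\<Sum>i\<in>{0..<?n}. \<Sum>j\<in>{0..<?n}. \<Sum>g\<in>carrier G. x $ i * (((\<rho> g)\<^sup>T * \<rho> g) $$ (i, j) * x $ j))"
      using x by (auto simp: B_def mat_sum_def scalar_prod_def[of _ x] sum_distrib_left sum_distrib_right intro!: sum.cong)
    also have "\<dots> = (\<Sum>i\<in>{0..<?n}. \<Sum>g\<in>carrier G. \<Sum>j\<in>{0..<?n}. x $ i * (((\<rho> g)\<^sup>T * \<rho> g) $$ (i, j) * x $ j))"
      by (intro sum.cong refl sum.swap)
    also have "\<dots> = (\<Sum>g\<in>carrier G. \<Sum>i\<in>{0..<?n}. \<Sum>j\<in>{0..<?n}. x $ i * (((\<rho> g)\<^sup>T * \<rho> g) $$ (i, j) * x $ j))"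
      by (rule sum.swap)
    also have "\<dots> = (\<Sum>g\<in>carrier G. (\<rho> g *\<^sub>v x) \<bullet> (\<rho> g *\<^sub>v x))"
    proof (intro sum.cong refl)
      fix g assume g: "g \<in> carrier G"
      note Rg = R(1)[OF g]
      have "(\<Sum>i\<in>{0..<?n}. \<Sum>j\<in>{0..<?n}. x $ i * (((\<rho> g)\<^sup>T * \<rho> g) $$ (i, j) * x $ j)) =
          x \<bullet> (((\<rho> g)\<^sup>T * \<rho> g) *\<^sub>v x)"
        by (rule scalar_prod_mult_mat_vec[OF x c[OF g], symmetric])
      also have "((\<rho> g)\<^sup>T * \<rho> g) *\<^sub>v x = (\<rho> g)\<^sup>T *\<^sub>v (\<rho> g *\<^sub>v x)"
        using Rg x by (intro assoc_mult_mat_vec[of _ ?n ?n]) auto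
      also have "x \<bullet> \<dots> = (\<rho> g *\<^sub>v x) \<bullet> (\<rho> g *\<^sub>v x)"
        using transpose_vec_mult_scalar[of "(\<rho> g)\<^sup>T" ?n ?n "\<rho> g *\<^sub>v x" x] Rg x by simp
      finally show "(\<Sum>i\<in>{0..<?n}. \<Sum>j\<in>{0..<?n}. x $ i * (((\<rho> g)\<^sup>T * \<rho> g) $$ (i, j) * x $ j)) =
          (\<rho> g *\<^sub>v x) \<bullet> (\<rho> g *\<^sub>v x)" .
    qed
    finally have "(\<Sum>g\<in>carrier G. (\<rho> g *\<^sub>v x) \<bullet> (\<rho> g *\<^sub>v x)) = 0" by simp
    moreover have "(\<rho> g *\<^sub>v x) \<bullet> (\<rho> g *\<^sub>v x) \<ge> 0" for g
      by (auto simp: scalar_prod_def intro!: sum_nonneg)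
    \<comment> \<open>The summand of the identity element alone already forces
      \<open>x = 0\<close>.\<close>
    ultimately have "(\<rho> \<one> *\<^sub>v x) \<bullet> (\<rho> \<one> *\<^sub>v x) = 0"
      by (simp add: sum_nonneg_eq_0_iff)
    then have "x \<bullet> x = 0" using R(2) x by simp
    then have "\<forall>i<?n. x $ i = 0" using x by (simp add: scalar_prod_def sum_nonneg_eq_0_iff)
    then show ?thesis using x by (intro eq_vecI) auto
  qed
  then obtain C where C: "C \<in> carrier_mat ?n ?n" "C * B = 1\<^sub>m ?n"
    using left_inverse_rat[OF B] by blast
  have "B * C = 1\<^sub>m ?n" using mat_mult_left_right_inverse[OF C(1) B C(2)] .
  then have inv: "invertible_mat B" using invertible_matI[OF B C(1) C(2)] by blast
  have "B * \<rho> h = (\<rho> (inv h))\<^sup>T * B" if h: "h \<in> carrier G" for h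
  proof -
    have h': "inv h \<in> carrier G" using h by simp
    have "(\<rho> (inv h))\<^sup>T * B = mat_sum ?n ?n (carrier G) (\<lambda>g. (\<rho> (inv h))\<^sup>T * ((\<rho> g)\<^sup>T * \<rho> g))"
      unfolding B_def using R(1)[OF h'] by (intro mat_sum_mult_left c) auto
    also have "\<dots> = mat_sum ?n ?n (carrier G) (\<lambda>g. (\<rho> (inv h))\<^sup>T * ((\<rho> (g \<otimes> h))\<^sup>T * \<rho> (g \<otimes> h)))"
      by (rule mat_sum_reindex[symmetric], rule bij_betwI[where g = "\<lambda>g. g \<otimes> inv h"])
        (use h in \<open>auto simp: m_assoc\<close>)
    also have "\<dots> = mat_sum ?n ?n (carrier G) (\<lambda>g. (\<rho> g)\<^sup>T * \<rho> g * \<rho> h)"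
    proof (rule mat_sum_cong)
      fix g assume g: "g \<in> carrier G"
      note cc = R(1)[OF g] R(1)[OF h] R(1)[OF h'] R(1)[of "g \<otimes> h"]
      have "(\<rho> (inv h))\<^sup>T * ((\<rho> (g \<otimes> h))\<^sup>T * \<rho> (g \<otimes> h)) = ((\<rho> (inv h))\<^sup>T * (\<rho> (g \<otimes> h))\<^sup>T) * \<rho> (g \<otimes> h)"
        using cc g h by (simp add: mat_assoc)
      also have "(\<rho> (inv h))\<^sup>T * (\<rho> (g \<otimes> h))\<^sup>T = (\<rho> (g \<otimes> h) * \<rho> (inv h))\<^sup>T"
        using cc g h by (intro transpose_mult[symmetric, of _ ?n ?n _ ?n]) auto
      also have "\<rho> (g \<otimes> h) * \<rho> (inv h) = \<rho> g"
        using R(3)[of "g \<otimes> h" "inv h"] g h by (simp add: m_assoc)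
      also have "(\<rho> g)\<^sup>T * \<rho> (g \<otimes> h) = (\<rho> g)\<^sup>T * \<rho> g * \<rho> h"
        using cc R(3)[OF g h] by (simp add: mat_assoc)
      finally show "(\<rho> (inv h))\<^sup>T * ((\<rho> (g \<otimes> h))\<^sup>T * \<rho> (g \<otimes> h)) = (\<rho> g)\<^sup>T * \<rho> g * \<rho> h" .
    qed
    also have "\<dots> = B * \<rho> h"
      unfolding B_def using R(1)[OF h] by (intro mat_sum_mult_right[symmetric] c) auto
    finally show ?thesis ..
  qed
  then show ?thesis using that B inv by blast
qed

text \<open>The invariant form makes \<open>\<rho> h\<close> similar to the transpose of
  \<open>\<rho> (inv h)\<close>. This self-duality is what permits the symmetrisation of the
  ramification character.\<close>

lemma rat_trace_inv:
  fixes \<rho> :: "('g, rat) rep"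
  assumes r: "is_rep G \<rho>" and h: "h \<in> carrier G"
  shows "rep_trace \<rho> (inv h) = rep_trace \<rho> h"
proof -
  let ?n = "rep_dim G \<rho>"
  note R = is_repD[OF r]
  obtain B where B: "B \<in> carrier_mat ?n ?n" "invertible_mat B" "B * \<rho> h = (\<rho> (inv h))\<^sup>T * B"
    using rat_invariant_form[OF r] h by metis
  have c: "\<rho> h \<in> carrier_mat ?n ?n" "\<rho> (inv h) \<in> carrier_mat ?n ?n" using R(1) h by auto
  have "mat_trace (\<rho> h) = mat_trace ((\<rho> (inv h))\<^sup>T)"
    using similar_mat_intertwine[OF B(1,2) c(1) _ B(3)] c(2) by (intro mat_trace_similar) auto
  then show ?thesis using c(2) by (simp add: rep_trace_eq mat_trace_transpose)
qed

text \<open>The average of \<rho> over \<open>H\<close> is an idempotent whose image is the space of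
  fixed vectors, so its trace is the dimension of that space.\<close>

lemma sum_trace_subgroup:
  fixes \<rho> :: "('g, rat) rep"
  assumes r: "is_rep G \<rho>" and H: "subgroup H G"
  shows "(\<Sum>h\<in>H. rep_trace \<rho> h) = of_nat (card H) * of_nat (fixed_dim G \<rho> H)"
proof -
  let ?n = "rep_dim G \<rho>"
  note R = is_repD[OF r]
  have HG: "H \<subseteq> carrier G" and fH: "finite H" and one: "\<one> \<in> H"
    using H finite_subset[OF _ finite_carrier] by (auto simp: subgroup_def)
  have cH: "card H > 0" using fH one card_gt_0_iff by blast
  define M where "M = mat_sum ?n ?n H \<rho>"
  have M: "M \<in> carrier_mat ?n ?n" by (simp add: M_def)
  have Rc: "\<rho> h \<in> carrier_mat ?n ?n" if "h \<in> H" for h using R(1) that HG by blast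
  have bij: "bij_betw (\<lambda>x. h \<otimes> x) H H" if h: "h \<in> H" for h
    by (rule bij_betwI[where g = "\<lambda>x. inv h \<otimes> x"])
      (use H h HG in \<open>auto simp: subgroup.m_closed subgroup.m_inv_closed subsetD simp flip: m_assoc\<close>)
  have hM: "\<rho> h * M = M" if h: "h \<in> H" for h
  proof -
    have "\<rho> h * M = mat_sum ?n ?n H (\<lambda>g. \<rho> h * \<rho> g)"
      unfolding M_def by (rule mat_sum_mult_left[OF Rc[OF h] Rc])
    also have "\<dots> = mat_sum ?n ?n H (\<lambda>g. \<rho> (h \<otimes> g))"
      using R(3) h HG by (intro mat_sum_cong) (metis subsetD)
    also have "\<dots> = M" unfolding M_def by (rule mat_sum_reindex[OF bij[OF h]])
    finally show ?thesis .
  qed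
  define E where "E = (1 / of_nat (card H)) \<cdot>\<^sub>m M"
  have E: "E \<in> carrier_mat ?n ?n" using M by (simp add: E_def)
  have hE: "\<rho> h * E = E" if h: "h \<in> H" for h
    unfolding E_def using hM[OF h] Rc[OF h] M by (simp add: mult_smult_distrib)
  have fix1: "E *\<^sub>v v = v" if "v \<in> carrier_vec ?n" "\<And>h. h \<in> H \<Longrightarrow> \<rho> h *\<^sub>v v = v" for v
  proof -
    have "M *\<^sub>v v = of_nat (card H) \<cdot>\<^sub>v v"
      unfolding M_def by (rule mat_sum_mult_vec_const[OF Rc that(1) that(1) that(2)])
    then have "E *\<^sub>v v = (1 / of_nat (card H)) \<cdot>\<^sub>v (of_nat (card H) \<cdot>\<^sub>v v)"
      unfolding E_def using smult_mat_mult_vec[OF M that(1)] by simp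
    then show ?thesis using cH that(1) by (simp add: smult_smult_assoc)
  qed
  have fix2: "\<rho> h *\<^sub>v (E *\<^sub>v v) = E *\<^sub>v v" if "v \<in> carrier_vec ?n" "h \<in> H" for v h
    using hE[OF that(2)] assoc_mult_mat_vec[OF Rc[OF that(2)] E that(1)] by simp
  have EE: "E * E = E"
  proof (rule mat_eqI_mult_vec)
    fix x :: "rat vec" assume x: "x \<in> carrier_vec ?n"
    then show "E * E *\<^sub>v x = E *\<^sub>v x"
      using fix1[of "E *\<^sub>v x"] fix2[OF x] E by simp
  qed (use E in auto)
  have "{v \<in> carrier_vec ?n. E *\<^sub>v v = v} = {v \<in> carrier_vec ?n. \<forall>h\<in>H. \<rho> h *\<^sub>v v = v}"
    using fix1 fix2 by (auto, metis)
  then have d: "fixed_dim G \<rho> H = vectorspace.dim class_ring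
      ((module_vec TYPE(rat) ?n)\<lparr>carrier := {v \<in> carrier_vec ?n. E *\<^sub>v v = v}\<rparr>)"
    by (simp add: fixed_dim_def)
  from idempotent_factor[OF E EE d] obtain B C where
    BC: "B \<in> carrier_mat ?n (fixed_dim G \<rho> H)" "C \<in> carrier_mat (fixed_dim G \<rho> H) ?n"
      "C * B = 1\<^sub>m (fixed_dim G \<rho> H)" "B * C = E" by blast
  have "mat_trace E = of_nat (fixed_dim G \<rho> H)"
    using mat_trace_mult_comm[OF BC(1,2)] BC(3,4) by simp
  moreover have "mat_trace E = (1 / of_nat (card H)) * (\<Sum>h\<in>H. rep_trace \<rho> h)"
    unfolding E_def mat_trace_smult[OF M] unfolding M_def by (simp add: mat_trace_mat_sum[OF Rc] rep_trace_eq)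
  ultimately show ?thesis using cH by (simp add: field_simps)
qed

end

section \<open>Direct sums and isomorphisms of representations\<close>

definition blk :: "'a::zero mat \<Rightarrow> 'a mat \<Rightarrow> 'a mat" where
  "blk A B = four_block_mat A (0\<^sub>m (dim_row A) (dim_col B)) (0\<^sub>m (dim_row B) (dim_col A)) B"

lemma diag_block_mat_blk: "diag_block_mat (A # As) = blk A (diag_block_mat As)"
  by (simp add: blk_def Let_def)

lemma diag_block_mat_append_blk: "diag_block_mat (As @ Bs) = blk (diag_block_mat As) (diag_block_mat Bs)"
  unfolding blk_def diag_block_mat_append Let_def ..

lemma dim_blk [simp]: "dim_row (blk A B) = dim_row A + dim_row B" "dim_col (blk A B) = dim_col A + dim_col B"
  by (simp_all add: blk_def)

lemma blk_carrier: "A \<in> carrier_mat n m \<Longrightarrow> B \<in> carrier_mat k l \<Longrightarrow> blk A B \<in> carrier_mat (n + k) (m + l)"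
  by auto

lemma blk_mult:
  fixes A B C D :: "'a::semiring_0 mat"
  assumes "A \<in> carrier_mat n k" "C \<in> carrier_mat k p" "B \<in> carrier_mat m l" "D \<in> carrier_mat l q"
  shows "blk A B * blk C D = blk (A * C) (B * D)"
proof -
  have "blk A B * blk C D = four_block_mat (A * C + 0\<^sub>m n l * 0\<^sub>m l p) (A * 0\<^sub>m k q + 0\<^sub>m n l * D)
      (0\<^sub>m m k * C + B * 0\<^sub>m l p) (0\<^sub>m m k * 0\<^sub>m k q + B * D)"
    using assms unfolding blk_def by (subst mult_four_block_mat[of _ n k _ l _ m]) auto
  then show ?thesis using assms by (simp add: blk_def)
qed

lemma blk_one: "blk (1\<^sub>m n) (1\<^sub>m m) = 1\<^sub>m (n + m)"
  by (simp add: blk_def)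

lemma mat_trace_blk:
  fixes A B :: "'a::comm_monoid_add mat"
  assumes "A \<in> carrier_mat n n" "B \<in> carrier_mat m m"
  shows "mat_trace (blk A B) = mat_trace A + mat_trace B"
proof -
  have "mat_trace (blk A B) = (\<Sum>i<n + m. if i < n then A $$ (i, i) else B $$ (i - n, i - n))"
    using assms by (auto simp: mat_trace_def blk_def intro!: sum.cong)
  also have "\<dots> = (\<Sum>i<n. A $$ (i, i)) + (\<Sum>i<m. B $$ (i, i))"
    using sum.atLeastLessThan_concat[of 0 n "n + m" "\<lambda>i. if i < n then A $$ (i, i) else B $$ (i - n, i - n)"]
      sum.shift_bounds_nat_ivl[of "\<lambda>i. if i < n then A $$ (i, i) else B $$ (i - n, i - n)" 0 n m]
    by (simp add: lessThan_atLeast0 add.commute)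
  finally show ?thesis using assms by (simp add: mat_trace_def)
qed

lemma rep_direct_sum_Nil: "rep_direct_sum [] g = 0\<^sub>m 0 0"
  by (simp add: rep_direct_sum_def)

lemma rep_direct_sum_Cons: "rep_direct_sum (\<rho> # \<rho>s) g = blk (\<rho> g) (rep_direct_sum \<rho>s g)"
  by (simp add: rep_direct_sum_def diag_block_mat_blk del: diag_block_mat.simps)

lemma rep_direct_sum_append: "rep_direct_sum (\<rho>s @ \<sigma>s) g = blk (rep_direct_sum \<rho>s g) (rep_direct_sum \<sigma>s g)"
  by (simp add: rep_direct_sum_def diag_block_mat_append_blk)

lemma rep_direct_sum_single: "rep_direct_sum [\<rho>] = \<rho>"
  by (simp add: rep_direct_sum_def fun_eq_iff del: diag_block_mat.simps)

lemma rep_dim_direct_sum: "rep_dim G (rep_direct_sum \<rho>s) = (\<Sum>\<rho>\<leftarrow>\<rho>s. rep_dim G \<rho>)"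
  by (simp add: rep_dim_def rep_direct_sum_def dim_diag_block_mat o_def)

text \<open>Isomorphism makes sense for families of square matrices, whether or not they are
  multiplicative.\<close>

definition square_rep :: "('g, 'b) monoid_scheme \<Rightarrow> ('g, 'a) rep \<Rightarrow> bool" where
  "square_rep G \<rho> \<longleftrightarrow> (\<forall>g\<in>carrier G. \<rho> g \<in> carrier_mat (rep_dim G \<rho>) (rep_dim G \<rho>))"

lemma square_repD: "square_rep G \<rho> \<Longrightarrow> g \<in> carrier G \<Longrightarrow> \<rho> g \<in> carrier_mat (rep_dim G \<rho>) (rep_dim G \<rho>)"
  by (simp add: square_rep_def)

lemma is_rep_square: "is_rep G \<rho> \<Longrightarrow> square_rep G \<rho>"
  by (simp add: square_rep_def is_rep_def)

lemma square_rep_direct_sum: "\<forall>\<rho>\<in>set \<rho>s. square_rep G \<rho> \<Longrightarrow> square_rep G (rep_direct_sum \<rho>s)"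
proof (induction \<rho>s)
  case (Cons \<rho> \<rho>s)
  then show ?case
    unfolding square_rep_def rep_dim_direct_sum
    by (auto simp: rep_direct_sum_Cons intro!: blk_carrier)
qed (simp add: square_rep_def rep_dim_direct_sum rep_direct_sum_Nil)

lemma rep_isoI:
  assumes "rep_dim G \<rho> = n" "rep_dim G \<sigma> = n" "T \<in> carrier_mat n n" "S \<in> carrier_mat n n"
    "S * T = 1\<^sub>m n" "T * S = 1\<^sub>m n" "\<And>g. g \<in> carrier G \<Longrightarrow> T * \<rho> g = \<sigma> g * T"
  shows "rep_iso G \<rho> \<sigma>"
  unfolding rep_iso_def assms(1,2) using invertible_matI[OF assms(3-6)] assms(3,7) by blast

lemma rep_isoE:
  assumes "rep_iso G \<rho> \<sigma>"
  obtains T S where "T \<in> carrier_mat (rep_dim G \<rho>) (rep_dim G \<rho>)" "S \<in> carrier_mat (rep_dim G \<rho>) (rep_dim G \<rho>)"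
    "S * T = 1\<^sub>m (rep_dim G \<rho>)" "T * S = 1\<^sub>m (rep_dim G \<rho>)"
    "\<forall>g\<in>carrier G. T * \<rho> g = \<sigma> g * T" "rep_dim G \<sigma> = rep_dim G \<rho>"
proof -
  obtain T where T: "T \<in> carrier_mat (rep_dim G \<rho>) (rep_dim G \<rho>)" "invertible_mat T"
      "\<forall>g\<in>carrier G. T * \<rho> g = \<sigma> g * T" "rep_dim G \<rho> = rep_dim G \<sigma>"
    using assms unfolding rep_iso_def by blast
  from invertible_matE[OF T(1,2)] obtain S where "S \<in> carrier_mat (rep_dim G \<rho>) (rep_dim G \<rho>)"
    "S * T = 1\<^sub>m (rep_dim G \<rho>)" "T * S = 1\<^sub>m (rep_dim G \<rho>)" .
  then show ?thesis using that[OF T(1) _ _ _ T(3) T(4)[symmetric]] by blast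
qed

lemma rep_iso_refl: "square_rep G \<rho> \<Longrightarrow> rep_iso G \<rho> \<rho>"
  by (rule rep_isoI[of _ _ _ _ "1\<^sub>m (rep_dim G \<rho>)" "1\<^sub>m (rep_dim G \<rho>)"]) (auto simp: square_rep_def)

lemma rep_iso_trans:
  assumes "square_rep G \<rho>" "square_rep G \<sigma>" "square_rep G \<tau>" "rep_iso G \<rho> \<sigma>" "rep_iso G \<sigma> \<tau>"
  shows "rep_iso G \<rho> \<tau>"
proof -
  let ?n = "rep_dim G \<rho>"
  obtain T S where T: "T \<in> carrier_mat ?n ?n" and S: "S \<in> carrier_mat ?n ?n" "S * T = 1\<^sub>m ?n" "T * S = 1\<^sub>m ?n"
    and Tg: "\<forall>g\<in>carrier G. T * \<rho> g = \<sigma> g * T" and n: "rep_dim G \<sigma> = ?n"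
    using rep_isoE[OF assms(4)] .
  obtain R Q where R: "R \<in> carrier_mat ?n ?n" and Q: "Q \<in> carrier_mat ?n ?n" "Q * R = 1\<^sub>m ?n" "R * Q = 1\<^sub>m ?n"
    and Rg: "\<forall>g\<in>carrier G. R * \<sigma> g = \<tau> g * R" and n': "rep_dim G \<tau> = ?n"
    using rep_isoE[OF assms(5)] unfolding n .
  have "R * T * \<rho> g = \<tau> g * (R * T)" if g: "g \<in> carrier G" for g
  proof -
    note c = square_repD[OF assms(1) g] square_repD[OF assms(2) g, unfolded n] square_repD[OF assms(3) g, unfolded n']
    have "R * T * \<rho> g = R * \<sigma> g * T" using T R c by (simp add: mat_assoc bspec[OF Tg g])
    also have "\<dots> = \<tau> g * (R * T)" using T R c by (simp add: bspec[OF Rg g] mat_assoc)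
    finally show ?thesis .
  qed
  moreover have "S * Q * (R * T) = 1\<^sub>m ?n"
  proof -
    have "S * Q * (R * T) = S * ((Q * R) * T)" using S(1) Q(1) R T by (simp add: mat_assoc)
    then show ?thesis using Q(2) S T by simp
  qed
  moreover have "R * T * (S * Q) = 1\<^sub>m ?n"
  proof -
    have "R * T * (S * Q) = R * ((T * S) * Q)" using S(1) Q(1) R T by (simp add: mat_assoc)
    then show ?thesis using Q S(3) R by simp
  qed
  ultimately show ?thesis
    using S(1) Q(1) R T n' by (intro rep_isoI[of _ _ ?n _ "R * T" "S * Q"]) auto
qed

lemma rep_iso_blk_cong:
  assumes "square_rep G \<rho>" "square_rep G \<sigma>" "square_rep G \<rho>'" "square_rep G \<sigma>'"
    and "rep_iso G \<rho> \<rho>'" "rep_iso G \<sigma> \<sigma>'"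
  shows "rep_iso G (\<lambda>g. blk (\<rho> g) (\<sigma> g)) (\<lambda>g. blk (\<rho>' g) (\<sigma>' g))"
proof -
  let ?n = "rep_dim G \<rho>" and ?m = "rep_dim G \<sigma>"
  obtain T S where T: "T \<in> carrier_mat ?n ?n" and S: "S \<in> carrier_mat ?n ?n" "S * T = 1\<^sub>m ?n" "T * S = 1\<^sub>m ?n"
    and Tg: "\<forall>g\<in>carrier G. T * \<rho> g = \<rho>' g * T" and n: "rep_dim G \<rho>' = ?n"
    using rep_isoE[OF assms(5)] .
  obtain R Q where R: "R \<in> carrier_mat ?m ?m" and Q: "Q \<in> carrier_mat ?m ?m" "Q * R = 1\<^sub>m ?m" "R * Q = 1\<^sub>m ?m"
    and Rg: "\<forall>g\<in>carrier G. R * \<sigma> g = \<sigma>' g * R" and n': "rep_dim G \<sigma>' = ?m"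
    using rep_isoE[OF assms(6)] .
  have d: "rep_dim G (\<lambda>g. blk (\<rho> g) (\<sigma> g)) = ?n + ?m" "rep_dim G (\<lambda>g. blk (\<rho>' g) (\<sigma>' g)) = ?n + ?m"
    using n n' by (simp_all add: rep_dim_def)
  have "blk T R * blk (\<rho> g) (\<sigma> g) = blk (\<rho>' g) (\<sigma>' g) * blk T R" if g: "g \<in> carrier G" for g
    using T R square_repD[OF assms(1) g] square_repD[OF assms(2) g]
      square_repD[OF assms(3) g, unfolded n] square_repD[OF assms(4) g, unfolded n']
    by (simp add: blk_mult[of _ ?n ?n _ ?n _ ?m ?m _ ?m] bspec[OF Tg g] bspec[OF Rg g])
  moreover have "blk S Q * blk T R = 1\<^sub>m (?n + ?m)" "blk T R * blk S Q = 1\<^sub>m (?n + ?m)"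
    using T R S Q by (simp_all add: blk_mult[of _ ?n ?n _ ?n _ ?m ?m _ ?m] blk_one)
  ultimately show ?thesis
    using T R S(1) Q(1) d
    by (intro rep_isoI[of _ _ "?n + ?m" _ "blk T R" "blk S Q"]) (auto intro!: blk_carrier)
qed

lemma rep_iso_blk_swap:
  fixes \<rho> \<sigma> :: "('g, 'a::field) rep"
  assumes "square_rep G \<rho>" "square_rep G \<sigma>"
  shows "rep_iso G (\<lambda>g. blk (\<rho> g) (\<sigma> g)) (\<lambda>g. blk (\<sigma> g) (\<rho> g))"
proof -
  let ?n = "rep_dim G \<rho>" and ?m = "rep_dim G \<sigma>"
  define P :: "nat \<Rightarrow> nat \<Rightarrow> 'a mat" where "P n m = four_block_mat (0\<^sub>m m n) (1\<^sub>m m) (1\<^sub>m n) (0\<^sub>m n m)" for n m :: nat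
  have c: "P n m \<in> carrier_mat (n + m) (n + m)" for n m by (auto simp: P_def)
  have PP: "P n m * P m n = 1\<^sub>m (n + m)" for n m
    unfolding P_def by (subst mult_four_block_mat[of _ m n _ m _ n _ _ m _ n]) (auto simp: add.commute)
  have d: "rep_dim G (\<lambda>g. blk (\<rho> g) (\<sigma> g)) = ?n + ?m" "rep_dim G (\<lambda>g. blk (\<sigma> g) (\<rho> g)) = ?n + ?m"
    by (simp_all add: rep_dim_def)
  have "P ?n ?m * blk (\<rho> g) (\<sigma> g) = blk (\<sigma> g) (\<rho> g) * P ?n ?m" if g: "g \<in> carrier G" for g
  proof -
    note cc = square_repD[OF assms(1) g] square_repD[OF assms(2) g]
    have "P ?n ?m * blk (\<rho> g) (\<sigma> g) = four_block_mat (0\<^sub>m ?m ?n) (\<sigma> g) (\<rho> g) (0\<^sub>m ?n ?m)"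
      unfolding P_def blk_def using cc by (subst mult_four_block_mat[of _ ?m ?n _ ?m _ ?n _ _ ?n _ ?m]) auto
    also have "\<dots> = blk (\<sigma> g) (\<rho> g) * P ?n ?m"
      unfolding P_def blk_def using cc by (subst mult_four_block_mat[of _ ?m ?m _ ?n _ ?n _ _ ?n _ ?m]) auto
    finally show ?thesis .
  qed
  then show ?thesis
    using c[of ?n ?m] c[of ?m ?n] PP[of ?n ?m] PP[of ?m ?n] d
    by (intro rep_isoI[of _ _ "?n + ?m" _ "P ?n ?m" "P ?m ?n"]) (auto simp: add.commute)
qed

lemma rep_iso_move_front:
  fixes \<rho> :: "('g, 'a::field) rep"
  assumes "square_rep G \<rho>" "\<forall>\<sigma>\<in>set xs \<union> set ys. square_rep G \<sigma>"
  shows "rep_iso G (rep_direct_sum (\<rho> # xs @ ys)) (rep_direct_sum (xs @ \<rho> # ys))"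
proof -
  let ?x = "rep_direct_sum xs" and ?y = "rep_direct_sum ys"
  have sq: "square_rep G ?x" "square_rep G ?y" "square_rep G (rep_direct_sum (\<rho> # xs))" "square_rep G (rep_direct_sum (xs @ [\<rho>]))"
    using assms by (auto intro!: square_rep_direct_sum)
  have 1: "rep_direct_sum (\<rho> # xs) = (\<lambda>g. blk (\<rho> g) (?x g))" "rep_direct_sum (xs @ [\<rho>]) = (\<lambda>g. blk (?x g) (\<rho> g))"
    by (simp_all add: fun_eq_iff rep_direct_sum_Cons rep_direct_sum_append rep_direct_sum_single)
  have "rep_iso G (rep_direct_sum (\<rho> # xs)) (rep_direct_sum (xs @ [\<rho>]))"
    unfolding 1 by (rule rep_iso_blk_swap[OF assms(1) sq(1)])
  from rep_iso_blk_cong[OF sq(3) sq(2) sq(4) sq(2) this rep_iso_refl[OF sq(2)]]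
  have "rep_iso G (rep_direct_sum ((\<rho> # xs) @ ys)) (rep_direct_sum ((xs @ [\<rho>]) @ ys))"
    by (simp only: rep_direct_sum_append[abs_def])
  then show ?thesis by simp
qed

text \<open>The summand of \<open>ys\<close> that equals the head of \<open>xs\<close> is moved to
  the front, and the rest is handled by induction. Consequently equal summands of a decomposition
  may be grouped together.\<close>

lemma rep_iso_mset:
  fixes xs ys :: "('g, 'a::field) rep list"
  assumes "mset xs = mset ys" "\<forall>\<sigma>\<in>set xs. square_rep G \<sigma>"
  shows "rep_iso G (rep_direct_sum xs) (rep_direct_sum ys)"
  using assms
proof (induction xs arbitrary: ys)
  case Nil
  then show ?case by (simp add: rep_iso_refl square_rep_direct_sum)
next
  case (Cons x xs)
  then have "x \<in> set ys" by (metis list.set_intros(1) set_mset_mset)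
  then obtain us vs where ys: "ys = us @ x # vs" using split_list by metis
  with Cons.prems have m: "mset xs = mset (us @ vs)" by simp
  have set: "set (us @ vs) = set xs" using m by (metis set_mset_mset)
  have sx: "square_rep G x" "\<forall>\<sigma>\<in>set xs. square_rep G \<sigma>" "\<forall>\<sigma>\<in>set (us @ vs). square_rep G \<sigma>"
    using Cons.prems set by auto
  note sq = sx(1) square_rep_direct_sum[OF sx(2)] sx(1) square_rep_direct_sum[OF sx(3)]
  have "rep_iso G (rep_direct_sum (x # xs)) (rep_direct_sum (x # us @ vs))"
    using rep_iso_blk_cong[OF sq rep_iso_refl[OF sx(1)] Cons.IH[OF m sx(2)]]
    by (simp only: rep_direct_sum_Cons[abs_def])
  moreover have "rep_iso G (rep_direct_sum (x # us @ vs)) (rep_direct_sum ys)"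
    unfolding ys using sx by (intro rep_iso_move_front) auto
  ultimately show ?case
    using sx ys set by (rule_tac rep_iso_trans[of G _ "rep_direct_sum (x # us @ vs)"])
      (auto intro!: square_rep_direct_sum)
qed

lemma rep_iso_trace:
  fixes \<rho> \<sigma> :: "('g, 'a::field) rep"
  assumes "square_rep G \<rho>" "square_rep G \<sigma>" "rep_iso G \<rho> \<sigma>" "g \<in> carrier G"
  shows "rep_trace \<rho> g = rep_trace \<sigma> g" "similar_mat (\<rho> g) (\<sigma> g)"
proof -
  obtain T S where T: "T \<in> carrier_mat (rep_dim G \<rho>) (rep_dim G \<rho>)"
    "S \<in> carrier_mat (rep_dim G \<rho>) (rep_dim G \<rho>)" "S * T = 1\<^sub>m (rep_dim G \<rho>)" "T * S = 1\<^sub>m (rep_dim G \<rho>)"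
    and Tg: "\<forall>g\<in>carrier G. T * \<rho> g = \<sigma> g * T" and n: "rep_dim G \<sigma> = rep_dim G \<rho>"
    using rep_isoE[OF assms(3)] .
  show s: "similar_mat (\<rho> g) (\<sigma> g)"
    using similar_mat_intertwine[OF T(1) invertible_matI[OF T(1-4)] square_repD[OF assms(1,4)]
      square_repD[OF assms(2,4), unfolded n] bspec[OF Tg assms(4)]] .
  then show "rep_trace \<rho> g = rep_trace \<sigma> g"
    using mat_trace_similar[OF s] by (simp add: rep_trace_def mat_trace_def)
qed

lemma rep_trace_direct_sum:
  assumes "\<forall>\<rho>\<in>set \<rho>s. square_rep G \<rho>" "g \<in> carrier G"
  shows "rep_trace (rep_direct_sum \<rho>s) g = (\<Sum>\<rho>\<leftarrow>\<rho>s. rep_trace \<rho> g)"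
  using assms
proof (induction \<rho>s)
  case (Cons \<rho> \<rho>s)
  have "square_rep G \<rho>" "square_rep G (rep_direct_sum \<rho>s)" using Cons.prems square_rep_direct_sum by auto
  then show ?case
    using Cons mat_trace_blk[OF square_repD square_repD, of G \<rho> g G "rep_direct_sum \<rho>s" g]
    by (simp add: rep_trace_def mat_trace_def rep_direct_sum_Cons)
qed (simp add: rep_trace_def rep_direct_sum_Nil)

lemma irreducible_representativesD:
  assumes "irreducible_representatives G M V"
  shows "\<forall>j\<in>{1..M}. irreducible_rep G (V j)"
    and "\<forall>i\<in>{1..M}. \<forall>j\<in>{1..M}. rep_iso G (V i) (V j) \<longrightarrow> i = j"
    and "\<forall>\<rho>. irreducible_rep G \<rho> \<longrightarrow> (\<exists>j\<in>{1..M}. rep_iso G \<rho> (V j))"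
  using assms unfolding irreducible_representatives_def by - (elim conjE, assumption)+

lemma count_concat_replicate:
  "count (mset (concat (map (\<lambda>j. replicate (c j) j) L))) i = (\<Sum>j\<leftarrow>L. if j = i then c j else 0)"
  by (induction L) auto

lemma irreducible_rep_square: "irreducible_rep G \<rho> \<Longrightarrow> square_rep G \<rho>"
  by (simp add: irreducible_rep_def is_rep_square)

section \<open>Maschke's theorem and complete reducibility over the rationals\<close>

context finite_group begin

text \<open>A projection \<open>P\<close> onto an invariant subspace is averaged to an equivariant
  idempotent \<open>E\<close> with the same image. The images of \<open>E\<close> and
  \<open>1 - E\<close> are invariant complements, realised as matrix representations through rank
  factorisations of the two idempotents.\<close>

lemma maschke_rat:
  fixes \<rho> :: "('g, rat) rep"
  assumes r: "is_rep G \<rho>" and pos: "rep_dim G \<rho> > 0" and red: "\<not> irreducible_rep G \<rho>"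
  obtains \<rho>1 \<rho>2 where "is_rep G \<rho>1" "is_rep G \<rho>2" "rep_dim G \<rho>1 < rep_dim G \<rho>" "rep_dim G \<rho>2 < rep_dim G \<rho>"
    "rep_iso G \<rho> (\<lambda>g. blk (\<rho>1 g) (\<rho>2 g))"
proof -
  let ?n = "rep_dim G \<rho>"
  note R = is_repD[OF r]
  obtain W where W: "subspace class_ring W (module_vec TYPE(rat) ?n)"
    "\<forall>g\<in>carrier G. \<forall>w\<in>W. \<rho> g *\<^sub>v w \<in> W" "W \<noteq> {0\<^sub>v ?n}" "W \<noteq> carrier_vec ?n"
    using r pos red unfolding irreducible_rep_def by blast
  define d where "d = vectorspace.dim class_ring ((module_vec TYPE(rat) ?n)\<lparr>carrier := W\<rparr>)"
  from subspace_matrix[OF W(1) d_def] obtain B0 where B0: "B0 \<in> carrier_mat ?n d" "W = {B0 *\<^sub>v x | x. x \<in> carrier_vec d}"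
    "\<And>x. x \<in> carrier_vec d \<Longrightarrow> B0 *\<^sub>v x = 0\<^sub>v ?n \<Longrightarrow> x = 0\<^sub>v d" by blast
  obtain C0 where C0: "C0 \<in> carrier_mat d ?n" "C0 * B0 = 1\<^sub>m d"
    using left_inverse_rat[OF B0(1,3)] by blast
  define P where "P = B0 * C0"
  have P: "P \<in> carrier_mat ?n ?n" using B0(1) C0(1) by (simp add: P_def)
  have Pw: "P *\<^sub>v w = w" if w: "w \<in> W" for w
  proof -
    obtain x where x: "w = B0 *\<^sub>v x" "x \<in> carrier_vec d" using w B0(2) by blast
    have "P *\<^sub>v w = B0 *\<^sub>v (C0 *\<^sub>v (B0 *\<^sub>v x))"
      unfolding x(1) P_def using B0(1) C0(1) x(2) by (intro assoc_mult_mat_vec) auto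
    also have "C0 *\<^sub>v (B0 *\<^sub>v x) = (C0 * B0) *\<^sub>v x"
      using B0(1) C0(1) x(2) by (intro assoc_mult_mat_vec[symmetric]) auto
    finally show ?thesis using C0(2) x by simp
  qed
  have PW: "P *\<^sub>v v \<in> W" if "v \<in> carrier_vec ?n" for v
  proof -
    have "P *\<^sub>v v = B0 *\<^sub>v (C0 *\<^sub>v v)"
      unfolding P_def using B0(1) C0(1) that by (intro assoc_mult_mat_vec) auto
    moreover have "C0 *\<^sub>v v \<in> carrier_vec d" using C0(1) that by auto
    ultimately show ?thesis using B0(2) by blast
  qed
  \<comment> \<open>The image of \<open>P\<close> is \<open>W\<close>, which is stable under
    \<open>\<rho> g\<close>, and \<open>P\<close> is the identity on \<open>W\<close>.\<close>
  have PgP: "P * (\<rho> g * P) = \<rho> g * P" if g: "g \<in> carrier G" for g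
  proof (rule mat_eqI_mult_vec)
    fix x :: "rat vec" assume x: "x \<in> carrier_vec ?n"
    have gP: "\<rho> g * P \<in> carrier_mat ?n ?n" using R(1)[OF g] P by simp
    have "P * (\<rho> g * P) *\<^sub>v x = P *\<^sub>v ((\<rho> g * P) *\<^sub>v x)"
      by (rule assoc_mult_mat_vec[OF P gP x])
    also have "(\<rho> g * P) *\<^sub>v x = \<rho> g *\<^sub>v (P *\<^sub>v x)"
      by (rule assoc_mult_mat_vec[OF R(1)[OF g] P x])
    also have "P *\<^sub>v \<dots> = \<dots>"
      using Pw PW[OF x] W(2) g by blast
    also have "\<dots> = (\<rho> g * P) *\<^sub>v x"
      by (rule assoc_mult_mat_vec[OF R(1)[OF g] P x, symmetric])
    finally show "P * (\<rho> g * P) *\<^sub>v x = \<rho> g * P *\<^sub>v x" .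
  qed (use R(1)[OF g] P in auto)
  define N :: rat where "N = of_nat (card (carrier G))"
  have N: "N \<noteq> 0" unfolding N_def of_nat_eq_0_iff by (rule gr_implies_not0[OF order_pos])
  define A where "A = avg \<rho> \<rho> P"
  have A: "A \<in> carrier_mat ?n ?n" by (simp add: A_def)
  have c: "\<rho> g * P * \<rho> (inv g) \<in> carrier_mat ?n ?n" if "g \<in> carrier G" for g
    using R(1)[OF that] R(1)[of "inv g"] P that by simp
  have PA: "P * A = A"
  proof -
    have "P * A = mat_sum ?n ?n (carrier G) (\<lambda>g. P * (\<rho> g * P * \<rho> (inv g)))"
      unfolding A_def avg_def by (rule mat_sum_mult_left[OF P c])
    also have "\<dots> = A" unfolding A_def avg_def
    proof (rule mat_sum_cong)
      fix g assume g: "g \<in> carrier G"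
      have "P * (\<rho> g * P * \<rho> (inv g)) = P * (\<rho> g * P) * \<rho> (inv g)"
        using R(1)[OF g] R(1)[of "inv g"] P g by (simp add: mat_assoc)
      then show "P * (\<rho> g * P * \<rho> (inv g)) = \<rho> g * P * \<rho> (inv g)" by (simp only: PgP[OF g])
    qed
    finally show ?thesis .
  qed
  have AP: "A * P = N \<cdot>\<^sub>m P"
  proof -
    have "A * P = mat_sum ?n ?n (carrier G) (\<lambda>g. \<rho> g * P * \<rho> (inv g) * P)"
      unfolding A_def avg_def by (rule mat_sum_mult_right[OF P c])
    also have "\<dots> = mat_sum ?n ?n (carrier G) (\<lambda>g. P)"
    proof (rule mat_sum_cong)
      fix g assume g: "g \<in> carrier G"
      then have g': "inv g \<in> carrier G" by simp
      have "\<rho> g * P * \<rho> (inv g) * P = \<rho> g * (P * (\<rho> (inv g) * P))"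
        using R(1)[OF g] R(1)[OF g'] P by (simp add: mat_assoc)
      also have "\<dots> = (\<rho> g * \<rho> (inv g)) * P"
        unfolding PgP[OF g'] using R(1)[OF g] R(1)[OF g'] P by (simp add: mat_assoc)
      finally show "\<rho> g * P * \<rho> (inv g) * P = P" using rep_inv[OF r g] P by simp
    qed
    also have "\<dots> = N \<cdot>\<^sub>m P" using P by (intro eq_matI) (auto simp: mat_sum_def N_def)
    finally show ?thesis .
  qed
  define E where "E = (1 / N) \<cdot>\<^sub>m A"
  have E: "E \<in> carrier_mat ?n ?n" using A by (simp add: E_def)
  \<comment> \<open>\<open>PE\<close> says that the image of \<open>E\<close> lies in
    \<open>W\<close>, and \<open>EP\<close> that \<open>E\<close> is the identity on
    \<open>W\<close>. Together they make \<open>E\<close> idempotent.\<close>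
  have PE: "P * E = E" unfolding E_def using PA P A by (simp add: mult_smult_distrib)
  have EP: "E * P = P"
  proof -
    have "E * P = (1 / N) \<cdot>\<^sub>m (N \<cdot>\<^sub>m P)"
      unfolding E_def AP[symmetric] by (rule mult_smult_assoc_mat[OF A P])
    also have "\<dots> = P" using N by (intro eq_matI) auto
    finally show ?thesis .
  qed
  have EE: "E * E = E"
  proof -
    have "E * E = E * (P * E)" by (simp only: PE)
    also have "\<dots> = E * P * E" using E P by (simp add: mat_assoc)
    finally show ?thesis by (simp only: EP PE)
  qed
  have Eg: "E * \<rho> g = \<rho> g * E" if g: "g \<in> carrier G" for g
    using avg_intertwines[OF r r P g] R(1)[OF g] A
    unfolding E_def A_def[symmetric] by (simp add: mult_smult_assoc_mat mult_smult_distrib)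
  have E0: "E \<noteq> 0\<^sub>m ?n ?n"
  proof
    assume "E = 0\<^sub>m ?n ?n"
    then have "P = 0\<^sub>m ?n ?n" using EP P by simp
    moreover have "(0\<^sub>m ?n ?n :: rat mat) *\<^sub>v w = 0\<^sub>v ?n" if "w \<in> W" for w
      using that B0(1,2) by (intro eq_vecI) auto
    ultimately have "w = 0\<^sub>v ?n" if "w \<in> W" for w
      using Pw[OF that] that by simp
    moreover have "W \<noteq> {}" using PW[of "0\<^sub>v ?n"] by auto
    ultimately show False using W(3) by blast
  qed
  have E1: "E \<noteq> 1\<^sub>m ?n"
  proof
    assume "E = 1\<^sub>m ?n"
    then have "P = 1\<^sub>m ?n" using PE P by simp
    then have "v \<in> W" if "v \<in> carrier_vec ?n" for v using PW[OF that] that by simp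
    moreover have "W \<subseteq> carrier_vec ?n" using B0(1,2) by auto
    ultimately show False using W(4) by blast
  qed
  define F where "F = 1\<^sub>m ?n - E"
  have F: "F \<in> carrier_mat ?n ?n" using E by (auto simp: F_def)
  have EF: "E * F = 0\<^sub>m ?n ?n" "F * E = 0\<^sub>m ?n ?n"
    using E EE by (simp_all add: F_def mult_minus_distrib_mat[OF E one_carrier_mat E] minus_mult_distrib_mat[OF one_carrier_mat E E])
  have FF: "F * F = F"
  proof -
    have "F * F = F * 1\<^sub>m ?n - F * E"
      using mult_minus_distrib_mat[OF F one_carrier_mat E] by (simp only: F_def[symmetric])
    also have "\<dots> = F" unfolding EF(2) using F by (intro eq_matI) auto
    finally show ?thesis .
  qed
  have Fg: "F * \<rho> g = \<rho> g * F" if g: "g \<in> carrier G" for g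
    using Eg[OF g] R(1)[OF g] E
    by (simp add: F_def mult_minus_distrib_mat[OF R(1)[OF g] one_carrier_mat E]
        minus_mult_distrib_mat[OF one_carrier_mat E R(1)[OF g]])
  define a where "a = vectorspace.dim class_ring
      ((module_vec TYPE(rat) ?n)\<lparr>carrier := {v \<in> carrier_vec ?n. E *\<^sub>v v = v}\<rparr>)"
  define b where "b = vectorspace.dim class_ring
      ((module_vec TYPE(rat) ?n)\<lparr>carrier := {v \<in> carrier_vec ?n. F *\<^sub>v v = v}\<rparr>)"
  from idempotent_factor[OF E EE a_def] obtain B C where
    BC: "B \<in> carrier_mat ?n a" "C \<in> carrier_mat a ?n" "C * B = 1\<^sub>m a" "B * C = E" by blast
  from idempotent_factor[OF F FF b_def] obtain B' C' where
    BC': "B' \<in> carrier_mat ?n b" "C' \<in> carrier_mat b ?n" "C' * B' = 1\<^sub>m b" "B' * C' = F" by blast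
  have EFsum: "E + F = 1\<^sub>m ?n" using E by (intro eq_matI) (auto simp: F_def)
  have CE: "C * E = C" "C' * F = C'" "E * B = B" "F * B' = B'"
  proof -
    have "C * E = (C * B) * C" unfolding BC(4)[symmetric] using BC(1,2) by (simp add: mat_assoc)
    then show "C * E = C" using BC by simp
    have "C' * F = (C' * B') * C'" unfolding BC'(4)[symmetric] using BC'(1,2) by (simp add: mat_assoc)
    then show "C' * F = C'" using BC' by simp
    have "E * B = B * (C * B)" unfolding BC(4)[symmetric] using BC(1,2) by (simp add: mat_assoc)
    then show "E * B = B" using BC by simp
    have "F * B' = B' * (C' * B')" unfolding BC'(4)[symmetric] using BC'(1,2) by (simp add: mat_assoc)
    then show "F * B' = B'" using BC' by simp
  qed
  have CB': "C * B' = 0\<^sub>m a b" "C' * B = 0\<^sub>m b a"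
  proof -
    have "C * B' = (C * E) * (F * B')" by (simp only: CE)
    also have "\<dots> = C * ((E * F) * B')" using BC(2) E F BC'(1) by (simp add: mat_assoc)
    finally show "C * B' = 0\<^sub>m a b" using EF BC(2) BC'(1) by simp
    have "C' * B = (C' * F) * (E * B)" by (simp only: CE)
    also have "\<dots> = C' * ((F * E) * B)" using BC'(2) E F BC(1) by (simp add: mat_assoc)
    finally show "C' * B = 0\<^sub>m b a" using EF BC'(2) BC(1) by simp
  qed
  have trE: "mat_trace E = of_nat a" "mat_trace F = of_nat b"
    using mat_trace_mult_comm[OF BC(1,2)] BC(3,4) mat_trace_mult_comm[OF BC'(1,2)] BC'(3,4) by simp_all
  \<comment> \<open>Traces of idempotents count dimensions, so \<open>E + F = 1\<close> shows that
    the two images have complementary dimensions.\<close>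
  have "mat_trace E + mat_trace F = mat_trace (E + F)"
    using E F by (simp add: mat_trace_def sum.distrib)
  then have "(of_nat (a + b) :: rat) = of_nat ?n" using trE EFsum by simp
  then have ab: "a + b = ?n" by (simp only: of_nat_eq_iff)
  have a0: "a > 0"
  proof (rule ccontr)
    assume "\<not> a > 0" then have "E = 0\<^sub>m ?n ?n" using BC by (intro eq_matI) (auto simp: scalar_prod_def)
    then show False using E0 by blast
  qed
  have b0: "b > 0"
  proof (rule ccontr)
    assume "\<not> b > 0" then have "F = 0\<^sub>m ?n ?n" using BC' by (intro eq_matI) (auto simp: scalar_prod_def)
    then have "E = 1\<^sub>m ?n" using EFsum E by simp
    then show False using E1 by blast
  qed
  define \<rho>1 where "\<rho>1 g = C * \<rho> g * B" for g
  define \<rho>2 where "\<rho>2 g = C' * \<rho> g * B'" for g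
  have d: "rep_dim G \<rho>1 = a" "rep_dim G \<rho>2 = b" using BC(2) BC'(2) by (auto simp: rep_dim_def \<rho>1_def \<rho>2_def)
  have sub: "is_rep G (\<lambda>g. Q * \<rho> g * S)" if QS: "Q \<in> carrier_mat k ?n" "S \<in> carrier_mat ?n k" "Q * S = 1\<^sub>m k"
      and D: "S * Q \<in> carrier_mat ?n ?n" "(S * Q) * S = S" "\<And>g. g \<in> carrier G \<Longrightarrow> (S * Q) * \<rho> g = \<rho> g * (S * Q)" for Q S k
  proof -
    have dk: "rep_dim G (\<lambda>g. Q * \<rho> g * S) = k" using QS by (auto simp: rep_dim_def)
    have "Q * \<rho> (g \<otimes> h) * S = (Q * \<rho> g * S) * (Q * \<rho> h * S)" if gh: "g \<in> carrier G" "h \<in> carrier G" for g h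
    proof -
      note cc = R(1)[OF gh(1)] R(1)[OF gh(2)] QS(1,2)
      have "(Q * \<rho> g * S) * (Q * \<rho> h * S) = Q * \<rho> g * (((S * Q) * \<rho> h) * S)" using cc by (simp add: mat_assoc)
      also have "\<dots> = Q * \<rho> g * (\<rho> h * ((S * Q) * S))" unfolding D(3)[OF gh(2)] using cc by (simp add: mat_assoc)
      also have "\<dots> = Q * \<rho> (g \<otimes> h) * S" unfolding D(2) R(3)[OF gh] using cc by (simp add: mat_assoc)
      finally show ?thesis ..
    qed
    moreover have "Q * \<rho> g * S \<in> carrier_mat k k" if "g \<in> carrier G" for g using R(1)[OF that] QS by auto
    moreover have "Q * \<rho> \<one> * S = 1\<^sub>m k" unfolding R(2) using QS by simp
    ultimately show ?thesis unfolding is_rep_def dk by blast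
  qed
  have r1: "is_rep G \<rho>1" unfolding \<rho>1_def[abs_def]
    using sub[OF BC(2,1,3)] unfolding BC(4) using E CE(3) Eg by blast
  have r2: "is_rep G \<rho>2" unfolding \<rho>2_def[abs_def]
    using sub[OF BC'(2,1,3)] unfolding BC'(4) using F CE(4) Fg by blast
  \<comment> \<open>Empty blocks let \<open>four_block_mat\<close> stack \<open>C\<close> above
    \<open>C'\<close> and place \<open>B\<close> beside \<open>B'\<close>.\<close>
  define Z where "Z k l = (0\<^sub>m k l :: rat mat)" for k l
  define T where "T = four_block_mat C (Z a 0) C' (Z b 0)"
  define S where "S = four_block_mat B B' (Z 0 a) (Z 0 b)"
  have T: "T \<in> carrier_mat ?n ?n" using BC BC' ab by (auto simp: T_def Z_def)
  have S: "S \<in> carrier_mat ?n ?n" using BC BC' ab by (auto simp: S_def Z_def)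
  have TS: "T * S = 1\<^sub>m ?n"
  proof -
    have "T * S = four_block_mat (C * B + Z a 0 * Z 0 a) (C * B' + Z a 0 * Z 0 b) (C' * B + Z b 0 * Z 0 a) (C' * B' + Z b 0 * Z 0 b)"
      unfolding T_def S_def using BC BC' by (intro mult_four_block_mat) (auto simp: Z_def)
    also have "\<dots> = 1\<^sub>m (a + b)" using BC BC' CB' by (simp add: Z_def)
    finally show ?thesis using ab by simp
  qed
  have ST: "S * T = 1\<^sub>m ?n" using mat_mult_left_right_inverse[OF T S TS] .
  have "T * \<rho> g = blk (\<rho>1 g) (\<rho>2 g) * T" if g: "g \<in> carrier G" for g
  proof -
    note cc = R(1)[OF g]
    have g1: "\<rho>1 g \<in> carrier_mat a a" "\<rho>2 g \<in> carrier_mat b b" using cc BC BC' by (auto simp: \<rho>1_def \<rho>2_def)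
    have "\<rho>1 g * C = C * (\<rho> g * E)" unfolding \<rho>1_def BC(4)[symmetric] using cc BC(1,2) by (simp add: mat_assoc)
    also have "\<dots> = C * E * \<rho> g" unfolding Eg[OF g, symmetric] using cc BC(1,2) E by (simp add: mat_assoc)
    finally have 1: "\<rho>1 g * C = C * \<rho> g" by (simp only: CE)
    have "\<rho>2 g * C' = C' * (\<rho> g * F)" unfolding \<rho>2_def BC'(4)[symmetric] using cc BC'(1,2) by (simp add: mat_assoc)
    also have "\<dots> = C' * F * \<rho> g" unfolding Fg[OF g, symmetric] using cc BC'(1,2) F by (simp add: mat_assoc)
    finally have 2: "\<rho>2 g * C' = C' * \<rho> g" by (simp only: CE)
    have "blk (\<rho>1 g) (\<rho>2 g) * T = four_block_mat (\<rho>1 g * C + 0\<^sub>m a b * C') (\<rho>1 g * Z a 0 + 0\<^sub>m a b * Z b 0)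
        (0\<^sub>m b a * C + \<rho>2 g * C') (0\<^sub>m b a * Z a 0 + \<rho>2 g * Z b 0)"
      unfolding T_def blk_def using g1 BC BC' by (subst mult_four_block_mat[of _ a a _ b _ b]) (auto simp: Z_def)
    also have "\<dots> = four_block_mat (C * \<rho> g) (Z a 0) (C' * \<rho> g) (Z b 0)"
      using g1 BC BC' cc 1 2 by (simp add: Z_def)
    also have "\<dots> = T * four_block_mat (\<rho> g) (Z ?n 0) (Z 0 ?n) (Z 0 0)"
      unfolding T_def using BC BC' cc by (subst mult_four_block_mat[of _ a ?n _ 0 _ b]) (auto simp: Z_def)
    also have "four_block_mat (\<rho> g) (Z ?n 0) (Z 0 ?n) (Z 0 0) = \<rho> g"
      using cc by (intro eq_matI) (auto simp: Z_def)
    finally show ?thesis ..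
  qed
  then have iso: "rep_iso G \<rho> (\<lambda>g. blk (\<rho>1 g) (\<rho>2 g))"
    using T S TS ST d ab by (intro rep_isoI[of _ _ ?n _ T S]) (auto simp: rep_dim_def)
  show ?thesis
    using that[OF r1 r2 _ _ iso] d ab a0 b0 by simp
qed

lemma complete_reducibility_rat:
  fixes \<rho> :: "('g, rat) rep"
  assumes "is_rep G \<rho>"
  shows "\<exists>xs. (\<forall>\<sigma>\<in>set xs. irreducible_rep G \<sigma>) \<and> rep_iso G \<rho> (rep_direct_sum xs)"
  using assms
proof (induction "rep_dim G \<rho>" arbitrary: \<rho> rule: less_induct)
  case less
  note sq = is_rep_square[OF less.prems]
  consider "rep_dim G \<rho> = 0" | "irreducible_rep G \<rho>" | "rep_dim G \<rho> > 0" "\<not> irreducible_rep G \<rho>" by blast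
  then show ?case
  proof cases
    case 1
    have "1\<^sub>m 0 * \<rho> g = rep_direct_sum [] g * 1\<^sub>m 0" if "g \<in> carrier G" for g
      using square_repD[OF sq that] 1 by (intro eq_matI) (auto simp: rep_direct_sum_Nil)
    then have "rep_iso G \<rho> (rep_direct_sum [])"
      using 1 by (intro rep_isoI[of _ _ 0 _ "1\<^sub>m 0" "1\<^sub>m 0"]) (auto simp: rep_dim_direct_sum)
    then show ?thesis by (intro exI[of _ "[]"]) simp
  next
    case 2
    then show ?thesis using rep_iso_refl[OF sq] by (intro exI[of _ "[\<rho>]"]) (simp add: rep_direct_sum_single)
  next
    case 3
    obtain \<rho>1 \<rho>2 where r: "is_rep G \<rho>1" "is_rep G \<rho>2" "rep_dim G \<rho>1 < rep_dim G \<rho>" "rep_dim G \<rho>2 < rep_dim G \<rho>"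
      "rep_iso G \<rho> (\<lambda>g. blk (\<rho>1 g) (\<rho>2 g))" using maschke_rat[OF less.prems 3] .
    obtain xs ys where xs: "\<forall>\<sigma>\<in>set xs. irreducible_rep G \<sigma>" "rep_iso G \<rho>1 (rep_direct_sum xs)"
      and ys: "\<forall>\<sigma>\<in>set ys. irreducible_rep G \<sigma>" "rep_iso G \<rho>2 (rep_direct_sum ys)"
      using less.hyps[OF r(3) r(1)] less.hyps[OF r(4) r(2)] by blast
    have sx: "square_rep G (rep_direct_sum xs)" "square_rep G (rep_direct_sum ys)" "square_rep G (rep_direct_sum (xs @ ys))"
    proof -
      have "\<forall>\<sigma>\<in>set xs. square_rep G \<sigma>" "\<forall>\<sigma>\<in>set ys. square_rep G \<sigma>"
        using xs(1) ys(1) irreducible_rep_square by blast+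
      then show "square_rep G (rep_direct_sum xs)" "square_rep G (rep_direct_sum ys)" "square_rep G (rep_direct_sum (xs @ ys))"
        by (auto intro!: square_rep_direct_sum)
    qed
    have 1: "rep_direct_sum (xs @ ys) = (\<lambda>g. blk (rep_direct_sum xs g) (rep_direct_sum ys g))"
      by (simp add: fun_eq_iff rep_direct_sum_append)
    have "rep_direct_sum [\<rho>1, \<rho>2] = (\<lambda>g. blk (\<rho>1 g) (\<rho>2 g))"
      using rep_direct_sum_append[of "[\<rho>1]" "[\<rho>2]"] by (simp add: fun_eq_iff rep_direct_sum_single)
    then have sb: "square_rep G (\<lambda>g. blk (\<rho>1 g) (\<rho>2 g))"
      using square_rep_direct_sum[of "[\<rho>1, \<rho>2]" G] is_rep_square[OF r(1)] is_rep_square[OF r(2)] by simp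
    have "rep_iso G (\<lambda>g. blk (\<rho>1 g) (\<rho>2 g)) (rep_direct_sum (xs @ ys))"
      unfolding 1 using is_rep_square[OF r(1)] is_rep_square[OF r(2)] sx(1,2) xs(2) ys(2) by (rule rep_iso_blk_cong)
    then have "rep_iso G \<rho> (rep_direct_sum (xs @ ys))"
      by (rule rep_iso_trans[OF sq sb sx(3) r(5)])
    then show ?thesis using xs(1) ys(1) by (intro exI[of _ "xs @ ys"]) auto
  qed
qed

lemma rep_direct_sum_iso_map:
  fixes xs :: "('g, 'a::field) rep list"
  assumes "\<forall>\<sigma>\<in>set xs. square_rep G \<sigma> \<and> square_rep G (f \<sigma>) \<and> rep_iso G \<sigma> (f \<sigma>)"
  shows "rep_iso G (rep_direct_sum xs) (rep_direct_sum (map f xs))"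
  using assms
proof (induction xs)
  case Nil
  then show ?case by (simp add: rep_iso_refl square_rep_direct_sum)
next
  case (Cons x xs)
  then have "rep_iso G (\<lambda>g. blk (x g) (rep_direct_sum xs g)) (\<lambda>g. blk (f x g) (rep_direct_sum (map f xs) g))"
    by (intro rep_iso_blk_cong square_rep_direct_sum) auto
  then show ?case by (simp only: rep_direct_sum_Cons[abs_def] list.map)
qed

text \<open>\<open>c j\<close> counts the irreducible summands that are matched with
  \<open>V j\<close>. Sorting the summands by index only permutes the list, which does not change
  the isomorphism class.\<close>

lemma decompose_into_representatives:
  fixes \<rho> :: "('g, rat) rep"
  assumes r: "is_rep G \<rho>" and V: "irreducible_representatives G M V"
  obtains c where "rep_iso G \<rho> (rep_direct_sum (concat (map (\<lambda>j. replicate (c j) (V j)) [1..<Suc M])))"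
proof -
  obtain xs where xs: "\<forall>\<sigma>\<in>set xs. irreducible_rep G \<sigma>" "rep_iso G \<rho> (rep_direct_sum xs)"
    using complete_reducibility_rat[OF r] by blast
  have sV: "square_rep G (V j)" if "j \<in> {1..M}" for j
    using irreducible_rep_square[OF bspec[OF irreducible_representativesD(1)[OF V] that]] .
  have "\<forall>\<sigma>\<in>set xs. \<exists>j\<in>{1..M}. rep_iso G \<sigma> (V j)"
    using irreducible_representativesD(3)[OF V] xs(1) by simp
  from bchoice[OF this[unfolded Bex_def]]
  obtain J where J: "\<forall>\<sigma>\<in>set xs. J \<sigma> \<in> {1..M} \<and> rep_iso G \<sigma> (V (J \<sigma>))" ..
  have sx: "\<forall>\<sigma>\<in>set xs. square_rep G \<sigma>" using xs(1) irreducible_rep_square by blast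
  have i1: "rep_iso G (rep_direct_sum xs) (rep_direct_sum (map (\<lambda>\<sigma>. V (J \<sigma>)) xs))"
    using sx J sV by (intro rep_direct_sum_iso_map) blast
  define js where "js = map J xs"
  define c where "c j = count (mset js) j" for j
  let ?ys = "concat (map (\<lambda>j. replicate (c j) (V j)) [1..<Suc M])"
  have jsM: "set js \<subseteq> {1..M}" using J by (auto simp: js_def)
  have "mset (concat (map (\<lambda>j. replicate (c j) j) [1..<Suc M])) = mset js"
  proof (rule multiset_eqI)
    fix i
    have "count (mset (concat (map (\<lambda>j. replicate (c j) j) [1..<Suc M]))) i = (\<Sum>j\<leftarrow>[1..<Suc M]. if j = i then c j else 0)"
      by (rule count_concat_replicate)
    also have "\<dots> = (\<Sum>j\<in>{1..M}. if j = i then c j else 0)"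
      by (simp add: sum_list_distinct_conv_sum_set atLeastLessThanSuc_atLeastAtMost del: upt_Suc)
    also have "\<dots> = count (mset js) i"
      using jsM by (auto simp: c_def not_in_iff count_eq_zero_iff)
    finally show "count (mset (concat (map (\<lambda>j. replicate (c j) j) [1..<Suc M]))) i = count (mset js) i" .
  qed
  then have "image_mset V (mset (concat (map (\<lambda>j. replicate (c j) j) [1..<Suc M]))) = image_mset V (mset js)"
    by simp
  moreover have "map V (concat (map (\<lambda>j. replicate (c j) j) [1..<Suc M])) = ?ys"
    by (simp add: map_concat o_def del: upt_Suc)
  ultimately have m: "mset (map V js) = mset ?ys"
    by (metis mset_map)
  have mj: "map (\<lambda>\<sigma>. V (J \<sigma>)) xs = map V js" by (simp add: js_def)
  have s1: "\<forall>\<sigma>\<in>set (map V js). square_rep G \<sigma>" using jsM sV by auto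
  then have s2: "\<forall>\<sigma>\<in>set ?ys. square_rep G \<sigma>" by (simp only: mset_eq_setD[OF m])
  have "rep_iso G (rep_direct_sum (map V js)) (rep_direct_sum ?ys)"
    by (rule rep_iso_mset[OF m s1])
  with i1 have "rep_iso G (rep_direct_sum xs) (rep_direct_sum ?ys)"
    unfolding mj by (rule rep_iso_trans[OF square_rep_direct_sum[OF sx] square_rep_direct_sum[OF s1] square_rep_direct_sum[OF s2]])
  then have "rep_iso G \<rho> (rep_direct_sum ?ys)"
    by (rule rep_iso_trans[OF is_rep_square[OF r] square_rep_direct_sum[OF sx] square_rep_direct_sum[OF s2] xs(2)])
  then show ?thesis by (rule that)
qed

end

section \<open>Schur indices and multiplicities\<close>

lemma schur_decompositionD:
  assumes "schur_decomposition G V m d W"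
  shows "\<forall>r\<in>{1..d}. irreducible_rep G (W r)"
    and "\<forall>r\<in>{1..d}. \<forall>s\<in>{1..d}. rep_iso G (W r) (W s) \<longrightarrow> r = s"
    and "rep_iso G (extend_scalars of_rat V) (rep_direct_sum (concat (replicate m (map W [1..<Suc d]))))"
  using assms unfolding schur_decomposition_def by - (elim conjE, assumption)+

lemma rep_dim_extend_scalars [simp]: "rep_dim G (extend_scalars h \<rho>) = rep_dim G \<rho>"
  by (simp add: rep_dim_def extend_scalars_def)

lemma square_rep_extend_scalars: "square_rep G \<rho> \<Longrightarrow> square_rep G (extend_scalars h \<rho>)"
  by (simp add: square_rep_def) (simp add: extend_scalars_def)

lemma rep_trace_extend_scalars:
  assumes "square_rep G \<rho>" "g \<in> carrier G" "h 0 = 0" "\<And>x y. h (x + y) = h x + h y"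
  shows "rep_trace (extend_scalars h \<rho>) g = h (rep_trace \<rho> g)"
proof -
  have "h (\<Sum>i\<in>A. f i) = (\<Sum>i\<in>A. h (f i))" for A :: "nat set" and f
    using assms(3,4) by (induction A rule: infinite_finite_induct) auto
  then show ?thesis
    using square_repD[OF assms(1,2)] by (simp add: rep_trace_def extend_scalars_def)
qed

lemma sum_list_concat_replicate: "(\<Sum>x\<leftarrow>concat (replicate m xs). f x) = of_nat m * (\<Sum>x\<leftarrow>xs. f x)"
  for f :: "'a \<Rightarrow> 'b::semiring_1"
  by (induction m) (simp_all add: algebra_simps)

lemma sum_list_concat_map_replicate:
  "(\<Sum>x\<leftarrow>concat (map (\<lambda>j. replicate (c j) (V j)) L). f x) = (\<Sum>j\<leftarrow>L. of_nat (c j) * f (V j))"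
  for f :: "'a \<Rightarrow> 'b::semiring_1"
  by (induction L) (simp_all add: sum_list_replicate)

lemma sum_list_upt_Suc: "(\<Sum>j\<leftarrow>[1..<Suc M]. f j) = (\<Sum>j\<in>{1..M}. f j)"
  for f :: "nat \<Rightarrow> 'b::comm_monoid_add"
  by (simp add: sum_list_distinct_conv_sum_set atLeastLessThanSuc_atLeastAtMost del: upt_Suc)

context finite_group begin

text \<open>Over a splitting field irreducibility survives the passage to the algebraic closure,
  where the norm is known. The value descends along the injective map \<open>to_ac\<close>.\<close>

lemma schur_norm_splitting:
  fixes \<rho> :: "('g, 'f::field_char_0) rep"
  assumes \<rho>: "irreducible_rep G \<rho>" and spl: "splitting_field TYPE('f) G"
  shows "(\<Sum>g\<in>carrier G. rep_trace \<rho> g * rep_trace \<rho> (inv g)) = of_nat (card (carrier G))"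
proof -
  let ?\<rho> = "extend_scalars to_ac \<rho>"
  have irr: "irreducible_rep G ?\<rho>"
    using \<rho> spl unfolding splitting_field_def absolutely_irreducible_rep_def by blast
  have tr: "rep_trace ?\<rho> g = to_ac (rep_trace \<rho> g)" if "g \<in> carrier G" for g
    by (rule rep_trace_extend_scalars[OF irreducible_rep_square[OF \<rho>] that]) simp_all
  have "to_ac (\<Sum>g\<in>carrier G. rep_trace \<rho> g * rep_trace \<rho> (inv g)) =
      (\<Sum>g\<in>carrier G. rep_trace ?\<rho> g * rep_trace ?\<rho> (inv g))"
    by (simp add: to_ac_sum tr)
  also have "\<dots> = to_ac (of_nat (card (carrier G)))"
    using schur_norm[OF irr] by simp
  finally show ?thesis by (simp only: to_ac_eq_iff)
qed

text \<open>The character of \<open>V\<close> is \<open>m\<close> times a sum of \<open>d\<close>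
  distinct irreducible characters, each of norm \<open>|G|\<close>. This is the origin of the
  denominator \<open>m^2 d\<close>.\<close>

lemma schur_decomposition_norm:
  fixes W :: "nat \<Rightarrow> ('g, 'f::field_char_0) rep" and V :: "('g, rat) rep"
  assumes V: "irreducible_rep G V" and spl: "splitting_field TYPE('f) G"
    and dec: "schur_decomposition G V m d W"
  shows "(\<Sum>g\<in>carrier G. rep_trace V g * rep_trace V (inv g)) = of_nat (card (carrier G)) * (of_nat m ^ 2 * of_nat d)"
    and "m > 0" "d > 0"
proof -
  note D = schur_decompositionD[OF dec]
  let ?L = "concat (replicate m (map W [1..<Suc d]))"
  have sW: "\<forall>\<sigma>\<in>set ?L. square_rep G \<sigma>"
  proof -
    have "\<forall>r\<in>{1..d}. square_rep G (W r)" using D(1) irreducible_rep_square by blast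
    then show ?thesis by (auto simp del: upt_Suc)
  qed
  note sV = irreducible_rep_square[OF V]
  have tr: "of_rat (rep_trace V g) = of_nat m * (\<Sum>r\<in>{1..d}. rep_trace (W r) g)" if g: "g \<in> carrier G" for g
  proof -
    have "of_rat (rep_trace V g) = rep_trace (extend_scalars (of_rat :: rat \<Rightarrow> 'f) V) g"
      using rep_trace_extend_scalars[OF sV g, of "of_rat :: rat \<Rightarrow> 'f"] by (simp add: of_rat_add)
    also have "\<dots> = rep_trace (rep_direct_sum ?L) g"
      by (rule rep_iso_trace(1)[OF square_rep_extend_scalars[OF sV] square_rep_direct_sum[OF sW] D(3) g])
    also have "\<dots> = of_nat m * (\<Sum>r\<in>{1..d}. rep_trace (W r) g)"
      unfolding rep_trace_direct_sum[OF sW g] sum_list_concat_replicate map_map o_def sum_list_upt_Suc ..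
    finally show ?thesis .
  qed
  have orth: "(\<Sum>g\<in>carrier G. rep_trace (W r) g * rep_trace (W s) (inv g)) =
      (if r = s then of_nat (card (carrier G)) else 0)" if rs: "r \<in> {1..d}" "s \<in> {1..d}" for r s
  proof (cases "r = s")
    case True
    then show ?thesis using schur_norm_splitting[OF bspec[OF D(1) rs(1)] spl] by simp
  next
    case False
    then have "\<not> rep_iso G (W s) (W r)" using bspec[OF bspec[OF D(2) rs(2)] rs(1)] by blast
    then show ?thesis
      using schur_orthogonal[OF bspec[OF D(1) rs(1)] bspec[OF D(1) rs(2)]] False by simp
  qed
  have "(of_rat (\<Sum>g\<in>carrier G. rep_trace V g * rep_trace V (inv g)) :: 'f) =
      (\<Sum>g\<in>carrier G. (of_nat m * (\<Sum>r\<in>{1..d}. rep_trace (W r) g)) * (of_nat m * (\<Sum>s\<in>{1..d}. rep_trace (W s) (inv g))))"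
    by (simp add: of_rat_sum of_rat_mult tr)
  also have "\<dots> = of_nat m ^ 2 * (\<Sum>g\<in>carrier G. \<Sum>r\<in>{1..d}. \<Sum>s\<in>{1..d}. rep_trace (W r) g * rep_trace (W s) (inv g))"
  proof -
    have "(\<Sum>g\<in>carrier G. (of_nat m * a g) * (of_nat m * b g)) = (of_nat m ^ 2 * (\<Sum>g\<in>carrier G. a g * b g) :: 'f)" for a b
      by (simp add: sum_distrib_left power2_eq_square mult_ac)
    then show ?thesis by (simp only: sum_product)
  qed
  also have "(\<Sum>g\<in>carrier G. \<Sum>r\<in>{1..d}. \<Sum>s\<in>{1..d}. rep_trace (W r) g * rep_trace (W s) (inv g)) =
      (\<Sum>r\<in>{1..d}. \<Sum>g\<in>carrier G. \<Sum>s\<in>{1..d}. rep_trace (W r) g * rep_trace (W s) (inv g))"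
    by (rule sum.swap)
  also have "\<dots> = (\<Sum>r\<in>{1..d}. \<Sum>s\<in>{1..d}. \<Sum>g\<in>carrier G. rep_trace (W r) g * rep_trace (W s) (inv g))"
    by (intro sum.cong refl sum.swap)
  also have "\<dots> = (\<Sum>r\<in>{1..d}. \<Sum>s\<in>{1..d}. if r = s then of_nat (card (carrier G)) else 0)"
    by (intro sum.cong refl orth)
  also have "\<dots> = of_nat d * of_nat (card (carrier G))" by simp
  finally have "(of_rat (\<Sum>g\<in>carrier G. rep_trace V g * rep_trace V (inv g)) :: 'f) =
      of_rat (of_nat (card (carrier G)) * (of_nat m ^ 2 * of_nat d))"
    by (simp add: of_rat_mult of_rat_power mult_ac)
  then show "(\<Sum>g\<in>carrier G. rep_trace V g * rep_trace V (inv g)) = of_nat (card (carrier G)) * (of_nat m ^ 2 * of_nat d)"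
    by (simp only: of_rat_eq_iff)
  \<comment> \<open>If \<open>m\<close> or \<open>d\<close> were zero, the decomposition would be
    empty and \<open>V\<close> would be zero. Positivity is what makes the division in the
    multiplicity formula meaningful.\<close>
  have "rep_dim G V > 0" using V unfolding irreducible_rep_def by blast
  moreover have "rep_dim G V = m * (\<Sum>\<rho>\<leftarrow>map W [1..<Suc d]. rep_dim G \<rho>)"
    using D(3) sum_list_concat_replicate[of "rep_dim G" m "map W [1..<Suc d]"]
    by (simp add: rep_iso_def rep_dim_direct_sum del: upt_Suc)
  ultimately have "m * (\<Sum>\<rho>\<leftarrow>map W [1..<Suc d]. rep_dim G \<rho>) > 0" by simp
  then show "m > 0" "d > 0" by (auto intro: gr0I simp del: upt_Suc)
qed

lemma multiplicity_formula:
  fixes W :: "nat \<Rightarrow> nat \<Rightarrow> ('g, 'f::field_char_0) rep" and V :: "nat \<Rightarrow> ('g, rat) rep"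
  assumes V: "irreducible_representatives G M V" and spl: "splitting_field TYPE('f) G"
    and dec: "\<forall>j\<in>{1..M}. schur_decomposition G (V j) (m j) (d j) (W j)"
    and U: "is_rep G U" and iso: "rep_iso G U (rep_direct_sum (concat (map (\<lambda>j. replicate (c j) (V j)) [1..<Suc M])))"
    and j: "j \<in> {1..M}"
  shows "(of_nat (c j) :: rat) = 1 / (of_nat (m j) ^ 2 * of_nat (d j)) *
    ((\<Sum>g\<in>carrier G. rep_trace U g * rep_trace (V j) (inv g)) / of_nat (card (carrier G)))"
proof -
  note VD = irreducible_representativesD[OF V]
  let ?L = "concat (map (\<lambda>j. replicate (c j) (V j)) [1..<Suc M])"
  have sL: "\<forall>\<sigma>\<in>set ?L. square_rep G \<sigma>"
  proof -
    have "\<forall>r\<in>{1..M}. square_rep G (V r)" using VD(1) irreducible_rep_square by blast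
    then show ?thesis by (auto simp del: upt_Suc)
  qed
  have tr: "rep_trace U g = (\<Sum>i\<in>{1..M}. of_nat (c i) * rep_trace (V i) g)" if g: "g \<in> carrier G" for g
  proof -
    have "rep_trace U g = rep_trace (rep_direct_sum ?L) g"
      by (rule rep_iso_trace(1)[OF is_rep_square[OF U] square_rep_direct_sum[OF sL] iso g])
    also have "\<dots> = (\<Sum>\<rho>\<leftarrow>?L. rep_trace \<rho> g)" by (rule rep_trace_direct_sum[OF sL g])
    also have "\<dots> = (\<Sum>i\<leftarrow>[1..<Suc M]. of_nat (c i) * rep_trace (V i) g)"
      by (rule sum_list_concat_map_replicate)
    finally show ?thesis by (simp only: sum_list_upt_Suc)
  qed
  have orth: "(\<Sum>g\<in>carrier G. rep_trace (V i) g * rep_trace (V j) (inv g)) =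
      (if i = j then of_nat (card (carrier G)) * (of_nat (m j) ^ 2 * of_nat (d j)) else 0)" if i: "i \<in> {1..M}" for i
  proof (cases "i = j")
    case True
    then show ?thesis using schur_decomposition_norm(1)[OF bspec[OF VD(1) j] spl bspec[OF dec j]] by simp
  next
    case False
    then have "\<not> rep_iso G (V j) (V i)" using bspec[OF bspec[OF VD(2) j] i] by blast
    then show ?thesis
      using schur_orthogonal[OF bspec[OF VD(1) i] bspec[OF VD(1) j]] False by simp
  qed
  have "(\<Sum>g\<in>carrier G. rep_trace U g * rep_trace (V j) (inv g)) =
      (\<Sum>g\<in>carrier G. \<Sum>i\<in>{1..M}. of_nat (c i) * (rep_trace (V i) g * rep_trace (V j) (inv g)))"
    by (simp add: tr sum_distrib_right mult.assoc)
  also have "\<dots> = (\<Sum>i\<in>{1..M}. of_nat (c i) * (\<Sum>g\<in>carrier G. rep_trace (V i) g * rep_trace (V j) (inv g)))"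
    by (subst sum.swap) (simp add: sum_distrib_left)
  also have "\<dots> = (\<Sum>i\<in>{1..M}. if i = j then of_nat (c j) * (of_nat (card (carrier G)) * (of_nat (m j) ^ 2 * of_nat (d j))) else 0)"
    by (intro sum.cong refl) (simp add: orth)
  also have "\<dots> = of_nat (c j) * (of_nat (card (carrier G)) * (of_nat (m j) ^ 2 * of_nat (d j)))"
    using j by simp
  finally show ?thesis
    using schur_decomposition_norm(2,3)[OF bspec[OF VD(1) j] spl bspec[OF dec j]] gr_implies_not0[OF order_pos]
    by (simp add: field_simps del: card_eq_0_iff)
qed

end

section \<open>Brauer characters of induced representations\<close>

text \<open>Separates the lifting of eigenvalues from matrices: products of nonzero polynomials
  become sums, so a Brauer character can be computed from any factorisation of the characteristic
  polynomial.\<close>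

definition lift_roots :: "('k::field \<Rightarrow> 'c::semiring_1) \<Rightarrow> 'k poly \<Rightarrow> 'c" where
  "lift_roots \<iota> p = (\<Sum>\<zeta> | poly p \<zeta> = 0. of_nat (Polynomial.order \<zeta> p) * \<iota> \<zeta>)"

lemma brauer_char_lift_roots: "brauer_char \<iota> \<rho> g = lift_roots \<iota> (char_poly (\<rho> g))"
  by (simp add: brauer_char_def lift_roots_def)

lemma lift_roots_superset:
  assumes "p \<noteq> 0" "finite A" "{\<zeta>. poly p \<zeta> = 0} \<subseteq> A"
  shows "lift_roots \<iota> p = (\<Sum>\<zeta>\<in>A. of_nat (Polynomial.order \<zeta> p) * \<iota> \<zeta>)"
  unfolding lift_roots_def using assms by (intro sum.mono_neutral_left) (auto simp: order_0I)

lemma lift_roots_mult: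
  assumes "p \<noteq> 0" "q \<noteq> 0"
  shows "lift_roots \<iota> (p * q) = lift_roots \<iota> p + lift_roots \<iota> q"
proof -
  let ?A = "{\<zeta>. poly (p * q) \<zeta> = 0}"
  have fin: "finite ?A" using assms by (intro poly_roots_finite) auto
  have pq: "p * q \<noteq> 0" using assms by simp
  have eq: "lift_roots \<iota> (p * q) = (\<Sum>\<zeta>\<in>?A. of_nat (Polynomial.order \<zeta> p) * \<iota> \<zeta> + of_nat (Polynomial.order \<zeta> q) * \<iota> \<zeta>)"
    unfolding lift_roots_def order_mult[OF pq] of_nat_add distrib_right ..
  show ?thesis
  proof -
    have "{\<zeta>. poly p \<zeta> = 0} \<subseteq> ?A" "{\<zeta>. poly q \<zeta> = 0} \<subseteq> ?A" by auto
    note s = lift_roots_superset[OF assms(1) fin this(1), of \<iota>] lift_roots_superset[OF assms(2) fin this(2), of \<iota>]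
    show ?thesis unfolding eq s by (rule sum.distrib)
  qed
qed

lemma lift_roots_one [simp]: "lift_roots \<iota> 1 = 0"
  by (simp add: lift_roots_def)

lemma lift_roots_linear: "lift_roots \<iota> [:- z, 1:] = \<iota> z"
proof -
  have "{\<zeta>. poly [:- z, 1:] \<zeta> = 0} = {z}" by auto
  moreover have "Polynomial.order z [:- z, 1:] = 1" using order_power_n_n[of z 1] by simp
  ultimately show ?thesis by (simp only: lift_roots_def) simp
qed

lemma prod_linear_nonzero: "(\<Prod>z\<in>S. [:- z, 1:]) \<noteq> (0 :: 'k::field poly)"
  by (cases "finite S") auto

lemma lift_roots_prod_linear:
  fixes S :: "'k::field set"
  assumes "finite S"
  shows "lift_roots \<iota> (\<Prod>z\<in>S. [:- z, 1:]) = (\<Sum>z\<in>S. \<iota> z)"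
  using assms
proof (induction S)
  case (insert z S)
  have "lift_roots \<iota> ([:- z, 1:] * (\<Prod>z\<in>S. [:- z, 1:])) = lift_roots \<iota> [:- z, 1:] + lift_roots \<iota> (\<Prod>z\<in>S. [:- z, 1:])"
    by (rule lift_roots_mult) (simp_all add: prod_linear_nonzero)
  then show ?case using insert by (simp add: lift_roots_linear)
qed simp

lemma prod_linear_dvd:
  fixes p :: "'k::field poly"
  assumes "finite S" "\<And>z. z \<in> S \<Longrightarrow> poly p z = 0"
  shows "(\<Prod>z\<in>S. [:- z, 1:]) dvd p"
  using assms
proof (induction S arbitrary: p)
  case (insert z S)
  then obtain q where q: "p = [:- z, 1:] * q" by (metis insertI1 poly_eq_0_iff_dvd dvdE)
  have "poly q x = 0" if "x \<in> S" for x
    using insert.prems[of x] insert.hyps(2) that by (auto simp: q)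
  then have "(\<Prod>z\<in>S. [:- z, 1:]) dvd q" by (rule insert.IH)
  then show ?case unfolding q prod.insert[OF insert.hyps] by (rule mult_dvd_mono[OF dvd_refl])
qed simp

lemma monic_eq_prod_linear:
  fixes p :: "'k::field poly"
  assumes "finite S" "\<And>z. z \<in> S \<Longrightarrow> poly p z = 0" "monic p" "degree p = card S"
  shows "p = (\<Prod>z\<in>S. [:- z, 1:])"
proof -
  let ?q = "\<Prod>z\<in>S. [:- z, 1:]"
  have "?q dvd p" using assms(1,2) by (rule prod_linear_dvd)
  then obtain r where r: "p = ?q * r" by (elim dvdE)
  have "p \<noteq> 0" using assms(3) by auto
  then have r0: "r \<noteq> 0" using r by auto
  have dq: "degree ?q = card S" by (subst degree_prod_eq_sum_degree) auto
  have "degree p = degree ?q + degree r" unfolding r by (rule degree_mult_eq[OF prod_linear_nonzero r0])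
  then have "degree r = 0" using assms(4) dq by simp
  moreover have "lead_coeff ?q = 1" by (simp add: lead_coeff_prod)
  then have "lead_coeff r = 1" using assms(3) unfolding r lead_coeff_mult by simp
  moreover obtain c where "r = [:c:]" using \<open>degree r = 0\<close> by (elim degree_eq_zeroE)
  ultimately have "r = 1" by (simp add: one_pCons)
  then show ?thesis using r by simp
qed

text \<open>The polynomial \<open>X^L - h\<close> is separable: a double root would be a root of the
  derivative \<open>L X^(L-1)\<close>, hence zero because \<open>L\<close> is invertible, but zero
  is not a root because \<open>h\<close> is nonzero.\<close>

lemma card_roots_of_unit:
  fixes h :: "'k::alg_closed_field"
  assumes L: "L > 0" "(of_nat L :: 'k) \<noteq> 0" and h: "h \<noteq> 0"
  shows "card {z. z ^ L = h} = L" "finite {z. z ^ L = h}"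
proof -
  define p where "p = Polynomial.monom 1 L + [:- h:]"
  have pz: "poly p z = z ^ L - h" for z by (simp add: p_def poly_monom)
  have dp: "degree p = L" using L(1) unfolding p_def by (subst degree_add_eq_left) (simp_all add: degree_monom_eq)
  have p0: "p \<noteq> 0" using dp L(1) by auto
  obtain A where A: "size A = degree p" "p = smult (lead_coeff p) (\<Prod>x\<in>#A. [:-x, 1:])"
    using alg_closed_imp_factorization[OF p0] by blast
  have "count A x \<le> 1" for x
  proof (rule ccontr)
    assume "\<not> count A x \<le> 1"
    then have "{#x, x#} \<subseteq># A" by (auto simp: subseteq_mset_def)
    then obtain B where B: "A = {#x, x#} + B" by (metis subset_mset.le_iff_add)
    define q where "q = smult (lead_coeff p) (\<Prod>x\<in>#B. [:-x, 1:])"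
    have pq: "p = [:-x, 1:] * ([:-x, 1:] * q)" by (subst A(2)) (simp add: B q_def mult_ac)
    have "poly (pderiv p) x = 0" unfolding pq pderiv_mult poly_add poly_mult by simp
    moreover have "pderiv p = smult (of_nat L) (Polynomial.monom 1 (L - 1))"
      by (simp add: p_def pderiv_add pderiv_monom pderiv_pCons smult_monom)
    ultimately have "x ^ (L - 1) = 0" using L(2) by (simp add: poly_monom)
    then have "x = 0" by simp
    moreover have "poly p x = 0" by (subst pq) simp
    ultimately show False using pz[of x] L(1) h by (simp add: power_0_left)
  qed
  then have "A = mset_set (set_mset A)"
    by (intro multiset_eqI) (metis count_greater_eq_one_iff count_mset_set(1,3) finite_set_mset le_antisym not_in_iff)
  then have "card (set_mset A) = L" using A(1) dp by (metis size_mset_set)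
  moreover have "set_mset A = {z. z ^ L = h}"
  proof -
    have "poly p z = lead_coeff p * (\<Prod>x\<in>#A. z - x)" for z
      by (subst A(2)) (simp add: poly_prod_mset image_mset.compositionality o_def)
    then have "poly p z = 0 \<longleftrightarrow> z \<in> set_mset A" for z using p0 by (auto simp: prod_mset_zero_iff)
    then show ?thesis using pz by auto
  qed
  ultimately show "card {z. z ^ L = h} = L" by simp
  then show "finite {z. z ^ L = h}" using L(1) card.infinite by fastforce
qed

section \<open>Characteristic polynomials of monomial matrices\<close>

lemma char_poly_matrix_blk:
  assumes "A \<in> carrier_mat n n" "B \<in> carrier_mat m m"
  shows "char_poly_matrix (blk A B) = blk (char_poly_matrix A) (char_poly_matrix B)"
  using assms by (intro eq_matI) (auto simp: char_poly_matrix_def blk_def)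

lemma char_poly_blk:
  fixes A B :: "'a::idom mat"
  assumes "A \<in> carrier_mat n n" "B \<in> carrier_mat m m"
  shows "char_poly (blk A B) = char_poly A * char_poly B"
  unfolding char_poly_def char_poly_matrix_blk[OF assms] unfolding blk_def
  using char_poly_matrix_closed[OF assms(1)] char_poly_matrix_closed[OF assms(2)]
  by (intro det_four_block_mat_lower_left_zero) auto

lemma char_poly_nonzero: "A \<in> carrier_mat n n \<Longrightarrow> char_poly A \<noteq> (0 :: 'k::field poly)"
  using degree_monic_char_poly[of A n] by auto

text \<open>Indexing rows and columns by a list of labels allows the basis to be reordered and then
  split along the cycles of a permutation.\<close>

definition list_mat :: "('s \<Rightarrow> 's \<Rightarrow> 'a) \<Rightarrow> 's list \<Rightarrow> 'a mat" where
  "list_mat f xs = mat (length xs) (length xs) (\<lambda>(i, j). f (xs ! i) (xs ! j))"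

lemma list_mat_carrier [simp]: "list_mat f xs \<in> carrier_mat (length xs) (length xs)"
  by (simp add: list_mat_def)

lemma list_mat_append:
  assumes "\<And>x y. x \<in> set xs \<Longrightarrow> y \<in> set ys \<Longrightarrow> f x y = 0 \<and> f y x = 0"
  shows "list_mat f (xs @ ys) = blk (list_mat f xs) (list_mat f ys)"
  using assms by (intro eq_matI) (auto simp: list_mat_def blk_def nth_append)

text \<open>Reordering the labels conjugates the matrix by a permutation matrix.\<close>

lemma char_poly_list_mat_mset:
  fixes f :: "'s \<Rightarrow> 's \<Rightarrow> 'a::field"
  assumes "mset xs = mset ys"
  shows "char_poly (list_mat f xs) = char_poly (list_mat f ys)"
proof -
  obtain p where p: "p permutes {..<length ys}" "permute_list p ys = xs"
    using mset_eq_permutation[OF assms] .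
  let ?n = "length ys"
  have len: "length xs = ?n" using assms by (metis size_mset)
  have nth: "xs ! i = ys ! p i" if "i < ?n" for i using permute_list_nth[OF p(1) that] p(2) by simp
  have pn: "p i < ?n" if "i < ?n" for i using permutes_in_image[OF p(1)] that by auto
  define T :: "'a mat" where "T = mat ?n ?n (\<lambda>(i, k). if k = p i then 1 else 0)"
  define S :: "'a mat" where "S = mat ?n ?n (\<lambda>(k, i). if k = p i then 1 else 0)"
  have T: "T \<in> carrier_mat ?n ?n" and S: "S \<in> carrier_mat ?n ?n" by (simp_all add: T_def S_def)
  have TS: "T * S = 1\<^sub>m ?n"
  proof (rule eq_matI)
    fix i j assume ij: "i < dim_row (1\<^sub>m ?n)" "j < dim_col (1\<^sub>m ?n)"
    have "(T * S) $$ (i, j) = (\<Sum>k\<in>{0..<?n}. (if k = p i then 1 else 0) * (if k = p j then 1 else 0))"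
      using ij by (simp add: T_def S_def scalar_prod_def)
    also have "\<dots> = (\<Sum>k\<in>{0..<?n}. if k = p i then (if p i = p j then 1 else 0) else 0)"
      by (intro sum.cong) auto
    also have "\<dots> = (if i = j then 1 else 0)"
      using ij pn[of i] permutes_inj[OF p(1)] by (auto simp: inj_eq)
    finally show "(T * S) $$ (i, j) = 1\<^sub>m ?n $$ (i, j)" using ij by simp
  qed (auto simp: T_def S_def)
  have ST: "S * T = 1\<^sub>m ?n" using mat_mult_left_right_inverse[OF T S TS] .
  have "T * list_mat f ys = list_mat f xs * T"
  proof (rule eq_matI)
    fix i j assume "i < dim_row (list_mat f xs * T)" "j < dim_col (list_mat f xs * T)"
    then have ij: "i < ?n" "j < ?n" by (simp_all add: list_mat_def T_def len)
    have "(T * list_mat f ys) $$ (i, j) = (\<Sum>k\<in>{0..<?n}. (if k = p i then 1 else 0) * f (ys ! k) (ys ! j))"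
      using ij by (simp add: T_def list_mat_def scalar_prod_def)
    also have "\<dots> = (\<Sum>k\<in>{0..<?n}. if k = p i then f (ys ! p i) (ys ! j) else 0)"
      by (intro sum.cong) auto
    also have "\<dots> = f (ys ! p i) (ys ! j)" using pn[OF ij(1)] by simp
    finally have 1: "(T * list_mat f ys) $$ (i, j) = f (ys ! p i) (ys ! j)" .
    obtain k0 where k0: "k0 < ?n" "j = p k0"
      using permutes_image[OF p(1)] ij(2) by (metis imageE lessThan_iff)
    have "(list_mat f xs * T) $$ (i, j) = (\<Sum>k\<in>{0..<?n}. f (xs ! i) (xs ! k) * (if j = p k then 1 else 0))"
      using ij by (simp add: T_def list_mat_def scalar_prod_def len)
    also have "\<dots> = (\<Sum>k\<in>{0..<?n}. if k = k0 then f (xs ! i) (xs ! k0) else 0)"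
      using permutes_inj[OF p(1)] k0(2) by (intro sum.cong) (auto simp: inj_eq)
    also have "\<dots> = f (ys ! p i) (ys ! j)" using k0 ij nth by simp
    finally show "(T * list_mat f ys) $$ (i, j) = (list_mat f xs * T) $$ (i, j)" using 1 by simp
  qed (simp_all add: T_def list_mat_def len)
  then have "similar_mat (list_mat f ys) (list_mat f xs)"
    using similar_mat_intertwine[OF T invertible_matI[OF T S ST TS]] list_mat_carrier[of f ys] list_mat_carrier[of f xs] len
    by metis
  then show ?thesis by (rule char_poly_similar[symmetric])
qed

lemma prod_lessThan_add: "(\<Prod>j<n + m. f j) = (\<Prod>j<n. f j) * (\<Prod>j<m. f (j + n))"
  for f :: "nat \<Rightarrow> 'a::comm_monoid_mult"
  by (induction m) (simp_all add: mult_ac add.commute)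

locale root_lift =
  fixes N :: nat and \<iota> :: "'k::alg_closed_field \<Rightarrow> 'c::field_char_0"
  assumes N: "N > 0" "(of_nat N :: 'k) \<noteq> 0"
    and inj: "inj_on \<iota> {x. x ^ N = 1}" and root: "x ^ N = 1 \<Longrightarrow> \<iota> x ^ N = 1"
    and mult: "x ^ N = 1 \<Longrightarrow> y ^ N = 1 \<Longrightarrow> \<iota> (x * y) = \<iota> x * \<iota> y"
begin

lemma \<iota>_one: "\<iota> 1 = 1"
proof -
  have "\<iota> 1 * \<iota> 1 = \<iota> 1" using mult[of 1 1] by simp
  moreover have "\<iota> 1 \<noteq> 0" using root[of 1] N(1) by (auto simp: power_0_left)
  ultimately show ?thesis by simp
qed

lemma \<iota>_power: "x ^ N = 1 \<Longrightarrow> \<iota> (x ^ k) = \<iota> x ^ k"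
proof (induction k)
  case (Suc k)
  have "(x ^ k) ^ N = 1" using Suc.prems by (metis power_mult mult.commute power_one)
  then show ?case using Suc mult[of x "x ^ k"] by simp
qed (simp add: \<iota>_one)

lemma of_nat_dvd_N: "L dvd N \<Longrightarrow> (of_nat L :: 'k) \<noteq> 0"
  using N(2) by (metis dvdE mult_zero_left of_nat_mult)

text \<open>The solutions of \<open>z^L = h\<close> are \<open>N\<close>-th roots of unity and form
  a coset of the \<open>L\<close>-th roots of unity. If \<open>L > 1\<close>, multiplication by an
  \<open>L\<close>-th root of unity \<open>w \<noteq> 1\<close> permutes them, so their lifted sum
  is unchanged by the factor \<open>\<iota> w \<noteq> 1\<close> and vanishes.\<close>

lemma sum_lift_roots_of:
  assumes L: "L dvd N" and h: "h ^ (N div L) = 1"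
  shows "(\<Sum>z | z ^ L = h. \<iota> z) = (if L = 1 then \<iota> h else 0)"
proof (cases "L = 1")
  case True
  then have "{z. z ^ L = h} = {h}" by auto
  then show ?thesis using True by simp
next
  case False
  have L0: "L > 0" using L N(1) by (metis dvd_0_left gr0I)
  note Lk = of_nat_dvd_N[OF L]
  have "card {z::'k. z ^ L = 1} = L" by (rule card_roots_of_unit[OF L0 Lk]) simp
  then have "{z::'k. z ^ L = 1} \<noteq> {1}" using False by auto
  then obtain w :: 'k where w: "w ^ L = 1" "w \<noteq> 1" by (metis (mono_tags, lifting) power_one singletonI singleton_iff Collect_cong mem_Collect_eq subsetI subset_antisym)
  have wN: "w ^ N = 1" using w(1) L by (metis dvdE power_mult power_one)
  have zN: "z ^ N = 1" if "z ^ L = h" for z using that h L by (metis dvd_mult_div_cancel power_mult)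
  have w0: "w \<noteq> 0" using w(1) L0 by (auto simp: power_0_left)
  have bij: "bij_betw (\<lambda>z. w * z) {z. z ^ L = h} {z. z ^ L = h}"
    by (rule bij_betwI[where g = "\<lambda>z. z / w"]) (use w0 w(1) in \<open>auto simp: power_mult_distrib power_divide\<close>)
  have "(\<Sum>z | z ^ L = h. \<iota> z) = (\<Sum>z | z ^ L = h. \<iota> (w * z))"
    by (rule sum.reindex_bij_betw[OF bij, symmetric])
  also have "\<dots> = \<iota> w * (\<Sum>z | z ^ L = h. \<iota> z)"
    unfolding sum_distrib_left using mult[OF wN zN] by (intro sum.cong) auto
  finally have "(1 - \<iota> w) * (\<Sum>z | z ^ L = h. \<iota> z) = 0" by (simp add: algebra_simps)
  moreover have "\<iota> w \<noteq> 1" using inj_onD[OF inj, of w 1] wN w(2) \<iota>_one by auto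
  ultimately show ?thesis using False by simp
qed

text \<open>A weighted cycle of length \<open>L\<close> has characteristic polynomial \<open>X\<^sup>L - h\<close>, where \<open>h\<close> is the
  product of the weights; we exhibit an eigenvector for each of its \<open>L\<close> distinct roots.\<close>

lemma lift_roots_cycle:
  fixes b :: "nat \<Rightarrow> 'k"
  assumes L: "L > 0" "L dvd N" and h: "(\<Prod>j<L. b j) ^ (N div L) = 1"
    and A: "A = mat L L (\<lambda>(i, j). if i = Suc j mod L then b j else 0)"
  shows "lift_roots \<iota> (char_poly A) = (if L = 1 then \<iota> (b 0) else 0)"
proof -
  let ?h = "\<Prod>j<L. b j"
  have Ac: "A \<in> carrier_mat L L" by (simp add: A)
  have "N div L > 0" using L N(1) by (auto elim!: dvdE)
  then have h0: "?h \<noteq> 0" using h by (metis power_0_left zero_neq_one less_numeral_extra(3))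
  note Lk = of_nat_dvd_N[OF L(2)]
  have root: "poly (char_poly A) z = 0" if z: "z ^ L = ?h" for z
  proof -
    have z0: "z \<noteq> 0" using z h0 L(1) by (auto simp: power_0_left)
    \<comment> \<open>The equation for an eigenvector is solved along the cycle, starting from the
      entry 1. The cycle closes up exactly because \<open>z^L\<close> is the product of the
      weights.\<close>
    define v where "v = vec L (\<lambda>j. (\<Prod>i<j. b i) / z ^ j)"
    have v: "v \<in> carrier_vec L" by (simp add: v_def)
    have v0: "v $ 0 = 1" using L(1) by (simp add: v_def)
    have "v \<noteq> 0\<^sub>v L" using v0 L(1) by auto
    moreover have "A *\<^sub>v v = z \<cdot>\<^sub>v v"
    proof (rule eq_vecI)
      fix i assume "i < dim_vec (z \<cdot>\<^sub>v v)"
      then have i: "i < L" by (simp add: v_def)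
      define j where "j = (if i = 0 then L - 1 else i - 1)"
      have j: "j < L" "Suc j mod L = i" using i L(1) by (auto simp: j_def)
      have juniq: "j' = j" if "j' < L" "i = Suc j' mod L" for j'
        using that j i by (cases "Suc j' = L"; cases "Suc j = L") auto
      have "(A *\<^sub>v v) $ i = (\<Sum>j'\<in>{0..<L}. (if i = Suc j' mod L then b j' else 0) * v $ j')"
        using i v by (simp add: A scalar_prod_def)
      also have "\<dots> = (\<Sum>j'\<in>{0..<L}. if j' = j then b j * v $ j else 0)"
      proof (intro sum.cong refl)
        fix j' assume "j' \<in> {0..<L}"
        then show "(if i = Suc j' mod L then b j' else 0) * v $ j' = (if j' = j then b j * v $ j else 0)"
          using juniq[of j'] j(2) by (cases "j' = j") auto
      qed
      also have "\<dots> = b j * v $ j" using j(1) by simp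
      also have "\<dots> = z * v $ i"
      proof (cases "i = 0")
        case True
        then have "Suc j = L" using L(1) by (simp add: j_def)
        then have "b j * v $ j = (\<Prod>i<L. b i) / z ^ j" using j(1) by (auto simp: v_def lessThan_Suc mult.commute)
        also have "\<dots> = z ^ Suc j / z ^ j" by (simp only: z[symmetric] \<open>Suc j = L\<close>)
        also have "\<dots> = z" using z0 by simp
        finally show ?thesis using True v0 by simp
      next
        case False
        then have "i = Suc j" by (simp add: j_def)
        then show ?thesis using i z0 by (simp add: v_def)
      qed
      finally show "(A *\<^sub>v v) $ i = (z \<cdot>\<^sub>v v) $ i" using i v by simp
    qed (simp add: A v_def)
    ultimately have "eigenvalue A z" unfolding eigenvalue_def eigenvector_def using v Ac by auto
    then show ?thesis using eigenvalue_root_char_poly[OF Ac] by simp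
  qed
  have card: "card {z. z ^ L = ?h} = L" and fin: "finite {z. z ^ L = ?h}"
    using card_roots_of_unit[OF L(1) Lk h0] by auto
  have "char_poly A = (\<Prod>z\<in>{z. z ^ L = ?h}. [:- z, 1:])"
    using degree_monic_char_poly[OF Ac] card root by (intro monic_eq_prod_linear[OF fin]) auto
  then have "lift_roots \<iota> (char_poly A) = (\<Sum>z | z ^ L = ?h. \<iota> z)"
    by (simp only: lift_roots_prod_linear[OF fin])
  also have "\<dots> = (if L = 1 then \<iota> ?h else 0)" by (rule sum_lift_roots_of[OF L(2) h])
  finally show ?thesis by auto
qed

text \<open>The characteristic polynomial is a product over the cycles of \<pi>, and only cycles of
  length one survive the lifting. The induction splits off the cycle of the first label. The
  hypothesis on \<open>N\<close> steps makes the product of the weights over a cycle of length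
  \<open>L\<close> an \<open>(N / L)\<close>-th root of unity.\<close>

lemma lift_roots_monomial:
  fixes a :: "'s \<Rightarrow> 'k"
  assumes "distinct xs" "\<And>x. x \<in> set xs \<Longrightarrow> \<pi> x \<in> set xs"
    and "\<And>x. x \<in> set xs \<Longrightarrow> (\<pi> ^^ N) x = x" and "\<And>x. x \<in> set xs \<Longrightarrow> (\<Prod>j<N. a ((\<pi> ^^ j) x)) = 1"
  shows "lift_roots \<iota> (char_poly (list_mat (\<lambda>x y. if x = \<pi> y then a y else 0) xs)) =
    (\<Sum>x | x \<in> set xs \<and> \<pi> x = x. \<iota> (a x))"
  using assms
proof (induction "length xs" arbitrary: xs rule: less_induct)
  case less
  let ?f = "\<lambda>x y. if x = \<pi> y then a y else 0"
  note dist = less.prems(1) and cl = less.prems(2) and per = less.prems(3) and hol = less.prems(4)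
  show ?case
  proof (cases xs)
    case Nil
    have "char_poly (list_mat ?f []) = 1" by (simp add: char_poly_def char_poly_matrix_def list_mat_def)
    then show ?thesis using Nil by simp
  next
    case (Cons x xs')
    then have x: "x \<in> set xs" by simp
    define L where "L = (LEAST L. L > 0 \<and> (\<pi> ^^ L) x = x)"
    have Lex: "\<exists>L. L > 0 \<and> (\<pi> ^^ L) x = x" using per[OF x] N(1) by blast
    have L: "L > 0" "(\<pi> ^^ L) x = x" using LeastI_ex[OF Lex] by (simp_all add: L_def)
    have Lmin: "(\<pi> ^^ k) x \<noteq> x" if "0 < k" "k < L" for k
      using not_less_Least[of k "\<lambda>L. L > 0 \<and> (\<pi> ^^ L) x = x"] that by (auto simp: L_def)
    have mod: "(\<pi> ^^ k) x = (\<pi> ^^ (k mod L)) x" for k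
      using funpow_mod_eq[OF L(2), of k] by simp
    have LN: "L dvd N"
    proof (rule ccontr)
      assume "\<not> L dvd N"
      then have "0 < N mod L" "N mod L < L" using L(1) by (auto simp: mod_greater_zero_iff_not_dvd)
      from Lmin[OF this] mod[of N] per[OF x] show False by simp
    qed
    have clj: "(\<pi> ^^ j) x \<in> set xs" for j using x cl by (induction j) auto
    define cs where "cs = map (\<lambda>j. (\<pi> ^^ j) x) [0..<L]"
    have injL: "inj_on (\<lambda>j. (\<pi> ^^ j) x) {0..<L}"
    proof (rule inj_onI)
      have aux: False if ij: "i < j" "j < L" and eq: "(\<pi> ^^ i) x = (\<pi> ^^ j) x" for i j
      proof -
        have "(\<pi> ^^ (L - j + i)) x = (\<pi> ^^ (L - j)) ((\<pi> ^^ i) x)" by (simp add: funpow_add)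
        also have "\<dots> = (\<pi> ^^ (L - j + j)) x" unfolding eq by (simp add: funpow_add)
        also have "\<dots> = x" using ij L(2) by simp
        finally have per_x: "(\<pi> ^^ (L - j + i)) x = x" .
        have "0 < L - j + i" "L - j + i < L" using ij by linarith+
        from Lmin[OF this] per_x show False by (rule notE)
      qed
      fix i j assume ij: "i \<in> {0..<L}" "j \<in> {0..<L}" and eq: "(\<pi> ^^ i) x = (\<pi> ^^ j) x"
      have lt: "i < L" "j < L" using ij by simp_all
      show "i = j"
      proof (cases i j rule: linorder_cases)
        case less
        show ?thesis using aux[OF less lt(2) eq] ..
      next
        case greater
        show ?thesis using aux[OF greater lt(1) eq[symmetric]] ..
      qed
    qed
    have dcs: "distinct cs" using injL by (simp add: cs_def distinct_map)
    have setcs: "set cs = (\<lambda>j. (\<pi> ^^ j) x) ` {0..<L}" by (simp add: cs_def)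
    have cs_cl: "\<pi> y \<in> set cs" if "y \<in> set cs" for y
    proof -
      obtain j where "j < L" "y = (\<pi> ^^ j) x" using \<open>y \<in> set cs\<close> setcs by auto
      then have "\<pi> y = (\<pi> ^^ (Suc j mod L)) x" using mod[of "Suc j"] by simp
      then show ?thesis unfolding setcs using L(1) by auto
    qed
    have cs_sub: "set cs \<subseteq> set xs" using clj by (auto simp: setcs)
    define ys where "ys = filter (\<lambda>y. y \<notin> set cs) xs"
    have setys: "set ys = set xs - set cs" by (auto simp: ys_def)
    have dys: "distinct ys" using dist by (simp add: ys_def)
    \<comment> \<open>If \<open>\<pi> y\<close> lay in the cycle \<open>cs\<close>, another
      \<open>N - 1\<close> steps would lead back to \<open>y\<close> without leaving the
      cycle.\<close>
    have ys_cl: "\<pi> y \<in> set ys" if y: "y \<in> set ys" for y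
    proof -
      have yx: "y \<in> set xs" using y setys by auto
      have "\<pi> y \<notin> set cs"
      proof
        assume "\<pi> y \<in> set cs"
        then have "(\<pi> ^^ k) (\<pi> y) \<in> set cs" for k using cs_cl by (induction k) auto
        then have "(\<pi> ^^ (N - 1)) (\<pi> y) \<in> set cs" .
        moreover have "(\<pi> ^^ (N - 1)) (\<pi> y) = (\<pi> ^^ N) y"
          using N(1) by (cases N) (simp_all add: funpow_swap1)
        ultimately show False using per[OF yx] y setys by simp
      qed
      then show ?thesis using cl[OF yx] setys by simp
    qed
    have ms: "mset xs = mset (cs @ ys)"
      using dist dcs dys setys cs_sub by (subst set_eq_iff_mset_eq_distinct[symmetric]) auto
    have "char_poly (list_mat ?f xs) = char_poly (list_mat ?f (cs @ ys))"
      by (rule char_poly_list_mat_mset[OF ms])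
    also have "list_mat ?f (cs @ ys) = blk (list_mat ?f cs) (list_mat ?f ys)"
      using cs_cl ys_cl setys by (intro list_mat_append) auto
    also have "char_poly \<dots> = char_poly (list_mat ?f cs) * char_poly (list_mat ?f ys)"
      by (rule char_poly_blk) (rule list_mat_carrier)+
    finally have "lift_roots \<iota> (char_poly (list_mat ?f xs)) =
        lift_roots \<iota> (char_poly (list_mat ?f cs)) + lift_roots \<iota> (char_poly (list_mat ?f ys))"
      by (simp add: lift_roots_mult char_poly_nonzero[OF list_mat_carrier])
    also have "lift_roots \<iota> (char_poly (list_mat ?f ys)) = (\<Sum>y | y \<in> set ys \<and> \<pi> y = y. \<iota> (a y))"
    proof (rule less.hyps)
      have "length cs + length ys = length xs" using arg_cong[OF ms, of size] by simp
      then show "length ys < length xs" using L(1) by (simp add: cs_def)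
    qed (use dys ys_cl setys per hol in auto)
    also have "lift_roots \<iota> (char_poly (list_mat ?f cs)) = (\<Sum>y | y \<in> set cs \<and> \<pi> y = y. \<iota> (a y))"
    proof -
      let ?b = "\<lambda>j. a ((\<pi> ^^ j) x)"
      have mat: "list_mat ?f cs = mat L L (\<lambda>(i, j). if i = Suc j mod L then ?b j else 0)"
      proof (rule eq_matI)
        fix i j assume "i < dim_row (mat L L (\<lambda>(i, j). if i = Suc j mod L then ?b j else 0))"
          "j < dim_col (mat L L (\<lambda>(i, j). if i = Suc j mod L then ?b j else 0))"
        then have ij: "i < L" "j < L" by auto
        have "(\<pi> ^^ i) x = \<pi> ((\<pi> ^^ j) x) \<longleftrightarrow> (\<pi> ^^ i) x = (\<pi> ^^ (Suc j mod L)) x" using mod[of "Suc j"] by simp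
        also have "\<dots> \<longleftrightarrow> i = Suc j mod L" using inj_on_eq_iff[OF injL, of i "Suc j mod L"] ij L(1) by simp
        finally show "list_mat ?f cs $$ (i, j) = mat L L (\<lambda>(i, j). if i = Suc j mod L then ?b j else 0) $$ (i, j)"
          using ij by (simp add: list_mat_def cs_def)
      qed (simp_all add: list_mat_def cs_def)
      \<comment> \<open>With \<open>m = N / L\<close> this rewrites the hypothesis on
        \<open>N\<close> steps as a statement about a single turn of the cycle.\<close>
      have prodm: "(\<Prod>j<L * m. ?b j) = (\<Prod>j<L. ?b j) ^ m" for m
      proof (induction m)
        case (Suc m)
        have "(\<Prod>j<L * Suc m. ?b j) = (\<Prod>j<L * m. ?b j) * (\<Prod>j<L. ?b (j + L * m))"
          by (simp only: mult_Suc_right add.commute[of L] prod_lessThan_add)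
        also have "(\<Prod>j<L. ?b (j + L * m)) = (\<Prod>j<L. ?b j)"
        proof (intro prod.cong refl)
          fix j assume "j \<in> {..<L}"
          then show "?b (j + L * m) = ?b j" using mod[of "j + L * m"] by simp
        qed
        finally show ?case using Suc by (simp add: mult.commute)
      qed simp
      have "(\<Prod>j<L. ?b j) ^ (N div L) = 1" using prodm[of "N div L"] LN hol[OF x] by simp
      from lift_roots_cycle[OF L(1) LN this mat]
      have 1: "lift_roots \<iota> (char_poly (list_mat ?f cs)) = (if L = 1 then \<iota> (a x) else 0)" by simp
      show ?thesis
      proof (cases "L = 1")
        case True
        then have "{y. y \<in> set cs \<and> \<pi> y = y} = {x}" using L(2) by (auto simp: setcs)
        then show ?thesis using 1 True by simp
      next
        case False
        have emp: "{y. y \<in> set cs \<and> \<pi> y = y} = {}"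
        proof (rule ccontr)
          assume "{y. y \<in> set cs \<and> \<pi> y = y} \<noteq> {}"
          then obtain j where j: "j < L" "\<pi> ((\<pi> ^^ j) x) = (\<pi> ^^ j) x" by (auto simp: setcs)
          have "\<pi> x = \<pi> ((\<pi> ^^ (L - j)) ((\<pi> ^^ j) x))" using j(1) L(2) by (simp flip: funpow_add[unfolded o_def fun_eq_iff, rule_format])
          also have "\<dots> = (\<pi> ^^ (L - j)) (\<pi> ((\<pi> ^^ j) x))" by (simp add: funpow_swap1)
          also have "\<dots> = x" unfolding j(2) using j(1) L(2) by (simp flip: funpow_add[unfolded o_def fun_eq_iff, rule_format])
          finally show False using Lmin[of 1] False L(1) by simp
        qed
        show ?thesis unfolding 1 emp using False by simp
      qed
    qed
    also have "(\<Sum>y | y \<in> set cs \<and> \<pi> y = y. \<iota> (a y)) + (\<Sum>y | y \<in> set ys \<and> \<pi> y = y. \<iota> (a y)) =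
        (\<Sum>y\<in>{y. y \<in> set cs \<and> \<pi> y = y} \<union> {y. y \<in> set ys \<and> \<pi> y = y}. \<iota> (a y))"
      using setys by (intro sum.union_disjoint[symmetric]) auto
    also have "{y. y \<in> set cs \<and> \<pi> y = y} \<union> {y. y \<in> set ys \<and> \<pi> y = y} = {y. y \<in> set xs \<and> \<pi> y = y}"
      using setys cs_sub by auto
    finally show ?thesis .
  qed
qed

end

section \<open>Coset representatives\<close>

context finite_group begin

lemma coset_reps_exist:
  assumes H: "subgroup H G"
  shows "\<exists>ts. distinct ts \<and> set ts \<subseteq> carrier G \<and> (\<forall>x\<in>carrier G. \<exists>!t. t \<in> set ts \<and> inv t \<otimes> x \<in> H)"
proof -
  \<comment> \<open>The predicate handed to the choice is the same for all elements of a left coset,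
    so \<open>rp\<close> picks one element per coset.\<close>
  define rp where "rp x = (SOME y. y \<in> carrier G \<and> inv x \<otimes> y \<in> H)" for x
  have HG: "H \<subseteq> carrier G" using H by (simp add: subgroup_def)
  note Hm = subgroup.m_closed[OF H] and Hi = subgroup.m_inv_closed[OF H] and H1 = subgroup.one_closed[OF H]
  have flip: "inv y \<otimes> x \<in> H" if "x \<in> carrier G" "y \<in> carrier G" "inv x \<otimes> y \<in> H" for x y
    using Hi[OF that(3)] that by (simp add: inv_mult_group)
  have comp: "inv x \<otimes> z \<in> H" if "x \<in> carrier G" "y \<in> carrier G" "z \<in> carrier G" "inv x \<otimes> y \<in> H" "inv y \<otimes> z \<in> H" for x y z
  proof -
    have "inv x \<otimes> y \<otimes> (inv y \<otimes> z) = inv x \<otimes> (y \<otimes> inv y) \<otimes> z" using that(1-3) by (simp only: m_assoc inv_closed m_closed)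
    also have "\<dots> = inv x \<otimes> z" using that(1-3) by simp
    finally show ?thesis using Hm[OF that(4,5)] by simp
  qed
  have rp: "rp x \<in> carrier G" "inv x \<otimes> rp x \<in> H" if "x \<in> carrier G" for x
  proof -
    have "x \<in> carrier G \<and> inv x \<otimes> x \<in> H" using that H1 by simp
    then have "rp x \<in> carrier G \<and> inv x \<otimes> rp x \<in> H" unfolding rp_def by (rule someI)
    then show "rp x \<in> carrier G" "inv x \<otimes> rp x \<in> H" by blast+
  qed
  have rp_eq: "rp x = rp y" if "x \<in> carrier G" "y \<in> carrier G" "inv x \<otimes> y \<in> H" for x y
  proof -
    have "(\<lambda>z. z \<in> carrier G \<and> inv x \<otimes> z \<in> H) = (\<lambda>z. z \<in> carrier G \<and> inv y \<otimes> z \<in> H)"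
      using comp[OF that(1,2)] comp[OF that(2,1)] flip[OF that] that(3) by blast
    then show ?thesis unfolding rp_def by (rule arg_cong)
  qed
  obtain ts where ts: "set ts = rp ` carrier G" "distinct ts"
    using finite_distinct_list[of "rp ` carrier G"] by auto
  have "\<exists>!t. t \<in> set ts \<and> inv t \<otimes> x \<in> H" if x: "x \<in> carrier G" for x
  proof (rule ex1I)
    show "rp x \<in> set ts \<and> inv (rp x) \<otimes> x \<in> H" using flip[OF x rp[OF x]] x ts(1) by simp
    fix t assume t: "t \<in> set ts \<and> inv t \<otimes> x \<in> H"
    then obtain y where y: "y \<in> carrier G" "t = rp y" using ts(1) by auto
    have "inv y \<otimes> x \<in> H" by (rule comp[OF y(1) _ x]) (use y rp[OF y(1)] t in auto)
    then show "t = rp x" using rp_eq[OF y(1) x] y(2) by simp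
  qed
  then show ?thesis using ts rp(1) by (intro exI[of _ ts]) auto
qed

lemma coset_reps:
  assumes H: "subgroup H G"
  shows "distinct (coset_reps G H)" "set (coset_reps G H) \<subseteq> carrier G"
    and "x \<in> carrier G \<Longrightarrow> \<exists>!t. t \<in> set (coset_reps G H) \<and> inv t \<otimes> x \<in> H"
proof -
  have *: "distinct (coset_reps G H) \<and> set (coset_reps G H) \<subseteq> carrier G \<and>
      (\<forall>x\<in>carrier G. \<exists>!t. t \<in> set (coset_reps G H) \<and> inv t \<otimes> x \<in> H)"
    unfolding coset_reps_def by (rule someI_ex[OF coset_reps_exist[OF H]])
  show "distinct (coset_reps G H)" using * by (elim conjE)
  show "set (coset_reps G H) \<subseteq> carrier G" using * by (elim conjE)
  show "\<exists>!t. t \<in> set (coset_reps G H) \<and> inv t \<otimes> x \<in> H" if "x \<in> carrier G"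
    using * that by (elim conjE) (rule bspec)
qed

lemma length_coset_reps:
  assumes H: "subgroup H G"
  shows "length (coset_reps G H) * card H = card (carrier G)"
proof -
  let ?ts = "coset_reps G H"
  note ts = coset_reps[OF H]
  have HG: "H \<subseteq> carrier G" using H by (simp add: subgroup_def)
  have "bij_betw (\<lambda>(t, h). t \<otimes> h) (set ?ts \<times> H) (carrier G)"
  proof (rule bij_betwI')
    fix p q assume pq: "p \<in> set ?ts \<times> H" "q \<in> set ?ts \<times> H"
    obtain t h t' h' where p: "p = (t, h)" "q = (t', h')" "t \<in> set ?ts" "h \<in> H" "t' \<in> set ?ts" "h' \<in> H"
      using pq by auto
    have c: "t \<in> carrier G" "h \<in> carrier G" "t' \<in> carrier G" "h' \<in> carrier G" using p ts(2) HG by auto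
    show "((case p of (t, h) \<Rightarrow> t \<otimes> h) = (case q of (t, h) \<Rightarrow> t \<otimes> h)) = (p = q)"
    proof
      assume "(case p of (t, h) \<Rightarrow> t \<otimes> h) = (case q of (t, h) \<Rightarrow> t \<otimes> h)"
      then have eq: "t \<otimes> h = t' \<otimes> h'" by (simp add: p)
      have "inv t \<otimes> (t \<otimes> h) = h" using c by (simp flip: m_assoc)
      moreover have "inv t' \<otimes> (t \<otimes> h) = h'" unfolding eq using c by (simp flip: m_assoc)
      ultimately have "inv t \<otimes> (t \<otimes> h) \<in> H" "inv t' \<otimes> (t \<otimes> h) \<in> H" using p by auto
      then have "t = t'" using ts(3)[of "t \<otimes> h"] c p by auto
      then show "p = q" using eq c p by simp
    qed simp
  next
    fix p assume "p \<in> set ?ts \<times> H"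
    then show "(case p of (t, h) \<Rightarrow> t \<otimes> h) \<in> carrier G" using ts(2) HG by auto
  next
    fix x assume x: "x \<in> carrier G"
    then obtain t where t: "t \<in> set ?ts" "inv t \<otimes> x \<in> H" using ts(3) by blast
    then have "t \<otimes> (inv t \<otimes> x) = x" using ts(2) x by (auto simp flip: m_assoc)
    then show "\<exists>p\<in>set ?ts \<times> H. x = (case p of (t, h) \<Rightarrow> t \<otimes> h)"
      using t by (intro bexI[of _ "(t, inv t \<otimes> x)"]) auto
  qed
  then have "card (set ?ts \<times> H) = card (carrier G)" by (rule bij_betw_same_card)
  then show ?thesis using distinct_card[OF ts(1)] by (simp add: card_cartesian_product)
qed

end

lemma sum_lessThan_mult: "(\<Sum>c<n * D. f c) = (\<Sum>q<n. \<Sum>i<D. f (q * D + i))"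
  for f :: "nat \<Rightarrow> 'a::comm_monoid_add"
proof -
  have "(\<Sum>c\<in>{q * D..<q * D + D}. f c) = (\<Sum>i<D. f (q * D + i))" for q
    using sum.shift_bounds_nat_ivl[of f 0 "q * D" D] by (simp add: lessThan_atLeast0 add.commute)
  then show ?thesis by (simp flip: sum.nat_group)
qed

section \<open>The induced representation as a monomial matrix\<close>

definition diag_rep :: "('g \<Rightarrow> 'k) \<Rightarrow> nat list \<Rightarrow> ('g, 'k::field) rep" where
  "diag_rep \<psi> es = (\<lambda>g. mat (length es) (length es) (\<lambda>(i, j). if i = j then \<psi> g ^ (es ! i) else 0))"

lemma diag_rep_eq: "rep_direct_sum (map (\<lambda>l. char_rep (\<lambda>g. \<psi> g ^ l)) es) = diag_rep \<psi> es"
proof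
  fix g show "rep_direct_sum (map (\<lambda>l. char_rep (\<lambda>g. \<psi> g ^ l)) es) g = diag_rep \<psi> es g"
  proof (induction es)
    case Nil
    then show ?case by (auto simp: rep_direct_sum_Nil diag_rep_def intro!: eq_matI)
  next
    case (Cons l es)
    then show ?case
      by (auto simp: rep_direct_sum_Cons diag_rep_def char_rep_def blk_def nth_Cons' intro!: eq_matI)
  qed
qed

locale finite_group_root_lift = finite_group G + root_lift "card (carrier G)" \<iota>
  for G :: "('g, 'b) monoid_scheme" (structure) and \<iota> :: "'k::alg_closed_field \<Rightarrow> 'c::field_char_0"
begin

lemma hom_root_of_unity:
  assumes H: "subgroup H G" and hom: "\<And>x y. x \<in> H \<Longrightarrow> y \<in> H \<Longrightarrow> \<psi> (x \<otimes> y) = \<psi> x * \<psi> y"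
    and one: "\<psi> \<one> = (1 :: 'k)" and x: "x \<in> H"
  shows "\<psi> x ^ card H = 1" "\<psi> x ^ card (carrier G) = 1"
proof -
  have HG: "H \<subseteq> carrier G" using H by (simp add: subgroup_def)
  have pow: "x [^] n \<in> H \<and> \<psi> (x [^] n) = \<psi> x ^ n" for n :: nat
    using x by (induction n) (auto simp: one hom mult.commute subgroup.one_closed[OF H] subgroup.m_closed[OF H])
  interpret H: group "G\<lparr>carrier := H\<rparr>" using H by (rule subgroup_imp_group)
  have "x [^] card H = \<one>"
    using H.pow_order_eq_1[of x] x by (simp add: Coset.order_def nat_pow_def)
  then show 1: "\<psi> x ^ card H = 1" using pow[of "card H"] one by simp
  have "card (carrier G) = length (coset_reps G H) * card H" using length_coset_reps[OF H] by simp
  then show "\<psi> x ^ card (carrier G) = 1" using 1 by (metis mult.commute power_mult power_one)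
qed

text \<open>Basis vectors are pairs of a coset and an exponent. The element \<open>g\<close>
  permutes the cosets and multiplies by values of \<psi>, so its matrix is monomial and only the
  cosets fixed by \<open>g\<close> contribute. The condition
  \<open>inv t \<otimes> g \<otimes> t \<in> H\<close> expresses that the coset of \<open>t\<close>
  is fixed.\<close>

lemma brauer_char_induced:
  assumes H: "subgroup H G" and hom: "\<And>x y. x \<in> H \<Longrightarrow> y \<in> H \<Longrightarrow> \<psi> (x \<otimes> y) = \<psi> x * \<psi> y"
    and one: "\<psi> \<one> = 1" and g: "g \<in> carrier G"
  shows "lift_roots \<iota> (char_poly (induced_rep G H (diag_rep \<psi> es) g)) =
    (\<Sum>t\<in>set (coset_reps G H). if inv t \<otimes> g \<otimes> t \<in> H then \<Sum>l\<leftarrow>es. \<iota> (\<psi> (inv t \<otimes> g \<otimes> t)) ^ l else 0)"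
proof -
  let ?ts = "coset_reps G H"
  note ts = coset_reps[OF H]
  have HG: "H \<subseteq> carrier G" using H by (simp add: subgroup_def)
  note Hm = subgroup.m_closed[OF H] and Hi = subgroup.m_inv_closed[OF H] and H1 = subgroup.one_closed[OF H]
  define n where "n = length ?ts"
  define D where "D = length es"
  let ?N = "card (carrier G)"
  have tc: "?ts ! q \<in> carrier G" if "q < n" for q using ts(2) that nth_mem by (auto simp: n_def)
  define idx where "idx x = (THE p. p < n \<and> inv (?ts ! p) \<otimes> x \<in> H)" for x
  have idx_ex1: "\<exists>!p. p < n \<and> inv (?ts ! p) \<otimes> x \<in> H" if x: "x \<in> carrier G" for x
  proof -
    obtain t where t: "t \<in> set ?ts" "inv t \<otimes> x \<in> H" using ts(3)[OF x] by blast
    then obtain p where p: "p < n" "?ts ! p = t" by (auto simp: in_set_conv_nth n_def)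
    show ?thesis
    proof (rule ex1I)
      show "p < n \<and> inv (?ts ! p) \<otimes> x \<in> H" using p t by simp
      fix p' assume p': "p' < n \<and> inv (?ts ! p') \<otimes> x \<in> H"
      then have "?ts ! p' \<in> set ?ts" by (simp add: n_def)
      then have "?ts ! p' = ?ts ! p" using p' t p ts(3)[OF x] by blast
      then show "p' = p" using p(1) p' ts(1) by (simp add: n_def nth_eq_iff_index_eq)
    qed
  qed
  have idx: "idx x < n" "inv (?ts ! idx x) \<otimes> x \<in> H" if "x \<in> carrier G" for x
    using theI'[OF idx_ex1[OF that]] unfolding idx_def by blast+
  have idx_eq: "idx x = p" if "x \<in> carrier G" "p < n" "inv (?ts ! p) \<otimes> x \<in> H" for x p
    unfolding idx_def by (rule the1_equality[OF idx_ex1[OF that(1)]]) (use that in simp)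
  \<comment> \<open>The element of \<open>H\<close> that corrects \<open>g \<otimes> x\<close> is
    the argument of a block entry times the one that corrects \<open>x\<close>. Through \<psi>, the
    product of the weights along an orbit therefore becomes a single value.\<close>
  have split: "inv (?ts ! p) \<otimes> (g \<otimes> x) = (inv (?ts ! p) \<otimes> g \<otimes> ?ts ! q) \<otimes> (inv (?ts ! q) \<otimes> x)"
    if "p < n" "q < n" "x \<in> carrier G" for p q x
  proof -
    have "(inv (?ts ! p) \<otimes> g \<otimes> ?ts ! q) \<otimes> (inv (?ts ! q) \<otimes> x) = inv (?ts ! p) \<otimes> g \<otimes> (?ts ! q \<otimes> inv (?ts ! q)) \<otimes> x"
      using that tc g by (simp only: m_assoc inv_closed m_closed)
    then show ?thesis using that tc g by (simp add: m_assoc)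
  qed
  \<comment> \<open>\<tau> is the permutation of the cosets induced by \<open>g\<close>, written in
    terms of their positions in the list of representatives.\<close>
  define \<tau> where "\<tau> q = idx (g \<otimes> ?ts ! q)" for q
  have \<tau>: "\<tau> q < n" "inv (?ts ! \<tau> q) \<otimes> g \<otimes> ?ts ! q \<in> H" if "q < n" for q
    unfolding \<tau>_def using idx[of "g \<otimes> ?ts ! q"] tc[OF that] g by (simp_all add: m_assoc tc)
  have \<tau>_iff: "inv (?ts ! p) \<otimes> g \<otimes> ?ts ! q \<in> H \<longleftrightarrow> p = \<tau> q" if "p < n" "q < n" for p q
    using idx_eq[of "g \<otimes> ?ts ! q" p] \<tau>[OF that(2)] tc that g by (auto simp: \<tau>_def m_assoc)
  have \<tau>_idx: "\<tau> (idx x) = idx (g \<otimes> x)" and \<psi>_idx: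
    "\<psi> (inv (?ts ! \<tau> (idx x)) \<otimes> g \<otimes> ?ts ! idx x) * \<psi> (inv (?ts ! idx x) \<otimes> x) =
      \<psi> (inv (?ts ! idx (g \<otimes> x)) \<otimes> (g \<otimes> x))" if x: "x \<in> carrier G" for x
  proof -
    note s = split[OF \<tau>(1)[OF idx(1)[OF x]] idx(1)[OF x] x]
    have "inv (?ts ! \<tau> (idx x)) \<otimes> (g \<otimes> x) \<in> H"
      unfolding s by (rule Hm[OF \<tau>(2)[OF idx(1)[OF x]] idx(2)[OF x]])
    then show 1: "\<tau> (idx x) = idx (g \<otimes> x)"
      using idx_eq[of "g \<otimes> x"] g x \<tau>(1)[OF idx(1)[OF x]] by simp
    show "\<psi> (inv (?ts ! \<tau> (idx x)) \<otimes> g \<otimes> ?ts ! idx x) * \<psi> (inv (?ts ! idx x) \<otimes> x) =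
      \<psi> (inv (?ts ! idx (g \<otimes> x)) \<otimes> (g \<otimes> x))"
      unfolding 1[symmetric] s by (rule hom[OF \<tau>(2)[OF idx(1)[OF x]] idx(2)[OF x], symmetric])
  qed
  \<comment> \<open>An index \<open>c\<close> encodes the coset \<open>c div D\<close> and the
    exponent at position \<open>c mod D\<close>; the group element leaves the latter
    unchanged.\<close>
  define \<pi> where "\<pi> c = \<tau> (c div D) * D + c mod D" for c
  define a where "a c = \<psi> (inv (?ts ! \<tau> (c div D)) \<otimes> g \<otimes> ?ts ! (c div D)) ^ (es ! (c mod D))" for c
  have lt: "c div D < n" "c mod D < D" "D > 0" if "c < n * D" for c
  proof -
    show "D > 0" using that by (cases D) auto
    then show "c mod D < D" by simp
    show "c div D < n" using that by (rule less_mult_imp_div_less)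
  qed
  have mk: "q * D + i < n * D" "(q * D + i) div D = q" "(q * D + i) mod D = i" if "q < n" "i < D" for q i
  proof -
    have "q * D + i < Suc q * D" using that by simp
    also have "\<dots> \<le> n * D" using that by (intro mult_le_mono1) simp
    finally show "q * D + i < n * D" .
  qed (use that in auto)
  have \<pi>lt: "\<pi> c < n * D" "\<pi> c div D = \<tau> (c div D)" "\<pi> c mod D = c mod D" if "c < n * D" for c
    unfolding \<pi>_def using mk[of "\<tau> (c div D)" "c mod D"] \<tau>(1)[OF lt(1)[OF that]] lt(2)[OF that] by auto
  have mat: "induced_rep G H (diag_rep \<psi> es) g = list_mat (\<lambda>r c. if r = \<pi> c then a c else 0) [0..<n * D]"
  proof (rule eq_matI)
    fix r c assume "r < dim_row (list_mat (\<lambda>r c. if r = \<pi> c then a c else 0) [0..<n * D])"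
      "c < dim_col (list_mat (\<lambda>r c. if r = \<pi> c then a c else 0) [0..<n * D])"
    then have rc: "r < n * D" "c < n * D" by (simp_all add: list_mat_def)
    let ?x = "inv (?ts ! (r div D)) \<otimes> g \<otimes> ?ts ! (c div D)"
    have "induced_rep G H (diag_rep \<psi> es) g $$ (r, c) =
        (if ?x \<in> H then diag_rep \<psi> es ?x $$ (r mod D, c mod D) else 0)"
      using rc by (simp add: induced_rep_def Let_def rep_dim_def diag_rep_def n_def D_def)
    also have "\<dots> = (if r div D = \<tau> (c div D) \<and> r mod D = c mod D then a c else 0)"
      using lt[OF rc(1)] lt[OF rc(2)] \<tau>_iff[of "r div D" "c div D"] by (auto simp: diag_rep_def a_def D_def)
    also have "r div D = \<tau> (c div D) \<and> r mod D = c mod D \<longleftrightarrow> r = \<pi> c"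
      using \<pi>lt[OF rc(2)] by (metis div_mult_mod_eq)
    finally show "induced_rep G H (diag_rep \<psi> es) g $$ (r, c) = list_mat (\<lambda>r c. if r = \<pi> c then a c else 0) [0..<n * D] $$ (r, c)"
      using rc by (simp add: list_mat_def)
  qed (simp_all add: list_mat_def induced_rep_def Let_def rep_dim_def diag_rep_def n_def D_def)
  have gj: "g [^] j \<in> carrier G" for j :: nat using g by simp
  \<comment> \<open>Position and accumulated weight after \<open>j\<close> steps depend only on
    \<open>g [^] j\<close>. At \<open>j = |G|\<close> this power is the identity, so both return to
    their initial values.\<close>
  have iter: "(\<pi> ^^ j) c = idx (g [^] j \<otimes> ?ts ! (c div D)) * D + c mod D \<and>
      (\<Prod>i<j. a ((\<pi> ^^ i) c)) = \<psi> (inv (?ts ! idx (g [^] j \<otimes> ?ts ! (c div D))) \<otimes> (g [^] j \<otimes> ?ts ! (c div D))) ^ (es ! (c mod D))"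
    if c: "c < n * D" for c j
  proof (induction j)
    case 0
    have "idx (?ts ! (c div D)) = c div D" using idx_eq tc lt(1)[OF c] H1 by simp
    then show ?case using tc[OF lt(1)[OF c]] one by simp
  next
    case (Suc j)
    let ?x = "g [^] j \<otimes> ?ts ! (c div D)"
    have x: "?x \<in> carrier G" using tc[OF lt(1)[OF c]] gj by simp
    have gx: "g [^] Suc j \<otimes> ?ts ! (c div D) = g \<otimes> ?x"
      unfolding nat_pow_Suc2[OF g] using tc[OF lt(1)[OF c]] g by (simp add: m_assoc)
    define c' where "c' = (\<pi> ^^ j) c"
    have c': "c' = idx ?x * D + c mod D" using Suc by (simp add: c'_def)
    have d: "c' div D = idx ?x" "c' mod D = c mod D" unfolding c' using mk[OF idx(1)[OF x] lt(2)[OF c]] by auto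
    have "(\<pi> ^^ Suc j) c = \<pi> c'" by (simp add: c'_def)
    also have "\<dots> = idx (g \<otimes> ?x) * D + c mod D" unfolding \<pi>_def d \<tau>_idx[OF x] ..
    finally have 1: "(\<pi> ^^ Suc j) c = idx (g \<otimes> ?x) * D + c mod D" .
    have "(\<Prod>i<Suc j. a ((\<pi> ^^ i) c)) = (\<Prod>i<j. a ((\<pi> ^^ i) c)) * a c'" by (simp add: c'_def)
    also have "(\<Prod>i<j. a ((\<pi> ^^ i) c)) = \<psi> (inv (?ts ! idx ?x) \<otimes> ?x) ^ (es ! (c mod D))" using Suc by simp
    also have "\<dots> * a c' = (\<psi> (inv (?ts ! \<tau> (idx ?x)) \<otimes> g \<otimes> ?ts ! idx ?x) * \<psi> (inv (?ts ! idx ?x) \<otimes> ?x)) ^ (es ! (c mod D))"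
      unfolding a_def d by (simp add: power_mult_distrib mult.commute)
    finally show ?case using 1 unfolding gx \<psi>_idx[OF x] by simp
  qed
  have gN: "g [^] ?N = \<one>" using pow_order_eq_1[OF g] by (simp add: Coset.order_def)
  have fin: "(\<pi> ^^ ?N) c = c \<and> (\<Prod>i<?N. a ((\<pi> ^^ i) c)) = 1" if c: "c < n * D" for c
  proof -
    have "idx (?ts ! (c div D)) = c div D" using idx_eq tc lt(1)[OF c] H1 by simp
    then show ?thesis using iter[OF c, of ?N] tc[OF lt(1)[OF c]] one by (simp add: gN)
  qed
  have "lift_roots \<iota> (char_poly (induced_rep G H (diag_rep \<psi> es) g)) =
      (\<Sum>c | c \<in> set [0..<n * D] \<and> \<pi> c = c. \<iota> (a c))"
    unfolding mat using fin \<pi>lt(1) by (intro lift_roots_monomial) auto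
  also have "\<dots> = (\<Sum>c<n * D. if \<pi> c = c then \<iota> (a c) else 0)"
    by (simp add: sum.If_cases Int_def lessThan_def)
  also have "\<dots> = (\<Sum>q<n. \<Sum>i<D. if \<pi> (q * D + i) = q * D + i then \<iota> (a (q * D + i)) else 0)"
    by (rule sum_lessThan_mult)
  also have "\<dots> = (\<Sum>q<n. if inv (?ts ! q) \<otimes> g \<otimes> ?ts ! q \<in> H then \<Sum>l\<leftarrow>es. \<iota> (\<psi> (inv (?ts ! q) \<otimes> g \<otimes> ?ts ! q)) ^ l else 0)"
  proof (intro sum.cong refl)
    fix q assume "q \<in> {..<n}"
    then have q: "q < n" by simp
    let ?x = "inv (?ts ! q) \<otimes> g \<otimes> ?ts ! q"
    have p: "\<pi> (q * D + i) = q * D + i \<longleftrightarrow> ?x \<in> H" if "i < D" for i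
      unfolding \<pi>_def mk(2,3)[OF q that] using \<tau>_iff[OF q q] that by auto
    have ai: "\<iota> (a (q * D + i)) = \<iota> (\<psi> ?x) ^ (es ! i)" if "i < D" "?x \<in> H" for i
    proof -
      have "q = \<tau> q" using \<tau>_iff[OF q q] that(2) by simp
      then have "a (q * D + i) = \<psi> ?x ^ (es ! i)" unfolding a_def mk(2,3)[OF q that(1)] by simp
      then show ?thesis using \<iota>_power[OF hom_root_of_unity(2)[OF H hom one that(2)]] by simp
    qed
    show "(\<Sum>i<D. if \<pi> (q * D + i) = q * D + i then \<iota> (a (q * D + i)) else 0) =
        (if ?x \<in> H then \<Sum>l\<leftarrow>es. \<iota> (\<psi> ?x) ^ l else 0)"
    proof (cases "?x \<in> H")
      case True
      then have "(\<Sum>i<D. if \<pi> (q * D + i) = q * D + i then \<iota> (a (q * D + i)) else 0) = (\<Sum>i<D. \<iota> (\<psi> ?x) ^ (es ! i))"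
        using p ai by (intro sum.cong) auto
      also have "\<dots> = (\<Sum>l\<leftarrow>es. \<iota> (\<psi> ?x) ^ l)"
        by (simp add: sum_list_sum_nth D_def lessThan_atLeast0)
      finally show ?thesis using True by simp
    next
      case False
      then show ?thesis using p by simp
    qed
  qed
  also have "\<dots> = (\<Sum>t\<in>set ?ts. if inv t \<otimes> g \<otimes> t \<in> H then \<Sum>l\<leftarrow>es. \<iota> (\<psi> (inv t \<otimes> g \<otimes> t)) ^ l else 0)"
    using sum.reindex_bij_betw[OF bij_betw_nth[OF ts(1) refl refl], of "\<lambda>t. if inv t \<otimes> g \<otimes> t \<in> H then \<Sum>l\<leftarrow>es. \<iota> (\<psi> (inv t \<otimes> g \<otimes> t)) ^ l else 0"]
    by (simp add: n_def lessThan_atLeast0)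
  finally show ?thesis .
qed

end

section \<open>Finite groups embedded in the multiplicative group of a field\<close>

text \<open>Counting elements by their order: at most \<open>\<phi> d\<close> have order \<open>d\<close>, and \<open>\<Sum> \<phi> d = |G|\<close> over the
  divisors of \<open>|G|\<close>.\<close>

lemma (in group) exists_generator_if_few_roots:
  assumes fin: "finite (carrier G)"
    and roots: "\<And>d::nat. d > 0 \<Longrightarrow> card {x \<in> carrier G. x [^] d = \<one>} \<le> d"
  shows "\<exists>a\<in>carrier G. ord a = Coset.order G"
proof -
  let ?N = "\<lambda>d. card {x \<in> carrier G. ord x = d}"
  have pos: "Coset.order G > 0" using fin order_gt_0_iff_finite by blast
  have finD: "finite {d. d dvd Coset.order G}" using pos by (simp add: dvd_nat_bounds)
  \<comment> \<open>If \<open>a\<close> has order \<open>d\<close>, its \<open>d\<close> powers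
    already exhaust the solutions of \<open>x [^] d = \<one>\<close>. The elements of order
    \<open>d\<close> are thus the powers of \<open>a\<close> with exponent coprime to
    \<open>d\<close>.\<close>
  have N_eq: "?N d = phi' d" if ex: "\<exists>a\<in>carrier G. ord a = d" for d
  proof -
    obtain a where a: "a \<in> carrier G" "ord a = d" using ex by blast
    have d: "d > 0" using ord_ge_1[OF fin a(1)] a(2) by simp
    have sub: "(\<lambda>n. a [^] n) ` {1..d} \<subseteq> {x \<in> carrier G. x [^] d = \<one>}"
    proof
      fix x assume "x \<in> (\<lambda>n. a [^] n) ` {1..d}"
      then obtain n :: nat where n: "x = a [^] n" by blast
      have "x [^] d = (a [^] d) [^] n" using a n by (simp add: nat_pow_pow mult.commute)
      also have "a [^] d = \<one>" using pow_ord_eq_1[OF a(1)] a(2) by simp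
      finally show "x \<in> {x \<in> carrier G. x [^] d = \<one>}" using n a by simp
    qed
    have eq: "(\<lambda>n. a [^] n) ` {1..d} = {x \<in> carrier G. x [^] d = \<one>}"
    proof (rule card_seteq[OF _ sub])
      show "card {x \<in> carrier G. x [^] d = \<one>} \<le> card ((\<lambda>n. a [^] n) ` {1..d})"
        using roots[OF d] ord_inj'[OF a(1)] a(2) by (simp add: card_image)
    qed (use fin in auto)
    have "{x \<in> carrier G. ord x = d} = (\<lambda>n. a [^] n) ` {n \<in> {1..d}. ord (a [^] n) = d}"
    proof (intro equalityI subsetI)
      fix x assume x: "x \<in> {x \<in> carrier G. ord x = d}"
      then have "x \<in> (\<lambda>n. a [^] n) ` {1..d}" unfolding eq using pow_ord_eq_1[of x] by auto
      then show "x \<in> (\<lambda>n. a [^] n) ` {n \<in> {1..d}. ord (a [^] n) = d}" using x by auto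
    qed (use a in auto)
    moreover have "inj_on (\<lambda>n. a [^] n) {n \<in> {1..d}. ord (a [^] n) = d}"
      by (rule inj_on_subset[OF ord_inj'[OF a(1), unfolded a(2)]]) blast
    ultimately have "?N d = card {n \<in> {1..d}. ord (a [^] n) = d}" by (simp only: card_image)
    also have "{n \<in> {1..d}. ord (a [^] n) = d} = {n. 1 \<le> n \<and> n \<le> d \<and> coprime n d}"
      using pow_ord_eq_ord_iff[OF fin a(1), unfolded a(2)] by simp
    finally show ?thesis unfolding phi'_def .
  qed
  have "(\<Sum>d | d dvd Coset.order G. ?N d) = card (\<Union>d\<in>{d. d dvd Coset.order G}. {x \<in> carrier G. ord x = d})"
    by (rule card_UN_disjoint[symmetric, OF finD]) (use fin in auto)
  also have "(\<Union>d\<in>{d. d dvd Coset.order G}. {x \<in> carrier G. ord x = d}) = carrier G"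
    using ord_dvd_group_order by auto
  finally have "(\<Sum>d | d dvd Coset.order G. ?N d) = (\<Sum>d | d dvd Coset.order G. phi' d)"
    using sum_phi'_factors[OF pos] by (simp add: Coset.order_def)
  moreover have le: "?N d \<le> phi' d" for d
  proof (cases "\<exists>a\<in>carrier G. ord a = d")
    case True
    from N_eq[OF this] show ?thesis by (rule eq_imp_le)
  next
    case False
    then have "{x \<in> carrier G. ord x = d} = {}" by blast
    then show ?thesis by (simp only: card.empty le0)
  qed
  \<comment> \<open>Termwise inequality together with equality of the sums forces equality in every
    term, in particular at the group order, where \<open>phi'\<close> is nonzero.\<close>
  ultimately have "?N (Coset.order G) = phi' (Coset.order G)"
  proof -
    assume eq: "(\<Sum>d | d dvd Coset.order G. ?N d) = (\<Sum>d | d dvd Coset.order G. phi' d)"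
    show ?thesis
    proof (rule ccontr)
      assume "?N (Coset.order G) \<noteq> phi' (Coset.order G)"
      then have lt: "?N (Coset.order G) < phi' (Coset.order G)" by (rule le_neq_implies_less[OF le])
      have "(\<Sum>d | d dvd Coset.order G. ?N d) < (\<Sum>d | d dvd Coset.order G. phi' d)"
      proof (intro sum_strict_mono_ex1[OF finD] ballI le)
        show "\<exists>d\<in>{d. d dvd Coset.order G}. ?N d < phi' d"
        proof (rule bexI)
          show "?N (Coset.order G) < phi' (Coset.order G)" by (rule lt)
          show "Coset.order G \<in> {d. d dvd Coset.order G}" by (rule CollectI) (rule dvd_refl)
        qed
      qed
      then show False unfolding eq by simp
    qed
  qed
  then have "card {x \<in> carrier G. ord x = Coset.order G} \<noteq> 0" using phi'_nonzero[OF pos] by linarith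
  then have "{x \<in> carrier G. ord x = Coset.order G} \<noteq> {}" by (rule contrapos_nn) (simp only: card.empty)
  then show ?thesis by blast
qed

lemma (in group) cyclic_if_embeds_in_field:
  fixes \<psi> :: "'a \<Rightarrow> 'k::field"
  assumes fin: "finite (carrier G)" and inj: "inj_on \<psi> (carrier G)"
    and hom: "\<And>x y. x \<in> carrier G \<Longrightarrow> y \<in> carrier G \<Longrightarrow> \<psi> (x \<otimes> y) = \<psi> x * \<psi> y" and one: "\<psi> \<one> = 1"
  shows "\<exists>a\<in>carrier G. carrier G = generate G {a}"
proof -
  have pow: "\<psi> (x [^] (n::nat)) = \<psi> x ^ n" if "x \<in> carrier G" for x n
    using that by (induction n) (simp_all add: one hom mult.commute)
  have "card {x \<in> carrier G. x [^] d = \<one>} \<le> d" if d: "d > 0" for d :: nat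
  proof -
    have sub: "\<psi> ` {x \<in> carrier G. x [^] d = \<one>} \<subseteq> {z. z ^ d = 1}"
    proof
      fix z assume "z \<in> \<psi> ` {x \<in> carrier G. x [^] d = \<one>}"
      then obtain x where "x \<in> carrier G" "x [^] d = \<one>" "z = \<psi> x" by blast
      then show "z \<in> {z. z ^ d = 1}" using pow[of x d] one by simp
    qed
    have inj_d: "inj_on \<psi> {x \<in> carrier G. x [^] d = \<one>}" using inj by (auto simp: inj_on_def)
    have roots: "{z::'k. z ^ d = 1} = {z. poly (Polynomial.monom 1 d - 1) z = 0}"
      by (auto simp: poly_monom)
    have deg: "Polynomial.degree (Polynomial.monom (1::'k) d - 1) \<le> d"
      by (intro degree_diff_le) (simp_all add: degree_monom_le)
    have "Polynomial.coeff (Polynomial.monom (1::'k) d - 1) d = 1" using d by simp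
    then have nz: "Polynomial.monom (1::'k) d - 1 \<noteq> 0" by (metis coeff_0 zero_neq_one)
    have finr: "finite {z::'k. z ^ d = 1}" unfolding roots by (rule poly_roots_finite[OF nz])
    have "card {x \<in> carrier G. x [^] d = \<one>} \<le> card {z::'k. z ^ d = 1}"
      by (rule card_inj_on_le[OF inj_d sub finr])
    also have "\<dots> \<le> d" unfolding roots by (rule order_trans[OF card_poly_roots_bound[OF nz] deg])
    finally show ?thesis .
  qed
  from exists_generator_if_few_roots[OF fin this] obtain a where a: "a \<in> carrier G" "ord a = Coset.order G" by blast
  have "generate G {a} \<subseteq> carrier G" using a(1) generate_incl by simp
  moreover have "card (generate G {a}) = card (carrier G)"
    using generate_pow_card[OF a(1)] a(2) by (simp add: Coset.order_def)
  ultimately show ?thesis using a(1) card_subset_eq[OF fin] by metis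
qed

section \<open>The Noetherian property\<close>

lemma nat_seq_mono_subseq:
  fixes x :: "nat \<Rightarrow> nat"
  shows "\<exists>\<psi> :: nat \<Rightarrow> nat. strict_mono \<psi> \<and> (\<forall>i j. i \<le> j \<longrightarrow> x (\<psi> i) \<le> x (\<psi> j))"
proof -
  obtain f :: "nat \<Rightarrow> nat" where f: "strict_mono f" "monoseq (\<lambda>n. x (f n))" using seq_monosub by blast
  show ?thesis
  proof (cases "\<forall>m n. m \<le> n \<longrightarrow> x (f m) \<le> x (f n)")
    case True
    then show ?thesis using f(1) by blast
  next
    case False
    \<comment> \<open>A nonincreasing sequence of natural numbers is constant from the position
      \<open>K\<close> of its minimum on.\<close>
    then have dec: "\<And>m n. m \<le> n \<Longrightarrow> x (f n) \<le> x (f m)" using f(2) by (auto simp: monoseq_def)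
    obtain K where K: "\<And>i. x (f K) \<le> x (f i)"
      using ex_has_least_nat[of "\<lambda>_. True" 0 "\<lambda>i. x (f i)"] by blast
    have "x (f (i + K)) = x (f K)" for i using dec[of K "i + K"] K[of "i + K"] by simp
    moreover have "strict_mono (\<lambda>i. f (i + K))" using f(1) by (auto simp: strict_mono_def)
    ultimately show ?thesis by (intro exI[of _ "\<lambda>i. f (i + K)"]) simp
  qed
qed

lemma nat_vector_seq_mono_subseq:
  fixes x :: "nat \<Rightarrow> nat \<Rightarrow> nat"
  shows "\<exists>\<phi> :: nat \<Rightarrow> nat. strict_mono \<phi> \<and> (\<forall>k<N. \<forall>i j. i \<le> j \<longrightarrow> x (\<phi> i) k \<le> x (\<phi> j) k)"
proof (induction N)
  case 0
  show ?case by (intro exI[of _ id]) (auto simp: strict_mono_def)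
next
  case (Suc N)
  then obtain \<phi> :: "nat \<Rightarrow> nat" where \<phi>: "strict_mono \<phi>" "\<And>k i j. k < N \<Longrightarrow> i \<le> j \<Longrightarrow> x (\<phi> i) k \<le> x (\<phi> j) k" by blast
  obtain \<psi> :: "nat \<Rightarrow> nat" where \<psi>: "strict_mono \<psi>" "\<And>i j. i \<le> j \<Longrightarrow> x (\<phi> (\<psi> i)) N \<le> x (\<phi> (\<psi> j)) N"
    using nat_seq_mono_subseq[of "\<lambda>i. x (\<phi> i) N"] by blast
  have "strict_mono (\<lambda>i. \<phi> (\<psi> i))" using \<phi>(1) \<psi>(1) by (auto simp: strict_mono_def)
  moreover have "x (\<phi> (\<psi> i)) k \<le> x (\<phi> (\<psi> j)) k" if "k < Suc N" "i \<le> j" for k i j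
    using \<phi>(2)[of k "\<psi> i" "\<psi> j"] \<psi>(2)[of i j] strict_mono_mono[OF \<psi>(1)] that
    by (cases "k = N") (auto simp: mono_def less_Suc_eq)
  ultimately show ?case by blast
qed

lemma dickson:
  fixes m :: "nat \<Rightarrow> (nat \<Rightarrow>\<^sub>0 nat)"
  assumes "\<And>i. Poly_Mapping.keys (m i) \<subseteq> {..n}"
  shows "\<exists>i j. i < j \<and> (\<forall>k. Poly_Mapping.lookup (m i) k \<le> Poly_Mapping.lookup (m j) k)"
proof -
  obtain \<phi> :: "nat \<Rightarrow> nat" where \<phi>: "strict_mono \<phi>" "\<forall>k<Suc n. \<forall>i j. i \<le> j \<longrightarrow>
      Poly_Mapping.lookup (m (\<phi> i)) k \<le> Poly_Mapping.lookup (m (\<phi> j)) k"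
    using nat_vector_seq_mono_subseq[of "Suc n" "\<lambda>i. Poly_Mapping.lookup (m i)"] by blast
  have "Poly_Mapping.lookup (m (\<phi> 0)) k \<le> Poly_Mapping.lookup (m (\<phi> 1)) k" for k
  proof (cases "k < Suc n")
    case True
    then show ?thesis using \<phi>(2) by simp
  next
    case False
    then have "k \<notin> Poly_Mapping.keys (m (\<phi> 0))" using assms[of "\<phi> 0"] by auto
    then show ?thesis by (simp add: in_keys_iff)
  qed
  moreover have "\<phi> 0 < \<phi> 1" using \<phi>(1) by (simp add: strict_mono_def)
  ultimately show ?thesis by blast
qed

section \<open>Leading monomials and chains of homogeneous ideals\<close>

definition mdeg :: "(nat \<Rightarrow>\<^sub>0 nat) \<Rightarrow> nat" where
  "mdeg m = (\<Sum>i\<in>Poly_Mapping.keys m. Poly_Mapping.lookup m i)"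

lemma mdeg_superset:
  assumes "finite A" "Poly_Mapping.keys m \<subseteq> A"
  shows "mdeg m = (\<Sum>i\<in>A. Poly_Mapping.lookup m i)"
  unfolding mdeg_def using assms by (intro sum.mono_neutral_left) (auto simp: in_keys_iff)

lemma mdeg_add: "mdeg (m + m') = mdeg m + mdeg m'"
  using mdeg_superset[of "Poly_Mapping.keys m \<union> Poly_Mapping.keys m'" "m + m'"]
    mdeg_superset[of "Poly_Mapping.keys m \<union> Poly_Mapping.keys m'" m]
    mdeg_superset[of "Poly_Mapping.keys m \<union> Poly_Mapping.keys m'" m'] Poly_Mapping.keys_add[of m m']
  by (simp add: lookup_add sum.distrib)

lemma is_form_iff: "is_form n d f \<longleftrightarrow> (\<forall>m\<in>Poly_Mapping.keys f. Poly_Mapping.keys m \<subseteq> {..n} \<and> mdeg m = d)"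
  by (simp add: is_form_def mdeg_def)

lemma is_form_zero [simp]: "is_form n d 0"
  by (simp add: is_form_def)

lemma is_form_single: "Poly_Mapping.keys m \<subseteq> {..n} \<Longrightarrow> is_form n (mdeg m) (Poly_Mapping.single m c)"
  by (auto simp: is_form_iff)

lemma is_form_add: "is_form n d f \<Longrightarrow> is_form n d g \<Longrightarrow> is_form n d (f + g)"
  using Poly_Mapping.keys_add[of f g] unfolding is_form_def by blast

lemma is_form_uminus: "is_form n d f \<Longrightarrow> is_form n d (- f)"
  by (simp add: is_form_def)

lemma is_form_diff: "is_form n d f \<Longrightarrow> is_form n d g \<Longrightarrow> is_form n d (f - g)"
  using is_form_add[of n d f "- g"] is_form_uminus by (metis diff_conv_add_uminus)

lemma is_form_degree_unique: "is_form n d f \<Longrightarrow> is_form n e f \<Longrightarrow> f \<noteq> 0 \<Longrightarrow> d = e"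
  unfolding is_form_def by (metis all_not_in_conv keys_eq_empty)

text \<open>Having only finitely many monomials in each degree allows a least leading monomial to be
  chosen without a well-ordering of all exponent vectors.\<close>

lemma finite_monomials: "finite {m :: nat \<Rightarrow>\<^sub>0 nat. Poly_Mapping.keys m \<subseteq> {..n} \<and> mdeg m = d}" (is "finite ?S")
proof (rule inj_on_finite[where f = "\<lambda>m. restrict (Poly_Mapping.lookup m) {..n}" and B = "{..n} \<rightarrow>\<^sub>E {..d}"])
  show "inj_on (\<lambda>m. restrict (Poly_Mapping.lookup m) {..n}) ?S"
  proof (rule inj_onI, rule poly_mapping_eqI)
    fix m m' k assume m: "m \<in> ?S" "m' \<in> ?S"
      and eq: "restrict (Poly_Mapping.lookup m) {..n} = restrict (Poly_Mapping.lookup m') {..n}"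
    show "Poly_Mapping.lookup m k = Poly_Mapping.lookup m' k"
    proof (cases "k \<le> n")
      case True
      then show ?thesis using fun_cong[OF eq, of k] by simp
    next
      case False
      then have "k \<notin> Poly_Mapping.keys m" "k \<notin> Poly_Mapping.keys m'" using m by auto
      then show ?thesis by (simp add: in_keys_iff)
    qed
  qed
  have "Poly_Mapping.lookup m k \<le> d" if "m \<in> ?S" for m k
  proof (cases "k \<in> Poly_Mapping.keys m")
    case True
    then show ?thesis using that member_le_sum[of k "Poly_Mapping.keys m" "Poly_Mapping.lookup m"] by (auto simp: mdeg_def)
  qed (simp add: in_keys_iff)
  then show "(\<lambda>m. restrict (Poly_Mapping.lookup m) {..n}) ` ?S \<subseteq> {..n} \<rightarrow>\<^sub>E {..d}"
    by (simp add: image_subset_iff restrict_PiE_iff)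
qed (intro finite_PiE; simp)

lemma lookup_single_times:
  fixes g :: "'k::comm_ring_1 mpoly"
  shows "Poly_Mapping.lookup (Poly_Mapping.single m c * g) (m + a) = c * Poly_Mapping.lookup g a"
proof -
  have "Poly_Mapping.single m c * g = (\<Sum>b\<in>Poly_Mapping.keys g. Poly_Mapping.single (m + b) (c * Poly_Mapping.lookup g b))"
    by (subst (1) poly_mapping_as_sum[of g]) (simp add: sum_distrib_left mult_single)
  then show ?thesis
    by (auto simp: lookup_sum lookup_single when_def in_keys_iff)
qed

text \<open>Hilbert's basis theorem for ascending chains of homogeneous ideals. By Dickson's lemma the
  leading monomial of some \<open>f\<^sub>i \<in> I\<^sub>i\<^sub>+\<^sub>1 - I\<^sub>i\<close> divides that of a later \<open>f\<^sub>j\<close>, and cancelling it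
  contradicts the minimality of the leading monomial of \<open>f\<^sub>j\<close>.\<close>

lemma homogeneous_chain_stabilises:
  fixes I :: "nat \<Rightarrow> 'k::field mpoly set"
  assumes forms: "\<And>i f. f \<in> I i \<Longrightarrow> \<exists>d. is_form n d f"
    and mono: "\<And>i. I i \<subseteq> I (Suc i)" and zero: "\<And>i. 0 \<in> I i"
    and comb: "\<And>i f g m c d e. f \<in> I i \<Longrightarrow> g \<in> I i \<Longrightarrow> is_form n d f \<Longrightarrow> is_form n e g \<Longrightarrow>
      Poly_Mapping.keys m \<subseteq> {..n} \<Longrightarrow> d = mdeg m + e \<Longrightarrow> f - Poly_Mapping.single m c * g \<in> I i"
  shows "\<exists>i. I (Suc i) = I i"
proof (rule ccontr)
  assume "\<nexists>i. I (Suc i) = I i"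
  then have neq: "\<exists>f. f \<in> I (Suc i) - I i" for i using mono[of i] by blast
  define lm :: "'k mpoly \<Rightarrow> (nat \<Rightarrow>\<^sub>0 nat)" where "lm f = Max (Poly_Mapping.keys f)" for f
  have lm_in: "lm f \<in> Poly_Mapping.keys f" if "f \<noteq> 0" for f
    unfolding lm_def using that by (intro Max_in) auto
  have lm_ge: "a \<le> lm f" if "a \<in> Poly_Mapping.keys f" for a f
    unfolding lm_def using that by (intro Max_ge) auto
  \<comment> \<open>Among the forms of some degree that are new in \<open>I (Suc i)\<close>, one
    with least leading monomial is selected.\<close>
  have "\<exists>f d. f \<in> I (Suc i) - I i \<and> is_form n d f \<and> (\<forall>g. g \<in> I (Suc i) - I i \<and> is_form n d g \<longrightarrow> lm f \<le> lm g)" for i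
  proof -
    obtain f d where f: "f \<in> I (Suc i) - I i" "is_form n d f" using neq forms by blast
    let ?S = "{g. g \<in> I (Suc i) - I i \<and> is_form n d g}"
    have "lm ` ?S \<subseteq> {m. Poly_Mapping.keys m \<subseteq> {..n} \<and> mdeg m = d}"
    proof
      fix x assume "x \<in> lm ` ?S"
      then obtain g where g: "g \<in> ?S" "x = lm g" by blast
      then have "g \<noteq> 0" using zero by blast
      from lm_in[OF this] g show "x \<in> {m. Poly_Mapping.keys m \<subseteq> {..n} \<and> mdeg m = d}"
        by (auto simp: is_form_iff)
    qed
    then have fin: "finite (lm ` ?S)" using finite_monomials finite_subset by blast
    have "lm ` ?S \<noteq> {}" using f by blast
    from Min_in[OF fin this] obtain g where "g \<in> ?S" "lm g = Min (lm ` ?S)" by auto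
    then show ?thesis using Min_le[OF fin] by (intro exI[of _ g] exI[of _ d]) auto
  qed
  then have "\<forall>i. \<exists>p. fst p \<in> I (Suc i) - I i \<and> is_form n (snd p) (fst p) \<and>
      (\<forall>g. g \<in> I (Suc i) - I i \<and> is_form n (snd p) g \<longrightarrow> lm (fst p) \<le> lm g)" by simp
  from choice[OF this] obtain p where p: "\<forall>i. fst (p i) \<in> I (Suc i) - I i \<and> is_form n (snd (p i)) (fst (p i)) \<and>
      (\<forall>g. g \<in> I (Suc i) - I i \<and> is_form n (snd (p i)) g \<longrightarrow> lm (fst (p i)) \<le> lm g)" ..
  define f d where "f i = fst (p i)" and "d i = snd (p i)" for i
  have fI: "f i \<in> I (Suc i)" "f i \<notin> I i" and ff: "is_form n (d i) (f i)"
    and fmin: "\<And>g. g \<in> I (Suc i) \<Longrightarrow> g \<notin> I i \<Longrightarrow> is_form n (d i) g \<Longrightarrow> lm (f i) \<le> lm g" for i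
    using spec[OF p, of i] by (auto simp: f_def d_def)
  have f0: "f i \<noteq> 0" for i using fI(2) zero by metis
  have keysf: "Poly_Mapping.keys (lm (f i)) \<subseteq> {..n}" "mdeg (lm (f i)) = d i" for i
    using ff[of i] lm_in[OF f0] by (auto simp: is_form_iff)
  obtain i j where ij: "i < j" "\<And>k. Poly_Mapping.lookup (lm (f i)) k \<le> Poly_Mapping.lookup (lm (f j)) k"
    using dickson[of "\<lambda>i. lm (f i)" n] keysf(1) by blast
  define m where "m = lm (f j) - lm (f i)"
  have m: "m + lm (f i) = lm (f j)"
    by (rule poly_mapping_eqI) (simp add: m_def lookup_add lookup_minus ij(2))
  have km: "Poly_Mapping.keys m \<subseteq> {..n}"
  proof
    fix k assume "k \<in> Poly_Mapping.keys m"
    then have "k \<in> Poly_Mapping.keys (lm (f j))" by (auto simp: in_keys_iff m_def lookup_minus)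
    then show "k \<in> {..n}" using keysf(1) by blast
  qed
  have dj: "d j = mdeg m + d i" using mdeg_add[of m "lm (f i)"] m keysf(2) by simp
  \<comment> \<open>The quotient of the leading coefficients, so that the leading terms of
    \<open>f j\<close> and \<open>s\<close> cancel.\<close>
  define c where "c = Poly_Mapping.lookup (f j) (lm (f j)) / Poly_Mapping.lookup (f i) (lm (f i))"
  define s where "s = Poly_Mapping.single m c * f i"
  define g where "g = f j - s"
  have Imono: "I a \<subseteq> I b" if "a \<le> b" for a b using lift_Suc_mono_le[of I, OF mono that] .
  have fiIj: "f i \<in> I j" using fI(1)[of i] Imono[of "Suc i" j] ij(1) by auto
  have sform: "is_form n (d j) s"
    unfolding s_def dj by (intro is_form_mult is_form_single km ff)
  have gI: "g \<in> I (Suc j)"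
    unfolding g_def s_def using comb[OF fI(1) _ ff ff km dj] fiIj mono by blast
  \<comment> \<open>Otherwise adding the multiple of \<open>f i\<close> back would put
    \<open>f j\<close> into \<open>I j\<close>. The closure property only subtracts, hence the
    coefficient \<open>- c\<close>.\<close>
  have gnI: "g \<notin> I j"
  proof
    assume "g \<in> I j"
    from comb[OF this fiIj _ ff km dj, of "- c"] have "g - Poly_Mapping.single m (- c) * f i \<in> I j"
      using is_form_diff[OF ff sform] by (simp add: g_def)
    moreover have "g - Poly_Mapping.single m (- c) * f i = f j"
      by (simp add: g_def s_def single_uminus)
    ultimately show False using fI(2) by simp
  qed
  have g0: "g \<noteq> 0" using gnI zero by metis
  have le: "lm (f j) \<le> lm g" by (rule fmin[OF gI gnI]) (simp add: g_def is_form_diff ff sform)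
  have "lm g \<in> Poly_Mapping.keys (f j) \<union> Poly_Mapping.keys s"
    using lm_in[OF g0] keys_diff[of "f j" s] by (auto simp: g_def)
  then have "lm g \<le> lm (f j)"
  proof
    assume "lm g \<in> Poly_Mapping.keys s"
    then obtain b where b: "b \<in> Poly_Mapping.keys (f i)" "lm g = m + b"
      using keys_mult[of "Poly_Mapping.single m c" "f i"] by (auto simp: s_def split: if_splits)
    then have "m + b \<le> m + lm (f i)" using lm_ge[OF b(1)] by (intro add_left_mono)
    then show ?thesis using b(2) m by simp
  qed (rule lm_ge)
  with le have eq: "lm g = lm (f j)" by simp
  have "Poly_Mapping.lookup s (lm (f j)) = c * Poly_Mapping.lookup (f i) (lm (f i))"
    unfolding s_def m[symmetric] by (rule lookup_single_times)
  also have "\<dots> = Poly_Mapping.lookup (f j) (lm (f j))"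
    using lm_in[OF f0, of i] by (simp add: c_def in_keys_iff)
  finally have "Poly_Mapping.lookup g (lm (f j)) = 0" by (simp add: g_def lookup_minus)
  then show False using lm_in[OF g0] eq by (simp add: in_keys_iff)
qed

section \<open>Discrete valuation rings of germs\<close>

text \<open>The local ring of a curve at a point \<open>P\<close>, presented by functions: \<open>R\<close> are the functions
  regular at \<open>P\<close>, and two of them represent the same germ iff they agree eventually along the
  neighbourhood filter \<open>F\<close>.\<close>

locale germ_ring =
  fixes F :: "'p filter" and R :: "('p \<Rightarrow> 'k::field) set" and P :: 'p
  assumes ev_P: "\<And>\<phi>. eventually \<phi> F \<Longrightarrow> \<phi> P"
    and const: "\<And>c. (\<lambda>_. c) \<in> R"
    and add: "\<And>f g. f \<in> R \<Longrightarrow> g \<in> R \<Longrightarrow> (\<lambda>Q. f Q + g Q) \<in> R"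
    and mult: "\<And>f g. f \<in> R \<Longrightarrow> g \<in> R \<Longrightarrow> (\<lambda>Q. f Q * g Q) \<in> R"
    and inv: "\<And>f. f \<in> R \<Longrightarrow> f P \<noteq> 0 \<Longrightarrow> (\<lambda>Q. inverse (f Q)) \<in> R"
    and ev_nonzero: "\<And>f. f \<in> R \<Longrightarrow> f P \<noteq> 0 \<Longrightarrow> \<forall>\<^sub>F Q in F. f Q \<noteq> 0"
    and dom: "\<And>f g. f \<in> R \<Longrightarrow> g \<in> R \<Longrightarrow> \<forall>\<^sub>F Q in F. f Q * g Q = 0 \<Longrightarrow>
      (\<forall>\<^sub>F Q in F. f Q = 0) \<or> (\<forall>\<^sub>F Q in F. g Q = 0)"
    and fin_gen: "\<exists>(K::nat) y. (\<forall>i<K. y i \<in> R \<and> y i P = 0) \<and> (\<forall>f\<in>R. f P = 0 \<longrightarrow>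
      (\<exists>u. (\<forall>i<K. u i \<in> R) \<and> (\<forall>\<^sub>F Q in F. f Q = (\<Sum>i<K. y i Q * u i Q))))"
    and acc: "\<And>h. (\<And>i::nat. h i \<in> R) \<Longrightarrow> (\<And>i. \<exists>u\<in>R. \<forall>\<^sub>F Q in F. h i Q = u Q * h (Suc i) Q) \<Longrightarrow>
      \<exists>i. \<exists>u\<in>R. \<forall>\<^sub>F Q in F. h (Suc i) Q = u Q * h i Q"
begin

definition \<mm> :: "('p \<Rightarrow> 'k) set" where "\<mm> = {f \<in> R. f P = 0}"

definition \<mm>2 :: "('p \<Rightarrow> 'k) set" where
  "\<mm>2 = {f. \<exists>N a b. (\<forall>i<N::nat. a i \<in> \<mm> \<and> b i \<in> \<mm>) \<and> (\<forall>\<^sub>F Q in F. f Q = (\<Sum>i<N. a i Q * b i Q))}"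

lemma uminus: "f \<in> R \<Longrightarrow> (\<lambda>Q. - f Q) \<in> R"
  using mult[OF const[of "-1"], of f] by simp

lemma diff: "f \<in> R \<Longrightarrow> g \<in> R \<Longrightarrow> (\<lambda>Q. f Q - g Q) \<in> R"
  using add[OF _ uminus, of f g] by simp

lemma power: "f \<in> R \<Longrightarrow> (\<lambda>Q. f Q ^ n) \<in> R"
  by (induction n) (auto intro: const mult)

lemma sum: "(\<And>i. i \<in> A \<Longrightarrow> f i \<in> R) \<Longrightarrow> (\<lambda>Q. \<Sum>i\<in>A. f i Q) \<in> R"
  by (induction A rule: infinite_finite_induct) (auto intro: const add)

lemmas R_intros = const add mult uminus diff power sum

end

text \<open>The cotangent space is a line spanned by the class of \<open>t\<close>: existence of
  \<open>c\<close> says that \<open>t\<close> spans, uniqueness that its class is nonzero. No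
  valuation is introduced; divisibility by powers of \<open>t\<close> takes its place.\<close>

locale dvr_germs = germ_ring F R P for F :: "'p filter" and R :: "('p \<Rightarrow> 'k::field) set" and P +
  fixes t :: "'p \<Rightarrow> 'k"
  assumes t: "t \<in> \<mm>"
    and cotangent: "\<And>f. f \<in> \<mm> \<Longrightarrow> \<exists>!c. (\<lambda>Q. f Q - c * t Q) \<in> \<mm>2"
begin

lemma tR: "t \<in> R" and tP: "t P = 0"
  using t by (auto simp: \<mm>_def)

text \<open>If \<open>t\<close> vanished near \<open>P\<close>, every multiple of it would lie in
  \<open>\<mm>2\<close>, contradicting the uniqueness of cotangent coordinates.\<close>

lemma t_nonzero: "\<not> (\<forall>\<^sub>F Q in F. t Q = 0)"
proof
  assume t0: "\<forall>\<^sub>F Q in F. t Q = 0"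
  have "(\<lambda>_. 0) \<in> \<mm>" using const by (simp add: \<mm>_def)
  moreover have "(\<lambda>Q. 0 - c * t Q) \<in> \<mm>2" for c
  proof -
    have "\<forall>\<^sub>F Q in F. 0 - c * t Q = (\<Sum>i<(0::nat). 0 * 0)"
      using t0 by eventually_elim simp
    then show ?thesis unfolding \<mm>2_def by (intro CollectI exI[of _ 0]) auto
  qed
  ultimately show False using cotangent[of "\<lambda>_. 0"] zero_neq_one by metis
qed

text \<open>Nakayama's lemma by eliminating the generators of the maximal ideal one at a time: the last
  one is congruent to a multiple of \<open>t\<close> modulo \<open>\<mm>2\<close>, and its own coefficient on the right
  hand side is a non-unit.\<close>

lemma principal_aux:
  fixes K :: nat
  assumes y: "\<And>i. i < K \<Longrightarrow> y i \<in> \<mm>"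
    and gen: "\<And>f. f \<in> \<mm> \<Longrightarrow> \<exists>u. (\<forall>i<K. u i \<in> R) \<and> (\<forall>\<^sub>F Q in F. f Q = (\<Sum>i<K. y i Q * u i Q))"
    and "r \<le> K" and "f \<in> \<mm>"
  shows "\<exists>v u. v \<in> R \<and> (\<forall>i<K - r. u i \<in> R) \<and> (\<forall>\<^sub>F Q in F. f Q = t Q * v Q + (\<Sum>i<K - r. y i Q * u i Q))"
  using assms(3,4)
proof (induction r arbitrary: f)
  case 0
  then obtain u where "\<forall>i<K. u i \<in> R" "\<forall>\<^sub>F Q in F. f Q = (\<Sum>i<K. y i Q * u i Q)" using gen by blast
  then show ?case using const[of 0] by (intro exI[of _ "\<lambda>_. 0"] exI[of _ u]) simp
next
  case (Suc r)
  define k where "k = K - Suc r"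
  have k: "K - r = Suc k" "k < K" using Suc.prems(1) by (auto simp: k_def)
  have IH: "\<exists>v u. v \<in> R \<and> (\<forall>i<Suc k. u i \<in> R) \<and> (\<forall>\<^sub>F Q in F. f Q = t Q * v Q + (\<Sum>i<Suc k. y i Q * u i Q))" if "f \<in> \<mm>" for f
    using Suc.IH[OF _ that] Suc.prems(1) unfolding k(1) by simp
  \<comment> \<open>In each product one factor is expanded in the generators while the other stays
    in the maximal ideal. Hence the coefficients of the generators are non-units.\<close>
  have sq: "\<exists>v u. v \<in> R \<and> (\<forall>i<Suc k. u i \<in> \<mm>) \<and> (\<forall>\<^sub>F Q in F. (\<Sum>j<N. a j Q * b j Q) = t Q * v Q + (\<Sum>i<Suc k. y i Q * u i Q))"
    if "\<forall>i<N::nat. a i \<in> \<mm> \<and> b i \<in> \<mm>" for N a b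
    using that
  proof (induction N)
    case 0
    then show ?case using const[of 0]
      by (intro exI[of _ "\<lambda>_. 0"] exI[of _ "\<lambda>_ _. 0"]) (auto simp: \<mm>_def)
  next
    case (Suc N)
    then obtain v u where vu: "v \<in> R" "\<forall>i<Suc k. u i \<in> \<mm>"
      "\<forall>\<^sub>F Q in F. (\<Sum>j<N. a j Q * b j Q) = t Q * v Q + (\<Sum>i<Suc k. y i Q * u i Q)" by fastforce
    have ab: "a N \<in> \<mm>" "b N \<in> \<mm>" using Suc.prems by auto
    obtain v' u' where vu': "v' \<in> R" "\<forall>i<Suc k. u' i \<in> R"
      "\<forall>\<^sub>F Q in F. a N Q = t Q * v' Q + (\<Sum>i<Suc k. y i Q * u' i Q)" using IH[OF ab(1)] by blast
    have "\<forall>\<^sub>F Q in F. (\<Sum>j<Suc N. a j Q * b j Q) =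
        t Q * (v Q + v' Q * b N Q) + (\<Sum>i<Suc k. y i Q * (u i Q + u' i Q * b N Q))"
      using vu(3) vu'(3)
    proof eventually_elim
      case (elim Q)
      have "(\<Sum>i<Suc k. y i Q * (u i Q + u' i Q * b N Q)) = (\<Sum>i<Suc k. y i Q * u i Q) + (\<Sum>i<Suc k. y i Q * u' i Q) * b N Q"
        unfolding sum_distrib_right sum.distrib[symmetric] by (intro sum.cong refl) (simp add: algebra_simps)
      then show ?case using elim by (simp add: algebra_simps del: sum.lessThan_Suc) (simp add: algebra_simps)
    qed
    then show ?case using vu vu' ab
      by (intro exI[of _ "\<lambda>Q. v Q + v' Q * b N Q"] exI[of _ "\<lambda>i Q. u i Q + u' i Q * b N Q"])
        (auto simp: \<mm>_def intro!: R_intros)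
  qed
  obtain c where "(\<lambda>Q. y k Q - c * t Q) \<in> \<mm>2" using cotangent[OF y[OF k(2)]] by blast
  then obtain N a b where "\<forall>i<N::nat. a i \<in> \<mm> \<and> b i \<in> \<mm>" "\<forall>\<^sub>F Q in F. y k Q - c * t Q = (\<Sum>i<N. a i Q * b i Q)"
    unfolding \<mm>2_def by blast
  moreover from sq[OF this(1)] obtain v \<mu> where v: "v \<in> R" "\<forall>i<Suc k. \<mu> i \<in> \<mm>"
    "\<forall>\<^sub>F Q in F. (\<Sum>j<N. a j Q * b j Q) = t Q * v Q + (\<Sum>i<Suc k. y i Q * \<mu> i Q)" by blast
  ultimately have yk: "\<forall>\<^sub>F Q in F. y k Q - c * t Q = t Q * v Q + (\<Sum>i<Suc k. y i Q * \<mu> i Q)"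
    by (auto elim: eventually_elim2)
  have \<mu>: "\<mu> i \<in> R" "\<mu> i P = 0" if "i < Suc k" for i using v(2) that by (auto simp: \<mm>_def)
  have one\<mu>: "(\<lambda>Q. 1 - \<mu> k Q) \<in> R" using \<mu>[of k] by (intro R_intros) auto
  \<comment> \<open>Solving the relation for \<open>y k\<close> requires division by
    \<open>1 - \<mu> k\<close>, a unit because \<open>\<mu> k\<close> vanishes at
    \<open>P\<close>.\<close>
  define w where "w = (\<lambda>Q. inverse (1 - \<mu> k Q))"
  have wR: "w \<in> R" unfolding w_def by (rule inv[OF one\<mu>]) (simp add: \<mu>)
  have nz: "\<forall>\<^sub>F Q in F. 1 - \<mu> k Q \<noteq> 0" by (rule ev_nonzero[OF one\<mu>]) (simp add: \<mu>)
  have yk': "\<forall>\<^sub>F Q in F. y k Q = t Q * (w Q * (c + v Q)) + (\<Sum>i<k. y i Q * (w Q * \<mu> i Q))"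
    using yk nz
  proof eventually_elim
    case (elim Q)
    have "(\<Sum>i<k. y i Q * (w Q * \<mu> i Q)) = w Q * (\<Sum>i<k. y i Q * \<mu> i Q)"
      unfolding sum_distrib_left by (intro sum.cong refl) (simp add: mult_ac)
    moreover have "y k Q * (1 - \<mu> k Q) = t Q * (c + v Q) + (\<Sum>i<k. y i Q * \<mu> i Q)"
      using elim(1) by (simp add: algebra_simps)
    moreover have "y k Q = w Q * (y k Q * (1 - \<mu> k Q))"
      using elim(2) by (simp add: w_def)
    ultimately show ?case by (simp add: distrib_left mult.left_commute)
  qed
  obtain v' u' where vu': "v' \<in> R" "\<forall>i<Suc k. u' i \<in> R"
    "\<forall>\<^sub>F Q in F. f Q = t Q * v' Q + (\<Sum>i<Suc k. y i Q * u' i Q)" using IH[OF Suc.prems(2)] by blast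
  have "\<forall>\<^sub>F Q in F. f Q = t Q * (v' Q + w Q * (c + v Q) * u' k Q) + (\<Sum>i<k. y i Q * (u' i Q + w Q * \<mu> i Q * u' k Q))"
    using vu'(3) yk'
  proof eventually_elim
    case (elim Q)
    have "(\<Sum>i<k. y i Q * (u' i Q + w Q * \<mu> i Q * u' k Q)) = (\<Sum>i<k. y i Q * u' i Q) + (\<Sum>i<k. y i Q * (w Q * \<mu> i Q)) * u' k Q"
      unfolding sum_distrib_right sum.distrib[symmetric] by (intro sum.cong refl) (simp add: algebra_simps)
    moreover have "f Q = t Q * v' Q + (\<Sum>i<k. y i Q * u' i Q) +
        (t Q * (w Q * (c + v Q)) + (\<Sum>i<k. y i Q * (w Q * \<mu> i Q))) * u' k Q"
      using elim by simp
    ultimately show ?case by (simp add: algebra_simps)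
  qed
  then show ?case unfolding k_def[symmetric] using vu' wR v(1) \<mu>
    by (intro exI[of _ "\<lambda>Q. v' Q + w Q * (c + v Q) * u' k Q"] exI[of _ "\<lambda>i Q. u' i Q + w Q * \<mu> i Q * u' k Q"])
      (auto intro!: R_intros)
qed

text \<open>With \<open>r = K\<close> in \<open>principal_aux\<close> all generators of the maximal
  ideal are eliminated and only \<open>t\<close> remains.\<close>

lemma principal:
  assumes "f \<in> R" "f P = 0"
  shows "\<exists>u\<in>R. \<forall>\<^sub>F Q in F. f Q = t Q * u Q"
proof -
  obtain K y where Ky: "\<forall>i<K::nat. y i \<in> R \<and> y i P = 0" "\<forall>f\<in>R. f P = 0 \<longrightarrow>
      (\<exists>u. (\<forall>i<K. u i \<in> R) \<and> (\<forall>\<^sub>F Q in F. f Q = (\<Sum>i<K. y i Q * u i Q)))"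
    using fin_gen by blast
  have "\<exists>v u. v \<in> R \<and> (\<forall>i<K - K. u i \<in> R) \<and> (\<forall>\<^sub>F Q in F. f Q = t Q * v Q + (\<Sum>i<K - K. y i Q * u i Q))"
    by (rule principal_aux) (use Ky assms in \<open>auto simp: \<mm>_def\<close>)
  then show ?thesis by auto
qed

lemma \<mm>2D:
  assumes "f \<in> \<mm>2"
  shows "\<exists>w\<in>R. \<forall>\<^sub>F Q in F. f Q = t Q * (t Q * w Q)"
proof -
  have sq: "\<exists>w\<in>R. \<forall>\<^sub>F Q in F. (\<Sum>i<N. a i Q * b i Q) = t Q * (t Q * w Q)"
    if "\<forall>i<N::nat. a i \<in> \<mm> \<and> b i \<in> \<mm>" for N a b
    using that
  proof (induction N)
    case 0
    then show ?case using const[of 0] by (intro bexI[of _ "\<lambda>_. 0"]) auto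
  next
    case (Suc N)
    then obtain w where w: "w \<in> R" "\<forall>\<^sub>F Q in F. (\<Sum>i<N. a i Q * b i Q) = t Q * (t Q * w Q)" by fastforce
    obtain u where u: "u \<in> R" "\<forall>\<^sub>F Q in F. a N Q = t Q * u Q" using principal[of "a N"] Suc.prems by (auto simp: \<mm>_def)
    obtain v where v: "v \<in> R" "\<forall>\<^sub>F Q in F. b N Q = t Q * v Q" using principal[of "b N"] Suc.prems by (auto simp: \<mm>_def)
    have "\<forall>\<^sub>F Q in F. (\<Sum>i<Suc N. a i Q * b i Q) = t Q * (t Q * (w Q + u Q * v Q))"
      using w(2) u(2) v(2) by eventually_elim (simp add: algebra_simps)
    then show ?case using w u v by (intro bexI[of _ "\<lambda>Q. w Q + u Q * v Q"]) (auto intro!: R_intros)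
  qed
  obtain N a b where ab: "\<forall>i<N::nat. a i \<in> \<mm> \<and> b i \<in> \<mm>" "\<forall>\<^sub>F Q in F. f Q = (\<Sum>i<N. a i Q * b i Q)"
    using assms unfolding \<mm>2_def by blast
  from sq[OF ab(1)] obtain w where "w \<in> R" "\<forall>\<^sub>F Q in F. (\<Sum>i<N. a i Q * b i Q) = t Q * (t Q * w Q)" by blast
  with ab(2) show ?thesis by (intro bexI[of _ w]) (auto elim: eventually_elim2)
qed

text \<open>Cancelling powers of \<open>t\<close> in the domain gives quotients \<open>h i\<close>
  of \<open>g\<close> by \<open>t^i\<close> with \<open>h i = t h (i + 1)\<close>. By the chain
  condition some \<open>h (i + 1)\<close> equals \<open>u h i\<close>, so it is annihilated by the
  unit \<open>1 - u t\<close>.\<close>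

lemma krull_intersection:
  assumes g: "\<And>i. \<exists>u\<in>R. \<forall>\<^sub>F Q in F. g Q = t Q ^ i * u Q"
  shows "\<forall>\<^sub>F Q in F. g Q = 0"
proof -
  obtain h where h: "\<And>i. h i \<in> R" "\<And>i. \<forall>\<^sub>F Q in F. g Q = t Q ^ i * h i Q"
    using g by metis
  have step: "\<forall>\<^sub>F Q in F. h i Q = t Q * h (Suc i) Q" for i
  proof -
    have "\<forall>\<^sub>F Q in F. t Q ^ i * (h i Q - t Q * h (Suc i) Q) = 0"
      using h(2)[of i] h(2)[of "Suc i"]
    proof eventually_elim
      case (elim Q)
      then have "t Q ^ i * h i Q = t Q ^ i * (t Q * h (Suc i) Q)" by (simp only: power_Suc2 mult.assoc)
      then show ?case by (simp only: right_diff_distrib diff_self)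
    qed
    then have "(\<forall>\<^sub>F Q in F. t Q ^ i = 0) \<or> (\<forall>\<^sub>F Q in F. h i Q - t Q * h (Suc i) Q = 0)"
      using tR h(1) by (intro dom R_intros) auto
    moreover have "\<not> (\<forall>\<^sub>F Q in F. t Q ^ i = 0)"
    proof
      assume "\<forall>\<^sub>F Q in F. t Q ^ i = 0"
      then have "\<forall>\<^sub>F Q in F. t Q = 0" by eventually_elim (simp add: power_eq_0_iff)
      then show False using t_nonzero by blast
    qed
    ultimately show ?thesis by simp
  qed
  obtain i u where u: "u \<in> R" "\<forall>\<^sub>F Q in F. h (Suc i) Q = u Q * h i Q"
    using acc[of h] h(1) step tR by blast
  have "\<forall>\<^sub>F Q in F. 1 - u Q * t Q \<noteq> 0"
    using u(1) tR tP by (intro ev_nonzero R_intros) auto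
  with u(2) step[of i] h(2)[of "Suc i"] show ?thesis
  proof eventually_elim
    case (elim Q)
    have "(1 - u Q * t Q) * h (Suc i) Q = 0" using elim(1,2) by (simp add: algebra_simps)
    then show ?case using elim(3,4) by simp
  qed
qed

text \<open>With \<open>D f = f \<circ> s - f\<close>: if \<open>D\<close> maps \<open>R\<close> into \<open>t\<^sup>i R\<close>, then \<open>D f\<close> is
  \<open>s\<close>-invariant modulo \<open>t\<^sup>i\<^sup>+\<^sup>1\<close>, so \<open>0 = f \<circ> s\<^sup>e - f \<equiv> e D f\<close>.\<close>

lemma trivial_on_cotangent_imp_trivial:
  assumes sR: "\<And>f. f \<in> R \<Longrightarrow> (\<lambda>Q. f (s Q)) \<in> R"
    and sF: "\<And>\<phi>. eventually \<phi> F \<Longrightarrow> \<forall>\<^sub>F Q in F. \<phi> (s Q)"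
    and sP: "s P = P"
    and se: "\<forall>\<^sub>F Q in F. (s ^^ e) Q = Q" and e: "(of_nat e :: 'k) \<noteq> 0"
    and triv: "(\<lambda>Q. t (s Q) - t Q) \<in> \<mm>2"
    and f: "f \<in> R"
  shows "\<forall>\<^sub>F Q in F. f (s Q) = f Q"
proof -
  obtain w where w: "w \<in> R" "\<forall>\<^sub>F Q in F. t (s Q) - t Q = t Q * (t Q * w Q)"
    using \<mm>2D[OF triv] by blast
  have ts: "\<forall>\<^sub>F Q in F. t (s Q) = t Q * (1 + t Q * w Q)"
    using w(2) by eventually_elim (simp add: algebra_simps)
  have sRj: "(\<lambda>Q. f ((s ^^ j) Q)) \<in> R" if "f \<in> R" for f j
    using that
  proof (induction j arbitrary: f)
    case (Suc j)
    show ?case using Suc.IH[OF sR[OF Suc.prems]] by simp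
  qed simp
  have sFj: "\<forall>\<^sub>F Q in F. \<phi> ((s ^^ j) Q)" if "eventually \<phi> F" for \<phi> j
    using that
  proof (induction j arbitrary: \<phi>)
    case (Suc j)
    show ?case using Suc.IH[OF sF[OF Suc.prems]] by simp
  qed simp
  have main: "\<exists>u\<in>R. \<forall>\<^sub>F Q in F. f (s Q) - f Q = t Q ^ i * u Q" if "f \<in> R" for f i
    using that
  proof (induction i arbitrary: f)
    case 0
    then show ?case by (intro bexI[of _ "\<lambda>Q. f (s Q) - f Q"] R_intros sR) auto
  next
    case (Suc i)
    let ?g = "\<lambda>Q. f (s Q) - f Q"
    obtain u where u: "u \<in> R" "\<forall>\<^sub>F Q in F. ?g Q = t Q ^ i * u Q" using Suc by blast
    \<comment> \<open>Since \<open>t (s Q) = t Q * (1 + t Q * w Q)\<close>, this is the coefficient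
      of \<open>t^i\<close> in the difference of \<open>?g (s Q)\<close> and \<open>?g Q\<close>. It
      vanishes at \<open>P\<close> and is therefore another multiple of \<open>t\<close>.\<close>
    let ?b = "\<lambda>Q. (1 + t Q * w Q) ^ i * u (s Q) - u Q"
    have "?b \<in> R" using u(1) w(1) tR by (intro R_intros sR)
    moreover have "?b P = 0" using tP sP by simp
    ultimately obtain v where v: "v \<in> R" "\<forall>\<^sub>F Q in F. ?b Q = t Q * v Q" using principal by blast
    have g1: "\<forall>\<^sub>F Q in F. ?g (s Q) = ?g Q + t Q ^ Suc i * v Q"
      using u(2) sF[OF u(2)] ts v(2)
    proof eventually_elim
      case (elim Q)
      have "?g (s Q) = t Q ^ i * ((1 + t Q * w Q) ^ i * u (s Q))"
        using elim(2,3) by (simp add: power_mult_distrib)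
      also have "(1 + t Q * w Q) ^ i * u (s Q) = u Q + t Q * v Q" using elim(4) by (simp add: algebra_simps)
      finally show ?case using elim(1) by (simp add: algebra_simps)
    qed
    have gj: "\<exists>v\<in>R. \<forall>\<^sub>F Q in F. ?g ((s ^^ j) Q) = ?g Q + t Q ^ Suc i * v Q" for j
    proof (induction j)
      case 0
      then show ?case using const[of 0] by (intro bexI[of _ "\<lambda>_. 0"]) auto
    next
      case (Suc j)
      then obtain v' where v': "v' \<in> R" "\<forall>\<^sub>F Q in F. ?g ((s ^^ j) Q) = ?g Q + t Q ^ Suc i * v' Q" by blast
      have "\<forall>\<^sub>F Q in F. ?g ((s ^^ Suc j) Q) = ?g Q + t Q ^ Suc i * (v Q + (1 + t Q * w Q) ^ Suc i * v' (s Q))"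
        using sF[OF v'(2)] g1 ts
      proof eventually_elim
        case (elim Q)
        have "?g ((s ^^ Suc j) Q) = ?g (s Q) + t (s Q) ^ Suc i * v' (s Q)"
          using elim(1) by (simp add: funpow_swap1)
        also have "\<dots> = ?g Q + t Q ^ Suc i * v Q + (t Q ^ Suc i * (1 + t Q * w Q) ^ Suc i) * v' (s Q)"
          unfolding elim(2) unfolding elim(3) power_mult_distrib ..
        finally show ?case by (simp only: distrib_left mult.assoc add.assoc)
      qed
      then show ?case using v(1) v'(1) w(1) tR
        by (intro bexI[of _ "\<lambda>Q. v Q + (1 + t Q * w Q) ^ Suc i * v' (s Q)"] R_intros sR) auto
    qed
    then have "\<forall>j. \<exists>v. v \<in> R \<and> (\<forall>\<^sub>F Q in F. ?g ((s ^^ j) Q) = ?g Q + t Q ^ Suc i * v Q)"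
      unfolding Bex_def by (rule allI)
    from choice[OF this] obtain V where
      V: "\<forall>j. V j \<in> R \<and> (\<forall>\<^sub>F Q in F. ?g ((s ^^ j) Q) = ?g Q + t Q ^ Suc i * V j Q)" ..
    have "\<forall>\<^sub>F Q in F. \<forall>j\<in>{..<e}. ?g ((s ^^ j) Q) = ?g Q + t Q ^ Suc i * V j Q"
      by (intro eventually_ball_finite finite_lessThan ballI conjunct2[OF spec[OF V]])
    with se have "\<forall>\<^sub>F Q in F. ?g Q = t Q ^ Suc i * (- (\<Sum>j<e. V j Q) / of_nat e)"
    proof eventually_elim
      case (elim Q)
      have "(\<Sum>j<e. ?g ((s ^^ j) Q)) = (\<Sum>j<e. f ((s ^^ Suc j) Q) - f ((s ^^ j) Q))" by simp
      also have "\<dots> = f ((s ^^ e) Q) - f ((s ^^ 0) Q)" by (rule sum_lessThan_telescope)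
      also have "\<dots> = 0" using elim(1) by simp
      finally have "0 = (\<Sum>j<e. ?g Q + t Q ^ Suc i * V j Q)" using elim(2) by simp
      also have "\<dots> = of_nat e * ?g Q + t Q ^ Suc i * (\<Sum>j<e. V j Q)"
        by (simp add: sum.distrib sum_distrib_left)
      finally have "of_nat e * ?g Q = - (t Q ^ Suc i * (\<Sum>j<e. V j Q))" by (simp only: eq_neg_iff_add_eq_0)
      then show ?case using e by (simp add: field_simps)
    qed
    moreover have "(\<lambda>Q. - (\<Sum>j<e. V j Q) / of_nat e) \<in> R"
    proof -
      have "(\<lambda>Q. - (\<Sum>j<e. V j Q) * (1 / of_nat e)) \<in> R" by (intro R_intros conjunct1[OF spec[OF V]])
      then show ?thesis by simp
    qed
    ultimately show ?case by (rule bexI[where x = "\<lambda>Q. - (\<Sum>j<e. V j Q) / of_nat e"])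
  qed
  have "\<forall>\<^sub>F Q in F. f (s Q) - f Q = 0"
    by (rule krull_intersection) (rule main[OF f])
  then show ?thesis by simp
qed

end

section \<open>The scalar by which an automorphism acts on the cotangent space\<close>

context dvr_germs
begin

lemma \<mm>2I:
  assumes "w \<in> R" "\<forall>\<^sub>F Q in F. f Q = t Q * (t Q * w Q)"
  shows "f \<in> \<mm>2"
proof -
  have "t \<in> \<mm>" "(\<lambda>Q. t Q * w Q) \<in> \<mm>"
    using t mult[OF tR assms(1)] tP by (simp_all add: \<mm>_def)
  then show ?thesis unfolding \<mm>2_def using assms(2)
    by (intro CollectI exI[of _ 1] exI[of _ "\<lambda>_. t"] exI[of _ "\<lambda>_ Q. t Q * w Q"]) simp
qed

lemma \<mm>2_lincomb:
  assumes "f \<in> \<mm>2" "g \<in> \<mm>2" "\<forall>\<^sub>F Q in F. h Q = a * f Q + b * g Q"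
  shows "h \<in> \<mm>2"
proof -
  obtain u where u: "u \<in> R" "\<forall>\<^sub>F Q in F. f Q = t Q * (t Q * u Q)" using \<mm>2D[OF assms(1)] by blast
  obtain v where v: "v \<in> R" "\<forall>\<^sub>F Q in F. g Q = t Q * (t Q * v Q)" using \<mm>2D[OF assms(2)] by blast
  show ?thesis
  proof (rule \<mm>2I[of "\<lambda>Q. a * u Q + b * v Q"])
    show "(\<lambda>Q. a * u Q + b * v Q) \<in> R" by (intro R_intros u(1) v(1))
    show "\<forall>\<^sub>F Q in F. h Q = t Q * (t Q * (a * u Q + b * v Q))"
      using u(2) v(2) assms(3) by eventually_elim (simp add: algebra_simps)
  qed
qed

lemma \<mm>2_pullback:
  assumes sR: "\<And>f. f \<in> R \<Longrightarrow> (\<lambda>Q. f (s Q)) \<in> R"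
    and sF: "\<And>\<phi>. eventually \<phi> F \<Longrightarrow> \<forall>\<^sub>F Q in F. \<phi> (s Q)"
    and sP: "s P = P" and f: "f \<in> \<mm>2"
  shows "(\<lambda>Q. f (s Q)) \<in> \<mm>2"
proof -
  obtain N a b where ab: "\<forall>i<N::nat. a i \<in> \<mm> \<and> b i \<in> \<mm>" "\<forall>\<^sub>F Q in F. f Q = (\<Sum>i<N. a i Q * b i Q)"
    using f unfolding \<mm>2_def mem_Collect_eq by (elim exE conjE)
  have "\<forall>i<N. (\<lambda>Q. a i (s Q)) \<in> \<mm> \<and> (\<lambda>Q. b i (s Q)) \<in> \<mm>"
    using ab(1) sR sP by (simp add: \<mm>_def)
  then show ?thesis unfolding \<mm>2_def using sF[OF ab(2)]
    by (intro CollectI exI[of _ N] exI[of _ "\<lambda>i Q. a i (s Q)"] exI[of _ "\<lambda>i Q. b i (s Q)"]) simp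
qed

text \<open>The scalar is read off from \<open>t\<close>. It serves every other \<open>f\<close>
  because \<open>f\<close> is congruent to a multiple of \<open>t\<close> and pullback preserves
  \<open>\<mm>2\<close>.\<close>

lemma cotangent_scalar:
  assumes sR: "\<And>f. f \<in> R \<Longrightarrow> (\<lambda>Q. f (s Q)) \<in> R"
    and sF: "\<And>\<phi>. eventually \<phi> F \<Longrightarrow> \<forall>\<^sub>F Q in F. \<phi> (s Q)"
    and sP: "s P = P"
  obtains c where "\<And>f. f \<in> \<mm> \<Longrightarrow> (\<lambda>Q. f (s Q) - c * f Q) \<in> \<mm>2"
proof -
  have "(\<lambda>Q. t (s Q)) \<in> \<mm>" using sR[OF tR] sP tP by (simp add: \<mm>_def)
  then obtain c where c: "(\<lambda>Q. t (s Q) - c * t Q) \<in> \<mm>2" using cotangent by blast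
  show ?thesis
  proof (rule that[of c])
    fix f assume "f \<in> \<mm>"
    then obtain a where a: "(\<lambda>Q. f Q - a * t Q) \<in> \<mm>2" using cotangent by blast
    have "(\<lambda>Q. (f (s Q) - a * t (s Q)) - c * (f Q - a * t Q)) \<in> \<mm>2"
      by (rule \<mm>2_lincomb[OF \<mm>2_pullback[of s, OF sR sF sP a] a, of _ 1 "- c"]) simp_all
    from this c show "(\<lambda>Q. f (s Q) - c * f Q) \<in> \<mm>2"
      by (rule \<mm>2_lincomb[of _ _ _ 1 a]) (simp add: algebra_simps)
  qed
qed

lemma cotangent_scalar_unique:
  assumes "\<And>f. f \<in> \<mm> \<Longrightarrow> (\<lambda>Q. f (s Q) - c * f Q) \<in> \<mm>2"
    and "\<And>f. f \<in> \<mm> \<Longrightarrow> (\<lambda>Q. f (s Q) - d * f Q) \<in> \<mm>2"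
  shows "c = d"
proof -
  have "(\<lambda>_. 0) \<in> \<mm>" using const by (simp add: \<mm>_def)
  from cotangent[OF this] have uniq: "\<And>a b. (\<lambda>Q. 0 - a * t Q) \<in> \<mm>2 \<Longrightarrow> (\<lambda>Q. 0 - b * t Q) \<in> \<mm>2 \<Longrightarrow> a = b" by blast
  have "(\<lambda>Q. 0 - (c - d) * t Q) \<in> \<mm>2"
    by (rule \<mm>2_lincomb[OF assms(1)[OF t] assms(2)[OF t], of _ 1 "- 1"]) (simp add: algebra_simps)
  moreover have "(\<lambda>Q. 0 - 0 * t Q) \<in> \<mm>2"
    by (rule \<mm>2_lincomb[OF assms(1)[OF t] assms(2)[OF t], of _ 0 0]) simp
  ultimately have "c - d = 0" by (rule uniq)
  then show ?thesis by simp
qed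

lemma cotangent_scalar_comp:
  assumes s: "\<And>f. f \<in> \<mm> \<Longrightarrow> (\<lambda>Q. f (s Q) - c * f Q) \<in> \<mm>2"
    and r: "\<And>f. f \<in> \<mm> \<Longrightarrow> (\<lambda>Q. f (r Q) - d * f Q) \<in> \<mm>2"
    and rR: "\<And>f. f \<in> R \<Longrightarrow> (\<lambda>Q. f (r Q)) \<in> R" and rP: "r P = P"
    and q: "\<forall>\<^sub>F Q in F. q Q = r (s Q)" and f: "f \<in> \<mm>"
  shows "(\<lambda>Q. f (q Q) - c * d * f Q) \<in> \<mm>2"
proof -
  have "(\<lambda>Q. f (r Q)) \<in> \<mm>" using f rR rP by (simp add: \<mm>_def)
  from s[OF this] r[OF f] show ?thesis
    by (rule \<mm>2_lincomb[of _ _ _ 1 c]) (use q in eventually_elim, simp add: algebra_simps)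
qed

end

section \<open>Points and regular functions of a smooth curve\<close>

text \<open>An arbitrary representative of the point. Values of a form depend on it, quotients of
  two forms of the same degree do not.\<close>

definition coords :: "'k::field point \<Rightarrow> 'k vec" where
  "coords Q = (SOME v. v \<in> Q)"

definition ev :: "'k::field mpoly \<Rightarrow> 'k point \<Rightarrow> 'k" where
  "ev f Q = mp_eval f (coords Q)"

definition xform :: "nat \<Rightarrow> 'k::field mpoly" where
  "xform i = Poly_Mapping.single (Poly_Mapping.single i 1) 1"

lemma ev_xform [simp]: "ev (xform i) Q = coords Q $ i"
  by (simp add: ev_def xform_def mp_eval_single monom_eval_def)

lemma ev_add [simp]: "ev (f + g) Q = ev f Q + ev g Q"
  by (simp add: ev_def mp_eval_add)

lemma ev_mult [simp]: "ev (f * g) Q = ev f Q * ev g Q"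
  by (simp add: ev_def mp_eval_mult)

lemma ev_zero [simp]: "ev 0 Q = 0"
  by (simp add: ev_def)

lemma ev_one [simp]: "ev 1 Q = 1"
  by (simp add: ev_def mp_eval_one)

lemma ev_diff [simp]: "ev (f - g) Q = ev f Q - ev g Q"
  using ev_add[of "f - g" g Q] by (simp add: algebra_simps)

lemma is_form_xform: "i \<le> n \<Longrightarrow> is_form n 1 (xform i :: 'k::field mpoly)"
  by (auto simp: is_form_def xform_def)

lemma is_form_one: "is_form n 0 (1 :: 'k::field mpoly)"
  by (auto simp: is_form_def)

lemma is_form_const: "is_form n 0 (Poly_Mapping.single 0 (c :: 'k::field))"
  by (auto simp: is_form_def)

lemma ev_const [simp]: "ev (Poly_Mapping.single 0 c) Q = c"
  by (simp add: ev_def mp_eval_single monom_eval_def)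

lemma is_form_scaled_xform: "i \<le> n \<Longrightarrow> is_form n 1 (Poly_Mapping.single 0 (c :: 'k::field) * xform i)"
  using is_form_mult[OF is_form_const[of n c] is_form_xform[of i n]] by simp

lemma is_form_power: "is_form n d (f :: 'k::field mpoly) \<Longrightarrow> is_form n (k * d) (f ^ k)"
  by (induction k) (auto intro: is_form_one is_form_mult)

lemma ev_power [simp]: "ev (f ^ k) Q = ev f Q ^ k"
  by (induction k) simp_all

lemma coords_in:
  assumes "Q \<in> proj_space n"
  shows "coords Q \<in> Q" "coords Q \<in> carrier_vec (Suc n)" "coords Q \<noteq> 0\<^sub>v (Suc n)"
    and "v \<in> Q \<longleftrightarrow> (\<exists>c. c \<noteq> 0 \<and> v = c \<cdot>\<^sub>v coords Q)"
proof -
  obtain u where u: "u \<in> carrier_vec (Suc n)" "u \<noteq> 0\<^sub>v (Suc n)" "Q = {c \<cdot>\<^sub>v u | c. c \<noteq> 0}"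
    using assms by (auto simp: proj_space_def)
  show Q: "coords Q \<in> Q" unfolding coords_def some_in_eq by (rule point_nonempty[OF assms])
  then obtain c where c: "coords Q = c \<cdot>\<^sub>v u" "c \<noteq> 0" using u(3) by blast
  show "coords Q \<in> carrier_vec (Suc n)" using c u(1) by simp
  have inv: "u = inverse c \<cdot>\<^sub>v coords Q" using c u(1) by (simp add: smult_smult_assoc)
  show "coords Q \<noteq> 0\<^sub>v (Suc n)"
  proof
    assume z: "coords Q = 0\<^sub>v (Suc n)"
    have "u = inverse c \<cdot>\<^sub>v 0\<^sub>v (Suc n)" by (rule inv[unfolded z])
    also have "\<dots> = 0\<^sub>v (Suc n)" by (intro eq_vecI) auto
    finally show False using u(2) by contradiction
  qed
  show "v \<in> Q \<longleftrightarrow> (\<exists>c. c \<noteq> 0 \<and> v = c \<cdot>\<^sub>v coords Q)"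
  proof
    assume "v \<in> Q"
    then obtain b where b: "v = b \<cdot>\<^sub>v u" "b \<noteq> 0" using u(3) by blast
    have "v = b \<cdot>\<^sub>v (inverse c \<cdot>\<^sub>v coords Q)" unfolding inv[symmetric] by (rule b(1))
    then have "v = (b * inverse c) \<cdot>\<^sub>v coords Q" using inv by (simp add: smult_smult_assoc)
    then show "\<exists>c. c \<noteq> 0 \<and> v = c \<cdot>\<^sub>v coords Q" using \<open>b \<noteq> 0\<close> c(2) by (intro exI[of _ "b * inverse c"]) simp
  next
    assume "\<exists>c. c \<noteq> 0 \<and> v = c \<cdot>\<^sub>v coords Q"
    then obtain b where "v = b \<cdot>\<^sub>v coords Q" "b \<noteq> 0" by blast
    then have "v = (b * c) \<cdot>\<^sub>v u" "b * c \<noteq> 0" using c by (simp_all add: smult_smult_assoc)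
    then show "v \<in> Q" using u(3) by blast
  qed
qed

lemma proj_point_eqI:
  assumes "P \<in> proj_space n" "Q \<in> proj_space n" "coords P = c \<cdot>\<^sub>v coords Q" "c \<noteq> 0"
  shows "P = Q"
proof (rule Set.set_eqI)
  fix v
  have "v \<in> P \<longleftrightarrow> (\<exists>b. b \<noteq> 0 \<and> v = (b * c) \<cdot>\<^sub>v coords Q)"
    using coords_in(4)[OF assms(1)] assms(3) by (simp add: smult_smult_assoc)
  also have "\<dots> \<longleftrightarrow> (\<exists>b. b \<noteq> 0 \<and> v = b \<cdot>\<^sub>v coords Q)"
  proof
    assume "\<exists>b. b \<noteq> 0 \<and> v = b \<cdot>\<^sub>v coords Q"
    then obtain b where "b \<noteq> 0" "v = b \<cdot>\<^sub>v coords Q" by blast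
    then show "\<exists>b. b \<noteq> 0 \<and> v = (b * c) \<cdot>\<^sub>v coords Q" using assms(4) by (intro exI[of _ "b / c"]) simp
  next
    assume "\<exists>b. b \<noteq> 0 \<and> v = (b * c) \<cdot>\<^sub>v coords Q"
    then show "\<exists>b. b \<noteq> 0 \<and> v = b \<cdot>\<^sub>v coords Q" using assms(4) by (metis mult_eq_0_iff)
  qed
  also have "\<dots> \<longleftrightarrow> v \<in> Q" using coords_in(4)[OF assms(2)] by simp
  finally show "v \<in> P \<longleftrightarrow> v \<in> Q" .
qed

text \<open>The same factor \<open>c\<close> serves all forms of degree \<open>d\<close>, which is
  why it cancels in their quotients.\<close>

lemma mp_eval_ev:
  assumes "Q \<in> proj_space n" "v \<in> Q" "is_form n d a"
  shows "\<exists>c. c \<noteq> 0 \<and> (\<forall>b. is_form n d b \<longrightarrow> mp_eval b v = c * ev b Q)"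
proof -
  obtain c where c: "c \<noteq> 0" "v = c \<cdot>\<^sub>v coords Q" using assms(2) coords_in(4)[OF assms(1)] by blast
  have "mp_eval b v = c ^ d * ev b Q" if "is_form n d b" for b
    unfolding c(2) ev_def by (rule mp_eval_smult[OF that coords_in(2)[OF assms(1)]])
  then show ?thesis using c(1) by (intro exI[of _ "c ^ d"]) simp
qed

lemma zero_locus_single:
  assumes "is_form n d a"
  shows "zero_locus n {a} = {Q \<in> proj_space n. ev a Q = 0}"
proof -
  have "(\<forall>v\<in>Q. mp_eval a v = 0) \<longleftrightarrow> ev a Q = 0" if Q: "Q \<in> proj_space n" for Q
  proof
    assume "\<forall>v\<in>Q. mp_eval a v = 0"
    then show "ev a Q = 0" using coords_in(1)[OF Q] by (simp add: ev_def)
  next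
    assume "ev a Q = 0"
    then show "\<forall>v\<in>Q. mp_eval a v = 0" using mp_eval_ev[OF Q _ assms] assms by force
  qed
  then show ?thesis by (auto simp: zero_locus_def)
qed

text \<open>A point is cut out by the linear equations saying that the variables are proportional to
  its coordinates, that is, by two-by-two minors.\<close>

lemma closed_point:
  assumes P: "P \<in> proj_space n"
  shows "closedin (zariski n) {P}"
proof -
  let ?S = "{Poly_Mapping.single 0 (coords P $ j) * xform i - Poly_Mapping.single 0 (coords P $ i) * xform j | i j. i \<le> n \<and> j \<le> n}"
  have form: "is_form n 1 f" if f: "f \<in> ?S" for f
  proof -
    obtain i j where "i \<le> n" "j \<le> n" "f = Poly_Mapping.single 0 (coords P $ j) * xform i - Poly_Mapping.single 0 (coords P $ i) * xform j"
      using f by blast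
    then show ?thesis by (simp add: is_form_diff is_form_scaled_xform del: One_nat_def)
  qed
  have "{P} = zero_locus n ?S"
  proof (intro equalityI subsetI)
    fix Q assume "Q \<in> {P}"
    then have Q: "Q = P" by simp
    have "mp_eval f v = 0" if f: "f \<in> ?S" and v: "v \<in> P" for f v
    proof -
      have "ev f P = 0" using f by (auto simp: mult.commute)
      then show ?thesis using mp_eval_ev[OF P v form[OF f]] form[OF f] by force
    qed
    then show "Q \<in> zero_locus n ?S" using P Q by (auto simp: zero_locus_def)
  next
    fix Q assume Q: "Q \<in> zero_locus n ?S"
    then have Qp: "Q \<in> proj_space n" by (simp add: zero_locus_def)
    note cP = coords_in[OF P] and cQ = coords_in[OF Qp]
    have rel: "coords P $ j * coords Q $ i = coords P $ i * coords Q $ j" if "i \<le> n" "j \<le> n" for i j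
    proof -
      have "Poly_Mapping.single 0 (coords P $ j) * xform i - Poly_Mapping.single 0 (coords P $ i) * xform j \<in> ?S" using that by blast
      then have "ev (Poly_Mapping.single 0 (coords P $ j) * xform i - Poly_Mapping.single 0 (coords P $ i) * xform j) Q = 0"
        using Q cQ(1) unfolding zero_locus_def ev_def by blast
      then show ?thesis by simp
    qed
    obtain j where j: "j \<le> n" "coords Q $ j \<noteq> 0"
    proof -
      have "\<exists>j<Suc n. coords Q $ j \<noteq> 0"
      proof (rule ccontr)
        assume "\<not> ?thesis"
        then have "coords Q = 0\<^sub>v (Suc n)" using cQ(2) by (intro eq_vecI) auto
        then show False using cQ(3) by blast
      qed
      then show ?thesis using that by (auto simp: less_Suc_eq_le)
    qed
    have eq: "coords P = (coords P $ j / coords Q $ j) \<cdot>\<^sub>v coords Q"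
      using cP(2) cQ(2) rel[OF _ j(1)] j(2) by (intro eq_vecI) (auto simp: field_simps less_Suc_eq_le)
    have "coords P $ j / coords Q $ j \<noteq> 0"
    proof
      assume "coords P $ j / coords Q $ j = 0"
      then have "coords P = 0\<^sub>v (Suc n)" using eq cQ(2) by (intro eq_vecI) (auto simp: index_smult_vec(1))
      then show False using cP(3) by blast
    qed
    from proj_point_eqI[OF P Qp eq this] show "Q \<in> {P}" by simp
  qed
  then show ?thesis unfolding closedin_zariski using form by blast
qed

text \<open>Vanishing forms turn a descending chain of closed sets into an ascending chain of
  homogeneous ideals, and a closed set can be recovered from the forms that vanish on it.\<close>

lemma zariski_dcc:
  fixes Z :: "nat \<Rightarrow> 'k::field point set"
  assumes closed: "\<And>i. closedin (zariski n) (Z i)" and dec: "\<And>i. Z (Suc i) \<subseteq> Z i"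
  shows "\<exists>i. Z (Suc i) = Z i"
proof -
  define I where "I i = {f. (\<exists>d. is_form n d f) \<and> (\<forall>P\<in>Z i. ev f P = 0)}" for i
  have Zp: "Z i \<subseteq> proj_space n" for i using closedin_subset[OF closed[of i]] by (simp add: topspace_zariski)
  have "\<exists>i. I (Suc i) = I i"
  proof (rule homogeneous_chain_stabilises[where n = n])
    fix i f g m c d e
    assume "f \<in> I i" "g \<in> I i" "is_form n d f" "is_form n e g" "Poly_Mapping.keys m \<subseteq> {..n}" "d = mdeg m + e"
    then show "f - Poly_Mapping.single m c * g \<in> I i"
      by (auto simp: I_def intro!: is_form_diff is_form_mult is_form_single exI[of _ d])
  qed (use dec in \<open>auto simp: I_def intro: exI[of _ 0]\<close>)
  then obtain i where i: "I (Suc i) = I i" by blast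
  obtain S where S: "\<forall>f\<in>S. \<exists>d. is_form n d f" "Z (Suc i) = zero_locus n S" using closed[of "Suc i"] by (auto simp: closedin_zariski)
  have "Z i \<subseteq> Z (Suc i)"
  proof
    fix P assume P: "P \<in> Z i"
    then have Pp: "P \<in> proj_space n" using Zp by blast
    have "mp_eval f v = 0" if f: "f \<in> S" and v: "v \<in> P" for f v
    proof -
      obtain d where d: "is_form n d f" using S(1) f by blast
      have "ev f Q = 0" if "Q \<in> Z (Suc i)" for Q
        using that S(2) f coords_in(1)[of Q n] by (auto simp: zero_locus_def ev_def)
      then have "f \<in> I i" using d i by (auto simp: I_def)
      then have "ev f P = 0" using P by (simp add: I_def)
      then show ?thesis using mp_eval_ev[OF Pp v d] d by force
    qed
    then show "P \<in> Z (Suc i)" unfolding S(2) using Pp by (simp add: zero_locus_def)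
  qed
  then show ?thesis using dec by blast
qed

section \<open>Regular functions as germs\<close>

locale curve =
  fixes n :: nat and C :: "'k::alg_closed_field point set"
  assumes smooth: "smooth_projective_curve n C"
begin

abbreviation "T \<equiv> var_top n C"
abbreviation "nb \<equiv> nhdsin T"

lemma irred: "irreducible_closed (zariski n) C"
  and dim1: "has_krull_dim T 1"
  and cot: "\<forall>P\<in>C. has_cotangent_dim n C P 1"
  using smooth unfolding smooth_projective_curve_def by - (elim conjE, assumption)+

lemma C_closed: "closedin (zariski n) C"
  using irred by (simp add: irreducible_closed_def)

lemma C_proj: "C \<subseteq> proj_space n"
  using closedin_subset[OF C_closed] by (simp add: topspace_zariski)

lemma topspace_T [simp]: "topspace T = C"
  using C_proj by (auto simp: var_top_def topspace_zariski)

lemma closedin_T: "closedin T A \<longleftrightarrow> closedin (zariski n) A \<and> A \<subseteq> C"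
  unfolding var_top_def by (rule closedin_closed_subtopology[OF C_closed])

lemma opens_meet:
  assumes "openin T U" "openin T V" "U \<noteq> {}" "V \<noteq> {}"
  shows "U \<inter> V \<noteq> {}"
proof
  assume UV: "U \<inter> V = {}"
  have "closedin T (C - U)" "closedin T (C - V)"
    using assms(1,2) unfolding openin_closedin_eq by simp_all
  then have "closedin (zariski n) (C - U)" "closedin (zariski n) (C - V)" by (simp_all add: closedin_T)
  moreover have "C \<subseteq> (C - U) \<union> (C - V)" using UV by blast
  moreover have "\<forall>A B. closedin (zariski n) A \<and> closedin (zariski n) B \<and> C \<subseteq> A \<union> B \<longrightarrow> C \<subseteq> A \<or> C \<subseteq> B"
    using irred unfolding irreducible_closed_def by (elim conjE)
  ultimately have "C \<subseteq> C - U \<or> C \<subseteq> C - V" by metis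
  moreover have "U \<subseteq> C" "V \<subseteq> C" using openin_subset[OF assms(1)] openin_subset[OF assms(2)] by simp_all
  ultimately show False using assms(3,4) by blast
qed

lemma open_nonzero:
  assumes "is_form n d a"
  shows "openin T {Q \<in> C. ev a Q \<noteq> 0}"
proof -
  have "openin (zariski n) (proj_space n - zero_locus n {a})"
    unfolding openin_zariski using assms by (intro exI[of _ "{a}"]) auto
  then have "openin T ((proj_space n - zero_locus n {a}) \<inter> C)"
    unfolding var_top_def by (rule openin_subtopology_Int)
  also have "(proj_space n - zero_locus n {a}) \<inter> C = {Q \<in> C. ev a Q \<noteq> 0}"
    using C_proj by (auto simp: zero_locus_single[OF assms])
  finally show ?thesis .
qed

lemma eventually_nb: "P \<in> C \<Longrightarrow> eventually \<phi> (nb P) \<longleftrightarrow> (\<exists>U. openin T U \<and> P \<in> U \<and> (\<forall>Q\<in>U. \<phi> Q))"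
  by (simp add: eventually_nhdsin)

lemma ev_in_C:
  assumes P: "P \<in> C"
  shows "\<forall>\<^sub>F Q in nb P. Q \<in> C"
  unfolding eventually_nb[OF P] using openin_topspace[of T] P by (intro exI[of _ C]) simp

lemma ev_form_nonzero:
  assumes P: "P \<in> C" and "is_form n d a" "ev a P \<noteq> 0"
  shows "\<forall>\<^sub>F Q in nb P. ev a Q \<noteq> 0"
  unfolding eventually_nb[OF P] using open_nonzero[OF assms(2)] P assms(3)
  by (intro exI[of _ "{Q \<in> C. ev a Q \<noteq> 0}"]) simp

lemma nb_P:
  assumes P: "P \<in> C" and "eventually \<phi> (nb P)"
  shows "\<phi> P"
  using assms(2) unfolding eventually_nb[OF P] by blast

definition reg :: "'k point \<Rightarrow> ('k point \<Rightarrow> 'k) set" where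
  "reg P = {f. regular_at n C P f}"

text \<open>Regularity in terms of the chosen coordinates and the neighbourhood filter, so that
  local identities become statements about eventual truth. The choice is harmless since numerator
  and denominator have the same degree.\<close>

lemma reg_iff:
  assumes P: "P \<in> C"
  shows "f \<in> reg P \<longleftrightarrow> (\<exists>d a b. is_form n d a \<and> is_form n d b \<and> (\<forall>\<^sub>F Q in nb P. ev b Q \<noteq> 0 \<and> f Q = ev a Q / ev b Q))"
proof -
  have *: "(\<forall>v\<in>Q. mp_eval b v \<noteq> 0 \<and> f Q = mp_eval a v / mp_eval b v) \<longleftrightarrow> ev b Q \<noteq> 0 \<and> f Q = ev a Q / ev b Q"
    if "is_form n d a" "is_form n d b" "Q \<in> C" for a b d Q
  proof -
    have Q: "Q \<in> proj_space n" using that(3) C_proj by blast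
    note forms = that(1,2)
    show ?thesis
    proof
      assume "\<forall>v\<in>Q. mp_eval b v \<noteq> 0 \<and> f Q = mp_eval a v / mp_eval b v"
      then show "ev b Q \<noteq> 0 \<and> f Q = ev a Q / ev b Q" using coords_in(1)[OF Q] by (simp add: ev_def)
    next
      assume r: "ev b Q \<noteq> 0 \<and> f Q = ev a Q / ev b Q"
      show "\<forall>v\<in>Q. mp_eval b v \<noteq> 0 \<and> f Q = mp_eval a v / mp_eval b v"
      proof
        fix v assume "v \<in> Q"
        from mp_eval_ev[OF Q this forms(1)] obtain c where
          "c \<noteq> 0" "mp_eval a v = c * ev a Q" "mp_eval b v = c * ev b Q" using forms by blast
        then show "mp_eval b v \<noteq> 0 \<and> f Q = mp_eval a v / mp_eval b v" using r by simp
      qed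
    qed
  qed
  show ?thesis
  proof
    assume "f \<in> reg P"
    then obtain U d a b where U: "openin T U" "P \<in> U" "is_form n d a" "is_form n d b"
      "\<forall>Q\<in>U. \<forall>v\<in>Q. mp_eval b v \<noteq> 0 \<and> f Q = mp_eval a v / mp_eval b v"
      unfolding reg_def regular_at_def mem_Collect_eq by (elim exE conjE)
    have "U \<subseteq> C" using openin_subset[OF U(1)] by simp
    then have "\<forall>Q\<in>U. ev b Q \<noteq> 0 \<and> f Q = ev a Q / ev b Q" using *[OF U(3,4)] U(5) by (meson subsetD)
    then have "\<forall>\<^sub>F Q in nb P. ev b Q \<noteq> 0 \<and> f Q = ev a Q / ev b Q"
      unfolding eventually_nb[OF P] using U(1,2) by (intro exI[of _ U]) simp
    then show "\<exists>d a b. is_form n d a \<and> is_form n d b \<and> (\<forall>\<^sub>F Q in nb P. ev b Q \<noteq> 0 \<and> f Q = ev a Q / ev b Q)"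
      using U(3,4) by (intro exI[of _ d] exI[of _ a] exI[of _ b]) simp
  next
    assume "\<exists>d a b. is_form n d a \<and> is_form n d b \<and> (\<forall>\<^sub>F Q in nb P. ev b Q \<noteq> 0 \<and> f Q = ev a Q / ev b Q)"
    then obtain d a b U where U: "is_form n d a" "is_form n d b" "openin T U" "P \<in> U"
      "\<forall>Q\<in>U. ev b Q \<noteq> 0 \<and> f Q = ev a Q / ev b Q" unfolding eventually_nb[OF P] by (elim exE conjE)
    have "U \<subseteq> C" using openin_subset[OF U(3)] by simp
    then have "\<forall>Q\<in>U. \<forall>v\<in>Q. mp_eval b v \<noteq> 0 \<and> f Q = mp_eval a v / mp_eval b v" using *[OF U(1,2)] U(5) by (meson subsetD)
    then show "f \<in> reg P" using U(1-4) unfolding reg_def regular_at_def mem_Collect_eq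
      by (intro exI[of _ U] exI[of _ d] exI[of _ a] exI[of _ b]) simp
  qed
qed

lemma regE:
  assumes "P \<in> C" "f \<in> reg P"
  obtains d a b where "is_form n d a" "is_form n d b" "ev b P \<noteq> 0" "\<forall>\<^sub>F Q in nb P. ev b Q \<noteq> 0" "\<forall>\<^sub>F Q in nb P. f Q = ev a Q / ev b Q"
proof -
  obtain d a b where *: "is_form n d a" "is_form n d b" "\<forall>\<^sub>F Q in nb P. ev b Q \<noteq> 0 \<and> f Q = ev a Q / ev b Q"
    using assms(2) unfolding reg_iff[OF assms(1)] by (elim exE conjE)
  then have "\<forall>\<^sub>F Q in nb P. ev b Q \<noteq> 0" "\<forall>\<^sub>F Q in nb P. f Q = ev a Q / ev b Q"
    by (auto elim: eventually_mono)
  then show ?thesis using that[OF *(1,2)] conjunct1[OF nb_P[OF assms(1) *(3)]] by simp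
qed

lemma regI:
  assumes "P \<in> C" "is_form n d a" "is_form n d b" "ev b P \<noteq> 0" "\<forall>\<^sub>F Q in nb P. f Q = ev a Q / ev b Q"
  shows "f \<in> reg P"
  unfolding reg_iff[OF assms(1)] using assms(2,3,5) ev_form_nonzero[OF assms(1,3,4)]
  by (intro exI[of _ d] exI[of _ a] exI[of _ b]) (simp add: eventually_conj_iff)

lemma reg_const: "P \<in> C \<Longrightarrow> (\<lambda>_. c) \<in> reg P"
  by (rule regI[OF _ is_form_const[of n c] is_form_one]) auto

lemma reg_add:
  assumes P: "P \<in> C" and "f \<in> reg P" "g \<in> reg P"
  shows "(\<lambda>Q. f Q + g Q) \<in> reg P"
proof -
  obtain d a b where f: "is_form n d a" "is_form n d b" "ev b P \<noteq> 0" "\<forall>\<^sub>F Q in nb P. ev b Q \<noteq> 0" "\<forall>\<^sub>F Q in nb P. f Q = ev a Q / ev b Q"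
    using regE[OF P assms(2)] .
  obtain d' a' b' where g: "is_form n d' a'" "is_form n d' b'" "ev b' P \<noteq> 0" "\<forall>\<^sub>F Q in nb P. ev b' Q \<noteq> 0" "\<forall>\<^sub>F Q in nb P. g Q = ev a' Q / ev b' Q"
    using regE[OF P assms(3)] .
  have "\<forall>\<^sub>F Q in nb P. f Q + g Q = ev (a * b' + b * a') Q / ev (b * b') Q"
    using f(4,5) g(4,5) by eventually_elim (simp add: field_simps)
  then show ?thesis
    using f(1-3) g(1-3) by (intro regI[OF P, of "d + d'" "a * b' + b * a'" "b * b'"] is_form_add is_form_mult) auto
qed

lemma reg_mult:
  assumes P: "P \<in> C" and "f \<in> reg P" "g \<in> reg P"
  shows "(\<lambda>Q. f Q * g Q) \<in> reg P"
proof -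
  obtain d a b where f: "is_form n d a" "is_form n d b" "ev b P \<noteq> 0" "\<forall>\<^sub>F Q in nb P. ev b Q \<noteq> 0" "\<forall>\<^sub>F Q in nb P. f Q = ev a Q / ev b Q"
    using regE[OF P assms(2)] .
  obtain d' a' b' where g: "is_form n d' a'" "is_form n d' b'" "ev b' P \<noteq> 0" "\<forall>\<^sub>F Q in nb P. ev b' Q \<noteq> 0" "\<forall>\<^sub>F Q in nb P. g Q = ev a' Q / ev b' Q"
    using regE[OF P assms(3)] .
  have "\<forall>\<^sub>F Q in nb P. f Q * g Q = ev (a * a') Q / ev (b * b') Q"
    using f(5) g(5) by eventually_elim simp
  then show ?thesis
    using f(1-3) g(1-3) by (intro regI[OF P, of "d + d'" "a * a'" "b * b'"] is_form_mult) auto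
qed

lemma reg_inv:
  assumes P: "P \<in> C" and "f \<in> reg P" "f P \<noteq> 0"
  shows "(\<lambda>Q. inverse (f Q)) \<in> reg P"
proof -
  obtain d a b where f: "is_form n d a" "is_form n d b" "ev b P \<noteq> 0" "\<forall>\<^sub>F Q in nb P. ev b Q \<noteq> 0" "\<forall>\<^sub>F Q in nb P. f Q = ev a Q / ev b Q"
    using regE[OF P assms(2)] .
  have "ev a P \<noteq> 0" using nb_P[OF P f(5)] assms(3) by auto
  moreover have "\<forall>\<^sub>F Q in nb P. inverse (f Q) = ev b Q / ev a Q"
    using f(5) by eventually_elim simp
  ultimately show ?thesis using f(1,2) by (intro regI[OF P, of d b a])
qed

lemma reg_nonzero:
  assumes P: "P \<in> C" and "f \<in> reg P" "f P \<noteq> 0"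
  shows "\<forall>\<^sub>F Q in nb P. f Q \<noteq> 0"
proof -
  obtain d a b where f: "is_form n d a" "is_form n d b" "ev b P \<noteq> 0" "\<forall>\<^sub>F Q in nb P. ev b Q \<noteq> 0" "\<forall>\<^sub>F Q in nb P. f Q = ev a Q / ev b Q"
    using regE[OF P assms(2)] .
  have "ev a P \<noteq> 0" using nb_P[OF P f(5)] assms(3) by auto
  from ev_form_nonzero[OF P f(1) this] f(4,5) show ?thesis by eventually_elim simp
qed

text \<open>The loci near \<open>P\<close> where the two numerators do not vanish are open and
  disjoint, so by irreducibility of \<open>C\<close> one of them is empty.\<close>

lemma reg_dom:
  assumes P: "P \<in> C" and "f \<in> reg P" "g \<in> reg P" and z: "\<forall>\<^sub>F Q in nb P. f Q * g Q = 0"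
  shows "(\<forall>\<^sub>F Q in nb P. f Q = 0) \<or> (\<forall>\<^sub>F Q in nb P. g Q = 0)"
proof -
  obtain d a b where f: "is_form n d a" "is_form n d b" "ev b P \<noteq> 0" "\<forall>\<^sub>F Q in nb P. ev b Q \<noteq> 0" "\<forall>\<^sub>F Q in nb P. f Q = ev a Q / ev b Q"
    using regE[OF P assms(2)] .
  obtain d' a' b' where g: "is_form n d' a'" "is_form n d' b'" "ev b' P \<noteq> 0" "\<forall>\<^sub>F Q in nb P. ev b' Q \<noteq> 0" "\<forall>\<^sub>F Q in nb P. g Q = ev a' Q / ev b' Q"
    using regE[OF P assms(3)] .
  have "\<forall>\<^sub>F Q in nb P. ev a Q * ev a' Q = 0"
    using f(4,5) g(4,5) z by eventually_elim auto
  then obtain U where U: "openin T U" "P \<in> U" "\<forall>Q\<in>U. ev a Q * ev a' Q = 0" unfolding eventually_nb[OF P] by blast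
  have UC: "U \<subseteq> C" using openin_subset[OF U(1)] by simp
  let ?A = "U \<inter> {Q \<in> C. ev a Q \<noteq> 0}" and ?B = "U \<inter> {Q \<in> C. ev a' Q \<noteq> 0}"
  have "?A \<inter> ?B = {}" using U(3) by auto
  then have "?A = {} \<or> ?B = {}"
    using opens_meet[of ?A ?B] openin_Int[OF U(1) open_nonzero[OF f(1)]] openin_Int[OF U(1) open_nonzero[OF g(1)]] by blast
  then have "(\<forall>Q\<in>U. ev a Q = 0) \<or> (\<forall>Q\<in>U. ev a' Q = 0)" using UC by blast
  then have "(\<forall>\<^sub>F Q in nb P. ev a Q = 0) \<or> (\<forall>\<^sub>F Q in nb P. ev a' Q = 0)"
    using U(1,2) unfolding eventually_nb[OF P] by blast
  then show ?thesis
  proof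
    assume "\<forall>\<^sub>F Q in nb P. ev a Q = 0"
    with f(5) have "\<forall>\<^sub>F Q in nb P. f Q = 0" by eventually_elim simp
    then show ?thesis ..
  next
    assume "\<forall>\<^sub>F Q in nb P. ev a' Q = 0"
    with g(5) have "\<forall>\<^sub>F Q in nb P. g Q = 0" by eventually_elim simp
    then show ?thesis ..
  qed
qed

lemma nonzero_coord:
  assumes "P \<in> C"
  obtains j where "j \<le> n" "coords P $ j \<noteq> 0"
proof -
  have P: "P \<in> proj_space n" using assms C_proj by blast
  have "\<exists>j<Suc n. coords P $ j \<noteq> 0"
  proof (rule ccontr)
    assume "\<not> ?thesis"
    then have "coords P = 0\<^sub>v (Suc n)" using coords_in(2)[OF P] by (intro eq_vecI) auto
    then show False using coords_in(3)[OF P] by blast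
  qed
  then show ?thesis using that by (auto simp: less_Suc_eq_le)
qed

end

section \<open>Finiteness properties of the local ring\<close>

context curve
begin

lemma reg_uminus: "P \<in> C \<Longrightarrow> f \<in> reg P \<Longrightarrow> (\<lambda>Q. - f Q) \<in> reg P"
  using reg_mult[OF _ reg_const[of P "- 1"], of f] by simp

lemma reg_diff: "P \<in> C \<Longrightarrow> f \<in> reg P \<Longrightarrow> g \<in> reg P \<Longrightarrow> (\<lambda>Q. f Q - g Q) \<in> reg P"
  using reg_add[OF _ _ reg_uminus, of P f g] by simp

lemma ev_dehomogenise:
  assumes "is_form n d a"
  shows "ev a Q / coords Q $ j ^ d = (\<Sum>m\<in>Poly_Mapping.keys a. Poly_Mapping.lookup a m *
    (\<Prod>i\<in>Poly_Mapping.keys m. (coords Q $ i / coords Q $ j) ^ Poly_Mapping.lookup m i))"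
  unfolding ev_def mp_eval_def sum_divide_distrib
proof (intro sum.cong refl)
  fix m assume m: "m \<in> Poly_Mapping.keys a"
  have "coords Q $ j ^ d = (\<Prod>i\<in>Poly_Mapping.keys m. coords Q $ j ^ Poly_Mapping.lookup m i)"
    using assms m by (simp add: is_form_def flip: power_sum)
  then show "Poly_Mapping.lookup a m * monom_eval m (coords Q) / coords Q $ j ^ d = Poly_Mapping.lookup a m *
      (\<Prod>i\<in>Poly_Mapping.keys m. (coords Q $ i / coords Q $ j) ^ Poly_Mapping.lookup m i)"
    by (simp add: monom_eval_def power_divide prod_dividef)
qed

text \<open>The maximal ideal at \<open>P\<close> is generated by the affine coordinate functions minus their values at \<open>P\<close>,
  in the chart where the \<open>j\<close>-th coordinate does not vanish.\<close>

lemma reg_fin_gen: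
  assumes P: "P \<in> C"
  shows "\<exists>(K::nat) y. (\<forall>i<K. y i \<in> reg P \<and> y i P = 0) \<and> (\<forall>f\<in>reg P. f P = 0 \<longrightarrow>
      (\<exists>u. (\<forall>i<K. u i \<in> reg P) \<and> (\<forall>\<^sub>F Q in nb P. f Q = (\<Sum>i<K. y i Q * u i Q))))"
proof -
  obtain j where j: "j \<le> n" "coords P $ j \<noteq> 0" using nonzero_coord[OF P] .
  define z :: "nat \<Rightarrow> 'k point \<Rightarrow> 'k" where "z i Q = coords Q $ i / coords Q $ j" for i Q
  have zreg: "z i \<in> reg P" if "i \<le> n" for i
    by (rule regI[OF P is_form_xform[OF that] is_form_xform[OF j(1)]]) (simp_all add: j z_def)
  define y :: "nat \<Rightarrow> 'k point \<Rightarrow> 'k" where "y i Q = z i Q - z i P" for i Q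
  have yreg: "y i \<in> reg P" if "i \<le> n" for i
    unfolding y_def[abs_def] by (rule reg_diff[OF P zreg[OF that] reg_const[OF P]])
  let ?K = "Suc n"
  \<comment> \<open>\<open>J\<close> holds for the functions whose increment at \<open>P\<close>
    lies in the ideal generated by the coordinate differences. It is stable under the ring
    operations and under inverting units, hence holds for every quotient of forms that is regular at
    \<open>P\<close>.\<close>
  define J where "J f \<longleftrightarrow> f \<in> reg P \<and> (\<exists>u. (\<forall>i<?K. u i \<in> reg P) \<and> (\<forall>\<^sub>F Q in nb P. f Q - f P = (\<Sum>i<?K. y i Q * u i Q)))" for f
  have JI: "J f" if "f \<in> reg P" "\<And>i. i < ?K \<Longrightarrow> u i \<in> reg P" "\<forall>\<^sub>F Q in nb P. f Q - f P = (\<Sum>i<?K. y i Q * u i Q)" for f u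
    unfolding J_def using that by blast
  have JE: "\<exists>u. (\<forall>i<?K. u i \<in> reg P) \<and> (\<forall>\<^sub>F Q in nb P. f Q - f P = (\<Sum>i<?K. y i Q * u i Q))" "f \<in> reg P" if "J f" for f
    using that unfolding J_def by blast+
  have J_const: "J (\<lambda>_. c)" for c
    by (rule JI[OF reg_const[OF P], of "\<lambda>_ _. 0"]) (auto intro: reg_const[OF P])
  have J_z: "J (z i)" if "i \<le> n" for i
  proof (rule JI[OF zreg[OF that], of "\<lambda>k _. if k = i then 1 else 0"])
    show "\<forall>\<^sub>F Q in nb P. z i Q - z i P = (\<Sum>k<?K. y k Q * (if k = i then 1 else 0))"
    proof (intro always_eventually allI)
      fix Q
      have "(\<Sum>k<?K. y k Q * (if k = i then 1 else 0)) = (\<Sum>k<?K. if k = i then y i Q else 0)"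
        by (intro sum.cong) auto
      then show "z i Q - z i P = (\<Sum>k<?K. y k Q * (if k = i then 1 else 0))" using that by (simp add: y_def)
    qed
  qed (auto intro: reg_const[OF P])
  have J_add: "J (\<lambda>Q. f Q + g Q)" if hyp: "J f" "J g" for f g
  proof -
    obtain u where u: "\<forall>i<?K. u i \<in> reg P" "\<forall>\<^sub>F Q in nb P. f Q - f P = (\<Sum>i<?K. y i Q * u i Q)" using JE(1)[OF hyp(1)] by blast
    obtain v where v: "\<forall>i<?K. v i \<in> reg P" "\<forall>\<^sub>F Q in nb P. g Q - g P = (\<Sum>i<?K. y i Q * v i Q)" using JE(1)[OF hyp(2)] by blast
    show ?thesis
    proof (rule JI[OF reg_add[OF P JE(2)[OF hyp(1)] JE(2)[OF hyp(2)]], of "\<lambda>i Q. u i Q + v i Q"])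
      show "\<forall>\<^sub>F Q in nb P. f Q + g Q - (f P + g P) = (\<Sum>i<?K. y i Q * (u i Q + v i Q))"
        using u(2) v(2)
      proof eventually_elim
        case (elim Q)
        have "(\<Sum>i<?K. y i Q * (u i Q + v i Q)) = (f Q - f P) + (g Q - g P)"
          unfolding elim distrib_left by (rule sum.distrib)
        then show ?case by simp
      qed
    qed (use u(1) v(1) in \<open>auto intro!: reg_add[OF P]\<close>)
  qed
  have J_mult: "J (\<lambda>Q. f Q * g Q)" if hyp: "J f" "J g" for f g
  proof -
    obtain u where u: "\<forall>i<?K. u i \<in> reg P" "\<forall>\<^sub>F Q in nb P. f Q - f P = (\<Sum>i<?K. y i Q * u i Q)" using JE(1)[OF hyp(1)] by blast
    obtain v where v: "\<forall>i<?K. v i \<in> reg P" "\<forall>\<^sub>F Q in nb P. g Q - g P = (\<Sum>i<?K. y i Q * v i Q)" using JE(1)[OF hyp(2)] by blast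
    show ?thesis
    proof (rule JI[OF reg_mult[OF P JE(2)[OF hyp(1)] JE(2)[OF hyp(2)]], of "\<lambda>i Q. u i Q * g Q + f P * v i Q"])
      show "\<forall>\<^sub>F Q in nb P. f Q * g Q - f P * g P = (\<Sum>i<?K. y i Q * (u i Q * g Q + f P * v i Q))"
        using u(2) v(2)
      proof eventually_elim
        case (elim Q)
        have "(\<Sum>i<?K. y i Q * (u i Q * g Q + f P * v i Q)) = (\<Sum>i<?K. y i Q * u i Q) * g Q + f P * (\<Sum>i<?K. y i Q * v i Q)"
          unfolding sum_distrib_left sum_distrib_right sum.distrib[symmetric] by (intro sum.cong refl) (simp add: algebra_simps)
        also have "\<dots> = f Q * g Q - f P * g P" unfolding elim[symmetric] by (simp add: algebra_simps)
        finally show ?case ..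
      qed
    qed (use u(1) v(1) JE(2)[OF hyp(2)] in \<open>auto intro!: reg_add[OF P] reg_mult[OF P] reg_const[OF P]\<close>)
  qed
  have J_inv: "J (\<lambda>Q. inverse (f Q))" if hyp: "J f" "f P \<noteq> 0" for f
  proof -
    obtain u where u: "\<forall>i<?K. u i \<in> reg P" "\<forall>\<^sub>F Q in nb P. f Q - f P = (\<Sum>i<?K. y i Q * u i Q)" using JE(1)[OF hyp(1)] by blast
    note fi = reg_inv[OF P JE(2)[OF hyp(1)] hyp(2)]
    show ?thesis
    proof (rule JI[OF fi, of "\<lambda>i Q. u i Q * (inverse (f Q) * (- inverse (f P)))"])
      show "\<forall>\<^sub>F Q in nb P. inverse (f Q) - inverse (f P) = (\<Sum>i<?K. y i Q * (u i Q * (inverse (f Q) * (- inverse (f P)))))"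
        using u(2) reg_nonzero[OF P JE(2)[OF hyp(1)] hyp(2)]
      proof eventually_elim
        case (elim Q)
        have "(\<Sum>i<?K. y i Q * (u i Q * (inverse (f Q) * (- inverse (f P))))) = (\<Sum>i<?K. y i Q * u i Q) * (inverse (f Q) * (- inverse (f P)))"
          unfolding sum_distrib_right by (intro sum.cong refl) (simp only: mult.assoc)
        also have "\<dots> = inverse (f Q) - inverse (f P)" unfolding elim(1)[symmetric] using elim(2) hyp(2) by (simp add: field_simps)
        finally show ?case ..
      qed
      fix i assume "i < ?K"
      then have "u i \<in> reg P" using u(1) by blast
      then show "(\<lambda>Q. u i Q * (inverse (f Q) * (- inverse (f P)))) \<in> reg P"
        by (intro reg_mult[OF P] reg_const[OF P] fi)
    qed
  qed
  have J_sum: "J (\<lambda>Q. \<Sum>i\<in>A. f i Q)" if "\<And>i. i \<in> A \<Longrightarrow> J (f i)" for A :: "(nat \<Rightarrow>\<^sub>0 nat) set" and f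
    using that by (induction A rule: infinite_finite_induct) (auto intro: J_const J_add)
  have J_power: "J (\<lambda>Q. f Q ^ k)" if "J f" for f and k :: nat
    using that by (induction k) (auto intro: J_const J_mult)
  have J_prod: "J (\<lambda>Q. \<Prod>i\<in>A. f i Q)" if "\<And>i. i \<in> A \<Longrightarrow> J (f i)" for A :: "nat set" and f
    using that by (induction A rule: infinite_finite_induct) (auto intro: J_const J_mult)
  have J_form: "J (\<lambda>Q. ev a Q / coords Q $ j ^ d)" if a: "is_form n d a" for a d
    unfolding ev_dehomogenise[OF a] z_def[symmetric]
  proof (intro J_sum J_mult[OF J_const] J_prod J_power)
    fix m i assume "m \<in> Poly_Mapping.keys a" "i \<in> Poly_Mapping.keys m"
    then show "J (z i)" using a by (intro J_z) (auto simp: is_form_def)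
  qed
  have J_all: "J f" if f: "f \<in> reg P" for f
  proof -
    obtain d a b where ab: "is_form n d a" "is_form n d b" "ev b P \<noteq> 0" "\<forall>\<^sub>F Q in nb P. ev b Q \<noteq> 0" "\<forall>\<^sub>F Q in nb P. f Q = ev a Q / ev b Q"
      using regE[OF P f] .
    let ?g = "\<lambda>Q. ev a Q / coords Q $ j ^ d * inverse (ev b Q / coords Q $ j ^ d)"
    have "J ?g" using ab(3) j(2) by (intro J_mult J_inv J_form ab(1,2)) simp
    from JE(1)[OF this] obtain u where u: "\<forall>i<?K. u i \<in> reg P" "\<forall>\<^sub>F Q in nb P. ?g Q - ?g P = (\<Sum>i<?K. y i Q * u i Q)" by blast
    have "\<forall>\<^sub>F Q in nb P. coords Q $ j \<noteq> 0"
      using ev_form_nonzero[OF P is_form_xform[OF j(1)]] j(2) by simp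
    with ab(5) have eq: "\<forall>\<^sub>F Q in nb P. f Q = ?g Q" by eventually_elim simp
    have "\<forall>\<^sub>F Q in nb P. f Q - f P = (\<Sum>i<?K. y i Q * u i Q)"
      using eq u(2) by eventually_elim (simp only: nb_P[OF P eq])
    then show ?thesis using u(1) f by (intro JI[of f u]) auto
  qed
  show ?thesis
  proof (rule exI[of _ ?K], rule exI[of _ y], intro conjI ballI allI impI)
    fix f assume f: "f \<in> reg P" "f P = 0"
    from JE(1)[OF J_all[OF f(1)]] show "\<exists>u. (\<forall>i<?K. u i \<in> reg P) \<and> (\<forall>\<^sub>F Q in nb P. f Q = (\<Sum>i<?K. y i Q * u i Q))"
      unfolding f(2) by simp
  qed (use yreg in \<open>auto simp: y_def\<close>)
qed

text \<open>\<open>I i\<close> consists of the forms whose dehomogenisation lies in the ideal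
  generated by \<open>h i\<close>. When this chain of homogeneous ideals stabilises, the numerator
  of \<open>h (Suc i)\<close> lies in \<open>I i\<close>, and its denominator is a unit.\<close>

lemma reg_acc:
  assumes P: "P \<in> C" and h: "\<And>i::nat. h i \<in> reg P"
    and chain: "\<And>i. \<exists>u\<in>reg P. \<forall>\<^sub>F Q in nb P. h i Q = u Q * h (Suc i) Q"
  shows "\<exists>i. \<exists>u\<in>reg P. \<forall>\<^sub>F Q in nb P. h (Suc i) Q = u Q * h i Q"
proof -
  obtain j where j: "j \<le> n" "coords P $ j \<noteq> 0" using nonzero_coord[OF P] .
  have jnz: "\<forall>\<^sub>F Q in nb P. coords Q $ j \<noteq> 0"
    using ev_form_nonzero[OF P is_form_xform[OF j(1)]] j(2) by simp
  have form_reg: "(\<lambda>Q. ev a Q / coords Q $ j ^ d) \<in> reg P" if "is_form n d a" for a d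
    using regI[OF P that is_form_power[OF is_form_xform[OF j(1)], of d, simplified]] j(2) by simp
  define I where "I i = {a. \<exists>d. is_form n d a \<and> (\<exists>u\<in>reg P. \<forall>\<^sub>F Q in nb P. ev a Q / coords Q $ j ^ d = u Q * h i Q)}" for i
  \<comment> \<open>Membership in \<open>I i\<close> records the relation for some degree of
    \<open>a\<close>. Any other degree will do, because only the zero polynomial has more than
    one.\<close>
  have ID: "\<exists>u\<in>reg P. \<forall>\<^sub>F Q in nb P. ev a Q / coords Q $ j ^ d = u Q * h i Q" if a: "a \<in> I i" "is_form n d a" for a i d
  proof (cases "a = 0")
    case True
    then show ?thesis using reg_const[OF P, of 0] by (intro bexI[of _ "\<lambda>_. 0"]) auto
  next
    case False
    obtain d' where "is_form n d' a" and u: "\<exists>u\<in>reg P. \<forall>\<^sub>F Q in nb P. ev a Q / coords Q $ j ^ d' = u Q * h i Q"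
      using a(1) unfolding I_def by blast
    then have "d' = d" using is_form_degree_unique[OF _ a(2) False] by blast
    then show ?thesis using u by simp
  qed
  have "\<exists>i. I (Suc i) = I i"
  proof (rule homogeneous_chain_stabilises[where n = n])
    fix i f assume "f \<in> I i" then show "\<exists>d. is_form n d f" unfolding I_def by blast
  next
    fix i show "I i \<subseteq> I (Suc i)"
    proof
      fix a assume "a \<in> I i"
      then obtain d u where a: "is_form n d a" and u: "u \<in> reg P" "\<forall>\<^sub>F Q in nb P. ev a Q / coords Q $ j ^ d = u Q * h i Q"
        unfolding I_def by blast
      obtain v where v: "v \<in> reg P" "\<forall>\<^sub>F Q in nb P. h i Q = v Q * h (Suc i) Q" using chain by blast
      have "\<forall>\<^sub>F Q in nb P. ev a Q / coords Q $ j ^ d = (u Q * v Q) * h (Suc i) Q"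
        using u(2) v(2) by eventually_elim simp
      then show "a \<in> I (Suc i)" unfolding I_def
        by (intro CollectI exI[of _ d] conjI a bexI[of _ "\<lambda>Q. u Q * v Q"] reg_mult[OF P u(1) v(1)])
    qed
  next
    fix i show "0 \<in> I i"
      unfolding I_def using reg_const[OF P, of 0] by (intro CollectI exI[of _ 0] conjI bexI[of _ "\<lambda>_. 0"]) auto
  next
    fix i d e and f g :: "'k mpoly" and m and c :: 'k
    assume fg: "f \<in> I i" "g \<in> I i" "is_form n d f" "is_form n e g" and m: "Poly_Mapping.keys m \<subseteq> {..n}" "d = mdeg m + e"
    let ?s = "Poly_Mapping.single m c"
    obtain u where u: "u \<in> reg P" "\<forall>\<^sub>F Q in nb P. ev f Q / coords Q $ j ^ d = u Q * h i Q" using ID[OF fg(1,3)] by blast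
    obtain v where v: "v \<in> reg P" "\<forall>\<^sub>F Q in nb P. ev g Q / coords Q $ j ^ e = v Q * h i Q" using ID[OF fg(2,4)] by blast
    let ?w = "\<lambda>Q. ev ?s Q / coords Q $ j ^ mdeg m"
    have sf: "is_form n d (f - ?s * g)" unfolding m(2)
      using fg(3,4) m by (intro is_form_diff is_form_mult is_form_single) auto
    have "\<forall>\<^sub>F Q in nb P. ev (f - ?s * g) Q / coords Q $ j ^ d = (u Q - ?w Q * v Q) * h i Q"
      using u(2) v(2)
    proof eventually_elim
      case (elim Q)
      have "ev (f - ?s * g) Q / coords Q $ j ^ d = ev f Q / coords Q $ j ^ d - ?w Q * (ev g Q / coords Q $ j ^ e)"
        by (simp add: m(2) power_add diff_divide_distrib)
      then show ?case unfolding elim by (simp add: algebra_simps)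
    qed
    then show "f - ?s * g \<in> I i" unfolding I_def
    proof (intro CollectI exI[of _ d] conjI sf bexI[of _ "\<lambda>Q. u Q - ?w Q * v Q"])
      show "(\<lambda>Q. u Q - ?w Q * v Q) \<in> reg P"
        by (rule reg_diff[OF P u(1) reg_mult[OF P form_reg[OF is_form_single[OF m(1)]] v(1)]])
    qed
  qed
  then obtain i where i: "I (Suc i) = I i" by blast
  obtain d a b where ab: "is_form n d a" "is_form n d b" "ev b P \<noteq> 0" "\<forall>\<^sub>F Q in nb P. ev b Q \<noteq> 0" "\<forall>\<^sub>F Q in nb P. h (Suc i) Q = ev a Q / ev b Q"
    using regE[OF P h] .
  have "\<forall>\<^sub>F Q in nb P. ev a Q / coords Q $ j ^ d = ev b Q / coords Q $ j ^ d * h (Suc i) Q"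
    using ab(4,5) by eventually_elim simp
  then have "a \<in> I (Suc i)" unfolding I_def
    by (intro CollectI exI[of _ d] conjI ab(1) bexI[of _ "\<lambda>Q. ev b Q / coords Q $ j ^ d"] form_reg[OF ab(2)])
  then obtain u where u: "u \<in> reg P" "\<forall>\<^sub>F Q in nb P. ev a Q / coords Q $ j ^ d = u Q * h i Q" using ID[OF _ ab(1)] i by blast
  let ?w = "\<lambda>Q. inverse (ev b Q / coords Q $ j ^ d)"
  have w: "?w \<in> reg P" using reg_inv[OF P form_reg[OF ab(2)]] ab(3) j(2) by simp
  have "\<forall>\<^sub>F Q in nb P. h (Suc i) Q = (?w Q * u Q) * h i Q"
    using ab(5) u(2) jnz
  proof eventually_elim
    case (elim Q)
    have "(?w Q * u Q) * h i Q = ?w Q * (ev a Q / coords Q $ j ^ d)" using elim(2) by simp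
    then show ?case using elim(1,3) by (simp only: inverse_divide) simp
  qed
  then show ?thesis by (intro exI[of _ i] bexI[of _ "\<lambda>Q. ?w Q * u Q"] reg_mult[OF P w u(1)])
qed

lemma germ_ring_at:
  assumes P: "P \<in> C"
  shows "germ_ring (nb P) (reg P) P"
proof
  show "\<phi> P" if "eventually \<phi> (nb P)" for \<phi> using nb_P[OF P that] .
  show "\<exists>(K::nat) y. (\<forall>i<K. y i \<in> reg P \<and> y i P = 0) \<and> (\<forall>f\<in>reg P. f P = 0 \<longrightarrow>
      (\<exists>u. (\<forall>i<K. u i \<in> reg P) \<and> (\<forall>\<^sub>F Q in nb P. f Q = (\<Sum>i<K. y i Q * u i Q))))"
    by (rule reg_fin_gen[OF P])
  show "\<exists>i. \<exists>u\<in>reg P. \<forall>\<^sub>F Q in nb P. h (Suc i) Q = u Q * h i Q"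
    if "\<And>i::nat. h i \<in> reg P" "\<And>i. \<exists>u\<in>reg P. \<forall>\<^sub>F Q in nb P. h i Q = u Q * h (Suc i) Q" for h
    by (rule reg_acc[OF P]) (rule that)+
qed (rule reg_const[OF P] reg_add[OF P] reg_mult[OF P] reg_inv[OF P] reg_nonzero[OF P] reg_dom[OF P]; assumption)+

lemma max_ideal_eq: "P \<in> C \<Longrightarrow> max_ideal n C P = germ_ring.\<mm> (reg P) P"
  unfolding max_ideal_def reg_def by (subst germ_ring.\<mm>_def[OF germ_ring_at[unfolded reg_def]]) simp_all

lemma max_ideal_sq_eq: "P \<in> C \<Longrightarrow> max_ideal_sq n C P = germ_ring.\<mm>2 (nb P) (reg P) P"
  by (subst germ_ring.\<mm>2_def[OF germ_ring_at]) (simp_all add: max_ideal_sq_def max_ideal_eq germ_eq_def eventually_nb)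

lemma dvr_at:
  assumes P: "P \<in> C"
  obtains t where "dvr_germs (nb P) (reg P) P t"
proof -
  interpret germ_ring "nb P" "reg P" P by (rule germ_ring_at[OF P])
  obtain t where t: "t (0::nat) \<in> \<mm>" and ex: "\<And>f. f \<in> \<mm> \<Longrightarrow> \<exists>!c. c \<in> {..<1::nat} \<rightarrow>\<^sub>E UNIV \<and>
        (\<lambda>Q. f Q - (\<Sum>i<1. c i * t i Q)) \<in> \<mm>2"
    using bspec[OF cot P] unfolding has_cotangent_dim_def max_ideal_eq[OF P] max_ideal_sq_eq[OF P] by auto
  have "dvr_germs (nb P) (reg P) P (t 0)"
  proof
    show "t 0 \<in> \<mm>" by (rule t)
    fix f assume "f \<in> \<mm>"
    from ex[OF this] obtain c where c: "(\<lambda>Q. f Q - c (0::nat) * t 0 Q) \<in> \<mm>2"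
      and uniq: "\<And>c'. c' \<in> {..<1::nat} \<rightarrow>\<^sub>E UNIV \<Longrightarrow> (\<lambda>Q. f Q - c' 0 * t 0 Q) \<in> \<mm>2 \<Longrightarrow> c' = c" by auto
    show "\<exists>!c. (\<lambda>Q. f Q - c * t 0 Q) \<in> \<mm>2"
    proof (rule ex1I[of _ "c 0"])
      show "(\<lambda>Q. f Q - c 0 * t 0 Q) \<in> \<mm>2" by (rule c)
      fix b assume "(\<lambda>Q. f Q - b * t 0 Q) \<in> \<mm>2"
      then have "(\<lambda>i\<in>{..<1::nat}. b) = c" by (intro uniq) auto
      then show "b = c 0" by auto
    qed
  qed
  then show ?thesis by (rule that)
qed

end

section \<open>Automorphisms and inertia\<close>

text \<open>Plays the role of separatedness of the curve: it is what makes the fixed locus of an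
  automorphism closed. If all quotients \<open>x_r / l\<close> agreed at the two points, their
  coordinate vectors would be proportional.\<close>

lemma (in curve) separating_function:
  assumes P: "P \<in> C" and Q: "Q \<in> C" and "P \<noteq> Q"
  obtains f where "f \<in> reg P" "f \<in> reg Q" "f P \<noteq> f Q"
proof -
  obtain i where i: "i \<le> n" "coords P $ i \<noteq> 0" using nonzero_coord[OF P] .
  obtain j where j: "j \<le> n" "coords Q $ j \<noteq> 0" using nonzero_coord[OF Q] .
  \<comment> \<open>One of the two coordinates works unless each vanishes at the other point; in
    that case their sum is nonzero at both points.\<close>
  obtain l where l: "is_form n 1 l" "ev l P \<noteq> 0" "ev l Q \<noteq> 0"
  proof (cases "coords Q $ i = 0 \<and> coords P $ j = 0")
    case True
    then show ?thesis using i j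
      by (intro that[of "xform i + xform j"] is_form_add is_form_xform) auto
  next
    case False
    then show ?thesis using i j that[OF is_form_xform[OF i(1)]] that[OF is_form_xform[OF j(1)]] by auto
  qed
  have "\<exists>r\<le>n. coords P $ r / ev l P \<noteq> coords Q $ r / ev l Q"
  proof (rule ccontr)
    assume "\<not> ?thesis"
    then have eq: "coords P $ r / ev l P = coords Q $ r / ev l Q" if "r \<le> n" for r using that by blast
    have PQ: "P \<in> proj_space n" "Q \<in> proj_space n" using C_proj P Q by blast+
    note car = coords_in(2)[OF PQ(1)] coords_in(2)[OF PQ(2)]
    have "coords P = (ev l P / ev l Q) \<cdot>\<^sub>v coords Q"
    proof (rule eq_vecI)
      fix r assume "r < dim_vec ((ev l P / ev l Q) \<cdot>\<^sub>v coords Q)"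
      then have "r \<le> n" "r < dim_vec (coords Q)" using car by simp_all
      then show "coords P $ r = ((ev l P / ev l Q) \<cdot>\<^sub>v coords Q) $ r" using eq[of r] l(2,3) by (simp add: field_simps)
    qed (use car in simp)
    from proj_point_eqI[OF PQ this] show False using l(2,3) \<open>P \<noteq> Q\<close> by simp
  qed
  then obtain r where r: "r \<le> n" "coords P $ r / ev l P \<noteq> coords Q $ r / ev l Q" by blast
  let ?f = "\<lambda>Q. coords Q $ r / ev l Q"
  have "?f \<in> reg P" by (rule regI[OF P is_form_xform[OF r(1)] l(1,2)]) simp
  moreover have "?f \<in> reg Q" by (rule regI[OF Q is_form_xform[OF r(1)] l(1,3)]) simp
  ultimately show ?thesis using r(2) by (intro that[of ?f])
qed

text \<open>A minimal infinite proper closed subset, which exists by the descending chain condition,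
  is irreducible. Placed between one of its points and \<open>C\<close> it gives a chain of length
  two, against dimension one.\<close>

lemma (in curve) closed_subset_finite:
  assumes "closedin T Z" "Z \<noteq> C"
  shows "finite Z"
proof (rule ccontr)
  assume "infinite Z"
  define Bad where "Bad Z \<longleftrightarrow> closedin T Z \<and> infinite Z \<and> Z \<noteq> C" for Z
  have "Bad Z" using assms \<open>infinite Z\<close> by (simp add: Bad_def)
  have ex_min: "\<exists>Z. Bad Z \<and> (\<forall>Y. Bad Y \<longrightarrow> Y \<subseteq> Z \<longrightarrow> Y = Z)"
  proof (rule ccontr)
    assume "\<not> ?thesis"
    then have "\<forall>Z. \<exists>Y. Bad Z \<longrightarrow> Bad Y \<and> Y \<subset> Z" by blast
    then obtain f where f: "\<And>Z. Bad Z \<Longrightarrow> Bad (f Z) \<and> f Z \<subset> Z" by metis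
    define S where "S i = (f ^^ i) Z" for i
    have S: "Bad (S i)" for i by (induction i) (use \<open>Bad Z\<close> f in \<open>auto simp: S_def\<close>)
    have sub: "S (Suc i) \<subset> S i" for i using f[OF S[of i]] by (simp add: S_def)
    have "\<exists>i. S (Suc i) = S i"
    proof (rule zariski_dcc)
      fix i show "closedin (zariski n) (S i)" using S[of i] unfolding Bad_def closedin_T by blast
      show "S (Suc i) \<subseteq> S i" using sub[of i] by blast
    qed
    then show False using sub by blast
  qed
  then obtain Z0 where Z0: "Bad Z0" "\<And>Y. Bad Y \<Longrightarrow> Y \<subseteq> Z0 \<Longrightarrow> Y = Z0" by blast
  have Z0C: "closedin T Z0" "infinite Z0" "Z0 \<noteq> C" "Z0 \<subseteq> C"
    using Z0(1) closedin_subset[of T Z0] by (simp_all add: Bad_def)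
  have irrZ0: "irreducible_closed T Z0"
    unfolding irreducible_closed_def
  proof (intro conjI allI impI)
    show "Z0 \<noteq> {}" using Z0C(2) by auto
    fix A B assume AB: "closedin T A \<and> closedin T B \<and> Z0 \<subseteq> A \<union> B"
    show "Z0 \<subseteq> A \<or> Z0 \<subseteq> B"
    proof (rule ccontr)
      assume neg: "\<not> ?thesis"
      \<comment> \<open>By minimality of \<open>Z0\<close>, a closed set that does not contain it
        meets it in finitely many points.\<close>
      have fin: "finite (Z0 \<inter> Y)" if "closedin T Y" "\<not> Z0 \<subseteq> Y" for Y
      proof (rule ccontr)
        assume "infinite (Z0 \<inter> Y)"
        moreover have "closedin T (Z0 \<inter> Y)" using Z0C(1) that(1) by (rule closedin_Int)
        moreover have "Z0 \<inter> Y \<noteq> C" using Z0C(3,4) by blast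
        ultimately have "Bad (Z0 \<inter> Y)" by (simp add: Bad_def)
        from Z0(2)[OF this] show False using that(2) by blast
      qed
      have "finite (Z0 \<inter> A \<union> Z0 \<inter> B)" using fin[of A] fin[of B] AB neg by blast
      moreover have "Z0 \<inter> A \<union> Z0 \<inter> B = Z0" using AB by blast
      ultimately show False using Z0C(2) by simp
    qed
  qed (rule Z0C(1))
  have "Z0 \<noteq> {}" using Z0C(2) by auto
  then obtain P where P: "P \<in> Z0" by blast
  have irrP: "irreducible_closed T {P}"
    unfolding irreducible_closed_def
  proof (intro conjI allI impI)
    show "closedin T {P}" unfolding closedin_T using P Z0C(4) C_proj by (auto intro: closed_point)
  qed auto
  have irrC: "irreducible_closed T C"
    using irred unfolding irreducible_closed_def closedin_T by blast
  let ?Z = "\<lambda>i::nat. if i = 0 then {P} else if i = 1 then Z0 else C"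
  have "{P} \<noteq> Z0" using Z0C(2) by auto
  then have "has_irreducible_chain T (Suc 1)" unfolding has_irreducible_chain_def
    using irrP irrZ0 irrC P Z0C(3,4) by (intro exI[of _ ?Z]) (auto simp: less_Suc_eq)
  then show False using dim1 unfolding has_krull_dim_def by blast
qed

section \<open>The action of a finite group of automorphisms\<close>

locale curve_group = curve n C for n and C :: "'k::alg_closed_field point set" +
  fixes G :: "('k point \<Rightarrow> 'k point) monoid" (structure)
  assumes aut: "finite_automorphism_group n C G"
begin

text \<open>Inverses are defined relative to the carrier, so those in \<open>aut_group\<close> and
  those in the group of all bijections must be shown to agree before the subgroup property transfers
  to the latter.\<close>

lemma subgroup_BijGroup: "\<exists>A. subgroup A (BijGroup C) \<and> finite A \<and> G = (BijGroup C)\<lparr>carrier := A\<rparr> \<and>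
    (\<forall>g\<in>A. variety_morphism n C n C g)"
proof -
  obtain A where A: "subgroup A (aut_group n C)" "finite A" "G = (aut_group n C)\<lparr>carrier := A\<rparr>"
    using aut unfolding finite_automorphism_group_def by blast
  interpret B: group "BijGroup C" by (rule group_BijGroup)
  let ?B = "carrier (aut_group n C)"
  have Bij: "g \<in> Bij C" "variety_morphism n C n C g" "variety_morphism n C n C (inv\<^bsub>BijGroup C\<^esub> g)" if "g \<in> ?B" for g
    using that inv_BijGroup[of g C] by (auto simp: aut_group_def)
  have carB: "carrier (BijGroup C) = Bij C" by (simp add: BijGroup_def)
  have inv_in: "inv\<^bsub>BijGroup C\<^esub> g \<in> ?B" if "g \<in> ?B" for g
  proof -
    have g: "g \<in> carrier (BijGroup C)" using Bij(1)[OF that] carB by simp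
    then have ig: "inv\<^bsub>BijGroup C\<^esub> g \<in> Bij C" using B.inv_closed[OF g] carB by simp
    have "restrict (inv_into C (inv\<^bsub>BijGroup C\<^esub> g)) C = g"
      using inv_BijGroup[OF ig] B.inv_inv[OF g] by simp
    then show ?thesis using ig Bij[OF that] by (simp add: aut_group_def)
  qed
  have inv_eq: "inv\<^bsub>aut_group n C\<^esub> g = inv\<^bsub>BijGroup C\<^esub> g" if "g \<in> ?B" for g
  proof -
    have g: "g \<in> carrier (BijGroup C)" using Bij(1)[OF that] carB by simp
    have ops: "monoid.mult (aut_group n C) = monoid.mult (BijGroup C)" "monoid.one (aut_group n C) = monoid.one (BijGroup C)"
      by (simp_all add: aut_group_def)
    show ?thesis unfolding m_inv_def[of "aut_group n C"] ops
    proof (rule the_equality)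
      show "inv\<^bsub>BijGroup C\<^esub> g \<in> ?B \<and> g \<otimes>\<^bsub>BijGroup C\<^esub> inv\<^bsub>BijGroup C\<^esub> g = \<one>\<^bsub>BijGroup C\<^esub> \<and>
          inv\<^bsub>BijGroup C\<^esub> g \<otimes>\<^bsub>BijGroup C\<^esub> g = \<one>\<^bsub>BijGroup C\<^esub>"
        using inv_in[OF that] B.r_inv[OF g] B.l_inv[OF g] by simp
      fix y assume y: "y \<in> ?B \<and> g \<otimes>\<^bsub>BijGroup C\<^esub> y = \<one>\<^bsub>BijGroup C\<^esub> \<and> y \<otimes>\<^bsub>BijGroup C\<^esub> g = \<one>\<^bsub>BijGroup C\<^esub>"
      then have "y \<in> carrier (BijGroup C)" using Bij(1)[of y] carB by simp
      then show "y = inv\<^bsub>BijGroup C\<^esub> g" using B.inv_equality[OF _ g] y by metis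
    qed
  qed
  have AB: "A \<subseteq> ?B" by (rule subgroup.subset[OF A(1)])
  have "subgroup A (BijGroup C)"
  proof (rule subgroup.intro)
    show "A \<subseteq> carrier (BijGroup C)" using AB Bij(1) carB by blast
    show "x \<otimes>\<^bsub>BijGroup C\<^esub> y \<in> A" if "x \<in> A" "y \<in> A" for x y
      using subgroup.m_closed[OF A(1) that] by (simp add: aut_group_def)
    show "\<one>\<^bsub>BijGroup C\<^esub> \<in> A" using subgroup.one_closed[OF A(1)] by (simp add: aut_group_def)
    show "inv\<^bsub>BijGroup C\<^esub> x \<in> A" if "x \<in> A" for x
      using subgroup.m_inv_closed[OF A(1) that] inv_eq[of x] that AB by auto
  qed
  moreover have "G = (BijGroup C)\<lparr>carrier := A\<rparr>" using A(3) by (simp add: aut_group_def)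
  ultimately show ?thesis using A(2) AB Bij(2) by (intro exI[of _ A]) blast
qed

lemma group_G: "group G" and finite_G: "finite (carrier G)"
  and carrier_Bij: "g \<in> carrier G \<Longrightarrow> g \<in> Bij C"
  and carrier_morphism: "g \<in> carrier G \<Longrightarrow> variety_morphism n C n C g"
  and mult_eq: "g \<in> carrier G \<Longrightarrow> h \<in> carrier G \<Longrightarrow> g \<otimes> h = compose C g h"
  and one_eq: "\<one> = (\<lambda>x\<in>C. x)"
proof -
  obtain A where A: "subgroup A (BijGroup C)" "finite A" "G = (BijGroup C)\<lparr>carrier := A\<rparr>"
      "\<forall>g\<in>A. variety_morphism n C n C g"
    using subgroup_BijGroup by (elim exE conjE)
  have AC: "A \<subseteq> Bij C" using subgroup.subset[OF A(1)] by (simp add: BijGroup_def)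
  show "group G" unfolding A(3) by (rule subgroup.subgroup_is_group[OF A(1) group_BijGroup])
  show "finite (carrier G)" using A(2,3) by simp
  show "g \<in> carrier G \<Longrightarrow> g \<in> Bij C" using AC A(3) by auto
  show "g \<in> carrier G \<Longrightarrow> variety_morphism n C n C g" using A(3,4) by simp
  show "g \<in> carrier G \<Longrightarrow> h \<in> carrier G \<Longrightarrow> g \<otimes> h = compose C g h" using AC A(3) by (auto simp: BijGroup_def)
  show "\<one> = (\<lambda>x\<in>C. x)" using A(3) by (simp add: BijGroup_def)
qed

sublocale group G by (rule group_G)

sublocale act: group_action G C "\<lambda>g. g"
proof (intro group_action.intro group_hom.intro group_hom_axioms.intro)
  show "(\<lambda>g. g) \<in> hom G (BijGroup C)"
    by (rule homI) (simp_all add: BijGroup_def carrier_Bij mult_eq)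
qed (rule group_G group_BijGroup)+

lemma image_in_C: "g \<in> carrier G \<Longrightarrow> P \<in> C \<Longrightarrow> g P \<in> C"
  using Bij_imp_funcset[OF carrier_Bij] by (rule funcset_mem)

lemma mult_apply: "g \<in> carrier G \<Longrightarrow> h \<in> carrier G \<Longrightarrow> P \<in> C \<Longrightarrow> (g \<otimes> h) P = g (h P)"
  by (simp add: mult_eq compose_def)

lemma one_apply: "P \<in> C \<Longrightarrow> \<one> P = P"
  by (simp add: one_eq)

lemma eqI_on_C: "g \<in> carrier G \<Longrightarrow> h \<in> carrier G \<Longrightarrow> (\<And>P. P \<in> C \<Longrightarrow> g P = h P) \<Longrightarrow> g = h"
  by (rule extensionalityI[of _ C]) (auto intro: Bij_imp_extensional carrier_Bij)

lemma eventually_pullback: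
  assumes g: "g \<in> carrier G" and P: "P \<in> C" and ev: "eventually \<phi> (nb (g P))"
  shows "\<forall>\<^sub>F Q in nb P. \<phi> (g Q)"
proof -
  have gP: "g P \<in> C" by (rule image_in_C[OF g P])
  obtain U where U: "openin T U" "g P \<in> U" "\<forall>Q\<in>U. \<phi> Q" using ev unfolding eventually_nb[OF gP] by blast
  have "continuous_map T T g" using carrier_morphism[OF g] unfolding variety_morphism_def by blast
  from openin_continuous_map_preimage[OF this U(1)] have "openin T {Q \<in> C. g Q \<in> U}" by simp
  then show ?thesis unfolding eventually_nb[OF P] using U(2,3) P
    by (intro exI[of _ "{Q \<in> C. g Q \<in> U}"]) simp
qed

lemma reg_pullback:
  assumes g: "g \<in> carrier G" and P: "P \<in> C" and f: "f \<in> reg (g P)"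
  shows "(\<lambda>Q. f (g Q)) \<in> reg P"
proof -
  obtain U d a b where U: "openin T U" "g P \<in> U" "is_form n d a" "is_form n d b"
      "\<forall>Q\<in>U. \<forall>v\<in>Q. mp_eval b v \<noteq> 0 \<and> f Q = mp_eval a v / mp_eval b v"
    using f unfolding reg_def regular_at_def mem_Collect_eq by (elim exE conjE)
  have reg: "\<forall>Q\<in>U. regular_at n C Q f"
    unfolding regular_at_def using U by (intro ballI exI[of _ U] exI[of _ d] exI[of _ a] exI[of _ b]) simp
  have "\<forall>V f. openin T V \<and> (\<forall>Q\<in>V. regular_at n C Q f) \<longrightarrow> (\<forall>P\<in>C. g P \<in> V \<longrightarrow> regular_at n C P (f \<circ> g))"
    using carrier_morphism[OF g] unfolding variety_morphism_def by (elim conjE)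
  then have "regular_at n C P (f \<circ> g)" using U(1,2) reg P by blast
  then show ?thesis by (simp add: reg_def comp_def)
qed

text \<open>A moved point and its image are separated by a function \<open>f\<close> regular at
  both. The difference of \<open>f\<close> and its pullback is nonzero nearby, so nearby points are
  moved as well.\<close>

lemma fixed_points_closed:
  assumes g: "g \<in> carrier G"
  shows "closedin T {P \<in> C. g P = P}"
proof -
  have "openin T {P \<in> C. g P \<noteq> P}"
  proof (subst openin_subopen, intro ballI)
    fix P assume "P \<in> {P \<in> C. g P \<noteq> P}"
    then have P: "P \<in> C" "P \<noteq> g P" by auto
    obtain f where f: "f \<in> reg P" "f \<in> reg (g P)" "f P \<noteq> f (g P)"
      using separating_function[OF P(1) image_in_C[OF g P(1)] P(2)] .
    have "\<forall>\<^sub>F Q in nb P. f Q - f (g Q) \<noteq> 0"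
      by (rule reg_nonzero[OF P(1) reg_diff[OF P(1) f(1) reg_pullback[OF g P(1) f(2)]]]) (use f(3) in simp)
    then obtain U where U: "openin T U" "P \<in> U" "\<forall>Q\<in>U. f Q - f (g Q) \<noteq> 0" unfolding eventually_nb[OF P(1)] by blast
    have "U \<subseteq> C" using openin_subset[OF U(1)] by simp
    then have "U \<subseteq> {P \<in> C. g P \<noteq> P}" using U(3) by force
    then show "\<exists>T'. openin T T' \<and> P \<in> T' \<and> T' \<subseteq> {P \<in> C. g P \<noteq> P}" using U(1,2) by blast
  qed
  moreover have "C - {P \<in> C. g P = P} = {P \<in> C. g P \<noteq> P}" by blast
  ultimately show ?thesis unfolding closedin_def by simp
qed

lemma fixes_neighbourhood_imp_one:
  assumes g: "g \<in> carrier G" and P: "P \<in> C" and fix_near: "\<forall>\<^sub>F Q in nb P. g Q = Q"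
  shows "g = \<one>"
proof -
  obtain U where U: "openin T U" "P \<in> U" "\<forall>Q\<in>U. g Q = Q" using fix_near unfolding eventually_nb[OF P] by blast
  let ?V = "C - {P \<in> C. g P = P}"
  have V: "openin T ?V" using fixed_points_closed[OF g] unfolding closedin_def by simp
  have "?V = {}"
  proof (rule ccontr)
    assume "?V \<noteq> {}"
    from opens_meet[OF U(1) V _ this] show False using U(2,3) by blast
  qed
  then show ?thesis by (intro eqI_on_C[OF g one_closed]) (auto simp: one_apply)
qed

text \<open>The affine coordinates are germs at \<open>P\<close>, and near \<open>P\<close> they
  determine the point, so \<open>g\<close> fixes a neighbourhood.\<close>

lemma fixes_germs_imp_one:
  assumes g: "g \<in> carrier G" and P: "P \<in> C" and gP: "g P = P"
    and triv: "\<And>f. f \<in> reg P \<Longrightarrow> \<forall>\<^sub>F Q in nb P. f (g Q) = f Q"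
  shows "g = \<one>"
proof (rule fixes_neighbourhood_imp_one[OF g P])
  obtain j where j: "j \<le> n" "coords P $ j \<noteq> 0" using nonzero_coord[OF P] .
  have jnz: "\<forall>\<^sub>F Q in nb P. coords Q $ j \<noteq> 0"
    using ev_form_nonzero[OF P is_form_xform[OF j(1)]] j(2) by simp
  have gjnz: "\<forall>\<^sub>F Q in nb P. coords (g Q) $ j \<noteq> 0"
    by (rule eventually_pullback[OF g P]) (use jnz gP in simp)
  have "\<forall>\<^sub>F Q in nb P. coords (g Q) $ r / coords (g Q) $ j = coords Q $ r / coords Q $ j" if "r \<le> n" for r
    by (rule triv, rule regI[OF P is_form_xform[OF that] is_form_xform[OF j(1)]]) (simp_all add: j)
  then have "\<forall>\<^sub>F Q in nb P. \<forall>r\<in>{..n}. coords (g Q) $ r / coords (g Q) $ j = coords Q $ r / coords Q $ j"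
    by (intro eventually_ball_finite) auto
  with jnz gjnz ev_in_C[OF P] show "\<forall>\<^sub>F Q in nb P. g Q = Q"
  proof eventually_elim
    case (elim Q)
    have PQ: "g Q \<in> proj_space n" "Q \<in> proj_space n" using image_in_C[OF g elim(3)] elim(3) C_proj by blast+
    note car = coords_in(2)[OF PQ(1)] coords_in(2)[OF PQ(2)]
    let ?c = "coords (g Q) $ j / coords Q $ j"
    have "coords (g Q) = ?c \<cdot>\<^sub>v coords Q"
    proof (rule eq_vecI)
      fix r assume "r < dim_vec (?c \<cdot>\<^sub>v coords Q)"
      then have r: "r \<in> {..n}" "r < dim_vec (coords Q)" using car by simp_all
      then show "coords (g Q) $ r = (?c \<cdot>\<^sub>v coords Q) $ r"
        using bspec[OF elim(4) r(1)] elim(1,2) by (simp add: field_simps)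
    qed (use car in simp)
    from proj_point_eqI[OF PQ this] show "g Q = Q" using elim(1,2) by simp
  qed
qed

text \<open>Each nontrivial element fixes a proper closed subset, which is finite because the curve
  has dimension one.\<close>

lemma finite_ramified: "finite (ramified_points G C)"
proof -
  have "ramified_points G C \<subseteq> (\<Union>g\<in>carrier G - {\<one>}. {P \<in> C. g P = P})"
  proof
    fix P assume P: "P \<in> ramified_points G C"
    then have PC: "P \<in> C" "stabilizer G (\<lambda>g. g) P \<noteq> {\<one>}" by (auto simp: ramified_points_def)
    have "\<one> \<in> stabilizer G (\<lambda>g. g) P" by (rule act.stabilizer_one_closed[OF PC(1)])
    then obtain g where "g \<in> stabilizer G (\<lambda>g. g) P" "g \<noteq> \<one>" using PC(2) by blast
    then show "P \<in> (\<Union>g\<in>carrier G - {\<one>}. {P \<in> C. g P = P})" using PC(1) by (auto simp: stabilizer_def)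
  qed
  moreover have "finite {P \<in> C. g P = P}" if "g \<in> carrier G - {\<one>}" for g
  proof (rule closed_subset_finite[OF fixed_points_closed])
    show "g \<in> carrier G" using that by blast
    show "{P \<in> C. g P = P} \<noteq> C"
    proof
      assume "{P \<in> C. g P = P} = C"
      then have "g = \<one>" using that by (intro eqI_on_C[OF _ one_closed]) (auto simp: one_apply)
      then show False using that by blast
    qed
  qed
  ultimately show ?thesis using finite_G by (meson finite_UN_I finite_Diff finite_subset)
qed

end

section \<open>The ramification character and the inertia groups\<close>

context curve_group
begin

lemma inertia_iff: "g \<in> inertia G P \<longleftrightarrow> g \<in> carrier G \<and> g P = P"
  by (simp add: stabilizer_def)

lemma inertia_subgroup: "P \<in> C \<Longrightarrow> subgroup (inertia G P) G"
  by (rule act.stabilizer_subgroup)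

lemma inv_apply: "g \<in> carrier G \<Longrightarrow> P \<in> C \<Longrightarrow> (inv g) (g P) = P"
  using mult_apply[of "inv g" g P] by (simp add: one_apply)

lemma inertia_pullback:
  assumes P: "P \<in> C" and g: "g \<in> inertia G P"
  shows "g P = P" "g \<in> carrier G" "f \<in> reg P \<Longrightarrow> (\<lambda>Q. f (g Q)) \<in> reg P"
    and "eventually \<phi> (nb P) \<Longrightarrow> \<forall>\<^sub>F Q in nb P. \<phi> (g Q)"
proof -
  show gP: "g P = P" and gG: "g \<in> carrier G" using g by (simp_all add: inertia_iff)
  show "f \<in> reg P \<Longrightarrow> (\<lambda>Q. f (g Q)) \<in> reg P"
    by (rule reg_pullback[OF gG P]) (simp add: gP)
  show "eventually \<phi> (nb P) \<Longrightarrow> \<forall>\<^sub>F Q in nb P. \<phi> (g Q)"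
    by (rule eventually_pullback[OF gG P]) (simp add: gP)
qed

lemma ram_charI:
  assumes P: "P \<in> C"
    and c: "\<And>f. f \<in> max_ideal n C P \<Longrightarrow> (\<lambda>Q. f ((inv g) Q) - c * f Q) \<in> max_ideal_sq n C P"
  shows "ram_char n C G P g = c"
proof -
  obtain t where "dvr_germs (nb P) (reg P) P t" using dvr_at[OF P] .
  then interpret dvr_germs "nb P" "reg P" P t .
  show ?thesis unfolding ram_char_def
  proof (rule the_equality)
    show "\<forall>f\<in>max_ideal n C P. (\<lambda>Q. f ((inv g) Q) - c * f Q) \<in> max_ideal_sq n C P" using c by blast
    fix d assume d: "\<forall>f\<in>max_ideal n C P. (\<lambda>Q. f ((inv g) Q) - d * f Q) \<in> max_ideal_sq n C P"
    show "d = c"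
      by (rule cotangent_scalar_unique[of "inv g"])
        (use d c in \<open>simp_all only: max_ideal_eq[OF P] max_ideal_sq_eq[OF P]\<close>)
  qed
qed

lemma ram_char_spec:
  assumes P: "P \<in> C" and g: "g \<in> inertia G P" and f: "f \<in> max_ideal n C P"
  shows "(\<lambda>Q. f ((inv g) Q) - ram_char n C G P g * f Q) \<in> max_ideal_sq n C P"
proof -
  obtain t where "dvr_germs (nb P) (reg P) P t" using dvr_at[OF P] .
  then interpret dvr_germs "nb P" "reg P" P t .
  have ig: "inv g \<in> inertia G P" by (rule subgroup.m_inv_closed[OF inertia_subgroup[OF P] g])
  note s = inertia_pullback[OF P ig]
  obtain c where c: "\<And>f. f \<in> \<mm> \<Longrightarrow> (\<lambda>Q. f ((inv g) Q) - c * f Q) \<in> \<mm>2"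
    using cotangent_scalar[of "inv g", OF s(3) s(4) s(1)] by blast
  have "ram_char n C G P g = c"
    by (rule ram_charI[OF P]) (use c in \<open>simp only: max_ideal_eq[OF P] max_ideal_sq_eq[OF P]\<close>)
  then show ?thesis using c[of f] f by (simp only: max_ideal_eq[OF P] max_ideal_sq_eq[OF P])
qed

lemma ram_char_mult:
  assumes P: "P \<in> C" and g: "g \<in> inertia G P" and h: "h \<in> inertia G P"
  shows "ram_char n C G P (g \<otimes> h) = ram_char n C G P g * ram_char n C G P h"
proof (rule ram_charI[OF P])
  fix f assume f: "f \<in> max_ideal n C P"
  obtain t where "dvr_germs (nb P) (reg P) P t" using dvr_at[OF P] .
  then interpret dvr_germs "nb P" "reg P" P t .
  have ih: "inv h \<in> inertia G P" by (rule subgroup.m_inv_closed[OF inertia_subgroup[OF P] h])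
  have gG: "g \<in> carrier G" "h \<in> carrier G" using g h by (simp_all add: inertia_iff)
  note s = inertia_pullback[OF P ih]
  have q: "\<forall>\<^sub>F Q in nb P. (inv (g \<otimes> h)) Q = (inv h) ((inv g) Q)"
    using ev_in_C[OF P] by eventually_elim (simp add: inv_mult_group gG mult_apply)
  note spec = ram_char_spec[OF P, unfolded max_ideal_eq[OF P] max_ideal_sq_eq[OF P]]
  show "(\<lambda>Q. f ((inv (g \<otimes> h)) Q) - ram_char n C G P g * ram_char n C G P h * f Q) \<in> max_ideal_sq n C P"
    unfolding max_ideal_sq_eq[OF P]
    by (rule cotangent_scalar_comp[of "inv g" _ "inv h", OF spec[OF g] spec[OF h] s(3) s(1) q f[unfolded max_ideal_eq[OF P]]])
qed

lemma ram_char_one: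
  assumes P: "P \<in> C"
  shows "ram_char n C G P \<one> = 1"
proof (rule ram_charI[OF P])
  fix f assume f: "f \<in> max_ideal n C P"
  obtain t where "dvr_germs (nb P) (reg P) P t" using dvr_at[OF P] .
  then interpret dvr_germs "nb P" "reg P" P t .
  show "(\<lambda>Q. f ((inv \<one>) Q) - 1 * f Q) \<in> max_ideal_sq n C P"
    unfolding max_ideal_sq_eq[OF P]
  proof (rule \<mm>2I[OF const[of 0]])
    show "\<forall>\<^sub>F Q in nb P. f ((inv \<one>) Q) - 1 * f Q = t Q * (t Q * 0)"
      using ev_in_C[OF P] by eventually_elim (simp add: one_apply)
  qed
qed

lemma funpow_apply:
  assumes g: "g \<in> carrier G" and Q: "Q \<in> C"
  shows "(g ^^ k) Q = (g [^] (k::nat)) Q"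
proof (induction k)
  case 0
  show ?case using Q by (simp add: one_apply)
next
  case (Suc k)
  have "(g ^^ Suc k) Q = g ((g [^] k) Q)" using Suc by simp
  also have "\<dots> = (g \<otimes> g [^] k) Q" by (rule mult_apply[symmetric]) (use g Q in auto)
  also have "g \<otimes> g [^] k = g [^] Suc k" using nat_pow_Suc2[OF g, of k] by simp
  finally show ?case .
qed

lemma ram_char_eq_one:
  assumes P: "P \<in> C" and g: "g \<in> inertia G P" and one: "ram_char n C G P g = 1"
    and card: "(of_nat (card (carrier G)) :: 'k) \<noteq> 0"
  shows "g = \<one>"
proof -
  obtain t where "dvr_germs (nb P) (reg P) P t" using dvr_at[OF P] .
  then interpret dvr_germs "nb P" "reg P" P t .
  have gG: "g \<in> carrier G" using g by (simp add: inertia_iff)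
  have ig: "inv g \<in> inertia G P" by (rule subgroup.m_inv_closed[OF inertia_subgroup[OF P] g])
  note s = inertia_pullback[OF P ig]
  \<comment> \<open>The group order serves as the exponent \<open>e\<close>: it annihilates every
    element and is invertible in the ground field.\<close>
  have se: "\<forall>\<^sub>F Q in nb P. ((inv g) ^^ card (carrier G)) Q = Q"
    using ev_in_C[OF P]
  proof eventually_elim
    case (elim Q)
    have "inv g [^] card (carrier G) = \<one>" using pow_order_eq_1[of "inv g"] gG by (simp add: Coset.order_def)
    then show ?case using funpow_apply[of "inv g" Q "card (carrier G)"] gG elim by (simp add: one_apply)
  qed
  have "t \<in> max_ideal n C P" using t by (simp only: max_ideal_eq[OF P])
  from ram_char_spec[OF P g this] have triv: "(\<lambda>Q. t ((inv g) Q) - t Q) \<in> \<mm>2"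
    unfolding one max_ideal_sq_eq[OF P] by simp
  have "inv g = \<one>"
    by (rule fixes_germs_imp_one[OF s(2) P s(1)])
      (rule trivial_on_cotangent_imp_trivial[of "inv g", OF s(3) s(4) s(1) se card triv])
  then show ?thesis using gG by simp
qed

lemma ram_char_inj:
  assumes P: "P \<in> C" and card: "(of_nat (card (carrier G)) :: 'k) \<noteq> 0"
  shows "inj_on (ram_char n C G P) (inertia G P)"
proof (rule inj_onI)
  fix g h assume gh: "g \<in> inertia G P" "h \<in> inertia G P" and eq: "ram_char n C G P g = ram_char n C G P h"
  note S = inertia_subgroup[OF P]
  have ih: "inv h \<in> inertia G P" by (rule subgroup.m_inv_closed[OF S gh(2)])
  have gG: "g \<in> carrier G" "h \<in> carrier G" using gh by (simp_all add: inertia_iff)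
  have "ram_char n C G P (g \<otimes> inv h) = ram_char n C G P (h \<otimes> inv h)"
    by (simp only: ram_char_mult[OF P gh(1) ih] ram_char_mult[OF P gh(2) ih] eq)
  also have "\<dots> = 1" using gG by (simp add: ram_char_one[OF P])
  finally have "g \<otimes> inv h = \<one>"
    by (rule ram_char_eq_one[OF P subgroup.m_closed[OF S gh(1) ih] _ card])
  then show "g = h" using inv_solve_right[OF one_closed gG] gG by simp
qed

lemma inertia_cyclic:
  assumes P: "P \<in> C" and card: "(of_nat (card (carrier G)) :: 'k) \<noteq> 0"
  shows "cyclic_subgroup G (inertia G P)"
proof -
  note S = inertia_subgroup[OF P]
  interpret H: group "G\<lparr>carrier := inertia G P\<rparr>" by (rule subgroup_imp_group[OF S])
  have "\<exists>a\<in>carrier (G\<lparr>carrier := inertia G P\<rparr>). carrier (G\<lparr>carrier := inertia G P\<rparr>) = generate (G\<lparr>carrier := inertia G P\<rparr>) {a}"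
  proof (rule H.cyclic_if_embeds_in_field[of "ram_char n C G P"])
    show "finite (carrier (G\<lparr>carrier := inertia G P\<rparr>))"
      using finite_subset[OF subgroup.subset[OF S] finite_G] by simp
  qed (use ram_char_inj[OF P card] ram_char_mult[OF P] ram_char_one[OF P] in simp_all)
  then obtain a where a: "a \<in> inertia G P" "inertia G P = generate (G\<lparr>carrier := inertia G P\<rparr>) {a}" by auto
  moreover have "generate (G\<lparr>carrier := inertia G P\<rparr>) {a} = generate G {a}"
    by (rule generate_consistent[OF _ S]) (use a(1) in simp)
  ultimately show ?thesis unfolding cyclic_subgroup_def using subgroup.subset[OF S] by blast
qed

lemma inertia_conjugate:
  assumes g: "g \<in> carrier G" and P: "P \<in> C"
  shows "inertia G (g P) = (\<lambda>h. g \<otimes> h \<otimes> inv g) ` inertia G P"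
proof (intro equalityI subsetI)
  fix x assume x: "x \<in> inertia G (g P)"
  then have xG: "x \<in> carrier G" "x (g P) = g P" by (simp_all add: inertia_iff)
  have gP: "g P \<in> C" by (rule image_in_C[OF g P])
  have "(inv g \<otimes> x \<otimes> g) P = P" using g xG P gP by (simp add: mult_apply inv_apply)
  then have mem: "inv g \<otimes> x \<otimes> g \<in> inertia G P" using g xG by (simp add: inertia_iff)
  have "x = g \<otimes> (inv g \<otimes> x \<otimes> g) \<otimes> inv g"
  proof -
    have "g \<otimes> (inv g \<otimes> x \<otimes> g) \<otimes> inv g = (g \<otimes> inv g) \<otimes> x \<otimes> (g \<otimes> inv g)"
      by (simp only: m_assoc m_closed inv_closed g xG(1))
    then show ?thesis using g xG(1) by simp
  qed
  then show "x \<in> (\<lambda>h. g \<otimes> h \<otimes> inv g) ` inertia G P" by (rule image_eqI[OF _ mem])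
next
  fix x assume "x \<in> (\<lambda>h. g \<otimes> h \<otimes> inv g) ` inertia G P"
  then obtain h where h: "x = g \<otimes> h \<otimes> inv g" "h \<in> carrier G" "h P = P" by (auto simp: inertia_iff)
  have gP: "g P \<in> C" by (rule image_in_C[OF g P])
  show "x \<in> inertia G (g P)" using g h P gP by (simp add: inertia_iff mult_apply inv_apply)
qed

end

section \<open>Counting over the branch points\<close>

lemma conjugate_subgroups_sym:
  assumes "group G" and H: "H \<subseteq> carrier G" and c: "conjugate_subgroups G H K"
  shows "conjugate_subgroups G K H"
proof -
  interpret group G by fact
  obtain g where g: "g \<in> carrier G" "K = (\<lambda>h. g \<otimes>\<^bsub>G\<^esub> h \<otimes>\<^bsub>G\<^esub> inv\<^bsub>G\<^esub> g) ` H"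
    using c unfolding conjugate_subgroups_def by blast
  have eq: "inv\<^bsub>G\<^esub> g \<otimes>\<^bsub>G\<^esub> (g \<otimes>\<^bsub>G\<^esub> h \<otimes>\<^bsub>G\<^esub> inv\<^bsub>G\<^esub> g) \<otimes>\<^bsub>G\<^esub> inv\<^bsub>G\<^esub> (inv\<^bsub>G\<^esub> g) = h" if "h \<in> H" for h
  proof -
    have h: "h \<in> carrier G" using that H by blast
    have "inv\<^bsub>G\<^esub> g \<otimes>\<^bsub>G\<^esub> (g \<otimes>\<^bsub>G\<^esub> h \<otimes>\<^bsub>G\<^esub> inv\<^bsub>G\<^esub> g) \<otimes>\<^bsub>G\<^esub> g = (inv\<^bsub>G\<^esub> g \<otimes>\<^bsub>G\<^esub> g) \<otimes>\<^bsub>G\<^esub> h \<otimes>\<^bsub>G\<^esub> (inv\<^bsub>G\<^esub> g \<otimes>\<^bsub>G\<^esub> g)"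
      by (simp only: m_assoc m_closed inv_closed g(1) h)
    then show ?thesis using g(1) h by simp
  qed
  have "H = (\<lambda>h. inv\<^bsub>G\<^esub> g \<otimes>\<^bsub>G\<^esub> h \<otimes>\<^bsub>G\<^esub> inv\<^bsub>G\<^esub> (inv\<^bsub>G\<^esub> g)) ` K"
    unfolding g(2) image_image by (rule sym, rule trans[OF image_cong[OF refl eq] image_ident])
  then show ?thesis unfolding conjugate_subgroups_def using g(1) by blast
qed

lemma conjugate_subgroups_trans:
  assumes "group G" and H: "H \<subseteq> carrier G" and c: "conjugate_subgroups G H K" "conjugate_subgroups G K L"
  shows "conjugate_subgroups G H L"
proof -
  interpret group G by fact
  obtain g where g: "g \<in> carrier G" "K = (\<lambda>h. g \<otimes>\<^bsub>G\<^esub> h \<otimes>\<^bsub>G\<^esub> inv\<^bsub>G\<^esub> g) ` H"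
    using c(1) unfolding conjugate_subgroups_def by blast
  obtain k where k: "k \<in> carrier G" "L = (\<lambda>h. k \<otimes>\<^bsub>G\<^esub> h \<otimes>\<^bsub>G\<^esub> inv\<^bsub>G\<^esub> k) ` K"
    using c(2) unfolding conjugate_subgroups_def by blast
  have eq: "k \<otimes>\<^bsub>G\<^esub> (g \<otimes>\<^bsub>G\<^esub> h \<otimes>\<^bsub>G\<^esub> inv\<^bsub>G\<^esub> g) \<otimes>\<^bsub>G\<^esub> inv\<^bsub>G\<^esub> k = (k \<otimes>\<^bsub>G\<^esub> g) \<otimes>\<^bsub>G\<^esub> h \<otimes>\<^bsub>G\<^esub> inv\<^bsub>G\<^esub> (k \<otimes>\<^bsub>G\<^esub> g)" if "h \<in> H" for h
  proof -
    have h: "h \<in> carrier G" using that H by blast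
    show ?thesis by (simp only: inv_mult_group m_assoc m_closed inv_closed g(1) h k(1))
  qed
  have "L = (\<lambda>h. (k \<otimes>\<^bsub>G\<^esub> g) \<otimes>\<^bsub>G\<^esub> h \<otimes>\<^bsub>G\<^esub> inv\<^bsub>G\<^esub> (k \<otimes>\<^bsub>G\<^esub> g)) ` H"
    unfolding k(2) g(2) image_image by (rule image_cong[OF refl eq])
  then show ?thesis unfolding conjugate_subgroups_def using g(1) k(1) by blast
qed

section \<open>Inner products of induced and local characters\<close>

context finite_group
begin

lemma rep_trace_conj:
  assumes r: "is_rep G \<rho>" and g: "g \<in> carrier G" and x: "x \<in> carrier G"
  shows "rep_trace \<rho> (g \<otimes> x \<otimes> inv g) = rep_trace \<rho> x"
proof -
  note R = is_repD[OF r]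
  have ig: "inv g \<in> carrier G" and gx: "g \<otimes> x \<in> carrier G" using g x by simp_all
  have "rep_trace \<rho> (g \<otimes> x \<otimes> inv g) = mat_trace (\<rho> (inv g) * \<rho> (g \<otimes> x))"
    unfolding rep_trace_eq R(3)[OF gx ig] by (rule mat_trace_mult_comm[OF R(1)[OF gx] R(1)[OF ig]])
  also have "\<rho> (inv g) * \<rho> (g \<otimes> x) = \<rho> (inv g \<otimes> (g \<otimes> x))" by (rule R(3)[OF ig gx, symmetric])
  also have "inv g \<otimes> (g \<otimes> x) = x" using g x by (simp flip: m_assoc)
  finally show ?thesis by (simp add: rep_trace_eq)
qed

text \<open>Conjugation preserves the order of the subgroup and the sum of the character over it,
  and these two determine the dimension of the fixed space.\<close>

lemma fixed_dim_conjugate: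
  fixes \<rho> :: "('g, rat) rep"
  assumes r: "is_rep G \<rho>" and H: "subgroup H G" and K: "subgroup K G" and c: "conjugate_subgroups G H K"
  shows "fixed_dim G \<rho> K = fixed_dim G \<rho> H"
proof -
  obtain g where g: "g \<in> carrier G" "K = (\<lambda>h. g \<otimes> h \<otimes> inv g) ` H"
    using c unfolding conjugate_subgroups_def by blast
  note HG = subgroup.subset[OF H]
  have inj: "inj_on (\<lambda>h. g \<otimes> h \<otimes> inv g) H"
  proof (rule inj_onI)
    fix x y assume "x \<in> H" "y \<in> H" and eq: "g \<otimes> x \<otimes> inv g = g \<otimes> y \<otimes> inv g"
    then have xy: "x \<in> carrier G" "y \<in> carrier G" using HG by blast+
    have "g \<otimes> x = g \<otimes> y" using eq g(1) xy right_cancel[of "inv g" "g \<otimes> x" "g \<otimes> y"] by simp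
    then show "x = y" using g(1) xy by simp
  qed
  have "card K = card H" unfolding g(2) by (rule card_image[OF inj])
  moreover have "(\<Sum>h\<in>K. rep_trace \<rho> h) = (\<Sum>h\<in>H. rep_trace \<rho> h)"
    unfolding g(2) sum.reindex[OF inj] comp_def
    by (rule sum.cong[OF refl]) (rule rep_trace_conj[OF r g(1)], use HG in blast)
  moreover have "card H > 0" using finite_subset[OF HG finite_carrier] subgroup.one_closed[OF H] card_gt_0_iff by blast
  ultimately show ?thesis unfolding sum_trace_subgroup[OF r H] sum_trace_subgroup[OF r K] by simp
qed

text \<open>Frobenius reciprocity without normalisation: after conjugation by a representative all
  cosets contribute the same amount, because \<chi> is a class function.\<close>

lemma induced_inner_product:
  fixes F \<chi> :: "'g \<Rightarrow> 'c::comm_ring_1"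
  assumes H: "H \<subseteq> carrier G" and ts: "distinct ts" "set ts \<subseteq> carrier G"
    and cls: "\<And>g x. g \<in> carrier G \<Longrightarrow> x \<in> carrier G \<Longrightarrow> \<chi> (g \<otimes> x \<otimes> inv g) = \<chi> x"
  shows "(\<Sum>g\<in>carrier G. (\<Sum>t\<in>set ts. if inv t \<otimes> g \<otimes> t \<in> H then F (inv t \<otimes> g \<otimes> t) else 0) * \<chi> (inv g)) =
    of_nat (length ts) * (\<Sum>h\<in>H. F h * \<chi> (inv h))"
proof -
  have one: "(\<Sum>g\<in>carrier G. (if inv t \<otimes> g \<otimes> t \<in> H then F (inv t \<otimes> g \<otimes> t) else 0) * \<chi> (inv g)) = (\<Sum>h\<in>H. F h * \<chi> (inv h))"
    if t: "t \<in> carrier G" for t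
  proof -
    let ?c = "\<lambda>x. t \<otimes> x \<otimes> inv t"
    have back_eq: "inv t \<otimes> ?c x \<otimes> t = x" if x: "x \<in> carrier G" for x
    proof -
      have "inv t \<otimes> ?c x \<otimes> t = (inv t \<otimes> t) \<otimes> x \<otimes> (inv t \<otimes> t)" by (simp only: m_assoc m_closed inv_closed t x)
      then show ?thesis using t x by simp
    qed
    have forth_eq: "?c (inv t \<otimes> x \<otimes> t) = x" if x: "x \<in> carrier G" for x
    proof -
      have "?c (inv t \<otimes> x \<otimes> t) = (t \<otimes> inv t) \<otimes> x \<otimes> (t \<otimes> inv t)" by (simp only: m_assoc m_closed inv_closed t x)
      then show ?thesis using t x by simp
    qed
    have bij: "bij_betw ?c (carrier G) (carrier G)"
      by (rule bij_betwI[where g = "\<lambda>x. inv t \<otimes> x \<otimes> t"]) (use t back_eq forth_eq in auto)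
    have inv_c: "\<chi> (inv (?c x)) = \<chi> (inv x)" if x: "x \<in> carrier G" for x
    proof -
      have "inv (?c x) = t \<otimes> inv x \<otimes> inv t" using t x by (simp add: inv_mult_group m_assoc)
      then show ?thesis using cls[OF t] x by simp
    qed
    have "(\<Sum>g\<in>carrier G. (if inv t \<otimes> g \<otimes> t \<in> H then F (inv t \<otimes> g \<otimes> t) else 0) * \<chi> (inv g)) =
        (\<Sum>x\<in>carrier G. (if x \<in> H then F x else 0) * \<chi> (inv x))"
      by (subst sum.reindex_bij_betw[OF bij, symmetric]) (intro sum.cong refl, simp only: back_eq inv_c)
    also have "\<dots> = (\<Sum>x\<in>carrier G. if x \<in> H then F x * \<chi> (inv x) else 0)" by (intro sum.cong) auto
    also have "\<dots> = (\<Sum>x\<in>carrier G \<inter> H. F x * \<chi> (inv x))"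
      using sum.inter_restrict[OF finite_carrier, of "\<lambda>x. F x * \<chi> (inv x)" H] by simp
    also have "carrier G \<inter> H = H" using H by blast
    finally show ?thesis .
  qed
  have "(\<Sum>g\<in>carrier G. (\<Sum>t\<in>set ts. if inv t \<otimes> g \<otimes> t \<in> H then F (inv t \<otimes> g \<otimes> t) else 0) * \<chi> (inv g)) =
    (\<Sum>t\<in>set ts. \<Sum>g\<in>carrier G. (if inv t \<otimes> g \<otimes> t \<in> H then F (inv t \<otimes> g \<otimes> t) else 0) * \<chi> (inv g))"
    unfolding sum_distrib_right by (rule sum.swap)
  also have "\<dots> = (\<Sum>t\<in>set ts. (\<Sum>h\<in>H. F h * \<chi> (inv h)))"
    by (rule sum.cong[OF refl one]) (use ts(2) in blast)
  also have "\<dots> = of_nat (length ts) * (\<Sum>h\<in>H. F h * \<chi> (inv h))"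
    using distinct_card[OF ts(1)] by simp
  finally show ?thesis .
qed

end

lemma sum_list_concat_replicate_upt:
  fixes f :: "nat \<Rightarrow> 'c::semiring_1"
  shows "(\<Sum>l\<leftarrow>concat (map (\<lambda>l. replicate l l) [1..<e]). f l) = (\<Sum>l\<in>{1..<e}. of_nat l * f l)"
proof -
  have "(\<Sum>l\<leftarrow>concat (map (\<lambda>l. replicate l l) xs). f l) = (\<Sum>l\<leftarrow>xs. of_nat l * f l)" for xs
    by (induction xs) (simp_all add: sum_list_replicate)
  then show ?thesis by (simp add: sum_list_distinct_conv_sum_set)
qed

text \<open>As \<open>w\<close> is the inverse of \<open>z\<close>, the substitution of
  \<open>e - l\<close> for \<open>l\<close> turns the second sum into the sum of
  \<open>(e - l) z^l\<close>. The total is \<open>e\<close> times the sum of \<open>z^l\<close> over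
  \<open>0 < l < e\<close>, which is \<open>-1\<close>.\<close>

lemma sum_weighted_roots:
  fixes z w :: "'c::field_char_0"
  assumes z: "z ^ e = 1" "z \<noteq> 1" and zw: "z * w = 1" and e: "e > 0"
  shows "(\<Sum>l\<in>{1..<e}. of_nat l * z ^ l) + (\<Sum>l\<in>{1..<e}. of_nat l * w ^ l) = - of_nat e"
proof -
  have "(z - 1) * (\<Sum>l<e. z ^ l) = z ^ e - 1" by (rule power_diff_1_eq[symmetric])
  then have "(\<Sum>l<e. z ^ l) = 0" using z by simp
  moreover have "{..<e} = insert 0 {1..<e}" using e by auto
  ultimately have s: "(\<Sum>l\<in>{1..<e}. z ^ l) = - 1" by (simp add: add_eq_0_iff)
  have wz: "w ^ (e - l) = z ^ l" if "l < e" for l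
  proof -
    have "z ^ l * z ^ (e - l) = 1" using that z(1) by (simp flip: power_add)
    moreover have "z ^ (e - l) * w ^ (e - l) = 1" using zw by (simp flip: power_mult_distrib)
    ultimately show ?thesis by (metis mult.assoc mult.commute mult_1)
  qed
  have "(\<Sum>l\<in>{1..<e}. of_nat l * w ^ l) = (\<Sum>l\<in>{1..<e}. of_nat (e - l) * w ^ (e - l))"
    using sum.atLeastLessThan_rev[of "\<lambda>l. of_nat l * w ^ l" 1 e] by simp
  also have "\<dots> = (\<Sum>l\<in>{1..<e}. of_nat (e - l) * z ^ l)" by (intro sum.cong) (simp_all add: wz)
  also have "\<dots> = of_nat e * (\<Sum>l\<in>{1..<e}. z ^ l) - (\<Sum>l\<in>{1..<e}. of_nat l * z ^ l)"
    unfolding sum_distrib_left sum_subtractf[symmetric] by (intro sum.cong) (auto simp: of_nat_diff left_diff_distrib)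
  finally show ?thesis unfolding s by simp
qed

context finite_group_root_lift
begin

text \<open>The factor 2 comes from adding the sum to its own reindexing under inversion, which
  leaves \<chi> unchanged and pairs each root of unity with its inverse.\<close>

lemma local_inner_product:
  fixes \<chi> :: "'g \<Rightarrow> 'c"
  assumes H: "subgroup H G" and hom: "\<And>x y. x \<in> H \<Longrightarrow> y \<in> H \<Longrightarrow> \<psi> (x \<otimes> y) = \<psi> x * \<psi> y"
    and one: "\<psi> \<one> = 1" and inj\<psi>: "inj_on \<psi> H"
    and inv\<chi>: "\<And>h. h \<in> H \<Longrightarrow> \<chi> (inv h) = \<chi> h"
  shows "2 * (\<Sum>h\<in>H. (\<Sum>l\<in>{1..<card H}. of_nat l * \<iota> (\<psi> h) ^ l) * \<chi> (inv h)) =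
    of_nat (card H) * (of_nat (card H) * \<chi> \<one> - (\<Sum>h\<in>H. \<chi> h))"
proof -
  let ?e = "card H"
  let ?F = "\<lambda>h. \<Sum>l\<in>{1..<?e}. of_nat l * \<iota> (\<psi> h) ^ l"
  have finH: "finite H" by (rule finite_subset[OF subgroup.subset[OF H] finite_carrier])
  have oneH: "\<one> \<in> H" by (rule subgroup.one_closed[OF H])
  have e: "?e > 0" using finH oneH card_gt_0_iff by blast
  have root_e: "\<psi> h ^ ?e = 1" and root_N: "\<psi> h ^ card (carrier G) = 1" if "h \<in> H" for h
    using hom_root_of_unity[of H \<psi> h, OF H hom one that] by blast+
  have Hinv: "h \<in> H \<Longrightarrow> inv h \<in> H" for h by (rule subgroup.m_inv_closed[OF H])
  have pair: "?F h + ?F (inv h) = - of_nat ?e" if h: "h \<in> H" "h \<noteq> \<one>" for h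
  proof (rule sum_weighted_roots[OF _ _ _ e])
    have hG: "h \<in> carrier G" using subgroup.subset[OF H] h(1) by blast
    show "\<iota> (\<psi> h) ^ ?e = 1" using \<iota>_power[OF root_N[OF h(1)], of ?e] root_e[OF h(1)] \<iota>_one by simp
    have "\<psi> h \<noteq> \<psi> \<one>" using inj_onD[OF inj\<psi> _ h(1) oneH] h(2) by blast
    then show "\<iota> (\<psi> h) \<noteq> 1"
      using inj_onD[OF inj, of "\<psi> h" 1] root_N[OF h(1)] \<iota>_one one by auto
    have "\<iota> (\<psi> h) * \<iota> (\<psi> (inv h)) = \<iota> (\<psi> h * \<psi> (inv h))"
      by (rule mult[OF root_N[OF h(1)] root_N[OF Hinv[OF h(1)]], symmetric])
    also have "\<psi> h * \<psi> (inv h) = 1" using hom[OF h(1) Hinv[OF h(1)]] hG one by simp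
    finally show "\<iota> (\<psi> h) * \<iota> (\<psi> (inv h)) = 1" by (simp add: \<iota>_one)
  qed
  have F1: "2 * ?F \<one> = of_nat ?e * of_nat ?e - of_nat ?e"
  proof -
    have "2 * (\<Sum>l\<in>{1..<k}. of_nat l) = of_nat k * of_nat k - (of_nat k :: 'c)" for k
      by (induction k) (simp_all add: algebra_simps)
    then show ?thesis by (simp add: one \<iota>_one)
  qed
  have bij: "bij_betw (\<lambda>h. inv h) H H"
    by (rule bij_betwI[where g = "\<lambda>h. inv h"]) (use Hinv subgroup.subset[OF H] in auto)
  let ?S = "\<Sum>h\<in>H. ?F h * \<chi> (inv h)"
  have inv_inv_H: "inv (inv h) = h" if "h \<in> H" for h using subgroup.subset[OF H] that by auto
  have "?S = (\<Sum>h\<in>H. ?F (inv h) * \<chi> (inv (inv h)))"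
    by (rule sum.reindex_bij_betw[OF bij, of "\<lambda>h. ?F h * \<chi> (inv h)", symmetric])
  also have "\<dots> = (\<Sum>h\<in>H. ?F (inv h) * \<chi> h)" by (rule sum.cong[OF refl]) (simp only: inv_inv_H)
  finally have S1: "?S = (\<Sum>h\<in>H. ?F (inv h) * \<chi> h)" .
  have S2: "?S = (\<Sum>h\<in>H. ?F h * \<chi> h)" by (rule sum.cong[OF refl]) (simp only: inv\<chi>)
  have "2 * ?S = ?S + ?S" by (rule mult_2)
  also have "\<dots> = (\<Sum>h\<in>H. ?F h * \<chi> h) + (\<Sum>h\<in>H. ?F (inv h) * \<chi> h)"
    by (rule arg_cong2[where f = "(+)", OF S2 S1])
  also have "\<dots> = (\<Sum>h\<in>H. (?F h + ?F (inv h)) * \<chi> h)"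
    by (simp only: distrib_right sum.distrib)
  also have "\<dots> = (?F \<one> + ?F (inv \<one>)) * \<chi> \<one> + (\<Sum>h\<in>H - {\<one>}. (?F h + ?F (inv h)) * \<chi> h)"
    by (rule sum.remove[OF finH oneH, of "\<lambda>h. (?F h + ?F (inv h)) * \<chi> h"])
  also have "(\<Sum>h\<in>H - {\<one>}. (?F h + ?F (inv h)) * \<chi> h) = (\<Sum>h\<in>H - {\<one>}. - of_nat ?e * \<chi> h)"
  proof (rule sum.cong[OF refl])
    fix h assume "h \<in> H - {\<one>}"
    then have "h \<in> H" "h \<noteq> \<one>" by auto
    from pair[OF this] show "(?F h + ?F (inv h)) * \<chi> h = - of_nat ?e * \<chi> h" by (rule arg_cong[where f = "\<lambda>x. x * \<chi> h"])
  qed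
  also have "\<dots> = - of_nat ?e * ((\<Sum>h\<in>H. \<chi> h) - \<chi> \<one>)"
    by (simp only: sum_distrib_left[symmetric] sum.remove[OF finH oneH, of \<chi>] add_diff_cancel_left')
  also have "?F \<one> + ?F (inv \<one>) = of_nat ?e * of_nat ?e - of_nat ?e"
    unfolding inv_one mult_2[symmetric] by (rule F1)
  finally show ?thesis by (simp add: algebra_simps)
qed

end

lemma brauer_char_direct_sum:
  fixes \<rho>s :: "('g, 'k::field) rep list"
  assumes "\<forall>\<rho>\<in>set \<rho>s. square_rep G \<rho>" and g: "g \<in> carrier G"
  shows "brauer_char \<iota> (rep_direct_sum \<rho>s) g = (\<Sum>\<rho>\<leftarrow>\<rho>s. brauer_char \<iota> \<rho> g)"
  using assms(1)
proof (induction \<rho>s)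
  case Nil
  have "char_poly (0\<^sub>m 0 0 :: 'k mat) = 1" by (simp add: char_poly_def char_poly_matrix_def)
  then show ?case by (simp add: brauer_char_lift_roots rep_direct_sum_Nil)
next
  case (Cons \<rho> \<rho>s)
  have c: "\<rho> g \<in> carrier_mat (rep_dim G \<rho>) (rep_dim G \<rho>)"
      "rep_direct_sum \<rho>s g \<in> carrier_mat (rep_dim G (rep_direct_sum \<rho>s)) (rep_dim G (rep_direct_sum \<rho>s))"
    using Cons.prems by (auto intro!: square_repD[OF _ g] square_rep_direct_sum)
  have "brauer_char \<iota> (rep_direct_sum (\<rho> # \<rho>s)) g = brauer_char \<iota> \<rho> g + brauer_char \<iota> (rep_direct_sum \<rho>s) g"
    unfolding brauer_char_lift_roots rep_direct_sum_Cons char_poly_blk[OF c]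
    by (rule lift_roots_mult[OF char_poly_nonzero[OF c(1)] char_poly_nonzero[OF c(2)]])
  then show ?case using Cons by simp
qed

lemma brauer_char_iso:
  fixes \<rho> \<sigma> :: "('g, 'k::field) rep"
  assumes "square_rep G \<rho>" "square_rep G \<sigma>" "rep_iso G \<rho> \<sigma>" "g \<in> carrier G"
  shows "brauer_char \<iota> \<rho> g = brauer_char \<iota> \<sigma> g"
  unfolding brauer_char_lift_roots using char_poly_similar[OF rep_iso_trace(2)[OF assms]] by simp

lemma square_rep_induced: "square_rep G (induced_rep G H \<sigma>)"
  unfolding square_rep_def by (simp add: induced_rep_def rep_dim_def Let_def)

section \<open>The ramification module paired with rational characters\<close>

locale tame_curve_group = curve_group n C G for n and C :: "'k::alg_closed_field point set" and G (structure) +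
  fixes \<iota> :: "'k \<Rightarrow> rat alg_closure"
  assumes tame: "CHAR('k) = 0 \<or> \<not> CHAR('k) dvd card (carrier G)"
    and roots: "root_identification (card (carrier G)) \<iota>"
begin

abbreviation "ind P \<equiv> induced_rep G (inertia G P) (local_ram_rep n C G P)"

lemma card_nonzero: "card (carrier G) > 0" "(of_nat (card (carrier G)) :: 'k) \<noteq> 0"
proof -
  show pos: "card (carrier G) > 0" using finite_G one_closed card_gt_0_iff by blast
  then show "(of_nat (card (carrier G)) :: 'k) \<noteq> 0"
    using tame by (auto simp: of_nat_eq_0_iff_char_dvd)
qed

sublocale lift: finite_group_root_lift G \<iota>
proof unfold_locales
  have bij: "bij_betw \<iota> {x. x ^ card (carrier G) = 1} {z. z ^ card (carrier G) = 1}"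
    and mult: "\<And>x y. x ^ card (carrier G) = 1 \<Longrightarrow> y ^ card (carrier G) = 1 \<Longrightarrow> \<iota> (x * y) = \<iota> x * \<iota> y"
    using roots unfolding root_identification_def by blast+
  show "inj_on \<iota> {x. x ^ card (carrier G) = 1}" by (rule bij_betw_imp_inj_on[OF bij])
  show "\<iota> x ^ card (carrier G) = 1" if "x ^ card (carrier G) = 1" for x
    using bij_betwE[OF bij] that by blast
  show "\<iota> (x * y) = \<iota> x * \<iota> y" if "x ^ card (carrier G) = 1" "y ^ card (carrier G) = 1" for x y
    by (rule mult[OF that])
qed (use finite_G card_nonzero in auto)

lemma local_ram_rep_eq:
  "local_ram_rep n C G P = diag_rep (ram_char n C G P) (concat (map (\<lambda>l. replicate l l) [1..<card (inertia G P)]))"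
  unfolding local_ram_rep_def diag_rep_eq[symmetric] by (simp add: map_concat o_def)

lemma brauer_char_ind:
  assumes P: "P \<in> C" and g: "g \<in> carrier G"
  shows "brauer_char \<iota> (ind P) g = (\<Sum>t\<in>set (coset_reps G (inertia G P)).
    if inv t \<otimes> g \<otimes> t \<in> inertia G P
    then \<Sum>l\<in>{1..<card (inertia G P)}. of_nat l * \<iota> (ram_char n C G P (inv t \<otimes> g \<otimes> t)) ^ l else 0)"
  unfolding brauer_char_lift_roots local_ram_rep_eq sum_list_concat_replicate_upt[symmetric]
  by (rule lift.brauer_char_induced[where \<psi> = "ram_char n C G P", OF inertia_subgroup[OF P] ram_char_mult[OF P] ram_char_one[OF P] g])

text \<open>The index of the inertia group from Frobenius reciprocity and one factor
  \<open>e\<close> from the local computation multiply to \<open>|G|\<close>. The other factor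
  \<open>e\<close> remains and later cancels against the size of the orbit.\<close>

lemma ind_inner_product:
  fixes V :: "('k point \<Rightarrow> 'k point, rat) rep"
  assumes P: "P \<in> C" and V: "is_rep G V"
  shows "2 * (\<Sum>g\<in>carrier G. brauer_char \<iota> (ind P) g * to_ac (rep_trace V (inv g))) =
    of_nat (card (carrier G)) * to_ac (of_nat (card (inertia G P)) * (of_nat (rep_dim G V) - of_nat (fixed_dim G V (inertia G P))))"
proof -
  let ?H = "inertia G P" and ?\<chi> = "\<lambda>g. to_ac (rep_trace V g)"
  let ?e = "card ?H" and ?ts = "coset_reps G (inertia G P)"
  let ?F = "\<lambda>h. \<Sum>l\<in>{1..<?e}. of_nat l * \<iota> (ram_char n C G P h) ^ l"
  note S = inertia_subgroup[OF P]
  note SG = subgroup.subset[OF S]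
  have "(\<Sum>g\<in>carrier G. brauer_char \<iota> (ind P) g * ?\<chi> (inv g)) =
      (\<Sum>g\<in>carrier G. (\<Sum>t\<in>set ?ts. if inv t \<otimes> g \<otimes> t \<in> ?H then ?F (inv t \<otimes> g \<otimes> t) else 0) * ?\<chi> (inv g))"
    by (rule sum.cong[OF refl]) (simp only: brauer_char_ind[OF P])
  also have "\<dots> = of_nat (length ?ts) * (\<Sum>h\<in>?H. ?F h * ?\<chi> (inv h))"
    by (rule lift.induced_inner_product[OF SG lift.coset_reps(1)[OF S] lift.coset_reps(2)[OF S]])
      (simp only: lift.rep_trace_conj[OF V])
  finally have A: "(\<Sum>g\<in>carrier G. brauer_char \<iota> (ind P) g * ?\<chi> (inv g)) =
      of_nat (length ?ts) * (\<Sum>h\<in>?H. ?F h * ?\<chi> (inv h))" .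
  have "2 * (\<Sum>h\<in>?H. ?F h * ?\<chi> (inv h)) = of_nat ?e * (of_nat ?e * ?\<chi> \<one> - (\<Sum>h\<in>?H. ?\<chi> h))"
    by (rule lift.local_inner_product[OF S ram_char_mult[OF P] ram_char_one[OF P] ram_char_inj[OF P card_nonzero(2)]])
      (use lift.rat_trace_inv[OF V] SG in auto)
  also have "(\<Sum>h\<in>?H. ?\<chi> h) = to_ac (of_nat ?e * of_nat (fixed_dim G V ?H))"
    unfolding to_ac_sum[symmetric] lift.sum_trace_subgroup[OF V S] ..
  also have "?\<chi> \<one> = of_nat (rep_dim G V)"
    using lift.is_repD(2)[OF V] by (simp add: lift.rep_trace_eq mat_trace_one)
  finally have B: "2 * (\<Sum>h\<in>?H. ?F h * ?\<chi> (inv h)) =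
      of_nat ?e * (of_nat ?e * (of_nat (rep_dim G V) - of_nat (fixed_dim G V ?H)))"
    by (simp add: algebra_simps)
  have "2 * (\<Sum>g\<in>carrier G. brauer_char \<iota> (ind P) g * ?\<chi> (inv g)) = of_nat (length ?ts) * (2 * (\<Sum>h\<in>?H. ?F h * ?\<chi> (inv h)))"
    unfolding A by (rule mult.left_commute)
  also have "\<dots> = of_nat (length ?ts * ?e) * (of_nat ?e * (of_nat (rep_dim G V) - of_nat (fixed_dim G V ?H)))"
    unfolding B by (simp only: of_nat_mult mult.assoc)
  finally show ?thesis unfolding lift.length_coset_reps[OF S] by simp
qed

lemma brauer_char_ramification_module:
  assumes \<Gamma>: "is_ramification_module n C G \<Gamma>t" and g: "g \<in> carrier G"
  shows "of_nat (card (carrier G)) * brauer_char \<iota> \<Gamma>t g = (\<Sum>P\<in>ramified_points G C. brauer_char \<iota> (ind P) g)"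
proof -
  have rep: "is_rep G \<Gamma>t" and iso: "rep_iso G (gamma_rep n C G) (rep_direct_sum (replicate (card (carrier G)) \<Gamma>t))"
    using \<Gamma> unfolding is_ramification_module_def by blast+
  let ?Ps = "SOME Ps. distinct Ps \<and> set Ps = ramified_points G C"
  have Ps: "distinct ?Ps \<and> set ?Ps = ramified_points G C"
    by (rule someI_ex) (use finite_distinct_list[OF finite_ramified] in blast)
  have sq: "square_rep G (gamma_rep n C G)" unfolding gamma_rep_def
    by (rule square_rep_direct_sum) (auto intro: square_rep_induced)
  have sqr: "\<forall>\<rho>\<in>set (replicate (card (carrier G)) \<Gamma>t). square_rep G \<rho>" using is_rep_square[OF rep] by simp
  have "of_nat (card (carrier G)) * brauer_char \<iota> \<Gamma>t g = brauer_char \<iota> (rep_direct_sum (replicate (card (carrier G)) \<Gamma>t)) g"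
    unfolding brauer_char_direct_sum[OF sqr g] by (simp add: sum_list_replicate)
  also have "\<dots> = brauer_char \<iota> (gamma_rep n C G) g"
    by (rule brauer_char_iso[OF sq square_rep_direct_sum[OF sqr] iso g, symmetric])
  also have "\<dots> = (\<Sum>\<rho>\<leftarrow>map ind ?Ps. brauer_char \<iota> \<rho> g)" unfolding gamma_rep_def
    by (rule brauer_char_direct_sum[OF _ g]) (auto intro: square_rep_induced)
  also have "\<dots> = (\<Sum>P\<in>ramified_points G C. brauer_char \<iota> (ind P) g)"
    using sum_list_distinct_conv_sum_set[of ?Ps "\<lambda>P. brauer_char \<iota> (ind P) g"] Ps by (simp add: o_def)
  finally show ?thesis .
qed

text \<open>Brauer characters take values in the algebraic closure of the rationals, so the identity
  is proved there, multiplied by \<open>|G|\<close> to replace the module by the explicit sum over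
  ramified points. Cancelling \<open>|G|\<close> and injectivity of \<open>to_ac\<close> bring it
  back to the rationals.\<close>

lemma ramification_inner_product:
  fixes U V :: "('k point \<Rightarrow> 'k point, rat) rep"
  assumes \<Gamma>: "is_ramification_module n C G \<Gamma>t" and U: "has_rational_structure G \<iota> \<Gamma>t U" and V: "is_rep G V"
  shows "2 * (\<Sum>g\<in>carrier G. rep_trace U g * rep_trace V (inv g)) =
    (\<Sum>P\<in>ramified_points G C. of_nat (card (inertia G P)) * (of_nat (rep_dim G V) - of_nat (fixed_dim G V (inertia G P))))"
    (is "2 * ?S = ?R")
proof -
  let ?N = "of_nat (card (carrier G)) :: rat alg_closure" and ?\<chi> = "\<lambda>g. to_ac (rep_trace V (inv g))"
  have tU: "to_ac (rep_trace U g) = brauer_char \<iota> \<Gamma>t g" if "g \<in> carrier G" for g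
    using U that unfolding has_rational_structure_def by blast
  have "?N * to_ac (2 * ?S) = 2 * (\<Sum>g\<in>carrier G. (?N * brauer_char \<iota> \<Gamma>t g) * ?\<chi> g)"
    by (simp add: to_ac_sum tU sum_distrib_left mult_ac)
  also have "\<dots> = 2 * (\<Sum>g\<in>carrier G. \<Sum>P\<in>ramified_points G C. brauer_char \<iota> (ind P) g * ?\<chi> g)"
    by (simp only: brauer_char_ramification_module[OF \<Gamma>] sum_distrib_right cong: sum.cong)
  also have "\<dots> = (\<Sum>P\<in>ramified_points G C. 2 * (\<Sum>g\<in>carrier G. brauer_char \<iota> (ind P) g * ?\<chi> g))"
    by (subst sum.swap) (rule sum_distrib_left)
  also have "\<dots> = (\<Sum>P\<in>ramified_points G C. ?N * to_ac (of_nat (card (inertia G P)) * (of_nat (rep_dim G V) - of_nat (fixed_dim G V (inertia G P)))))"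
    by (rule sum.cong[OF refl], rule ind_inner_product[OF _ V]) (simp add: ramified_points_def)
  also have "\<dots> = ?N * to_ac ?R" unfolding to_ac_sum sum_distrib_left ..
  finally have eq: "?N * to_ac (2 * ?S) = ?N * to_ac ?R" .
  have "?N \<noteq> 0" unfolding of_nat_eq_0_iff using card_nonzero(1) by (rule less_imp_neq[symmetric])
  from mult_left_cancel[OF this, THEN iffD1, OF eq] have "to_ac (2 * ?S) = to_ac ?R" .
  then show ?thesis by (simp only: to_ac_eq_iff)
qed

lemma orbit_points:
  assumes y: "y \<in> orbits G C (\<lambda>g. g)"
  shows "y \<subseteq> C" "y \<noteq> {}" and "P \<in> y \<Longrightarrow> y = orbit G (\<lambda>g. g) P"
proof -
  obtain P0 where P0: "P0 \<in> C" "y = orbit G (\<lambda>g. g) P0" using y unfolding orbits_def by blast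
  show yC: "y \<subseteq> C" using P0 image_in_C by (auto simp: orbit_def)
  show "y \<noteq> {}" using act.orbit_refl[OF P0(1)] P0(2) by blast
  assume Py: "P \<in> y"
  then have P: "P \<in> C" using yC by blast
  have P': "P \<in> orbit G (\<lambda>g. g) P0" using Py P0(2) by simp
  show "y = orbit G (\<lambda>g. g) P"
  proof (intro equalityI subsetI)
    fix Q assume Q: "Q \<in> y"
    show "Q \<in> orbit G (\<lambda>g. g) P"
      by (rule act.orbit_trans[OF P P0(1) _ act.orbit_sym[OF P0(1) P P']]) (use Q yC P0(2) in auto)
  next
    fix Q assume Q: "Q \<in> orbit G (\<lambda>g. g) P"
    then have "Q \<in> C" using P image_in_C by (auto simp: orbit_def)
    then show "Q \<in> y" unfolding P0(2) by (rule act.orbit_trans[OF P0(1) P _ P' Q])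
  qed
qed

lemma orbit_inertia_conjugate:
  assumes y: "y \<in> orbits G C (\<lambda>g. g)" and P: "P \<in> y" and Q: "Q \<in> y"
  shows "conjugate_subgroups G (inertia G P) (inertia G Q)"
proof -
  have "Q \<in> orbit G (\<lambda>g. g) P" using orbit_points(3)[OF y P] Q by simp
  then obtain g where g: "g \<in> carrier G" "Q = g P" unfolding orbit_def by blast
  have "P \<in> C" using orbit_points(1)[OF y] P by blast
  then show ?thesis unfolding conjugate_subgroups_def g(2) using inertia_conjugate[OF g(1)] g(1) by blast
qed

lemma orbit_inertia_trivial:
  assumes y: "y \<in> orbits G C (\<lambda>g. g)" and P: "P \<in> y" and Q: "Q \<in> y" and "inertia G P = {\<one>}"
  shows "inertia G Q = {\<one>}"
proof -
  obtain g where g: "g \<in> carrier G" "inertia G Q = (\<lambda>h. g \<otimes> h \<otimes> inv g) ` inertia G P"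
    using orbit_inertia_conjugate[OF y P Q] unfolding conjugate_subgroups_def by blast
  then show ?thesis using assms(4) by simp
qed

text \<open>The points are grouped first by orbits and then by the conjugacy class of their inertia
  groups. Since inertia groups are cyclic, every branch point falls into exactly one of the
  \<open>M\<close> classes.\<close>

lemma sum_ramified_points:
  fixes \<phi> :: "('k point \<Rightarrow> 'k point) set \<Rightarrow> rat"
  assumes H: "cyclic_representatives G M H"
    and conj: "\<And>K L. subgroup K G \<Longrightarrow> subgroup L G \<Longrightarrow> conjugate_subgroups G K L \<Longrightarrow> \<phi> L = \<phi> K"
  shows "(\<Sum>P\<in>ramified_points G C. of_nat (card (inertia G P)) * \<phi> (inertia G P)) =
    of_nat (card (carrier G)) * (\<Sum>l\<in>{1..M}. \<phi> (H l) * of_nat (num_branch_points G C (H l)))"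
proof -
  let ?B = "branch_points G C"
  \<comment> \<open>For trivial \<open>H l\<close> this set is empty, because inertia groups over a
    branch point are nontrivial. The trivial subgroup thus needs no separate treatment.\<close>
  define B where "B l = {y \<in> ?B. \<forall>P\<in>y. conjugate_subgroups G (inertia G P) (H l)}" for l
  have orb: "y \<in> orbits G C (\<lambda>g. g)" if "y \<in> ?B" for y using that by (simp add: branch_points_def)
  have Hcyc: "cyclic_subgroup G (H l)" if "l \<in> {1..M}" for l using H that unfolding cyclic_representatives_def by blast
  have Huniq: "i = l" if "i \<in> {1..M}" "l \<in> {1..M}" "conjugate_subgroups G (H i) (H l)" for i l
    using H that unfolding cyclic_representatives_def by blast
  have Hex: "\<exists>l\<in>{1..M}. conjugate_subgroups G K (H l)" if "cyclic_subgroup G K" for K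
    using H that unfolding cyclic_representatives_def by blast
  have Hsub: "subgroup (H l) G" if l: "l \<in> {1..M}" for l
  proof -
    obtain a where "a \<in> carrier G" "H l = generate G {a}" using Hcyc[OF l] unfolding cyclic_subgroup_def by blast
    then show ?thesis using generate_is_subgroup[of "{a}"] by simp
  qed
  have I_sub: "inertia G P \<subseteq> carrier G" for P by (auto simp: inertia_iff)
  have ram: "ramified_points G C = \<Union>?B"
  proof (intro equalityI subsetI)
    fix P assume "P \<in> ramified_points G C"
    then have P: "P \<in> C" "inertia G P \<noteq> {\<one>}" by (simp_all add: ramified_points_def)
    let ?y = "orbit G (\<lambda>g. g) P"
    have y: "?y \<in> orbits G C (\<lambda>g. g)" unfolding orbits_def using P(1) by blast
    have Py: "P \<in> ?y" by (rule act.orbit_refl[OF P(1)])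
    have "\<forall>Q\<in>?y. inertia G Q \<noteq> {\<one>}" using orbit_inertia_trivial[OF y _ Py] P(2) by blast
    then have "?y \<in> ?B" using y by (simp add: branch_points_def)
    then show "P \<in> \<Union>?B" using Py by blast
  next
    fix P assume "P \<in> \<Union>?B"
    then obtain y where y: "y \<in> ?B" "P \<in> y" by blast
    then show "P \<in> ramified_points G C" using orbit_points(1)[OF orb[OF y(1)]] by (auto simp: branch_points_def ramified_points_def)
  qed
  have fin_y: "finite y" if "y \<in> ?B" for y
    using finite_ramified that unfolding ram by (meson Union_upper finite_subset)
  have finB: "finite ?B" using finite_ramified unfolding ram by (rule finite_UnionD)
  have disj: "\<forall>y\<in>?B. \<forall>z\<in>?B. y \<noteq> z \<longrightarrow> y \<inter> z = {}"
  proof (intro ballI impI, rule ccontr)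
    fix y z assume yz: "y \<in> ?B" "z \<in> ?B" "y \<noteq> z" "y \<inter> z \<noteq> {}"
    then obtain P where "P \<in> y" "P \<in> z" by blast
    then show False using orbit_points(3)[OF orb[OF yz(1)]] orbit_points(3)[OF orb[OF yz(2)]] yz(3) by blast
  qed
  have finBl: "finite (B l)" for l using finB unfolding B_def by simp
  have BU: "?B = (\<Union>l\<in>{1..M}. B l)"
  proof (intro equalityI subsetI)
    fix y assume y: "y \<in> ?B"
    obtain P where P: "P \<in> y" using orbit_points(2)[OF orb[OF y]] by blast
    have "P \<in> C" using orbit_points(1)[OF orb[OF y]] P by blast
    from Hex[OF inertia_cyclic[OF this card_nonzero(2)]] obtain l where l: "l \<in> {1..M}" "conjugate_subgroups G (inertia G P) (H l)" by blast
    have "conjugate_subgroups G (inertia G Q) (H l)" if "Q \<in> y" for Q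
      by (rule conjugate_subgroups_trans[OF group_G I_sub orbit_inertia_conjugate[OF orb[OF y] that P] l(2)])
    then show "y \<in> (\<Union>l\<in>{1..M}. B l)" using l(1) y unfolding B_def by blast
  qed (auto simp: B_def)
  have Bdisj: "\<forall>i\<in>{1..M}. \<forall>l\<in>{1..M}. i \<noteq> l \<longrightarrow> B i \<inter> B l = {}"
  proof (intro ballI impI, rule ccontr)
    fix i l assume il: "i \<in> {1..M}" "l \<in> {1..M}" "i \<noteq> l" "B i \<inter> B l \<noteq> {}"
    then obtain y where y: "y \<in> B i" "y \<in> B l" by blast
    then have "y \<in> ?B" by (simp add: B_def)
    then obtain P where P: "P \<in> y" using orbit_points(2)[OF orb] by blast
    have "conjugate_subgroups G (inertia G P) (H i)" "conjugate_subgroups G (inertia G P) (H l)"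
      using y P unfolding B_def by blast+
    from conjugate_subgroups_trans[OF group_G subgroup.subset[OF Hsub[OF il(1)]] conjugate_subgroups_sym[OF group_G I_sub this(1)] this(2)]
    show False using Huniq[OF il(1,2)] il(3) by blast
  qed
  have sum_y: "(\<Sum>P\<in>y. of_nat (card (inertia G P)) * \<phi> (inertia G P)) = of_nat (card (carrier G)) * \<phi> (H l)"
    if l: "l \<in> {1..M}" and y: "y \<in> B l" for y l
  proof -
    have yB: "y \<in> ?B" using y by (simp add: B_def)
    note yo = orb[OF yB]
    \<comment> \<open>By the orbit-stabiliser theorem each of the \<open>card y\<close> summands is
      \<open>|G| \<phi> (H l) / card y\<close>, so the sum over the orbit does not depend on its
      size.\<close>
    have "(of_nat (card (inertia G P)) * \<phi> (inertia G P)) * of_nat (card y) = of_nat (card (carrier G)) * \<phi> (H l)" if P: "P \<in> y" for P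
    proof -
      have PC: "P \<in> C" using orbit_points(1)[OF yo] P by blast
      have "\<phi> (H l) = \<phi> (inertia G P)"
        by (rule conj[OF inertia_subgroup[OF PC] Hsub[OF l]]) (use y P in \<open>simp add: B_def\<close>)
      moreover have "card y * card (inertia G P) = card (carrier G)"
        using act.orbit_stabilizer_theorem[OF PC] orbit_points(3)[OF yo P] by (simp add: Coset.order_def)
      then have "of_nat (card (carrier G)) = (of_nat (card y) * of_nat (card (inertia G P)) :: rat)" by (simp flip: of_nat_mult)
      ultimately show ?thesis by simp
    qed
    note each = this
    have ypos: "of_nat (card y) \<noteq> (0::rat)" using fin_y[OF yB] orbit_points(2)[OF yo] by simp
    have "(\<Sum>P\<in>y. of_nat (card (inertia G P)) * \<phi> (inertia G P)) = (\<Sum>P\<in>y. of_nat (card (carrier G)) * \<phi> (H l) / of_nat (card y))"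
      by (rule sum.cong[OF refl]) (use each ypos in \<open>simp add: nonzero_eq_divide_eq\<close>)
    also have "\<dots> = of_nat (card (carrier G)) * \<phi> (H l)" using ypos by simp
    finally show ?thesis .
  qed
  have "(\<Sum>P\<in>ramified_points G C. of_nat (card (inertia G P)) * \<phi> (inertia G P)) =
      (\<Sum>y\<in>?B. \<Sum>P\<in>y. of_nat (card (inertia G P)) * \<phi> (inertia G P))"
    unfolding ram by (subst sum.Union_disjoint[OF ballI[OF fin_y] disj]) (simp_all add: comp_def)
  also have "\<dots> = (\<Sum>l\<in>{1..M}. \<Sum>y\<in>B l. \<Sum>P\<in>y. of_nat (card (inertia G P)) * \<phi> (inertia G P))"
    unfolding BU by (rule sum.UNION_disjoint[OF _ _ Bdisj]) (use finBl in auto)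
  also have "\<dots> = (\<Sum>l\<in>{1..M}. \<Sum>y\<in>B l. of_nat (card (carrier G)) * \<phi> (H l))"
    by (rule sum.cong[OF refl], rule sum.cong[OF refl], rule sum_y)
  also have "\<dots> = of_nat (card (carrier G)) * (\<Sum>l\<in>{1..M}. \<phi> (H l) * of_nat (num_branch_points G C (H l)))"
    unfolding sum_distrib_left num_branch_points_def B_def[symmetric] by (simp add: mult_ac)
  finally show ?thesis .
qed

end

theorem proposition5:
  fixes n M :: nat
    and C :: "'k::alg_closed_field point set"
    and G :: "('k point \<Rightarrow> 'k point) monoid"
    and \<Gamma>t :: "('k point \<Rightarrow> 'k point, 'k) rep"
    and \<iota> :: "'k \<Rightarrow> rat alg_closure"
    and U :: "('k point \<Rightarrow> 'k point, rat) rep"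
    and V :: "nat \<Rightarrow> ('k point \<Rightarrow> 'k point, rat) rep"
    and H :: "nat \<Rightarrow> ('k point \<Rightarrow> 'k point) set"
    and m d :: "nat \<Rightarrow> nat"
    and W :: "nat \<Rightarrow> nat \<Rightarrow> ('k point \<Rightarrow> 'k point, 'f::field_char_0) rep"
  assumes "smooth_projective_curve n C"
    and "finite_automorphism_group n C G"
    and "CHAR('k) = 0 \<or> \<not> CHAR('k) dvd card (carrier G)"
    and "is_ramification_module n C G \<Gamma>t"
    and "root_identification (card (carrier G)) \<iota>"
    and "irreducible_representatives G M V"
    and "cyclic_representatives G M H"
    and "finite_extension_of_rat TYPE('f)"
    and "splitting_field TYPE('f) G"
    and "\<forall>j\<in>{1..M}. schur_decomposition G (V j) (m j) (d j) (W j)"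
    and "has_rational_structure G \<iota> \<Gamma>t U"
  shows "\<exists>c :: nat \<Rightarrow> nat.
     (\<forall>j\<in>{1..M}. (of_nat (c j) :: rat) =
        1 / (of_nat (m j) ^ 2 * of_nat (d j)) *
        (\<Sum>l\<in>{1..M}. (of_nat (rep_dim G (V j)) - of_nat (fixed_dim G (V j) (H l))) *
                      (of_nat (num_branch_points G C (H l)) / 2))) \<and>
     rep_iso G U (rep_direct_sum (concat (map (\<lambda>j. replicate (c j) (V j)) [1..<Suc M])))"
proof -
  interpret tame_curve_group n C G \<iota>
    by unfold_locales (rule assms)+
  have U: "is_rep G U" using assms(11) unfolding has_rational_structure_def by blast
  \<comment> \<open>The multiplicities come from complete reducibility and are identified
    afterwards, so the formula needs no separate proof that its values are natural numbers.\<close>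
  obtain c where iso: "rep_iso G U (rep_direct_sum (concat (map (\<lambda>j. replicate (c j) (V j)) [1..<Suc M])))"
    using lift.decompose_into_representatives[OF U assms(6)] .
  have "(of_nat (c j) :: rat) = 1 / (of_nat (m j) ^ 2 * of_nat (d j)) *
      (\<Sum>l\<in>{1..M}. (of_nat (rep_dim G (V j)) - of_nat (fixed_dim G (V j) (H l))) * (of_nat (num_branch_points G C (H l)) / 2))"
    if j: "j \<in> {1..M}" for j
  proof -
    have V: "is_rep G (V j)"
      using bspec[OF irreducible_representativesD(1)[OF assms(6)] j] unfolding irreducible_rep_def by (elim conjE)
    let ?\<phi> = "\<lambda>K. of_nat (rep_dim G (V j)) - of_nat (fixed_dim G (V j) K) :: rat"
    let ?S = "\<Sum>g\<in>carrier G. rep_trace U g * rep_trace (V j) (inv\<^bsub>G\<^esub> g)"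
    have "2 * ?S = of_nat (card (carrier G)) * (\<Sum>l\<in>{1..M}. ?\<phi> (H l) * of_nat (num_branch_points G C (H l)))"
      unfolding ramification_inner_product[OF assms(4,11) V]
      by (rule sum_ramified_points[OF assms(7)]) (simp only: lift.fixed_dim_conjugate[OF V])
    moreover have "a / N = b / 2" if "2 * a = N * b" "N \<noteq> 0" for a b N :: rat
      using that by (simp add: field_simps)
    moreover have "(of_nat (card (carrier G)) :: rat) \<noteq> 0"
      unfolding of_nat_eq_0_iff using card_nonzero(1) by (rule less_imp_neq[symmetric])
    ultimately have "?S / of_nat (card (carrier G)) = (\<Sum>l\<in>{1..M}. ?\<phi> (H l) * of_nat (num_branch_points G C (H l))) / 2"
      by blast
    also have "\<dots> = (\<Sum>l\<in>{1..M}. ?\<phi> (H l) * (of_nat (num_branch_points G C (H l)) / 2))"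
      by (simp add: sum_divide_distrib)
    finally show ?thesis
      unfolding lift.multiplicity_formula[OF assms(6,9,10) U iso j] by (rule arg_cong)
  qed
  then show ?thesis using iso by blast
qed

end
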